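(* Let $S_n=\frac1n\Sigma_n^{1/2}X_nX_n^T\Sigma_n^{1/2}$, where $\Sigma_n$ is an $n\times n$ real symmetric matrix with eigenvalues $\theta,1,\dots,1$ ($\theta\ge0$) and $v_1^{(n)}$ is a unit eigenvector of $\Sigma_n$ for $\theta$, as described in the context. Let $a=(1-\sqrt\alpha)^2$, $b=(1+\sqrt\alpha)^2$ and $x\in(a,b)$. Let $(\varepsilon_n)_{n\ge1}$ be a sequence of positive reals satisfying $n^\delta/\sqrt n\ll\varepsilon_n\ll1$ for some $\delta>0$. Put $\mathcal I^{(n)}_{\varepsilon_n}(x)=\{1\le i\le n:\ |\lambda_i^{(n)}-x|\le\varepsilon_n\}$. Then for every $t>0$, $$\mathbf P\left(\left|\frac{n}{|\mathcal I^{(n)}_{\varepsilon_n}(x)|}\sum_{i\in\mathcal I^{(n)}_{\varepsilon_n}(x)}\left|\langle\phi_i^{(n)},v_1^{(n)}\rangle\right|^2-\frac{\theta}{x(1-\theta)+\theta(\alpha\theta-\alpha+1)}\right|>t\right)\underset{n\to+\infty}{\longrightarrow}0.$$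
   Context: $m=m(n)$ is a sequence of integers with $m/n\to\alpha\in(0,\infty)$. For each $n$, $X_n$ is an $n\times m$ real random matrix whose entries are i.i.d. copies of a fixed real random variable $X$ (whose law does not depend on $n$) with $\mathbf E[X]=0$, $\mathbf E[X^2]=1$ and finite moments of all orders. $\Sigma_n$ is deterministic (or random and independent of $X_n$), real symmetric with eigenvalues $\gamma_1^{(n)}=\theta$ and $\gamma_2^{(n)}=\dots=\gamma_n^{(n)}=1$, $\theta\ge0$ fixed, i.e. $\Sigma_n=I_n+(\theta-1)v_1^{(n)}(v_1^{(n)})^T$ with $v_1^{(n)}$ a unit vector (independent of $X_n$). $\lambda_1^{(n)}\ge\dots\ge\lambda_n^{(n)}$ are the eigenvalues of $S_n$ and $\phi_1^{(n)},\dots,\phi_n^{(n)}$ an associated orthonormal basis of eigenvectors. For positive sequences, $a_n\ll b_n$ means $a_n/b_n\to0$. *)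

theory Defs
  imports
    "HOL-Probability.Probability"
    "Jordan_Normal_Form.Char_Poly"
begin

(* Both HOL-Analysis and Jordan_Normal_Form are loaded.  Matrices and vectors are always those of
   Jordan_Normal_Form, whose dimensions are natural numbers and may therefore vary with n; their
   inner product is written scalar_prod because the infix is ambiguous. *)

text \<open>The Borel sigma-algebra on the real matrices (vectors) of a given dimension, obtained by
  identifying a matrix (vector) with the family of its entries.\<close>

definition borel_mat :: "nat \<Rightarrow> nat \<Rightarrow> real mat measure" where
  "borel_mat r c = vimage_algebra (carrier_mat r c)
     (\<lambda>A. restrict (index_mat A) ({..<r} \<times> {..<c}))
     (Pi\<^sub>M ({..<r} \<times> {..<c}) (\<lambda>_. borel))"

definition borel_vec :: "nat \<Rightarrow> real Matrix.vec measure" where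
  "borel_vec n = vimage_algebra (carrier_vec n)
     (\<lambda>v. restrict (vec_index v) {..<n})
     (Pi\<^sub>M {..<n} (\<lambda>_. borel))"

text \<open>The library's \<open>indep_var\<close> requires both variables to have values in the same type.\<close>

definition indep_rvs ::
    "'a measure \<Rightarrow> 'b measure \<Rightarrow> ('a \<Rightarrow> 'b) \<Rightarrow> 'c measure \<Rightarrow> ('a \<Rightarrow> 'c) \<Rightarrow> bool" where
  "indep_rvs M S X T Y \<longleftrightarrow> X \<in> measurable M S \<and> Y \<in> measurable M T \<and>
     prob_space.indep_set M
       (sets (vimage_algebra (space M) X S)) (sets (vimage_algebra (space M) Y T))"

definition sym_mat :: "nat \<Rightarrow> real mat \<Rightarrow> bool" where
  "sym_mat n A \<longleftrightarrow> A \<in> carrier_mat n n \<and> transpose_mat A = A"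

definition psd_mat :: "nat \<Rightarrow> real mat \<Rightarrow> bool" where
  "psd_mat n A \<longleftrightarrow> sym_mat n A \<and> (\<forall>w\<in>carrier_vec n. 0 \<le> scalar_prod w (A *\<^sub>v w))"

text \<open>The square root \<open>A\<^sup>1\<^sup>/\<^sup>2\<close>; meaningful only for positive semidefinite \<open>A\<close>, for which exactly one
  matrix with the property below exists.\<close>

definition psd_sqrt :: "real mat \<Rightarrow> real mat" where
  "psd_sqrt A = (THE B. psd_mat (dim_row A) B \<and> B * B = A)"

definition sample_cov :: "nat \<Rightarrow> real mat \<Rightarrow> real mat \<Rightarrow> real mat" where
  "sample_cov n \<Sigma> X = (1 / real n) \<cdot>\<^sub>m (psd_sqrt \<Sigma> * X * transpose_mat X * psd_sqrt \<Sigma>)"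

text \<open>Indices run over \<open>0, \<dots>, n - 1\<close> instead of \<open>1, \<dots>, n\<close>.  As the \<open>n\<close> eigenvectors are
  orthonormal, the numbers \<open>lam i\<close> are all the eigenvalues of \<open>A\<close>, with multiplicity.\<close>

definition ordered_eigenbasis ::
    "nat \<Rightarrow> real mat \<Rightarrow> (nat \<Rightarrow> real) \<Rightarrow> (nat \<Rightarrow> real Matrix.vec) \<Rightarrow> bool" where
  "ordered_eigenbasis n A lam \<phi> \<longleftrightarrow>
     (\<forall>i j. i \<le> j \<longrightarrow> j < n \<longrightarrow> lam j \<le> lam i) \<and>
     (\<forall>i<n. \<phi> i \<in> carrier_vec n \<and> eigenvector A (\<phi> i) (lam i)) \<and>
     (\<forall>i<n. \<forall>j<n. scalar_prod (\<phi> i) (\<phi> j) = (if i = j then 1 else 0))"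

definition window :: "nat \<Rightarrow> (nat \<Rightarrow> real) \<Rightarrow> real \<Rightarrow> real \<Rightarrow> nat set" where
  "window n lam x e = {i. i < n \<and> \<bar>lam i - x\<bar> \<le> e}"

definition much_less :: "(nat \<Rightarrow> real) \<Rightarrow> (nat \<Rightarrow> real) \<Rightarrow> bool" (infix \<open>\<lless>\<close> 50) where
  "a \<lless> b \<longleftrightarrow> (\<lambda>n. a n / b n) \<longlonglongrightarrow> 0"

end

theory Submission
  imports Defs "Jordan_Normal_Form.Schur_Decomposition"
begin

text \<open>Write \<open>\<Sigma>\<^sup>1\<^sup>/\<^sup>2 = 1 + (\<surd>\<theta> - 1) v v\<^sup>T\<close>, \<open>R = (S - z)\<^sup>-\<^sup>1\<close>, \<open>s = tr R / n\<close> and \<open>g = v\<^sup>T R v\<close>.  These are the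
  Stieltjes transforms of the spectral measure and of its reweighting by \<open>\<langle>\<phi>\<^sub>i, v\<rangle>\<^sup>2\<close>, so the
  average in question is a quotient of the masses which the two measures give to the window.

  \<open>S\<close> is a sum of the independent rank one matrices \<open>y\<^sub>k y\<^sub>k\<^sup>T\<close>.  Removing \<open>y\<^sub>k\<close> by Sherman--Morrison and using
  concentration of linear and quadratic forms in \<open>y\<^sub>k\<close> gives
  \<open>1 + z E s \<approx> (m / n) E s / (1 + E s)\<close> and \<open>1 + z E g \<approx> (m / n) \<theta> E g / (1 + E s)\<close> as soon as \<open>n (Im z)\<^sup>2\<close> is at
  least a power of \<open>n\<close>.  Fluctuations of \<open>s\<close> and \<open>g\<close> are controlled by an Efron--Stein inequality for higher
  moments, with Ward's identity \<open>|R v|\<^sup>2 = Im g / Im z\<close> absorbing the variance of \<open>g\<close>.  The first equation is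
  stable in the bulk and a continuity argument in \<open>Im z\<close> selects the Marchenko--Pastur root.

  Since \<open>v\<close> is independent of the columns and the bounds are uniform in \<open>v\<close>, Fubini and Markov give an \<open>L\<^sup>1\<close>
  bound on the segment \<open>Im z = \<eta> \<lless> \<epsilon>\<close>, with high probability.  Integrating Poisson kernels over that segment
  turns it into the two window masses.\<close>

section \<open>Resolvents of sums of rank one matrices\<close>

text \<open>The main obstacle is that nothing useful is known about g beforehand, only |g| \<le> 1 /
  Im z. Errors in the equation for E g are therefore measured relative to 1 + |E g|, and
  fluctuations of g relative to its own second moment; only the linear relation 1 + E g (z - (m / n)
  \<theta> / (1 + E s)) = small, whose coefficient stays away from 0 in the bulk, shows that E g is
  bounded. The other obstacle is the denominators 1 + y^T R y, for which only the lower bound Im z /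
  |z| is deterministic; the events on which they are small are charged to a high moment. Both
  devices work because the windows are wider than n^(-1/2), so that Im z may stay above that scale.
  Poisson integrals ask for an L^1 bound on a segment only, and this follows from bounds on
  expectations at single points, without any supremum over z. The limit is explicit because the
  Marchenko-Pastur root m at x satisfies x |m|^2 = 1 and x |1 + m|^2 = \<alpha>: g tends to -1 / (x
  - \<alpha> \<theta> / (1 + m)), and Im g / Im s to the stated fraction.\<close>

definition cdot :: "nat \<Rightarrow> (nat \<Rightarrow> complex) \<Rightarrow> (nat \<Rightarrow> complex) \<Rightarrow> complex" where
  "cdot n u w = (\<Sum>i<n. u i * w i)"

definition mv :: "nat \<Rightarrow> (nat \<Rightarrow> nat \<Rightarrow> complex) \<Rightarrow> (nat \<Rightarrow> complex) \<Rightarrow> nat \<Rightarrow> complex" where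
  "mv n R u = (\<lambda>i. \<Sum>j<n. R i j * u j)"

definition nrm2 :: "nat \<Rightarrow> (nat \<Rightarrow> complex) \<Rightarrow> real" where
  "nrm2 n u = (\<Sum>i<n. (cmod (u i))\<^sup>2)"

definition cx :: "(nat \<Rightarrow> real) \<Rightarrow> nat \<Rightarrow> complex" where
  "cx y = (\<lambda>i. complex_of_real (y i))"

definition ev :: "nat \<Rightarrow> nat \<Rightarrow> real" where
  "ev j = (\<lambda>i. if i = j then 1 else 0)"

text \<open>The resolvent \<open>(\<Sum> a a\<^sup>T - z)\<^sup>-\<^sup>1\<close> of the sum over a list of columns \<open>a\<close>, defined by
  Sherman--Morrison updates so that it is visibly measurable in the columns.\<close>

fun res :: "nat \<Rightarrow> complex \<Rightarrow> (nat \<Rightarrow> real) list \<Rightarrow> nat \<Rightarrow> nat \<Rightarrow> complex" where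
  "res n z [] = (\<lambda>i j. if i = j then - (1 / z) else 0)"
| "res n z (y # ys) = (\<lambda>i j. res n z ys i j
     - mv n (res n z ys) (cx y) i * mv n (res n z ys) (cx y) j / (1 + cdot n (cx y) (mv n (res n z ys) (cx y))))"

definition qf :: "nat \<Rightarrow> complex \<Rightarrow> (nat \<Rightarrow> real) list \<Rightarrow> (nat \<Rightarrow> real) \<Rightarrow> complex" where
  "qf n z ys y = cdot n (cx y) (mv n (res n z ys) (cx y))"

definition trn :: "nat \<Rightarrow> complex \<Rightarrow> (nat \<Rightarrow> real) list \<Rightarrow> complex" where
  "trn n z ys = (\<Sum>i<n. res n z ys i i) / of_nat n"

lemma cdot_commute: "cdot n u w = cdot n w u"
  by (simp add: cdot_def mult.commute)

lemma cdot_add_right: "cdot n u (\<lambda>i. w i + w' i) = cdot n u w + cdot n u w'"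
  by (simp add: cdot_def distrib_left sum.distrib)

lemma cdot_diff_right: "cdot n u (\<lambda>i. w i - w' i) = cdot n u w - cdot n u w'"
  by (simp add: cdot_def right_diff_distrib sum_subtractf)

lemma cdot_cmult_right: "cdot n u (\<lambda>i. c * w i) = c * cdot n u w"
  by (simp add: cdot_def sum_distrib_left mult_ac)

lemma cdot_sum_list_right: "cdot n u (\<lambda>i. \<Sum>a\<leftarrow>ys. f a i) = (\<Sum>a\<leftarrow>ys. cdot n u (f a))"
  by (induction ys) (auto simp: cdot_add_right, simp add: cdot_def)

lemma cdot_cong: "(\<And>i. i < n \<Longrightarrow> u i = u' i) \<Longrightarrow> (\<And>i. i < n \<Longrightarrow> w i = w' i) \<Longrightarrow> cdot n u w = cdot n u' w'"
  by (simp add: cdot_def)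

lemma cdot_ev: "i < n \<Longrightarrow> cdot n (cx (ev i)) w = w i"
  by (simp add: cdot_def cx_def ev_def if_distrib[of of_real] if_distrib[of "\<lambda>x. x * _"] sum.delta cong: if_cong)

lemma mv_ev: "j < n \<Longrightarrow> mv n R (cx (ev j)) i = R i j"
  by (simp add: mv_def cx_def ev_def if_distrib[of of_real] if_distrib[of "\<lambda>x. _ * x"] sum.delta cong: if_cong)

text \<open>\<open>cdot\<close> carries no conjugation, so the adjointness that matters is complex
  symmetry of R. A resolvent of a real symmetric matrix has it off the real axis, where it is not
  Hermitian.\<close>

lemma cdot_mv_symm:
  assumes "\<And>i j. R i j = R j i"
  shows "cdot n u (mv n R w) = cdot n (mv n R u) w"
proof -
  have "cdot n u (mv n R w) = (\<Sum>i<n. \<Sum>j<n. R i j * u i * w j)"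
    by (simp add: cdot_def mv_def sum_distrib_left mult_ac)
  also have "\<dots> = (\<Sum>j<n. \<Sum>i<n. R i j * u i * w j)" by (rule sum.swap)
  also have "\<dots> = (\<Sum>j<n. \<Sum>i<n. R j i * u i * w j)"
    by (intro sum.cong refl) (subst assms, rule refl)
  also have "\<dots> = cdot n (mv n R u) w" by (simp only: cdot_def mv_def sum_distrib_right)
  finally show ?thesis .
qed

lemma cdot_mv_bilinear: "cdot n u (mv n R w) = (\<Sum>i<n. \<Sum>j<n. R i j * u i * w j)"
  by (simp add: cdot_def mv_def sum_distrib_left mult_ac)

lemma nrm2_nonneg [simp]: "nrm2 n u \<ge> 0"
  by (simp add: nrm2_def sum_nonneg)

lemma cdot_cnj_self: "cdot n (\<lambda>i. cnj (u i)) u = of_real (nrm2 n u)"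
  by (simp add: cdot_def nrm2_def complex_norm_square[symmetric] mult.commute)

lemma cmod_cdot_le: "(cmod (cdot n u w))\<^sup>2 \<le> nrm2 n u * nrm2 n w"
proof -
  have "cmod (cdot n u w) \<le> (\<Sum>i<n. \<bar>cmod (u i)\<bar> * \<bar>cmod (w i)\<bar>)"
    unfolding cdot_def by (rule order_trans[OF norm_sum]) (simp add: norm_mult)
  also have "\<dots> \<le> L2_set (\<lambda>i. cmod (u i)) {..<n} * L2_set (\<lambda>i. cmod (w i)) {..<n}"
    by (rule L2_set_mult_ineq)
  finally have "(cmod (cdot n u w))\<^sup>2 \<le> (L2_set (\<lambda>i. cmod (u i)) {..<n} * L2_set (\<lambda>i. cmod (w i)) {..<n})\<^sup>2"
    by (intro power_mono) auto
  thus ?thesis by (simp add: L2_set_def power_mult_distrib nrm2_def sum_nonneg)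
qed

lemma nrm2_ev: "j < n \<Longrightarrow> nrm2 n (cx (ev j)) = 1"
  by (simp add: nrm2_def cx_def ev_def if_distrib[of of_real] if_distrib[of cmod] if_distrib[of "\<lambda>x. x^2"] sum.delta cong: if_cong)

lemma res_symm: "res n z ys i j = res n z ys j i"
  by (induction ys arbitrary: i j) (auto simp: mult.commute)

declare res.simps(2) [simp del]

text \<open>This is (A - z) r = u for A the sum of the a a^T. Positivity, order independence and the
  spectral formula are derived from this relation rather than from the recursion of
  \<open>res\<close>, which depends on the order of the columns.\<close>

definition res_eqn :: "nat \<Rightarrow> complex \<Rightarrow> (nat \<Rightarrow> real) list \<Rightarrow> (nat \<Rightarrow> complex) \<Rightarrow> (nat \<Rightarrow> complex) \<Rightarrow> bool" where
  "res_eqn n z ys u r \<longleftrightarrow> (\<forall>i<n. (\<Sum>a\<leftarrow>ys. cx a i * cdot n (cx a) r) = u i + z * r i)"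

text \<open>The equation is paired with the conjugate of r, where A contributes a real and
  nonnegative sum of squares. Real and imaginary parts of this identity yield the norm and sign
  estimates of the resolvent.\<close>

lemma res_eqn_quadratic:
  assumes "res_eqn n z ys u r"
  shows "cdot n (\<lambda>i. cnj (r i)) u + z * of_real (nrm2 n r) = of_real (\<Sum>a\<leftarrow>ys. (cmod (cdot n (cx a) r))\<^sup>2)"
proof -
  have c: "cdot n (\<lambda>i. cnj (r i)) (cx a) = cnj (cdot n (cx a) r)" for a
    by (simp add: cdot_def cx_def mult.commute)
  have "cdot n (\<lambda>i. cnj (r i)) (\<lambda>i. \<Sum>a\<leftarrow>ys. cdot n (cx a) r * cx a i) = (\<Sum>a\<leftarrow>ys. cdot n (cx a) r * cnj (cdot n (cx a) r))"
    by (simp add: cdot_sum_list_right cdot_cmult_right c)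
  also have "\<dots> = of_real (\<Sum>a\<leftarrow>ys. (cmod (cdot n (cx a) r))\<^sup>2)"
    by (induction ys) (auto simp: complex_norm_square[symmetric])
  finally have 1: "cdot n (\<lambda>i. cnj (r i)) (\<lambda>i. \<Sum>a\<leftarrow>ys. cdot n (cx a) r * cx a i) = \<dots>" .
  have "cdot n (\<lambda>i. cnj (r i)) (\<lambda>i. \<Sum>a\<leftarrow>ys. cdot n (cx a) r * cx a i) = cdot n (\<lambda>i. cnj (r i)) (\<lambda>i. u i + z * r i)"
    using assms by (intro cdot_cong) (auto simp: res_eqn_def mult.commute)
  also have "\<dots> = cdot n (\<lambda>i. cnj (r i)) u + z * of_real (nrm2 n r)"
    by (simp add: cdot_add_right cdot_cmult_right cdot_cnj_self)
  finally show ?thesis using 1 by simp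
qed

lemma sum_list_cmod_nonneg: "(\<Sum>a\<leftarrow>ys. (cmod (f a))\<^sup>2) \<ge> 0"
  by (intro sum_list_nonneg) auto

text \<open>For real y the quadratic identity says q = T - conj z |r|^2 with q = y^T R y. Its
  imaginary part is Ward's identity; multiplication by z makes the |r|^2 term real and leaves Im (z
  q) = T Im z, the positivity that controls the denominators.\<close>

lemma res_eqn_real:
  assumes "res_eqn n z ys (cx y) r"
  shows "Im (cdot n (cx y) r) = Im z * nrm2 n r" "Im z \<ge> 0 \<Longrightarrow> Im (z * cdot n (cx y) r) \<ge> 0"
proof -
  define T where "T = (\<Sum>a\<leftarrow>ys. (cmod (cdot n (cx a) r))\<^sup>2)"
  have "cdot n (\<lambda>i. cnj (r i)) (cx y) = cnj (cdot n (cx y) r)"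
    by (simp add: cdot_def cx_def mult.commute)
  hence e: "cnj (cdot n (cx y) r) + z * of_real (nrm2 n r) = of_real T"
    using res_eqn_quadratic[OF assms] by (simp add: T_def)
  from arg_cong[OF e, of Im] show "Im (cdot n (cx y) r) = Im z * nrm2 n r" by simp
  have "cdot n (cx y) r = of_real T - cnj z * of_real (nrm2 n r)"
    using arg_cong[OF e, of cnj] by (simp add: algebra_simps)
  hence "z * cdot n (cx y) r = z * (of_real T - cnj z * of_real (nrm2 n r))" by simp
  hence "z * cdot n (cx y) r = z * of_real T - of_real ((cmod z)\<^sup>2) * of_real (nrm2 n r)"
    by (simp add: algebra_simps complex_norm_square del: of_real_power)
  hence "Im (z * cdot n (cx y) r) = Im z * T" by (simp del: of_real_power)
  moreover have "T \<ge> 0" unfolding T_def by (rule sum_list_cmod_nonneg)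
  ultimately show "Im z \<ge> 0 \<Longrightarrow> Im (z * cdot n (cx y) r) \<ge> 0" by simp
qed

text \<open>Im z \<le> Im (z (1 + q)) because Im (z q) is nonnegative. The Sherman-Morrison
  denominators thus never vanish, but the lower bound Im z / |z| is poor; quantitatively it is spent
  only on rare events.\<close>

lemma one_plus_lower:
  assumes "Im (z * q) \<ge> 0" "Im z > 0"
  shows "cmod z * cmod (1 + q) \<ge> Im z" "1 + q \<noteq> 0" "cmod (1 / (1 + q)) \<le> cmod z / Im z"
proof -
  have "Im z \<le> Im (z * (1 + q))" using assms by (simp add: distrib_left)
  also have "\<dots> \<le> cmod (z * (1+q))" using abs_Im_le_cmod[of "z * (1+q)"] by simp
  finally show 1: "cmod z * cmod (1 + q) \<ge> Im z" by (simp add: norm_mult)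
  thus 2: "1 + q \<noteq> 0" using assms by auto
  hence "cmod (1+q) > 0" by simp
  thus "cmod (1 / (1 + q)) \<le> cmod z / Im z"
    using 1 assms by (simp add: norm_divide field_simps)
qed

text \<open>By induction, the positivity that the equation implies for \<open>ys\<close> makes the
  next denominator non-zero; the rank one correction then cancels the contribution of the new
  column.\<close>

lemma res_eqn_res:
  assumes z: "Im z > 0"
  shows "res_eqn n z ys u (mv n (res n z ys) u)"
proof (induction ys arbitrary: u)
  case Nil
  have "z \<noteq> 0" using z by auto
  thus ?case
    by (auto simp: res_eqn_def mv_def if_distrib[of "\<lambda>x. x * _"] sum.delta cong: if_cong)
next
  case (Cons y ys)
  let ?R = "res n z ys" let ?r = "mv n ?R (cx y)" let ?w = "mv n ?R u"
  let ?q = "cdot n (cx y) ?r"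
  define c where "c = cdot n (cx y) ?w / (1 + ?q)"
  have q: "1 + ?q \<noteq> 0"
    using one_plus_lower(2)[OF res_eqn_real(2)[OF Cons] z] z by simp
  have sy: "cdot n ?r u = cdot n (cx y) ?w"
    by (rule cdot_mv_symm[symmetric]) (rule res_symm)
  have mv': "mv n (res n z (y # ys)) u = (\<lambda>i. ?w i - c * ?r i)"
  proof
    fix i
    have "mv n (res n z (y # ys)) u i = (\<Sum>j<n. ?R i j * u j - ?r i / (1 + ?q) * (?r j * u j))"
      unfolding mv_def[of n "res n z (y # ys)"] by (simp add: res.simps(2) algebra_simps)
    also have "\<dots> = ?w i - ?r i / (1 + ?q) * cdot n ?r u"
      by (simp only: sum_subtractf sum_distrib_left[symmetric] cdot_def[of n ?r] mv_def[of n ?R u])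
    finally show "mv n (res n z (y # ys)) u i = ?w i - c * ?r i" by (simp add: sy c_def)
  qed
  have lin0: "(\<Sum>a\<leftarrow>as. f a * (g a - d * h a)) = (\<Sum>a\<leftarrow>as. f a * g a) - d * (\<Sum>a\<leftarrow>as. f a * h a)"
    for as :: "(nat \<Rightarrow> real) list" and f g h :: "_ \<Rightarrow> complex" and d
    by (induction as) (auto simp: algebra_simps)
  note lin = lin0[where as = ys and d = c]
  show ?case
    unfolding res_eqn_def
  proof (intro allI impI)
    fix i assume i: "i < n"
    have 1: "(\<Sum>a\<leftarrow>ys. cx a i * cdot n (cx a) ?w) = u i + z * ?w i"
      and 2: "(\<Sum>a\<leftarrow>ys. cx a i * cdot n (cx a) ?r) = cx y i + z * ?r i"
      using Cons i by (auto simp: res_eqn_def)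
    have c': "cdot n (cx y) ?w = c * (1 + ?q)" using q by (simp add: c_def)
    show "(\<Sum>a\<leftarrow>y # ys. cx a i * cdot n (cx a) (mv n (res n z (y # ys)) u)) = u i + z * mv n (res n z (y # ys)) u i"
      by (simp only: mv' sum_list.Cons list.map cdot_diff_right cdot_cmult_right lin 1 2 c')
         (simp add: algebra_simps)
  qed
qed

context
  fixes n :: nat and z :: complex
  assumes z: "Im z > 0"
begin

lemma Im_qf: "Im (qf n z ys y) = Im z * nrm2 n (mv n (res n z ys) (cx y))"
  unfolding qf_def by (rule res_eqn_real(1)[OF res_eqn_res[OF z]])

lemma Im_z_qf: "Im (z * qf n z ys y) \<ge> 0"
  unfolding qf_def using z by (intro res_eqn_real(2)[OF res_eqn_res[OF z]]) auto

lemmas one_plus_qf = one_plus_lower[OF Im_z_qf z]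

lemma Im_qf_nonneg: "Im (qf n z ys y) \<ge> 0"
  using z by (simp add: Im_qf)

text \<open>Cauchy-Schwarz gives |q|^2 \<le> |y|^2 |R y|^2, Ward's identity turns |R y|^2 into Im q
  / Im z \<le> |q| / Im z, and one factor |q| cancels.\<close>

lemma cmod_qf_le: "cmod (qf n z ys y) \<le> nrm2 n (cx y) / Im z"
proof -
  let ?q = "qf n z ys y"
  have "(cmod ?q)\<^sup>2 \<le> nrm2 n (cx y) * nrm2 n (mv n (res n z ys) (cx y))"
    unfolding qf_def by (rule cmod_cdot_le)
  also have "\<dots> = nrm2 n (cx y) * (Im ?q / Im z)" using z by (simp add: Im_qf)
  also have "\<dots> \<le> nrm2 n (cx y) * (cmod ?q / Im z)"
    using z abs_Im_le_cmod[of ?q] by (intro mult_left_mono divide_right_mono) auto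
  finally have *: "cmod ?q * cmod ?q \<le> (nrm2 n (cx y) / Im z) * cmod ?q" by (simp add: power2_eq_square)
  show ?thesis
  proof (cases "?q = 0")
    case True thus ?thesis using z by simp
  next
    case False
    hence "cmod ?q > 0" by simp
    thus ?thesis using * mult_right_le_imp_le by blast
  qed
qed

lemma nrm2_mv_res_le: "nrm2 n (mv n (res n z ys) u) \<le> nrm2 n u / (Im z)\<^sup>2"
proof -
  let ?r = "mv n (res n z ys) u"
  have "Im (cdot n (\<lambda>i. cnj (?r i)) u) = - Im z * nrm2 n ?r"
    using arg_cong[OF res_eqn_quadratic[OF res_eqn_res[OF z]], of Im n ys u] by simp
  hence "(Im z * nrm2 n ?r)\<^sup>2 \<le> (cmod (cdot n (\<lambda>i. cnj (?r i)) u))\<^sup>2"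
    using abs_Im_le_cmod[of "cdot n (\<lambda>i. cnj (?r i)) u"] z
    by (intro power_mono) (auto simp: )
  also have "\<dots> \<le> nrm2 n ?r * nrm2 n u"
    using cmod_cdot_le[of n "\<lambda>i. cnj (?r i)" u] by (simp add: nrm2_def)
  finally have *: "((Im z)\<^sup>2 * nrm2 n ?r) * nrm2 n ?r \<le> nrm2 n u * nrm2 n ?r"
    by (simp add: power_mult_distrib power2_eq_square mult_ac)
  show ?thesis
  proof (cases "nrm2 n ?r = 0")
    case True thus ?thesis using z by (simp add: zero_le_divide_iff)
  next
    case False
    hence "nrm2 n ?r > 0" using nrm2_nonneg[of n ?r] by linarith
    hence "(Im z)\<^sup>2 * nrm2 n ?r \<le> nrm2 n u" using * by simp
    thus ?thesis using z by (simp add: field_simps)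
  qed
qed

lemma res_diag: "i < n \<Longrightarrow> res n z ys i i = qf n z ys (ev i)"
  by (simp add: qf_def cdot_ev mv_ev)

lemma cmod_trn_le: "cmod (trn n z ys) \<le> 1 / Im z"
proof (cases "n = 0")
  case True thus ?thesis using z by (simp add: trn_def)
next
  case False
  have "cmod (\<Sum>i<n. res n z ys i i) \<le> (\<Sum>i<n. 1 / Im z)"
    using cmod_qf_le by (intro sum_norm_le) (auto simp: res_diag intro!: order_trans[OF cmod_qf_le] simp: nrm2_ev)
  thus ?thesis using False by (simp add: trn_def norm_divide field_simps)
qed

lemma Im_trn_nonneg: "Im (trn n z ys) \<ge> 0"
proof -
  have "Im (\<Sum>i<n. res n z ys i i) \<ge> 0"
    using Im_qf_nonneg by (auto simp: res_diag intro!: sum_nonneg)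
  thus ?thesis by (simp add: trn_def)
qed

lemma Im_z_trn_nonneg: "Im (z * trn n z ys) \<ge> 0"
proof -
  have "Im (\<Sum>i<n. z * res n z ys i i) \<ge> 0"
    unfolding Im_sum using Im_z_qf by (intro sum_nonneg) (simp add: res_diag)
  hence "Im (z * (\<Sum>i<n. res n z ys i i)) \<ge> 0" by (simp only: sum_distrib_left)
  moreover have "z * trn n z ys = (z * (\<Sum>i<n. res n z ys i i)) / of_nat n" by (simp add: trn_def)
  ultimately show ?thesis by (simp only: Im_divide_of_nat) simp
qed

text \<open>Ward's identity summed over the basis vectors. As long as s stays bounded, this gains a
  factor Im z over the operator norm bound n / (Im z)^2, and the concentration of quadratic forms
  profits from it.\<close>

lemma frobenius_res: "(\<Sum>i<n. \<Sum>j<n. (cmod (res n z ys i j))\<^sup>2) = n * Im (trn n z ys) / Im z"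
proof -
  have "(\<Sum>i<n. \<Sum>j<n. (cmod (res n z ys i j))\<^sup>2) = (\<Sum>j<n. nrm2 n (mv n (res n z ys) (cx (ev j))))"
    by (subst sum.swap) (simp add: nrm2_def mv_ev)
  also have "\<dots> = (\<Sum>j<n. Im (qf n z ys (ev j)) / Im z)" using z by (simp add: Im_qf)
  also have "\<dots> = Im (\<Sum>j<n. res n z ys j j) / Im z" by (simp add: res_diag sum_divide_distrib)
  finally show ?thesis by (cases "n = 0") (simp_all add: trn_def)
qed

lemma mv_res_Cons:
  "mv n (res n z (y # ys)) u = (\<lambda>i. mv n (res n z ys) u i
     - cdot n (cx y) (mv n (res n z ys) u) / (1 + qf n z ys y) * mv n (res n z ys) (cx y) i)"
proof
  fix i
  let ?R = "res n z ys" let ?r = "mv n ?R (cx y)"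
  have sy: "cdot n ?r u = cdot n (cx y) (mv n ?R u)"
    by (rule cdot_mv_symm[symmetric]) (rule res_symm)
  have "mv n (res n z (y # ys)) u i = (\<Sum>j<n. ?R i j * u j - ?r i / (1 + qf n z ys y) * (?r j * u j))"
    unfolding mv_def[of n "res n z (y # ys)"] by (simp add: res.simps(2) algebra_simps qf_def)
  also have "\<dots> = mv n ?R u i - ?r i / (1 + qf n z ys y) * cdot n ?r u"
    by (simp only: sum_subtractf sum_distrib_left[symmetric] cdot_def[of n ?r] mv_def[of n ?R u])
  finally show "mv n (res n z (y # ys)) u i = mv n ?R u i - cdot n (cx y) (mv n ?R u) / (1 + qf n z ys y) * ?r i"
    by (simp add: sy)
qed

lemma cdot_res_Cons_same: "cdot n (cx y) (mv n (res n z (y # ys)) u) = cdot n (cx y) (mv n (res n z ys) u) / (1 + qf n z ys y)"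
  using one_plus_qf(2)[of ys y]
  unfolding mv_res_Cons cdot_diff_right cdot_cmult_right qf_def[symmetric] by (simp add: field_simps)

lemma cdot_res_Cons: "cdot n w (mv n (res n z (y # ys)) u) = cdot n w (mv n (res n z ys) u)
    - cdot n (cx y) (mv n (res n z ys) u) * cdot n (cx y) (mv n (res n z ys) w) / (1 + qf n z ys y)"
proof -
  have "cdot n w (mv n (res n z ys) (cx y)) = cdot n (cx y) (mv n (res n z ys) w)"
    by (subst cdot_mv_symm[OF res_symm]) (rule cdot_commute)
  thus ?thesis unfolding mv_res_Cons cdot_diff_right cdot_cmult_right by simp
qed

text \<open>The trace changes by r^T r / (1 + q) with r = R y, and |r|^2 = Im (1 + q) / Im z \<le>
  |1 + q| / Im z. The denominator cancels, so the bound is deterministic and independent of the size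
  of y.\<close>

lemma trn_Cons_diff: "cmod (trn n z (y # ys) - trn n z ys) \<le> 1 / (n * Im z)"
proof (cases "n = 0")
  case True thus ?thesis by (simp add: trn_def)
next
  case n: False
  let ?r = "mv n (res n z ys) (cx y)" let ?q = "qf n z ys y"
  have "(\<Sum>i<n. res n z (y # ys) i i) - (\<Sum>i<n. res n z ys i i) = - cdot n ?r ?r / (1 + ?q)"
    by (simp add: sum_subtractf cdot_def[of n ?r] qf_def sum_divide_distrib[symmetric] res.simps(2))
  hence "cmod (trn n z (y # ys) - trn n z ys) = cmod (cdot n ?r ?r) / cmod (1 + ?q) / n"
    by (simp add: trn_def diff_divide_distrib[symmetric] norm_divide norm_mult)
  also have "\<dots> \<le> nrm2 n ?r / cmod (1 + ?q) / n"
  proof (intro divide_right_mono)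
    have "cmod (cdot n ?r ?r) \<le> (\<Sum>i<n. cmod (?r i * ?r i))" unfolding cdot_def by (rule norm_sum)
    thus "cmod (cdot n ?r ?r) \<le> nrm2 n ?r" by (simp add: nrm2_def norm_mult power2_eq_square)
  qed auto
  also have "\<dots> \<le> 1 / Im z / n"
  proof (intro divide_right_mono)
    have "Im z * nrm2 n ?r = Im (1 + ?q)" by (simp add: Im_qf)
    also have "\<dots> \<le> cmod (1 + ?q)" using abs_Im_le_cmod[of "1 + ?q"] by linarith
    finally show "nrm2 n ?r / cmod (1 + ?q) \<le> 1 / Im z"
      using z one_plus_qf(2)[of ys y] by (simp add: field_simps)
  qed auto
  finally show ?thesis by (simp add: field_simps)
qed

lemma one_plus_z_quadratic: "(\<Sum>a\<leftarrow>ys. cdot n w (cx a) * cdot n (cx a) (mv n (res n z ys) u)) = cdot n w u + z * cdot n w (mv n (res n z ys) u)"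
proof -
  let ?r = "mv n (res n z ys) u"
  have "cdot n w (\<lambda>i. \<Sum>a\<leftarrow>ys. cdot n (cx a) ?r * cx a i) = cdot n w (\<lambda>i. u i + z * ?r i)"
    using res_eqn_res[OF z, of n ys u] by (intro cdot_cong) (auto simp: res_eqn_def mult.commute)
  thus ?thesis unfolding cdot_sum_list_right cdot_cmult_right cdot_add_right by (simp only: mult.commute)
qed

text \<open>The trace of A R = 1 + z R, the trace of a a^T R being a^T R a.\<close>

lemma one_plus_z_trace: "(\<Sum>a\<leftarrow>ys. qf n z ys a) = of_nat n * (1 + z * trn n z ys)"
proof -
  have sw: "(\<Sum>i<n. \<Sum>a\<leftarrow>as. cx a i * cdot n (cx a) (mv n (res n z ys) (cx (ev i)))) = (\<Sum>a\<leftarrow>as. qf n z ys a)" for as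
  proof (induction as)
    case (Cons a as)
    have "(\<Sum>i<n. cx a i * cdot n (cx a) (mv n (res n z ys) (cx (ev i)))) = qf n z ys a"
    proof -
      have "cdot n (cx a) (mv n (res n z ys) (cx (ev i))) = mv n (res n z ys) (cx a) i" if "i < n" for i
        using that by (subst cdot_mv_symm[OF res_symm], subst cdot_commute) (rule cdot_ev)
      thus ?thesis by (simp add: qf_def cdot_def)
    qed
    thus ?case using Cons by (simp add: sum.distrib)
  qed simp
  have "(\<Sum>i<n. \<Sum>a\<leftarrow>ys. cx a i * cdot n (cx a) (mv n (res n z ys) (cx (ev i)))) = (\<Sum>i<n. 1 + z * res n z ys i i)"
    using res_eqn_res[OF z, of n ys] by (intro sum.cong) (auto simp: res_eqn_def mv_ev, simp add: cx_def ev_def)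
  also have "\<dots> = of_nat n * (1 + z * trn n z ys)"
    by (cases "n = 0") (simp_all add: trn_def sum.distrib sum_distrib_left[symmetric] distrib_left)
  finally show ?thesis using sw by simp
qed

end

text \<open>Symmetry of A evaluates r2^T A r1 in two ways. With z1 = z2 this gives uniqueness and
  independence of the order of the columns, with different z1 and z2 the resolvent identity, and
  with an eigenvector as one of the solutions the spectral formula.\<close>

lemma res_eqn_pair:
  assumes "mset xs = mset ys" "res_eqn n z1 xs u r1" "res_eqn n z2 ys w r2"
  shows "cdot n r2 u - cdot n w r1 = (z2 - z1) * cdot n r2 r1"
proof -
  have 1: "cdot n r2 u + z1 * cdot n r2 r1 = (\<Sum>a\<leftarrow>xs. cdot n (cx a) r1 * cdot n (cx a) r2)"
  proof -
    have "cdot n r2 (\<lambda>i. \<Sum>a\<leftarrow>xs. cdot n (cx a) r1 * cx a i) = cdot n r2 (\<lambda>i. u i + z1 * r1 i)"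
      using assms(2) by (intro cdot_cong) (auto simp: res_eqn_def mult.commute)
    thus ?thesis by (simp add: cdot_sum_list_right cdot_cmult_right cdot_add_right cdot_commute[of n r2])
  qed
  have 2: "cdot n r1 w + z2 * cdot n r1 r2 = (\<Sum>a\<leftarrow>ys. cdot n (cx a) r2 * cdot n (cx a) r1)"
  proof -
    have "cdot n r1 (\<lambda>i. \<Sum>a\<leftarrow>ys. cdot n (cx a) r2 * cx a i) = cdot n r1 (\<lambda>i. w i + z2 * r2 i)"
      using assms(3) by (intro cdot_cong) (auto simp: res_eqn_def mult.commute)
    thus ?thesis by (simp add: cdot_sum_list_right cdot_cmult_right cdot_add_right cdot_commute[of n r1])
  qed
  have "(\<Sum>a\<leftarrow>xs. cdot n (cx a) r1 * cdot n (cx a) r2) = (\<Sum>a\<leftarrow>ys. cdot n (cx a) r2 * cdot n (cx a) r1)"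
  proof -
    have "sum_list (map f xs) = sum_list (map f ys)" for f :: "_ \<Rightarrow> complex"
      using assms(1) by (metis mset_map sum_mset_sum_list)
    thus ?thesis by (simp only: mult.commute)
  qed
  thus ?thesis using 1 2 cdot_commute[of n r1] by (simp add: algebra_simps)
qed

text \<open>Any column may therefore be moved to the head of the list, where the Sherman-Morrison
  update exposes it.\<close>

lemma res_perm:
  assumes "Im z > 0" "mset xs = mset ys" "i < n" "j < n"
  shows "res n z xs i j = res n z ys i j"
proof -
  have "cdot n (mv n (res n z ys) (cx (ev j))) (cx (ev i)) - cdot n (cx (ev j)) (mv n (res n z xs) (cx (ev i))) = 0"
    by (subst res_eqn_pair[OF assms(2) res_eqn_res[OF assms(1)] res_eqn_res[OF assms(1)]]) simp
  thus ?thesis using assms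
    by (simp add: cdot_ev mv_ev cdot_commute[of n _ "cx (ev i)"]) (metis res_symm)
qed

lemma mv_res_perm:
  assumes "Im z > 0" "mset xs = mset ys" "i < n"
  shows "mv n (res n z xs) u i = mv n (res n z ys) u i"
  unfolding mv_def using res_perm[OF assms(1,2,3)] by (intro sum.cong) auto

lemma cdot_res_perm:
  assumes "Im z > 0" "mset xs = mset ys"
  shows "cdot n w (mv n (res n z xs) u) = cdot n w (mv n (res n z ys) u)"
  using mv_res_perm[OF assms] by (intro cdot_cong) auto

lemma trn_perm:
  assumes "Im z > 0" "mset xs = mset ys"
  shows "trn n z xs = trn n z ys"
  using res_perm[OF assms] by (simp add: trn_def)

text \<open>The resolvent identity with both factors of norm at most 1 / e. The constant does not
  depend on the columns and hence survives the expectation, which gives the continuity in z needed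
  to descend from Im z = 2.\<close>

lemma trn_lipschitz:
  assumes "Im z1 \<ge> e" "Im z2 \<ge> e" "e > 0"
  shows "cmod (trn n z1 ys - trn n z2 ys) \<le> cmod (z1 - z2) / e\<^sup>2"
proof (cases "n = 0")
  case n: False
  have zz: "Im z1 > 0" "Im z2 > 0" using assms by auto
  have d: "cmod (res n z1 ys i i - res n z2 ys i i) \<le> cmod (z1 - z2) / e\<^sup>2" if i: "i < n" for i
  proof -
    let ?e = "cx (ev i)" let ?r1 = "mv n (res n z1 ys) ?e" let ?r2 = "mv n (res n z2 ys) ?e"
    have "res n z2 ys i i - res n z1 ys i i = (z2 - z1) * cdot n ?r2 ?r1"
      using res_eqn_pair[OF refl res_eqn_res[OF zz(1)] res_eqn_res[OF zz(2)], of n ys ?e ?e] i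
      by (simp add: cdot_commute[of n ?r2 ?e] cdot_ev mv_ev)
    hence "cmod (res n z1 ys i i - res n z2 ys i i) = cmod (z1 - z2) * cmod (cdot n ?r2 ?r1)"
      by (metis norm_minus_commute norm_mult)
    also have "\<dots> \<le> cmod (z1 - z2) * (1 / e\<^sup>2)"
    proof (rule mult_left_mono[OF power2_le_imp_le])
      have b: "nrm2 n (mv n (res n z ys) ?e) \<le> 1 / e\<^sup>2" if "Im z \<ge> e" for z
      proof -
        have "nrm2 n (mv n (res n z ys) ?e) \<le> nrm2 n ?e / (Im z)\<^sup>2"
          using that assms by (intro nrm2_mv_res_le) auto
        also have "\<dots> \<le> 1 / e\<^sup>2" using that assms i by (auto simp: nrm2_ev intro!: divide_left_mono power_mono)
        finally show ?thesis .
      qed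
      have "(cmod (cdot n ?r2 ?r1))\<^sup>2 \<le> nrm2 n ?r2 * nrm2 n ?r1" by (rule cmod_cdot_le)
      also have "\<dots> \<le> 1 / e\<^sup>2 * (1 / e\<^sup>2)" using assms by (intro mult_mono b) auto
      finally show "(cmod (cdot n ?r2 ?r1))\<^sup>2 \<le> (1 / e\<^sup>2)\<^sup>2" by (simp add: power2_eq_square)
    qed auto
    finally show ?thesis by simp
  qed
  have "cmod ((\<Sum>i<n. res n z1 ys i i) - (\<Sum>i<n. res n z2 ys i i)) \<le> (\<Sum>i<n. cmod (z1 - z2) / e\<^sup>2)"
    unfolding sum_subtractf[symmetric] by (rule sum_norm_le) (simp add: d)
  thus ?thesis using n by (simp add: trn_def norm_divide diff_divide_distrib[symmetric] field_simps)
qed (simp add: trn_def)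

text \<open>An eigenvector f solves its own resolvent equation with right-hand side (l - z) f;
  pairing it with R u by \<open>res_eqn_pair\<close> evaluates f^T R u without inverting a
  matrix.\<close>

lemma cdot_res_eigen:
  assumes z: "Im z > 0" and e: "\<And>i. i < n \<Longrightarrow> (\<Sum>a\<leftarrow>ys. cx a i * cdot n (cx a) (cx f)) = of_real l * cx f i"
  shows "cdot n (cx f) (mv n (res n z ys) u) = cdot n (cx f) u / (of_real l - z)"
proof -
  have 1: "res_eqn n z ys (\<lambda>i. (of_real l - z) * cx f i) (cx f)"
    using e by (simp add: res_eqn_def algebra_simps)
  have lz: "of_real l - z \<noteq> 0" using z by (auto simp: complex_eq_iff)
  have "cdot n (mv n (res n z ys) u) (\<lambda>i. (of_real l - z) * cx f i) = cdot n u (cx f)"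
    using res_eqn_pair[OF refl 1 res_eqn_res[OF z], of u] by simp
  hence "(of_real l - z) * cdot n (cx f) (mv n (res n z ys) u) = cdot n (cx f) u"
    by (simp add: cdot_cmult_right cdot_commute[of n "cx f"])
  thus ?thesis using lz by (simp add: field_simps)
qed

lemma spectral_sums:
  assumes z: "Im z > 0"
    and e: "\<And>k i. k < n \<Longrightarrow> i < n \<Longrightarrow> (\<Sum>a\<leftarrow>ys. cx a i * cdot n (cx a) (cx (f k))) = of_real (l k) * cx (f k) i"
    and complete: "\<And>i j. i < n \<Longrightarrow> j < n \<Longrightarrow> (\<Sum>k<n. f k i * f k j) = (if i = j then 1 else 0)"
    and ortho: "\<And>k. k < n \<Longrightarrow> (\<Sum>i<n. (f k i)\<^sup>2) = 1"
  shows "cdot n u (mv n (res n z ys) u) = (\<Sum>k<n. (cdot n u (cx (f k)))\<^sup>2 / (of_real (l k) - z))"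
    and "trn n z ys = (\<Sum>k<n. 1 / (of_real (l k) - z)) / of_nat n"
proof -
  have pars: "cdot n u w = (\<Sum>k<n. cdot n u (cx (f k)) * cdot n (cx (f k)) w)" for u w
  proof -
    have "(\<Sum>k<n. cdot n u (cx (f k)) * cdot n (cx (f k)) w) = (\<Sum>k<n. \<Sum>i<n. \<Sum>j<n. (u i * w j) * of_real (f k i * f k j))"
      by (simp add: cdot_def sum_product cx_def mult_ac)
    also have "\<dots> = (\<Sum>i<n. \<Sum>k<n. \<Sum>j<n. (u i * w j) * of_real (f k i * f k j))" by (rule sum.swap)
    also have "\<dots> = (\<Sum>i<n. \<Sum>j<n. \<Sum>k<n. (u i * w j) * of_real (f k i * f k j))"
      by (intro sum.cong refl sum.swap)
    also have "\<dots> = (\<Sum>i<n. \<Sum>j<n. (u i * w j) * of_real (if i = j then 1 else 0))"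
      by (intro sum.cong refl) (simp add: sum_distrib_left[symmetric] of_real_sum[symmetric] complete del: of_real_mult of_real_sum)
    also have "\<dots> = cdot n u w"
      by (simp add: cdot_def if_distrib[of of_real] if_distrib[of "\<lambda>x. _ * x"] sum.delta cong: if_cong)
    finally show ?thesis by simp
  qed
  have g: "cdot n u (mv n (res n z ys) u) = (\<Sum>k<n. (cdot n u (cx (f k)))\<^sup>2 / (of_real (l k) - z))" for u
  proof -
    have "cdot n u (mv n (res n z ys) u) = (\<Sum>k<n. cdot n u (cx (f k)) * cdot n (cx (f k)) (mv n (res n z ys) u))"
      by (rule pars)
    also have "\<dots> = (\<Sum>k<n. (cdot n u (cx (f k)))\<^sup>2 / (of_real (l k) - z))"
      using cdot_res_eigen[OF z e] by (intro sum.cong) (auto simp: power2_eq_square cdot_commute[of n "cx _"])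
    finally show ?thesis .
  qed
  show "cdot n u (mv n (res n z ys) u) = (\<Sum>k<n. (cdot n u (cx (f k)))\<^sup>2 / (of_real (l k) - z))" by (rule g)
  have "(\<Sum>i<n. res n z ys i i) = (\<Sum>i<n. \<Sum>k<n. of_real ((f k i)\<^sup>2) / (of_real (l k) - z))"
  proof (intro sum.cong refl)
    fix i assume "i \<in> {..<n}"
    thus "res n z ys i i = (\<Sum>k<n. of_real ((f k i)\<^sup>2) / (of_real (l k) - z))"
      using g[of "cx (ev i)"] by (simp add: cdot_ev mv_ev) (simp add: cx_def)
  qed
  also have "\<dots> = (\<Sum>k<n. \<Sum>i<n. of_real ((f k i)\<^sup>2) / (of_real (l k) - z))" by (rule sum.swap)
  also have "\<dots> = (\<Sum>k<n. 1 / (of_real (l k) - z))"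
    using ortho by (intro sum.cong refl) (simp add: sum_divide_distrib[symmetric] of_real_sum[symmetric] del: of_real_sum of_real_power)
  finally show "trn n z ys = (\<Sum>k<n. 1 / (of_real (l k) - z)) / of_nat n" by (simp add: trn_def)
qed

section \<open>An Efron--Stein inequality for higher moments\<close>

text \<open>Functions with finite moments of all orders are closed under sums, products, powers and
  averaging over a coordinate, so that integrability of the polynomial expressions below is settled
  by structural rules.\<close>

definition allmom :: "'a measure \<Rightarrow> ('a \<Rightarrow> real) \<Rightarrow> bool" where
  "allmom M f \<longleftrightarrow> f \<in> borel_measurable M \<and> (\<forall>p::nat. integrable M (\<lambda>x. \<bar>f x\<bar> ^ p))"

lemma allmom_measurable [measurable_dest]: "allmom M f \<Longrightarrow> f \<in> borel_measurable M"
  by (simp add: allmom_def)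

lemma allmom_abs_power: "allmom M f \<Longrightarrow> integrable M (\<lambda>x. \<bar>f x\<bar> ^ p)"
  by (simp add: allmom_def)

lemma allmom_integrable: "allmom M f \<Longrightarrow> integrable M f"
  using allmom_abs_power[of M f 1] allmom_measurable[of M f]
  by (simp add: integrable_iff_bounded)

lemma allmom_mono:
  assumes "allmom M g" "f \<in> borel_measurable M" "\<And>x. x \<in> space M \<Longrightarrow> \<bar>f x\<bar> \<le> \<bar>g x\<bar>"
  shows "allmom M f"
  unfolding allmom_def
proof (intro conjI allI)
  fix p :: nat
  show "integrable M (\<lambda>x. \<bar>f x\<bar> ^ p)"
    using assms(2)
    by (intro Bochner_Integration.integrable_bound[OF allmom_abs_power[OF assms(1), of p]])
       (auto intro!: AE_I2 power_mono assms(3))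
qed fact

lemma (in finite_measure) allmom_const [simp, intro]: "allmom M (\<lambda>_. c)"
  by (simp add: allmom_def)

lemma (in finite_measure) allmom_bounded:
  assumes "f \<in> borel_measurable M" "\<And>x. x \<in> space M \<Longrightarrow> \<bar>f x\<bar> \<le> B"
  shows "allmom M f"
  using assms by (intro allmom_mono[OF allmom_const[of B]]) fastforce+

lemma abs_add_power_le:
  fixes a b :: real
  shows "\<bar>a + b\<bar> ^ p \<le> 2 ^ p * (\<bar>a\<bar> ^ p + \<bar>b\<bar> ^ p)"
proof -
  let ?m = "max \<bar>a\<bar> \<bar>b\<bar>"
  have "\<bar>a + b\<bar> ^ p \<le> (2 * ?m) ^ p" by (intro power_mono) auto
  also have "\<dots> = 2 ^ p * ?m ^ p" by (simp add: power_mult_distrib)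
  also have "?m ^ p \<le> \<bar>a\<bar> ^ p + \<bar>b\<bar> ^ p" by (auto simp: max_def)
  finally show ?thesis by simp
qed

lemma allmom_add [intro]:
  assumes "allmom M f" "allmom M g"
  shows "allmom M (\<lambda>x. f x + g x)"
  unfolding allmom_def
proof (intro conjI allI)
  have [measurable]: "f \<in> borel_measurable M" "g \<in> borel_measurable M"
    using assms by (auto simp: allmom_def)
  show "(\<lambda>x. f x + g x) \<in> borel_measurable M" by measurable
  fix p :: nat
  have *: "integrable M (\<lambda>x. 2 ^ p * (\<bar>f x\<bar> ^ p + \<bar>g x\<bar> ^ p))"
    using assms by (intro integrable_mult_right Bochner_Integration.integrable_add allmom_abs_power)
  show "integrable M (\<lambda>x. \<bar>f x + g x\<bar> ^ p)"
    by (rule Bochner_Integration.integrable_bound[OF *])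
       (auto intro!: AE_I2 order_trans[OF abs_add_power_le])
qed

lemma allmom_mult [intro]:
  assumes "allmom M f" "allmom M g"
  shows "allmom M (\<lambda>x. f x * g x)"
  unfolding allmom_def
proof (intro conjI allI)
  have [measurable]: "f \<in> borel_measurable M" "g \<in> borel_measurable M"
    using assms by (auto simp: allmom_def)
  show "(\<lambda>x. f x * g x) \<in> borel_measurable M" by measurable
  fix p :: nat
  have *: "integrable M (\<lambda>x. \<bar>f x\<bar> ^ (2*p) + \<bar>g x\<bar> ^ (2*p))"
    using assms by (intro Bochner_Integration.integrable_add allmom_abs_power)
  have "\<bar>f x * g x\<bar> ^ p \<le> \<bar>f x\<bar> ^ (2*p) + \<bar>g x\<bar> ^ (2*p)" for x
  proof -
    have "\<bar>f x\<bar> ^ p * \<bar>g x\<bar> ^ p \<le> (\<bar>f x\<bar> ^ p)\<^sup>2 + (\<bar>g x\<bar> ^ p)\<^sup>2"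
    proof -
      have "0 \<le> \<bar>f x\<bar> ^ p * \<bar>g x\<bar> ^ p" by simp
      thus ?thesis using sum_squares_bound[of "\<bar>f x\<bar> ^ p" "\<bar>g x\<bar> ^ p"] by linarith
    qed
    thus ?thesis by (simp add: abs_mult power_mult_distrib power_mult[symmetric] mult.commute)
  qed
  thus "integrable M (\<lambda>x. \<bar>f x * g x\<bar> ^ p)"
    by (intro Bochner_Integration.integrable_bound[OF *]) (auto intro!: AE_I2)
qed

context finite_measure
begin

lemma allmom_cmult [intro]: "allmom M f \<Longrightarrow> allmom M (\<lambda>x. c * f x)"
  by (rule allmom_mult) auto

lemma allmom_minus [intro]: "allmom M f \<Longrightarrow> allmom M (\<lambda>x. - f x)"
  using allmom_cmult[of f "-1"] by simp

lemma allmom_diff [intro]: "allmom M f \<Longrightarrow> allmom M g \<Longrightarrow> allmom M (\<lambda>x. f x - g x)"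
  using allmom_add[of M f "\<lambda>x. - g x"] by (auto dest: allmom_minus)

lemma allmom_sum [intro]: "(\<And>i. i \<in> A \<Longrightarrow> allmom M (f i)) \<Longrightarrow> allmom M (\<lambda>x. \<Sum>i\<in>A. f i x)"
  by (induction A rule: infinite_finite_induct) auto

lemma allmom_power [intro]: "allmom M f \<Longrightarrow> allmom M (\<lambda>x. f x ^ p)"
  by (induction p) auto

lemma allmom_abs [intro]: "allmom M f \<Longrightarrow> allmom M (\<lambda>x. \<bar>f x\<bar>)"
  by (auto simp: allmom_def)

lemma allmom_of_power_bound:
  assumes "f \<in> borel_measurable M" "\<And>p. (\<integral>\<^sup>+x. ennreal (\<bar>f x\<bar> ^ (2*p)) \<partial>M) < \<infinity>"
  shows "allmom M f"
  unfolding allmom_def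
proof (intro conjI allI)
  fix p :: nat
  have "integrable M (\<lambda>x. \<bar>f x\<bar> ^ (2*p))"
    using assms by (intro integrableI_bounded) auto
  hence *: "integrable M (\<lambda>x. 1 + \<bar>f x\<bar> ^ (2*p))" by auto
  have "\<bar>f x\<bar> ^ p \<le> 1 + \<bar>f x\<bar> ^ (2*p)" for x
  proof (cases "\<bar>f x\<bar> \<le> 1")
    case True thus ?thesis by (smt (verit) power_le_one zero_le_power abs_ge_zero)
  next
    case False
    hence "\<bar>f x\<bar> ^ p \<le> \<bar>f x\<bar> ^ (2*p)" by (intro power_increasing) auto
    thus ?thesis by linarith
  qed
  thus "integrable M (\<lambda>x. \<bar>f x\<bar> ^ p)"
    using assms(1) by (intro Bochner_Integration.integrable_bound[OF *]) (auto intro!: AE_I2)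
qed fact

end

text \<open>The bound 2 |f g| \<le> l f^2 + g^2 / l is integrated and l chosen optimally. Adding a
  small d to both second moments keeps the optimal l defined and positive when one of them
  vanishes.\<close>

lemma Cauchy_Schwarz_allmom:
  assumes f: "allmom M f" and g: "allmom M g"
  shows "(\<integral>x. \<bar>f x * g x\<bar> \<partial>M) \<le> sqrt (\<integral>x. (f x)\<^sup>2 \<partial>M) * sqrt (\<integral>x. (g x)\<^sup>2 \<partial>M)"
proof -
  have [measurable]: "f \<in> borel_measurable M" "g \<in> borel_measurable M"
    using f g by (auto simp: allmom_def)
  have i: "integrable M (\<lambda>x. (f x)\<^sup>2)" "integrable M (\<lambda>x. (g x)\<^sup>2)"
    using allmom_abs_power[OF f, of 2] allmom_abs_power[OF g, of 2] by simp_all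
  have ifg: "integrable M (\<lambda>x. \<bar>f x * g x\<bar>)"
    using allmom_abs_power[OF allmom_mult[OF f g], of 1] by simp
  define A where "A = (\<integral>x. (f x)\<^sup>2 \<partial>M)"
  define B where "B = (\<integral>x. (g x)\<^sup>2 \<partial>M)"
  have AB: "A \<ge> 0" "B \<ge> 0" by (auto simp: A_def B_def)
  have main: "2 * (\<integral>x. \<bar>f x * g x\<bar> \<partial>M) \<le> l * A + B / l" if "l > 0" for l
  proof -
    have "2 * \<bar>f x * g x\<bar> \<le> l * (f x)\<^sup>2 + (g x)\<^sup>2 / l" for x
    proof -
      have "0 \<le> (l * \<bar>f x\<bar> - \<bar>g x\<bar>)\<^sup>2" by simp
      hence "2 * l * \<bar>f x * g x\<bar> \<le> l\<^sup>2 * (f x)\<^sup>2 + (g x)\<^sup>2"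
        by (simp add: power2_diff power_mult_distrib abs_mult algebra_simps)
      thus ?thesis using that by (simp add: field_simps power2_eq_square)
    qed
    hence "(\<integral>x. 2 * \<bar>f x * g x\<bar> \<partial>M) \<le> (\<integral>x. l * (f x)\<^sup>2 + (g x)\<^sup>2 / l \<partial>M)"
      using i ifg by (intro integral_mono) auto
    thus ?thesis using i by (simp add: A_def B_def)
  qed
  have "(\<integral>x. \<bar>f x * g x\<bar> \<partial>M) \<le> sqrt A * sqrt B"
  proof (rule field_le_epsilon)
    fix e :: real assume e: "e > 0"
    have "((\<lambda>d. sqrt (A+d) * sqrt (B+d)) \<longlongrightarrow> sqrt (A+0) * sqrt (B+0)) (at_right 0)"
      by (intro tendsto_intros)
    hence "\<forall>\<^sub>F d in at_right 0. sqrt (A+d) * sqrt (B+d) < sqrt A * sqrt B + e"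
      using e by (intro order_tendstoD) auto
    from eventually_happens'[OF trivial_limit_at_right_real eventually_conj[OF eventually_at_right_less this]]
    obtain d where d: "d > 0" "sqrt (A+d) * sqrt (B+d) < sqrt A * sqrt B + e"
      by blast
    define l where "l = sqrt (B+d) / sqrt (A+d)"
    have l: "l > 0" using AB d by (simp add: l_def)
    have "2 * (\<integral>x. \<bar>f x * g x\<bar> \<partial>M) \<le> l * A + B / l" by (rule main[OF l])
    also have "\<dots> \<le> l * (A+d) + (B+d) / l"
      using l d by (intro add_mono mult_left_mono divide_right_mono) auto
    also have "l * (A+d) = sqrt (B+d) * sqrt (A+d)"
    proof -
      have "l * (A+d) = sqrt (B+d) * ((A+d) / sqrt (A+d))" by (simp add: l_def)
      thus ?thesis using AB d by (simp only: real_div_sqrt)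
    qed
    also have "(B+d)/l = sqrt (B+d) * sqrt (A+d)"
    proof -
      have "(B+d)/l = ((B+d) / sqrt (B+d)) * sqrt (A+d)" by (simp add: l_def)
      thus ?thesis using AB d by (simp only: real_div_sqrt)
    qed
    finally show "(\<integral>x. \<bar>f x * g x\<bar> \<partial>M) \<le> sqrt A * sqrt B + e" using d by (simp add: mult.commute)
  qed
  thus ?thesis by (simp add: A_def B_def)
qed

text \<open>Stated in \<open>ennreal\<close> because it is applied to sections of a function in one
  coordinate, which may fail to be integrable on a null set; a non-integrable f has integral 0 by
  convention, and the bound is then trivial for p > 0.\<close>

lemma (in prob_space) Jensen_even_power_nn:
  fixes f :: "'a \<Rightarrow> real"
  shows "ennreal (\<bar>\<integral>x. f x \<partial>M\<bar> ^ (2*p)) \<le> (\<integral>\<^sup>+x. ennreal (\<bar>f x\<bar> ^ (2*p)) \<partial>M)"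
proof (cases "integrable M f \<and> (\<integral>\<^sup>+x. ennreal (\<bar>f x\<bar> ^ (2*p)) \<partial>M) < \<infinity>")
  case True
  hence [measurable]: "f \<in> borel_measurable M" by auto
  have i: "integrable M (\<lambda>x. f x ^ (2*p))"
    using True by (intro integrableI_bounded) (auto simp: power_abs)
  have "(\<integral>x. f x \<partial>M) ^ (2*p) \<le> (\<integral>x. f x ^ (2*p) \<partial>M)"
    using True i by (intro jensens_inequality[where I=UNIV]) (auto intro!: convex_power_even)
  moreover have "(\<integral>\<^sup>+x. ennreal (\<bar>f x\<bar> ^ (2*p)) \<partial>M) = ennreal (\<integral>x. f x ^ (2*p) \<partial>M)"
    using i by (subst nn_integral_eq_integral[symmetric]) (auto simp: power_even_abs)
  ultimately show ?thesis by (simp add: power_even_abs ennreal_leI)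
next
  case False
  show ?thesis
  proof (cases "integrable M f")
    case True
    thus ?thesis using False by (auto simp: not_less top_unique)
  next
    case F: False
    show ?thesis
    proof (cases "p = 0")
      case True thus ?thesis by (simp add: emeasure_space_1)
    next
      case pF: False
      thus ?thesis using F by (simp add: not_integrable_integral_eq power_0_left)
    qed
  qed
qed

text \<open>The binomial expansion with its linear term kept exact, since that term will have mean
  zero. Every term of order k \<ge> 2 in d is dominated by the sum of those of order 2 and 2p, and
  4^p is the sum of all binomial coefficients.\<close>

lemma even_power_add_le:
  fixes a d :: real
  assumes "1 \<le> p"
  shows "(a + d) ^ (2*p) \<le> a ^ (2*p) + 2 * p * (a ^ (2*p-1) * d) + 4 ^ p * (\<bar>a\<bar> ^ (2*p-2) * d\<^sup>2 + \<bar>d\<bar> ^ (2*p))"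
proof -
  let ?T = "\<lambda>k. real (2*p choose k) * a ^ (2*p-k) * d ^ k"
  let ?B = "\<bar>a\<bar> ^ (2*p-2) * d\<^sup>2 + \<bar>d\<bar> ^ (2*p)"
  have B0: "?B \<ge> 0" by auto
  have "(a + d) ^ (2*p) = (\<Sum>k\<le>2*p. ?T k)"
    using binomial_ring[of d a "2*p"] by (simp add: add.commute mult_ac)
  also have "{..2*p} = {0,1} \<union> {2..2*p}" using assms by auto
  also have "(\<Sum>k\<in>{0,1} \<union> {2..2*p}. ?T k) = a ^ (2*p) + 2 * p * (a ^ (2*p-1) * d) + (\<Sum>k=2..2*p. ?T k)"
    by (subst sum.union_disjoint) auto
  also have "(\<Sum>k=2..2*p. ?T k) \<le> (\<Sum>k=2..2*p. real (2*p choose k) * ?B)"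
  proof (intro sum_mono)
    fix k assume k: "k \<in> {2..2*p}"
    have "\<bar>a\<bar> ^ (2*p-k) * \<bar>d\<bar> ^ k \<le> ?B"
    proof (cases "\<bar>d\<bar> \<le> \<bar>a\<bar>")
      case True
      have "\<bar>d\<bar> ^ k = \<bar>d\<bar> ^ (k-2) * \<bar>d\<bar>^2"
        using k by (metis atLeastAtMost_iff le_add_diff_inverse2 power_add)
      hence "\<bar>a\<bar> ^ (2*p-k) * \<bar>d\<bar> ^ k = \<bar>a\<bar> ^ (2*p-k) * (\<bar>d\<bar> ^ (k-2) * \<bar>d\<bar>^2)"
        by simp
      also have "\<dots> \<le> \<bar>a\<bar> ^ (2*p-k) * (\<bar>a\<bar> ^ (k-2) * \<bar>d\<bar>^2)"
        using True by (intro mult_left_mono mult_right_mono power_mono) auto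
      also have "\<dots> = \<bar>a\<bar> ^ (2*p-2) * d\<^sup>2" using k by (simp add: power_add[symmetric] mult.assoc[symmetric])
      finally show ?thesis by (smt (verit) zero_le_power abs_ge_zero)
    next
      case False
      have "\<bar>a\<bar> ^ (2*p-k) * \<bar>d\<bar> ^ k \<le> \<bar>d\<bar> ^ (2*p-k) * \<bar>d\<bar> ^ k"
        using False by (intro mult_right_mono power_mono) auto
      also have "\<dots> = \<bar>d\<bar> ^ (2*p)" using k by (simp add: power_add[symmetric])
      finally show ?thesis by (smt (verit) zero_le_power abs_ge_zero mult_nonneg_nonneg zero_le_power2)
    qed
    moreover have "a ^ (2*p-k) * d ^ k \<le> \<bar>a ^ (2*p-k) * d ^ k\<bar>" by simp
    ultimately have "a ^ (2*p-k) * d ^ k \<le> ?B"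
      by (simp only: abs_mult power_abs)
    thus "?T k \<le> real (2*p choose k) * ?B" by (metis mult.assoc mult_left_mono of_nat_0_le_iff)
  qed
  also have "\<dots> = real (\<Sum>k=2..2*p. 2*p choose k) * ?B" by (simp add: sum_distrib_right)
  also have "\<dots> \<le> 4 ^ p * ?B"
  proof (intro mult_right_mono B0)
    have "(\<Sum>k=2..2*p. 2*p choose k) \<le> (\<Sum>k\<le>2*p. 2*p choose k)" by (intro sum_mono2) auto
    also have "\<dots> = 4 ^ p" by (simp add: choose_row_sum power_mult)
    finally show "real (\<Sum>k=2..2*p. 2*p choose k) \<le> 4 ^ p" by (metis of_nat_le_iff of_nat_numeral of_nat_power)
  qed
  finally show ?thesis by simp
qed

text \<open>A weighted Young inequality: the first or the second term dominates according to whether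
  b \<le> t a. The weight t will be chosen separately for every coordinate.\<close>

lemma power_Young:
  fixes a b t :: real
  assumes "a \<ge> 0" "b \<ge> 0" "t > 0" and that: "1 \<le> p"
  shows "a ^ (p-1) * b \<le> t * a ^ p + b ^ p / t ^ (p-1)"
proof (cases "b \<le> t * a")
  case True
  have "a ^ (p-1) * b \<le> a ^ (p-1) * (t * a)" using True assms by (intro mult_left_mono) auto
  also have "\<dots> = t * a ^ p" using that by (cases p) auto
  finally show ?thesis using assms by (smt (verit) zero_le_power divide_nonneg_pos zero_less_power)
next
  case False
  hence "a \<le> b / t" using assms by (simp add: field_simps)
  hence "a ^ (p-1) * b \<le> (b/t) ^ (p-1) * b" using assms by (intro mult_right_mono power_mono) auto
  also have "\<dots> = b ^ p / t ^ (p-1)" using that by (cases p) (auto simp: power_divide)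
  finally show ?thesis using assms by (smt (verit) zero_le_power mult_nonneg_nonneg)
qed

section \<open>Averaging over single coordinates of a finite product space\<close>

definition ES :: "nat \<Rightarrow> real" where "ES p = exp (4^p) * (2 * 64^p)"

lemma ES_nonneg [simp]: "ES p \<ge> 0" by (simp add: ES_def)

locale prod_space =
  fixes N :: "'i \<Rightarrow> 'a measure" and I :: "'i set"
  assumes fin: "finite I" and prob: "\<And>i. prob_space (N i)"
begin

abbreviation \<Omega> where "\<Omega> \<equiv> PiM I N"

sublocale Om: prob_space \<Omega>
  by (intro prob_space_PiM prob)

text \<open>Conditional expectation given the other coordinates, realised by overwriting w at k, so
  that every function stays on the same product space.\<close>

definition avg :: "'i \<Rightarrow> (('i \<Rightarrow> 'a) \<Rightarrow> 'c) \<Rightarrow> ('i \<Rightarrow> 'a) \<Rightarrow> 'c::{banach, second_countable_topology}" where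
  "avg k f = (\<lambda>w. \<integral>y. f (w(k := y)) \<partial>N k)"

definition free_of :: "'i \<Rightarrow> (('i \<Rightarrow> 'a) \<Rightarrow> 'c) \<Rightarrow> bool" where
  "free_of k f \<longleftrightarrow> (\<forall>w\<in>space \<Omega>. \<forall>y\<in>space (N k). f (w(k := y)) = f w)"

lemma upd_space: "k \<in> I \<Longrightarrow> w \<in> space \<Omega> \<Longrightarrow> y \<in> space (N k) \<Longrightarrow> w(k := y) \<in> space \<Omega>"
  by (auto simp: space_PiM PiE_iff extensional_def)

lemma upd_measurable [measurable]:
  assumes k: "k \<in> I"
  shows "(\<lambda>(y, w). w(k := y)) \<in> N k \<Otimes>\<^sub>M \<Omega> \<rightarrow>\<^sub>M \<Omega>"
proof (rule measurable_PiM_single')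
  fix i assume i: "i \<in> I"
  show "(\<lambda>p. (case p of (y, w) \<Rightarrow> w(k := y)) i) \<in> N k \<Otimes>\<^sub>M \<Omega> \<rightarrow>\<^sub>M N i"
    using measurable_compose[OF measurable_snd measurable_component_singleton[OF i, of N], of "N k"]
    by (cases "i = k") (simp_all add: case_prod_unfold)
qed (use k in \<open>auto simp: space_pair_measure space_PiM PiE_iff extensional_def\<close>)

lemma upd_measurable' [measurable]:
  assumes k: "k \<in> I"
  shows "(\<lambda>(w, y). w(k := y)) \<in> \<Omega> \<Otimes>\<^sub>M N k \<rightarrow>\<^sub>M \<Omega>"
  using measurable_compose[OF measurable_pair_swap' upd_measurable[OF k]]
  by (simp add: case_prod_unfold)

text \<open>Resampling one coordinate preserves the product measure; the Fubini arguments on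
  \<Omega> rest on this.\<close>

lemma distr_upd: "k \<in> I \<Longrightarrow> distr (N k \<Otimes>\<^sub>M \<Omega>) \<Omega> (\<lambda>(y, w). w(k := y)) = \<Omega>"
  using distr_pair_PiM_eq_PiM[of I N k] prob by (simp add: insert_absorb)

lemma pair_prob: "pair_prob_space (N k) \<Omega>"
proof -
  interpret prob_space "N k" by (rule prob)
  show ?thesis by unfold_locales
qed

lemma nn_integral_resample:
  assumes k: "k \<in> I" and [measurable]: "f \<in> borel_measurable \<Omega>"
  shows "(\<integral>\<^sup>+w. f w \<partial>\<Omega>) = (\<integral>\<^sup>+w. \<integral>\<^sup>+y. f (w(k := y)) \<partial>N k \<partial>\<Omega>)"
proof -
  interpret pair_prob_space "N k" \<Omega> by (rule pair_prob)
  note [measurable] = upd_measurable[OF k] upd_measurable'[OF k]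
  have "(\<integral>\<^sup>+w. f w \<partial>\<Omega>) = (\<integral>\<^sup>+w. f w \<partial>distr (N k \<Otimes>\<^sub>M \<Omega>) \<Omega> (\<lambda>(y, w). w(k := y)))"
    by (simp only: distr_upd[OF k])
  also have "\<dots> = (\<integral>\<^sup>+p. f ((\<lambda>(y, w). w(k := y)) p) \<partial>(N k \<Otimes>\<^sub>M \<Omega>))"
    by (rule nn_integral_distr) measurable
  also have "\<dots> = (\<integral>\<^sup>+w. \<integral>\<^sup>+y. f (w(k := y)) \<partial>N k \<partial>\<Omega>)"
    by (subst nn_integral_snd[symmetric]) (auto simp: case_prod_beta)
  finally show ?thesis .
qed

lemma integrable_resample_pair:
  fixes f :: "('i \<Rightarrow> 'a) \<Rightarrow> 'c::{banach, second_countable_topology}"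
  assumes k: "k \<in> I" and f: "integrable \<Omega> f"
  shows "integrable (N k \<Otimes>\<^sub>M \<Omega>) (\<lambda>(y, w). f (w(k := y)))"
proof -
  have "integrable (distr (N k \<Otimes>\<^sub>M \<Omega>) \<Omega> (\<lambda>(y, w). w(k := y))) f"
    using f by (simp only: distr_upd[OF k])
  from integrable_distr[OF upd_measurable[OF k] this]
  show ?thesis by (simp add: case_prod_unfold)
qed

lemma integral_resample:
  fixes f :: "('i \<Rightarrow> 'a) \<Rightarrow> 'c::{banach, second_countable_topology}"
  assumes k: "k \<in> I" and f: "integrable \<Omega> f"
  shows "(\<integral>w. f w \<partial>\<Omega>) = (\<integral>w. avg k f w \<partial>\<Omega>)"
    and "integrable \<Omega> (avg k f)"
proof -
  interpret pair_prob_space "N k" \<Omega> by (rule pair_prob)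
  have [measurable]: "f \<in> borel_measurable \<Omega>" using f by auto
  have "(\<integral>w. f w \<partial>\<Omega>) = (\<integral>w. f w \<partial>distr (N k \<Otimes>\<^sub>M \<Omega>) \<Omega> (\<lambda>(y, w). w(k := y)))"
    by (simp only: distr_upd[OF k])
  also have "\<dots> = (\<integral>p. f ((\<lambda>(y, w). w(k := y)) p) \<partial>(N k \<Otimes>\<^sub>M \<Omega>))"
    using k by (intro integral_distr) measurable
  also have "\<dots> = (\<integral>(y,w). f (w(k := y)) \<partial>(N k \<Otimes>\<^sub>M \<Omega>))" by (simp add: case_prod_unfold)
  also have "\<dots> = (\<integral>w. avg k f w \<partial>\<Omega>)"
    unfolding avg_def by (rule integral_snd[symmetric, OF integrable_resample_pair[OF assms]])
  finally show "(\<integral>w. f w \<partial>\<Omega>) = (\<integral>w. avg k f w \<partial>\<Omega>)" .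
  show "integrable \<Omega> (avg k f)"
    unfolding avg_def by (rule integrable_snd[OF integrable_resample_pair[OF assms]])
qed

lemma avg_measurable [measurable]:
  fixes f :: "('i \<Rightarrow> 'a) \<Rightarrow> 'c::{banach, second_countable_topology}"
  assumes k: "k \<in> I" and [measurable]: "f \<in> borel_measurable \<Omega>"
  shows "avg k f \<in> borel_measurable \<Omega>"
proof -
  interpret prob_space "N k" by (rule prob)
  note [measurable] = upd_measurable'[OF k]
  have [measurable]: "(\<lambda>(w, y). f (w(k := y))) \<in> borel_measurable (\<Omega> \<Otimes>\<^sub>M N k)"
    using measurable_compose[OF upd_measurable'[OF k], of f borel] by (simp add: case_prod_beta)
  show ?thesis unfolding avg_def by measurable
qed

lemma avg_free: "free_of k (avg k f)"
  by (simp add: free_of_def avg_def)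

lemma avg_preserves_free:
  assumes "free_of j f" "k \<in> I" "j \<in> I" "k \<noteq> j"
  shows "free_of j (avg k f)"
  unfolding free_of_def avg_def
proof (intro ballI Bochner_Integration.integral_cong refl)
  fix w y y' assume *: "w \<in> space \<Omega>" "y \<in> space (N j)" "y' \<in> space (N k)"
  have "f (w(j := y, k := y')) = f (w(k := y', j := y))" using assms by (simp add: fun_upd_twist)
  also have "\<dots> = f (w(k := y'))" using assms * upd_space by (auto simp: free_of_def)
  finally show "f (w(j := y, k := y')) = f (w(k := y'))" .
qed

lemma avg_of_free:
  fixes f :: "('i \<Rightarrow> 'a) \<Rightarrow> 'c::{banach, second_countable_topology}"
  assumes "free_of k f" "w \<in> space \<Omega>"
  shows "avg k f w = f w"
proof -
  interpret prob_space "N k" by (rule prob)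
  have "avg k f w = (\<integral>y. f w \<partial>N k)" unfolding avg_def
    using assms by (intro Bochner_Integration.integral_cong) (auto simp: free_of_def)
  thus ?thesis by (simp add: prob_space)
qed

lemma avg_power_nn_le:
  assumes k: "k \<in> I" and [measurable]: "f \<in> borel_measurable \<Omega>"
  shows "(\<integral>\<^sup>+w. ennreal (\<bar>avg k f w\<bar> ^ (2*p)) \<partial>\<Omega>) \<le> (\<integral>\<^sup>+w. ennreal (\<bar>f w\<bar> ^ (2*p)) \<partial>\<Omega>)"
proof -
  interpret prob_space "N k" by (rule prob)
  have "(\<integral>\<^sup>+w. ennreal (\<bar>avg k f w\<bar> ^ (2*p)) \<partial>\<Omega>) \<le> (\<integral>\<^sup>+w. \<integral>\<^sup>+y. ennreal (\<bar>f (w(k:=y))\<bar> ^ (2*p)) \<partial>N k \<partial>\<Omega>)"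
    unfolding avg_def by (intro nn_integral_mono Jensen_even_power_nn)
  also have "\<dots> = (\<integral>\<^sup>+w. ennreal (\<bar>f w\<bar> ^ (2*p)) \<partial>\<Omega>)"
    using k by (subst nn_integral_resample[OF k, of "\<lambda>w. ennreal (\<bar>f w\<bar> ^ (2*p))"]) auto
  finally show ?thesis .
qed

lemma nn_power_eq:
  assumes "allmom \<Omega> f"
  shows "(\<integral>\<^sup>+w. ennreal (\<bar>f w\<bar> ^ p) \<partial>\<Omega>) = ennreal (\<integral>w. \<bar>f w\<bar> ^ p \<partial>\<Omega>)"
  using allmom_abs_power[OF assms] by (intro nn_integral_eq_integral) auto

lemma allmom_avg:
  assumes k: "k \<in> I" and f: "allmom \<Omega> f"
  shows "allmom \<Omega> (avg k f)"
proof (rule Om.allmom_of_power_bound)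
  have m: "f \<in> borel_measurable \<Omega>" using f by (simp add: allmom_def)
  thus "avg k f \<in> borel_measurable \<Omega>" using k by measurable
  show "(\<integral>\<^sup>+w. ennreal (\<bar>avg k f w\<bar> ^ (2*p)) \<partial>\<Omega>) < \<infinity>" for p
    by (rule le_less_trans[OF avg_power_nn_le[OF k m, of p]]) (simp add: nn_power_eq[OF f])
qed

lemma avg_power_le:
  assumes k: "k \<in> I" and f: "allmom \<Omega> f"
  shows "(\<integral>w. \<bar>avg k f w\<bar> ^ (2*p) \<partial>\<Omega>) \<le> (\<integral>w. \<bar>f w\<bar> ^ (2*p) \<partial>\<Omega>)"
proof -
  have m: "f \<in> borel_measurable \<Omega>" using f by (simp add: allmom_def)
  have "ennreal (\<integral>w. \<bar>avg k f w\<bar> ^ (2*p) \<partial>\<Omega>) \<le> ennreal (\<integral>w. \<bar>f w\<bar> ^ (2*p) \<partial>\<Omega>)"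
    using avg_power_nn_le[OF k m, of p] nn_power_eq[OF f, of "2*p"] nn_power_eq[OF allmom_avg[OF k f], of "2*p"]
    by simp
  thus ?thesis by (subst (asm) ennreal_le_iff) (auto intro!: integral_nonneg_AE)
qed

lemma free_const:
  assumes "\<And>k. k \<in> I \<Longrightarrow> free_of k f" "w \<in> space \<Omega>" "w' \<in> space \<Omega>"
  shows "f w = f w'"
proof -
  have "f (\<lambda>i. if i \<in> J then w' i else w i) = f w" if "J \<subseteq> I" for J
    using finite_subset[OF that fin] that
  proof (induction J rule: finite_induct)
    case (insert j J)
    let ?w = "\<lambda>i. if i \<in> J then w' i else w i"
    have w: "?w \<in> space \<Omega>" using assms(2,3) insert(4) by (auto simp: space_PiM PiE_iff extensional_def)
    have "(\<lambda>i. if i \<in> insert j J then w' i else w i) = ?w(j := w' j)" by auto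
    moreover have "w' j \<in> space (N j)" using assms(3) insert(4) by (auto simp: space_PiM PiE_iff)
    ultimately have "f (\<lambda>i. if i \<in> insert j J then w' i else w i) = f ?w"
      using assms(1)[of j] insert(4) w by (auto simp: free_of_def)
    thus ?case using insert by simp
  qed simp
  from this[of I] have "f (\<lambda>i. if i \<in> I then w' i else w i) = f w" by simp
  moreover have "(\<lambda>i. if i \<in> I then w' i else w i) = w'"
    using assms(2,3) by (auto simp: space_PiM PiE_iff extensional_def fun_eq_iff)
  ultimately show ?thesis by simp
qed

text \<open>A function split into a part not depending on coordinate \<open>k\<close> and a part with zero
  conditional mean: the linear term of the binomial expansion drops out.\<close>

lemma moment_step:
  assumes k: "k \<in> I" and F: "allmom \<Omega> F" "free_of k F" and d: "allmom \<Omega> d"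
    and d0: "\<And>w. w \<in> space \<Omega> \<Longrightarrow> avg k d w = 0" and p: "1 \<le> p" and t: "0 < t"
  shows "(\<integral>w. \<bar>F w + d w\<bar> ^ (2*p) \<partial>\<Omega>) \<le> (1 + 4^p * t) * (\<integral>w. \<bar>F w\<bar> ^ (2*p) \<partial>\<Omega>)
           + 4^p * (1 + 1 / t^(p-1)) * (\<integral>w. \<bar>d w\<bar> ^ (2*p) \<partial>\<Omega>)"
proof -
  have i1: "allmom \<Omega> (\<lambda>w. F w ^ (2*p-1) * d w)" using F(1) d by auto
  have "avg k (\<lambda>w. F w ^ (2*p-1) * d w) w = 0" if w: "w \<in> space \<Omega>" for w
  proof -
    have "avg k (\<lambda>w. F w ^ (2*p-1) * d w) w = (\<integral>y. F w ^ (2*p-1) * d (w(k:=y)) \<partial>N k)"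
      unfolding avg_def using F(2) w by (intro Bochner_Integration.integral_cong) (auto simp: free_of_def)
    also have "\<dots> = F w ^ (2*p-1) * avg k d w" by (simp add: avg_def)
    finally show ?thesis using d0[OF w] by simp
  qed
  hence z: "(\<integral>w. F w ^ (2*p-1) * d w \<partial>\<Omega>) = 0"
    using integral_resample(1)[OF k allmom_integrable[OF i1]]
    by (simp cong: Bochner_Integration.integral_cong)
  have iF: "integrable \<Omega> (\<lambda>w. \<bar>F w\<bar> ^ (2*p))" "integrable \<Omega> (\<lambda>w. \<bar>d w\<bar> ^ (2*p))"
    using F d by (auto intro: allmom_abs_power)
  have le: "\<bar>F w + d w\<bar> ^ (2*p) \<le> (1 + 4^p*t) * \<bar>F w\<bar> ^ (2*p) + 2 * p * (F w ^ (2*p-1) * d w)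
      + 4^p * (1 + 1 / t^(p-1)) * \<bar>d w\<bar>^(2*p)" for w
  proof -
    let ?a = "(F w)\<^sup>2" and ?b = "(d w)\<^sup>2"
    have Y: "?a ^ (p-1) * ?b \<le> t * ?a ^ p + ?b ^ p / t ^ (p-1)"
      using p t by (intro power_Young) auto
    have pw: "(u\<^sup>2) ^ q = \<bar>u\<bar> ^ (2*q)" for u :: real and q by (simp add: power_mult)
    have p2: "2 * p - 2 = 2 * (p - 1)" by simp
    have "\<bar>F w\<bar> ^ (2*p-2) * ?b \<le> t * \<bar>F w\<bar> ^ (2*p) + \<bar>d w\<bar> ^ (2*p) / t ^ (p-1)"
      using Y by (simp only: pw p2)
    hence "4^p * (\<bar>F w\<bar> ^ (2*p-2) * ?b + \<bar>d w\<bar> ^ (2*p)) \<le> 4^p * (t * \<bar>F w\<bar> ^ (2*p) + \<bar>d w\<bar> ^ (2*p) / t ^ (p-1) + \<bar>d w\<bar> ^ (2*p))"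
      by (intro mult_left_mono) auto
    with even_power_add_le[OF p, of "F w" "d w"] show ?thesis
      by (simp add: power_even_abs algebra_simps)
  qed
  have "(\<integral>w. \<bar>F w + d w\<bar> ^ (2*p) \<partial>\<Omega>) \<le> (\<integral>w. (1 + 4^p*t) * \<bar>F w\<bar> ^ (2*p) + 2 * p * (F w ^ (2*p-1) * d w)
      + 4^p * (1 + 1 / t^(p-1)) * \<bar>d w\<bar>^(2*p) \<partial>\<Omega>)"
  proof (rule integral_mono[OF _ _ le])
    show "integrable \<Omega> (\<lambda>w. \<bar>F w + d w\<bar> ^ (2*p))"
      using F(1) d by (intro allmom_abs_power allmom_add)
  qed (intro Bochner_Integration.integrable_add integrable_mult_right iF allmom_integrable[OF i1])
  also have "\<dots> = (1 + 4^p * t) * (\<integral>w. \<bar>F w\<bar> ^ (2*p) \<partial>\<Omega>)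
           + 4^p * (1 + 1 / t^(p-1)) * (\<integral>w. \<bar>d w\<bar> ^ (2*p) \<partial>\<Omega>)"
    using iF allmom_integrable[OF i1] z by simp
  finally show ?thesis .
qed

text \<open>Induction on J: coordinate k is averaged out, and \<open>moment_step\<close> is applied
  to f - E f = (avg k f - E f) + (f - avg k f) with t = c k / \<Lambda>. The factors 1 + 4^p t
  multiply up to exp (4^p sum c / \<Lambda>), while the choice of t makes c k^p / t^(p-1) =
  \<Lambda>^(p-1) c k linear in c k, so that the remainders add up.\<close>

lemma moment_Efron_Stein_pos:
  assumes J: "J \<subseteq> I" and f: "allmom \<Omega> f" and ff: "\<And>k. k \<in> I - J \<Longrightarrow> free_of k f"
    and fk: "\<And>k. k \<in> J \<Longrightarrow> allmom \<Omega> (fk k)" "\<And>k. k \<in> J \<Longrightarrow> free_of k (fk k)"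
    and c: "\<And>k. k \<in> J \<Longrightarrow> 0 < c k"
    and le: "\<And>k. k \<in> J \<Longrightarrow> (\<integral>w. \<bar>f w - fk k w\<bar> ^ (2*p) \<partial>\<Omega>) \<le> c k ^ p"
    and p: "1 \<le> p" and \<Lambda>: "sum c J \<le> \<Lambda>" "0 < \<Lambda>"
  shows "(\<integral>w. \<bar>f w - (\<integral>w. f w \<partial>\<Omega>)\<bar> ^ (2*p) \<partial>\<Omega>) \<le> exp (4^p * sum c J / \<Lambda>) * (2 * 64^p * \<Lambda>^(p-1) * sum c J)"
  using finite_subset[OF J fin] J f ff fk c le \<Lambda>(1)
proof (induction J arbitrary: f fk rule: finite_induct)
  case empty
  obtain w0 where w0: "w0 \<in> space \<Omega>" using Om.not_empty by blast
  have "f w = f w0" if "w \<in> space \<Omega>" for w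
    using free_const[of f w w0] empty that w0 by auto
  hence "(\<integral>w. f w \<partial>\<Omega>) = f w0" and "\<And>w. w \<in> space \<Omega> \<Longrightarrow> f w = f w0"
    by (simp_all add: Om.prob_space cong: Bochner_Integration.integral_cong)
  thus ?case using p by (simp add: Om.prob_space power_0_left cong: Bochner_Integration.integral_cong)
next
  case (insert k J)
  note f = insert.prems(2)
  have k: "k \<in> I" using insert by auto
  let ?E = "\<integral>w. f w \<partial>\<Omega>"
  define fb where "fb = avg k f"
  have fb: "allmom \<Omega> fb" "free_of k fb" unfolding fb_def using allmom_avg[OF k f] avg_free by auto
  have Efb: "(\<integral>w. fb w \<partial>\<Omega>) = ?E"
    unfolding fb_def using integral_resample(1)[OF k allmom_integrable[OF f]] by simp
  have sub: "avg j (\<lambda>w. g w - h w) w = avg j g w - avg j h w"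
    if "integrable (N j) (\<lambda>y. g (w(j:=y)))" "integrable (N j) (\<lambda>y. h (w(j:=y)))"
    for g h :: "_ \<Rightarrow> real" and w j using that by (simp add: avg_def)
  \<comment> \<open>Sections of an integrable function are integrable only almost everywhere, so
    linearity of \<open>avg\<close> is available only in that sense.\<close>
  have AEint: "AE w in \<Omega>. integrable (N k) (\<lambda>y. g (w(k:=y)))" if "allmom \<Omega> g" for g :: "_ \<Rightarrow> real"
  proof -
    interpret pair_prob_space "N k" \<Omega> by (rule pair_prob)
    interpret sw: pair_prob_space \<Omega> "N k" by unfold_locales
    have "integrable (\<Omega> \<Otimes>\<^sub>M N k) (\<lambda>(w, y). g (w(k:=y)))"
      using integrable_product_swap[OF integrable_resample_pair[OF k allmom_integrable[OF that]]]
      by (simp add: case_prod_beta)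
    from sw.AE_integrable_fst'[OF this] show ?thesis by simp
  qed
  have IH: "(\<integral>w. \<bar>fb w - (\<integral>w. fb w \<partial>\<Omega>)\<bar> ^ (2*p) \<partial>\<Omega>) \<le> exp (4^p * sum c J / \<Lambda>) * (2 * 64^p * \<Lambda>^(p-1) * sum c J)"
  proof (rule insert.IH[of fb "\<lambda>j. avg k (fk j)"])
    show "J \<subseteq> I" "allmom \<Omega> fb" using insert.prems fb by auto
    show "free_of j fb" if "j \<in> I - J" for j
    proof (cases "j = k")
      case False
      thus ?thesis unfolding fb_def using that insert.prems(3)[of j] k by (intro avg_preserves_free) auto
    qed (use fb in auto)
    fix j assume j: "j \<in> J"
    have jk: "j \<noteq> k" "j \<in> I" using insert j by auto
    have fj: "allmom \<Omega> (fk j)" using insert.prems(4) j by auto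
    show "allmom \<Omega> (avg k (fk j))" using fj k by (intro allmom_avg)
    show "free_of j (avg k (fk j))" using insert.prems(5)[of j] j jk k by (intro avg_preserves_free) auto
    show "0 < c j" using insert.prems(6) j by auto
    have am: "allmom \<Omega> (\<lambda>w. f w - fk j w)" using f fj by auto
    have "(\<integral>w. \<bar>fb w - avg k (fk j) w\<bar> ^ (2*p) \<partial>\<Omega>) = (\<integral>w. \<bar>avg k (\<lambda>w. f w - fk j w) w\<bar> ^ (2*p) \<partial>\<Omega>)"
    proof (rule integral_cong_AE)
      show "(\<lambda>w. \<bar>fb w - avg k (fk j) w\<bar> ^ (2*p)) \<in> borel_measurable \<Omega>"
        using allmom_avg[OF k fj] fb by (auto simp: allmom_def)
      show "(\<lambda>w. \<bar>avg k (\<lambda>w. f w - fk j w) w\<bar> ^ (2*p)) \<in> borel_measurable \<Omega>"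
        using allmom_avg[OF k am] by (auto simp: allmom_def)
      show "AE w in \<Omega>. \<bar>fb w - avg k (fk j) w\<bar> ^ (2*p) = \<bar>avg k (\<lambda>w. f w - fk j w) w\<bar> ^ (2*p)"
        using AEint[OF f] AEint[OF fj]
        by eventually_elim (simp only: sub fb_def)
    qed
    also have "\<dots> \<le> (\<integral>w. \<bar>f w - fk j w\<bar> ^ (2*p) \<partial>\<Omega>)" by (rule avg_power_le[OF k am])
    also have "\<dots> \<le> c j ^ p" using insert.prems(7) j by auto
    finally show "(\<integral>w. \<bar>fb w - avg k (fk j) w\<bar> ^ (2*p) \<partial>\<Omega>) \<le> c j ^ p" .
  next
    show "sum c J \<le> \<Lambda>" using insert by (simp add: insert.prems(6) less_imp_le order_trans[rotated, OF insert.prems(8)])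
  qed
  define F where "F = (\<lambda>w. fb w - ?E)"
  define d where "d = (\<lambda>w. f w - fb w)"
  have F: "allmom \<Omega> F" "free_of k F" using fb by (auto simp: F_def free_of_def)
  have d: "allmom \<Omega> d" using fb f by (auto simp: d_def)
  have d0: "avg k d w = 0" if w: "w \<in> space \<Omega>" for w
  proof -
    interpret prob_space "N k" by (rule prob)
    have "avg k d w = (\<integral>y. f (w(k:=y)) - fb w \<partial>N k)" unfolding avg_def d_def
      using fb(2) w by (intro Bochner_Integration.integral_cong) (auto simp: free_of_def)
    also have "\<dots> = 0"
    \<comment> \<open>Where the section is not integrable, \<open>fb w\<close> is 0 and so is the
      integral of the difference, both by convention: the mean vanishes at every point, as
      \<open>moment_step\<close> demands.\<close>
    proof (cases "integrable (N k) (\<lambda>y. f (w(k:=y)))")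
      case True thus ?thesis by (simp add: fb_def avg_def prob_space)
    next
      case False
      hence "fb w = 0" by (simp add: fb_def avg_def not_integrable_integral_eq)
      thus ?thesis using False by (simp add: not_integrable_integral_eq)
    qed
    finally show ?thesis .
  qed
  have ck: "0 < c k" using insert.prems(6) by auto
  have fkk: "allmom \<Omega> (fk k)" "free_of k (fk k)" using insert.prems(4,5) by auto
  have am: "allmom \<Omega> (\<lambda>w. f w - fk k w)" using f fkk by auto
  have am2: "allmom \<Omega> (avg k (\<lambda>w. f w - fk k w))" by (rule allmom_avg[OF k am])
  \<comment> \<open>Since \<open>fk k\<close> is unchanged by averaging, d = (f - fk k) - avg k (f -
    fk k) almost everywhere: any approximant free of k may stand in for the conditional mean, at the
    cost of the factor 2 * 4^p.\<close>
  have dle: "(\<integral>w. \<bar>d w\<bar> ^ (2*p) \<partial>\<Omega>) \<le> 2 * 4^p * c k ^ p"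
  proof -
    have "(\<integral>w. \<bar>d w\<bar> ^ (2*p) \<partial>\<Omega>) = (\<integral>w. \<bar>(f w - fk k w) + (- avg k (\<lambda>w. f w - fk k w) w)\<bar> ^ (2*p) \<partial>\<Omega>)"
    proof (rule integral_cong_AE)
      show "AE w in \<Omega>. \<bar>d w\<bar> ^ (2*p) = \<bar>(f w - fk k w) + (- avg k (\<lambda>w. f w - fk k w) w)\<bar> ^ (2*p)"
        using AEint[OF f] AEint[OF fkk(1)] AE_space
        by eventually_elim (simp only: sub fb_def d_def avg_of_free[OF fkk(2)], simp)
      show "(\<lambda>w. \<bar>d w\<bar> ^ (2*p)) \<in> borel_measurable \<Omega>" using d by (auto simp: allmom_def)
      show "(\<lambda>w. \<bar>(f w - fk k w) + (- avg k (\<lambda>w. f w - fk k w) w)\<bar> ^ (2*p)) \<in> borel_measurable \<Omega>"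
        using am am2 by (auto simp: allmom_def)
    qed
    also have "\<dots> \<le> (\<integral>w. 2^(2*p) * (\<bar>f w - fk k w\<bar>^(2*p) + \<bar>avg k (\<lambda>w. f w - fk k w) w\<bar> ^ (2*p)) \<partial>\<Omega>)"
    proof (rule integral_mono)
      show "integrable \<Omega> (\<lambda>w. \<bar>(f w - fk k w) + (- avg k (\<lambda>w. f w - fk k w) w)\<bar> ^ (2*p))"
        using am am2 by (intro allmom_abs_power allmom_add Om.allmom_minus)
      show "integrable \<Omega> (\<lambda>w. 2^(2*p) * (\<bar>f w - fk k w\<bar>^(2*p) + \<bar>avg k (\<lambda>w. f w - fk k w) w\<bar> ^ (2*p)))"
        using am am2 by (intro integrable_mult_right Bochner_Integration.integrable_add allmom_abs_power)
    qed (rule order_trans[OF abs_add_power_le], simp)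
    also have "\<dots> = 4^p * ((\<integral>w. \<bar>f w - fk k w\<bar>^(2*p) \<partial>\<Omega>) + (\<integral>w. \<bar>avg k (\<lambda>w. f w - fk k w) w\<bar> ^ (2*p) \<partial>\<Omega>))"
    proof -
      have "2^(2*p) = (4::real)^p" by (simp add: power_mult)
      thus ?thesis
        by (simp only: integral_mult_right_zero Bochner_Integration.integral_add[OF allmom_abs_power[OF am] allmom_abs_power[OF am2]])
    qed
    also have "\<dots> \<le> 4^p * (c k ^ p + c k ^ p)"
      using insert.prems(7)[of k] avg_power_le[OF k am, of p] by (intro mult_left_mono) auto
    finally show ?thesis by simp
  qed
  define t where "t = c k / \<Lambda>"
  have t: "0 < t" "t \<le> 1" 
  proof -
    show "0 < t" using ck \<Lambda> by (simp add: t_def)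
    have "sum c (insert k J) = c k + sum c J" using insert by simp
    moreover have "sum c J \<ge> 0" using insert.prems(6) by (intro sum_nonneg) (auto intro: less_imp_le)
    ultimately show "t \<le> 1" using insert.prems(8) \<Lambda> by (simp add: t_def)
  qed
  let ?S = "sum c J" and ?C = "4^p :: real" and ?X = "\<integral>w. \<bar>F w\<bar> ^ (2*p) \<partial>\<Omega>"
  have S: "?S \<ge> 0" using insert.prems(6) by (intro sum_nonneg) (auto intro: less_imp_le)
  have "(\<integral>w. \<bar>f w - ?E\<bar> ^ (2*p) \<partial>\<Omega>) = (\<integral>w. \<bar>F w + d w\<bar> ^ (2*p) \<partial>\<Omega>)" by (simp add: F_def d_def)
  also have "\<dots> \<le> (1 + ?C * t) * ?X + ?C * (1 + 1 / t^(p-1)) * (\<integral>w. \<bar>d w\<bar> ^ (2*p) \<partial>\<Omega>)"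
    by (rule moment_step[OF k F d d0 p t(1)])
  also have "\<dots> \<le> (1 + ?C * t) * (exp (?C * ?S / \<Lambda>) * (2 * 64^p * \<Lambda>^(p-1) * ?S)) + 2 * 64^p * \<Lambda>^(p-1) * c k"
  proof (intro add_mono mult_left_mono)
    show "?X \<le> exp (?C * ?S / \<Lambda>) * (2 * 64^p * \<Lambda>^(p-1) * ?S)" using IH by (simp add: F_def Efb)
    have t1: "t^(p-1) \<le> 1" using t by (intro power_le_one) auto
    have "?C * (1 + 1 / t^(p-1)) * (\<integral>w. \<bar>d w\<bar> ^ (2*p) \<partial>\<Omega>) \<le> ?C * (2 / t^(p-1)) * (2 * 4^p * c k ^ p)"
      using dle t t1 by (intro mult_mono mult_left_mono) (auto simp: field_simps intro!: integral_nonneg_AE)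
    also have "\<dots> = 4 * 16^p * \<Lambda>^(p-1) * c k"
    proof -
      have "c k ^ p = c k ^ (p-1) * c k" using p by (cases p) auto
      hence "c k ^ p / t^(p-1) = \<Lambda>^(p-1) * c k" using ck \<Lambda> by (simp add: t_def power_divide field_simps)
      moreover have "(4^p * 4^p :: real) = 16^p" by (simp add: power_mult_distrib[symmetric])
      moreover have "?C * (2 / t^(p-1)) * (2 * 4^p * c k ^ p) = 4 * (4^p * 4^p) * (c k ^ p / t^(p-1))" by simp
      ultimately show ?thesis by simp
    qed
    also have "\<dots> \<le> 2 * 64^p * \<Lambda>^(p-1) * c k"
    proof (intro mult_right_mono)
      have "(4::real) * 16^p \<le> 4^p * 16 ^ p" using p by (intro mult_right_mono) (auto intro: self_le_power)
      also have "\<dots> = 64^p" by (simp add: power_mult_distrib[symmetric])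
      finally show "(4::real) * 16^p \<le> 2 * 64^p" by (smt (verit) zero_le_power)
    qed (use ck \<Lambda> in auto)
    finally show "?C * (1 + 1 / t^(p-1)) * (\<integral>w. \<bar>d w\<bar> ^ (2*p) \<partial>\<Omega>) \<le> 2 * 64^p * \<Lambda>^(p-1) * c k" .
  qed (use t in auto)
  also have "\<dots> \<le> exp (?C * t) * (exp (?C * ?S / \<Lambda>) * (2 * 64^p * \<Lambda>^(p-1) * ?S)) + (exp (?C * t) * exp (?C * ?S / \<Lambda>)) * (2 * 64^p * \<Lambda>^(p-1) * c k)"
  proof (intro add_mono mult_right_mono)
    have "1 * (2 * 64^p * \<Lambda>^(p-1) * c k) \<le> (exp (?C * t) * exp (?C * ?S / \<Lambda>)) * (2 * 64^p * \<Lambda>^(p-1) * c k)"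
      using ck \<Lambda> S t by (intro mult_right_mono) (auto simp: exp_add[symmetric])
    thus "2 * 64^p * \<Lambda>^(p-1) * c k \<le> (exp (?C * t) * exp (?C * ?S / \<Lambda>)) * (2 * 64^p * \<Lambda>^(p-1) * c k)" by simp
  qed (use exp_ge_add_one_self[of "?C*t"] S \<Lambda> in auto)
  also have "\<dots> = exp (?C * sum c (insert k J) / \<Lambda>) * (2 * 64^p * \<Lambda>^(p-1) * sum c (insert k J))"
  proof -
    have "?C * sum c (insert k J) / \<Lambda> = ?C * t + ?C * ?S / \<Lambda>"
      using insert by (simp add: t_def add_divide_distrib distrib_left)
    thus ?thesis using insert by (simp add: exp_add algebra_simps)
  qed
  finally show ?case .
qed

text \<open>The positive version is applied to the weights c k + e with \<Lambda> their sum plus e,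
  which is positive even for empty I; then e tends to 0.\<close>

theorem moment_Efron_Stein:
  assumes f: "allmom \<Omega> f"
    and fk: "\<And>k. k \<in> I \<Longrightarrow> allmom \<Omega> (fk k)" "\<And>k. k \<in> I \<Longrightarrow> free_of k (fk k)"
    and c: "\<And>k. k \<in> I \<Longrightarrow> 0 \<le> c k"
    and le: "\<And>k. k \<in> I \<Longrightarrow> (\<integral>w. \<bar>f w - fk k w\<bar> ^ (2*p) \<partial>\<Omega>) \<le> c k ^ p"
    and p: "1 \<le> p"
  shows "(\<integral>w. \<bar>f w - (\<integral>w. f w \<partial>\<Omega>)\<bar> ^ (2*p) \<partial>\<Omega>) \<le> ES p * sum c I ^ p"
proof -
  have "(\<integral>w. \<bar>f w - (\<integral>w. f w \<partial>\<Omega>)\<bar> ^ (2*p) \<partial>\<Omega>) \<le> ES p * (sum c I + card I * e + e) ^ p" if e: "e > 0" for e :: real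
  proof -
    let ?c = "\<lambda>k. c k + e" and ?L = "sum c I + card I * e + e"
    have s: "sum ?c I = sum c I + card I * e" by (simp add: sum.distrib)
    have n: "0 \<le> sum c I" using c by (intro sum_nonneg)
    have L: "?L > 0" using n e by (simp add: add_nonneg_pos)
    have "(\<integral>w. \<bar>f w - (\<integral>w. f w \<partial>\<Omega>)\<bar> ^ (2*p) \<partial>\<Omega>) \<le> exp (4^p * sum ?c I / ?L) * (2 * 64^p * ?L^(p-1) * sum ?c I)"
    proof (rule moment_Efron_Stein_pos[OF subset_refl f _ fk])
      fix k assume k: "k \<in> I"
      show "0 < c k + e" using c[OF k] e by simp
      show "(\<integral>w. \<bar>f w - fk k w\<bar> ^ (2*p) \<partial>\<Omega>) \<le> (c k + e) ^ p"
        using c[OF k] e by (intro order_trans[OF le[OF k]] power_mono) auto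
    qed (use p s e L in auto)
    also have "\<dots> \<le> exp (4^p) * (2 * 64^p * ?L^(p-1) * ?L)"
    proof (intro mult_mono)
      show "exp (4^p * sum ?c I / ?L) \<le> exp (4^p)"
        using L s e n by (auto simp: field_simps)
    qed (use L s n e in \<open>auto intro!: mult_nonneg_nonneg add_nonneg_nonneg\<close>)
    also have "\<dots> = ES p * ?L^p" using p by (cases p) (auto simp: ES_def)
    finally show ?thesis .
  qed
  moreover have "((\<lambda>e::real. ES p * (sum c I + card I * e + e) ^ p) \<longlongrightarrow> ES p * (sum c I + card I * 0 + 0) ^ p) (at_right 0)"
    by (auto intro!: tendsto_eq_intros)
  ultimately show ?thesis
    by (intro tendsto_lowerbound[of "\<lambda>e. ES p * (sum c I + card I * e + e) ^ p" _ "at_right (0::real)"])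
       (auto simp: eventually_at_filter)
qed

end

section \<open>Linear and quadratic forms\<close>

lemma cmod_even_power_le: "cmod z ^ (2*p) \<le> 2 ^ p * (\<bar>Re z\<bar> ^ (2*p) + \<bar>Im z\<bar> ^ (2*p))"
proof -
  have "cmod z ^ (2*p) = \<bar>(Re z)\<^sup>2 + (Im z)\<^sup>2\<bar> ^ p"
    by (simp add: power_mult cmod_power2)
  also have "\<dots> \<le> 2 ^ p * (\<bar>(Re z)\<^sup>2\<bar> ^ p + \<bar>(Im z)\<^sup>2\<bar> ^ p)" by (rule abs_add_power_le)
  finally show ?thesis by (simp add: power_mult)
qed

lemma integrable_of_allmom_cmod:
  assumes "allmom M (\<lambda>x. cmod (f x))" "f \<in> borel_measurable M"
  shows "integrable M f"
  using allmom_integrable[OF assms(1)] assms(2) by (simp add: integrable_norm_iff)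

lemma allmom_Re_Im:
  assumes "allmom M (\<lambda>x. cmod (f x))" "f \<in> borel_measurable M"
  shows "allmom M (\<lambda>x. Re (f x))" "allmom M (\<lambda>x. Im (f x))"
  using assms(2) by (auto intro!: allmom_mono[OF assms(1)] abs_Re_le_cmod abs_Im_le_cmod)

lemma (in finite_measure) allmom_cmod_of_Re_Im:
  assumes "allmom M (\<lambda>x. Re (f x))" "allmom M (\<lambda>x. Im (f x))" "f \<in> borel_measurable M"
  shows "allmom M (\<lambda>x. cmod (f x))"
proof (rule allmom_mono)
  show "allmom M (\<lambda>x. \<bar>Re (f x)\<bar> + \<bar>Im (f x)\<bar>)" using assms by (intro allmom_add allmom_abs)
qed (use assms cmod_le in \<open>auto\<close>)

lemma (in prod_space) free_of_comp: "free_of k f \<Longrightarrow> free_of k (\<lambda>w. g (f w))"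
  by (auto simp: free_of_def)

definition ES2 :: "nat \<Rightarrow> real" where "ES2 p = 2 ^ p * 2 * exp (4^p) * (2 * 64^p)"

lemma ES2_nonneg [simp]: "ES2 p \<ge> 0" by (simp add: ES2_def)

lemma (in prod_space) moment_Efron_Stein_complex:
  fixes f :: "_ \<Rightarrow> complex"
  assumes f: "allmom \<Omega> (\<lambda>w. cmod (f w))" "f \<in> borel_measurable \<Omega>"
    and fk: "\<And>k. k \<in> I \<Longrightarrow> allmom \<Omega> (\<lambda>w. cmod (fk k w))" "\<And>k. k \<in> I \<Longrightarrow> fk k \<in> borel_measurable \<Omega>"
      "\<And>k. k \<in> I \<Longrightarrow> free_of k (fk k)"
    and c: "\<And>k. k \<in> I \<Longrightarrow> 0 \<le> c k"
    and le: "\<And>k. k \<in> I \<Longrightarrow> (\<integral>w. cmod (f w - fk k w) ^ (2*p) \<partial>\<Omega>) \<le> c k ^ p"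
    and p: "1 \<le> p"
  shows "(\<integral>w. cmod (f w - (\<integral>w. f w \<partial>\<Omega>)) ^ (2*p) \<partial>\<Omega>) \<le> ES2 p * sum c I ^ p"
proof -
  note am = allmom_Re_Im[OF f] 
  have amk: "allmom \<Omega> (\<lambda>w. Re (fk k w))" "allmom \<Omega> (\<lambda>w. Im (fk k w))" if "k \<in> I" for k
    using allmom_Re_Im[OF fk(1)[OF that] fk(2)[OF that]] by auto
  have intf: "integrable \<Omega> f" by (rule integrable_of_allmom_cmod[OF f])
  have E: "Re (\<integral>w. f w \<partial>\<Omega>) = (\<integral>w. Re (f w) \<partial>\<Omega>)" "Im (\<integral>w. f w \<partial>\<Omega>) = (\<integral>w. Im (f w) \<partial>\<Omega>)"
    using intf by simp_all
  have amd: "allmom \<Omega> (\<lambda>w. cmod (f w - fk k w))" if "k \<in> I" for k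
  proof (rule Om.allmom_cmod_of_Re_Im)
    show "allmom \<Omega> (\<lambda>w. Re (f w - fk k w))" "allmom \<Omega> (\<lambda>w. Im (f w - fk k w))"
      unfolding minus_complex.sel using am amk[OF that] by (intro Om.allmom_diff; simp)+
  qed (use f fk(2)[OF that] in auto)
  have R: "(\<integral>w. \<bar>Re (f w) - (\<integral>w. Re (f w) \<partial>\<Omega>)\<bar> ^ (2*p) \<partial>\<Omega>) \<le> ES p * sum c I ^ p"
  proof (rule moment_Efron_Stein[OF am(1), of "\<lambda>k w. Re (fk k w)"])
    fix k assume k: "k \<in> I"
    have "(\<integral>w. \<bar>Re (f w) - Re (fk k w)\<bar> ^ (2*p) \<partial>\<Omega>) \<le> (\<integral>w. cmod (f w - fk k w) ^ (2*p) \<partial>\<Omega>)"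
    proof (rule integral_mono)
      show "\<bar>Re (f w) - Re (fk k w)\<bar> ^ (2*p) \<le> cmod (f w - fk k w) ^ (2*p)" for w
        using abs_Re_le_cmod[of "f w - fk k w"] by (intro power_mono) auto
      show "integrable \<Omega> (\<lambda>w. \<bar>Re (f w) - Re (fk k w)\<bar> ^ (2*p))"
        using am amk[OF k] by (intro allmom_abs_power Om.allmom_diff) auto
      show "integrable \<Omega> (\<lambda>w. cmod (f w - fk k w) ^ (2*p))"
        using allmom_abs_power[OF amd[OF k], of "2*p"] by simp
    qed
    thus "(\<integral>w. \<bar>Re (f w) - Re (fk k w)\<bar> ^ (2*p) \<partial>\<Omega>) \<le> c k ^ p" using le[OF k] by simp
  qed (use amk fk c p in \<open>auto intro: free_of_comp\<close>)
  have I: "(\<integral>w. \<bar>Im (f w) - (\<integral>w. Im (f w) \<partial>\<Omega>)\<bar> ^ (2*p) \<partial>\<Omega>) \<le> ES p * sum c I ^ p"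
  proof (rule moment_Efron_Stein[OF am(2), of "\<lambda>k w. Im (fk k w)"])
    fix k assume k: "k \<in> I"
    have "(\<integral>w. \<bar>Im (f w) - Im (fk k w)\<bar> ^ (2*p) \<partial>\<Omega>) \<le> (\<integral>w. cmod (f w - fk k w) ^ (2*p) \<partial>\<Omega>)"
    proof (rule integral_mono)
      show "\<bar>Im (f w) - Im (fk k w)\<bar> ^ (2*p) \<le> cmod (f w - fk k w) ^ (2*p)" for w
        using abs_Im_le_cmod[of "f w - fk k w"] by (intro power_mono) auto
      show "integrable \<Omega> (\<lambda>w. \<bar>Im (f w) - Im (fk k w)\<bar> ^ (2*p))"
        using am amk[OF k] by (intro allmom_abs_power Om.allmom_diff) auto
      show "integrable \<Omega> (\<lambda>w. cmod (f w - fk k w) ^ (2*p))"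
        using allmom_abs_power[OF amd[OF k], of "2*p"] by simp
    qed
    thus "(\<integral>w. \<bar>Im (f w) - Im (fk k w)\<bar> ^ (2*p) \<partial>\<Omega>) \<le> c k ^ p" using le[OF k] by simp
  qed (use amk fk c p in \<open>auto intro: free_of_comp\<close>)
  let ?E = "\<integral>w. f w \<partial>\<Omega>"
  have iR: "integrable \<Omega> (\<lambda>w. \<bar>Re (f w) - (\<integral>w. Re (f w) \<partial>\<Omega>)\<bar> ^ (2*p))"
    and iI: "integrable \<Omega> (\<lambda>w. \<bar>Im (f w) - (\<integral>w. Im (f w) \<partial>\<Omega>)\<bar> ^ (2*p))"
    using am by (intro allmom_abs_power Om.allmom_diff Om.allmom_const; simp)+
  have "(\<integral>w. cmod (f w - ?E) ^ (2*p) \<partial>\<Omega>) \<le> (\<integral>w. 2 ^ p * (\<bar>Re (f w) - (\<integral>w. Re (f w) \<partial>\<Omega>)\<bar> ^ (2*p) + \<bar>Im (f w) - (\<integral>w. Im (f w) \<partial>\<Omega>)\<bar> ^ (2*p)) \<partial>\<Omega>)"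
  proof (rule integral_mono_AE')
    show "AE w in \<Omega>. cmod (f w - ?E) ^ (2*p) \<le> 2 ^ p * (\<bar>Re (f w) - (\<integral>w. Re (f w) \<partial>\<Omega>)\<bar> ^ (2*p) + \<bar>Im (f w) - (\<integral>w. Im (f w) \<partial>\<Omega>)\<bar> ^ (2*p))"
      using cmod_even_power_le[of "f _ - ?E" p] by (simp add: E)
    show "integrable \<Omega> (\<lambda>w. 2 ^ p * (\<bar>Re (f w) - (\<integral>w. Re (f w) \<partial>\<Omega>)\<bar> ^ (2*p) + \<bar>Im (f w) - (\<integral>w. Im (f w) \<partial>\<Omega>)\<bar> ^ (2*p)))"
      by (intro integrable_mult_right Bochner_Integration.integrable_add iR iI)
  qed simp
  also have "\<dots> = 2 ^ p * ((\<integral>w. \<bar>Re (f w) - (\<integral>w. Re (f w) \<partial>\<Omega>)\<bar> ^ (2*p) \<partial>\<Omega>) + (\<integral>w. \<bar>Im (f w) - (\<integral>w. Im (f w) \<partial>\<Omega>)\<bar> ^ (2*p) \<partial>\<Omega>))"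
    by (simp only: integral_mult_right_zero Bochner_Integration.integral_add[OF iR iI])
  also have "\<dots> \<le> 2 ^ p * (ES p * sum c I ^ p + ES p * sum c I ^ p)"
    using R I by (intro mult_left_mono) auto
  also have "\<dots> = ES2 p * sum c I ^ p" by (simp add: ES2_def ES_def)
  finally show ?thesis .
qed

definition quad :: "nat \<Rightarrow> (nat \<Rightarrow> nat \<Rightarrow> complex) \<Rightarrow> (nat \<Rightarrow> real) \<Rightarrow> complex" where
  "quad n A x = (\<Sum>i<n. \<Sum>j<n. A i j * of_real (x i * x j))"

locale entry_law = prob_space P for P :: "real measure" +
  assumes sets_P: "sets P = sets borel"
    and moments: "\<And>k::nat. integrable P (\<lambda>x. x ^ k)"
    and mean: "(\<integral>x. x \<partial>P) = 0" and var: "(\<integral>x. x\<^sup>2 \<partial>P) = 1"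
begin

definition Mo :: "nat \<Rightarrow> real" where "Mo p = (\<integral>x. \<bar>x\<bar> ^ p \<partial>P)"

lemma Mo_nonneg [simp]: "Mo p \<ge> 0"
  by (simp add: Mo_def)

lemma allmom_id: "allmom P (\<lambda>x. x)"
proof (rule allmom_of_power_bound)
  show "(\<lambda>x. x) \<in> borel_measurable P"
    by (subst measurable_cong_sets[OF sets_P refl]) simp
  fix p :: nat
  show "(\<integral>\<^sup>+x. ennreal (\<bar>x\<bar> ^ (2*p)) \<partial>P) < \<infinity>"
    using moments[of "2*p"] by (simp add: nn_integral_eq_integral power_even_abs)
qed

abbreviation C :: "nat \<Rightarrow> (nat \<Rightarrow> real) measure" where "C n \<equiv> PiM {..<n} (\<lambda>_. P)"

lemma col: "prod_space (\<lambda>_::nat. P) {..<n}"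
  by (simp add: prod_space_def prob_space_axioms)

lemma prob_C: "prob_space (C n)"
  using prod_space.prob[OF col] by (intro prob_space_PiM) (simp add: prob_space_axioms)

lemma finite_C: "finite_measure (C n)"
  by (rule prob_space.axioms(1)[OF prob_C])

lemma distr_coord: "i < n \<Longrightarrow> distr (C n) P (\<lambda>x. x i) = P"
  using distr_PiM_component[of "{..<n}" "\<lambda>_. P" i] prob_space_axioms by simp

lemma coord_measurable: "i < n \<Longrightarrow> (\<lambda>x. x i) \<in> C n \<rightarrow>\<^sub>M P"
  by (rule measurable_component_singleton) simp

lemma integral_coord:
  fixes f :: "real \<Rightarrow> 'b::{banach, second_countable_topology}"
  assumes "i < n" "integrable P f"
  shows "(\<integral>x. f (x i) \<partial>C n) = (\<integral>x. f x \<partial>P)" "integrable (C n) (\<lambda>x. f (x i))"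
proof -
  have m: "f \<in> borel_measurable P" using assms by auto
  show "(\<integral>x. f (x i) \<partial>C n) = (\<integral>x. f x \<partial>P)"
    using integral_distr[OF coord_measurable[OF assms(1)] m] by (simp add: distr_coord[OF assms(1)])
  show "integrable (C n) (\<lambda>x. f (x i))"
    using integrable_distr_eq[OF coord_measurable[OF assms(1)] m] assms by (simp add: distr_coord[OF assms(1)])
qed

lemma allmom_coord: "i < n \<Longrightarrow> allmom (C n) (\<lambda>x. x i)"
  unfolding allmom_def
  using integral_coord(2)[of i n "\<lambda>x. \<bar>x\<bar> ^ p" for p] allmom_abs_power[OF allmom_id]
    measurable_compose[OF coord_measurable allmom_measurable[OF allmom_id]]
  by auto

lemma moment_coord: "i < n \<Longrightarrow> (\<integral>x. \<bar>x i\<bar> ^ p \<partial>C n) = Mo p"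
  unfolding Mo_def by (rule integral_coord) (auto intro: allmom_abs_power allmom_id)

lemma mean_coord: "i < n \<Longrightarrow> (\<integral>x. x i \<partial>C n) = 0"
  using integral_coord(1)[of i n "\<lambda>x. x"] allmom_integrable[OF allmom_id] mean by simp

lemma cov_coord:
  assumes "i < n" "j < n"
  shows "(\<integral>x. x i * x j \<partial>C n) = (if i = j then 1 else 0)"
proof (cases "i = j")
  case True
  thus ?thesis using integral_coord(1)[of i n "\<lambda>x. x\<^sup>2"] moments[of 2] var assms
    by (simp add: power2_eq_square)
next
  case False
  interpret prod_space "\<lambda>_::nat. P" "{..<n}" by (rule col)
  have "integrable (C n) (\<lambda>x. x i * x j)"
    using assms by (intro allmom_integrable allmom_mult allmom_coord)
  hence "(\<integral>x. x i * x j \<partial>C n) = (\<integral>x. avg i (\<lambda>x. x i * x j) x \<partial>C n)"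
    using assms by (intro integral_resample(1)) auto
  also have "avg i (\<lambda>x. x i * x j) = (\<lambda>x. 0)"
    using False mean by (simp add: avg_def fun_eq_iff)
  finally show ?thesis using False by simp
qed

text \<open>The summand 1 makes the base at least 1, hence below its p-th power: increments are then
  bounded by a p-th power, the form that \<open>moment_Efron_Stein\<close> expects.\<close>

definition LC :: "nat \<Rightarrow> real" where "LC p = ES p * (Mo (2*p) + 1) ^ p"

lemma LC_nonneg [simp]: "LC p \<ge> 0" by (simp add: LC_def)

lemma allmom_linear: "allmom (C n) (\<lambda>x. \<Sum>i<n. a i * x i)"
proof -
  interpret finite_measure "C n" by (rule finite_C)
  show ?thesis by (intro allmom_sum allmom_cmult allmom_coord) auto
qed

text \<open>Deleting one summand changes the form by \<open>a k * x k\<close>, whose 2p-th moment is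
  explicit; the moment inequality becomes a Marcinkiewicz-Zygmund bound with the variance on the
  right.\<close>

lemma linear_moment:
  assumes p: "1 \<le> p"
  shows "(\<integral>x. \<bar>\<Sum>i<n. a i * x i\<bar> ^ (2*p) \<partial>C n) \<le> LC p * (\<Sum>i<n. (a i)\<^sup>2) ^ p"
proof -
  interpret prod_space "\<lambda>_::nat. P" "{..<n}" by (rule col)
  let ?f = "\<lambda>x. \<Sum>i<n. a i * x i"
  let ?K = "Mo (2*p) + 1"
  have E: "(\<integral>x. ?f x \<partial>C n) = 0"
    by (subst Bochner_Integration.integral_sum)
       (auto simp: mean_coord intro!: integrable_mult_right allmom_integrable allmom_coord)
  have "(\<integral>x. \<bar>?f x - (\<integral>x. ?f x \<partial>C n)\<bar> ^ (2*p) \<partial>C n) \<le> ES p * (\<Sum>k<n. (a k)\<^sup>2 * ?K) ^ p"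
  proof (rule moment_Efron_Stein[where fk = "\<lambda>k x. \<Sum>i\<in>{..<n}-{k}. a i * x i"])
    fix k assume k: "k \<in> {..<n}"
    show "allmom (C n) (\<lambda>x. \<Sum>i\<in>{..<n}-{k}. a i * x i)"
      by (intro Om.allmom_sum Om.allmom_cmult allmom_coord) auto
    show "free_of k (\<lambda>x. \<Sum>i\<in>{..<n}-{k}. a i * x i)"
      by (auto simp: free_of_def intro!: sum.cong)
    have "?f x - (\<Sum>i\<in>{..<n}-{k}. a i * x i) = a k * x k" for x :: "nat \<Rightarrow> real"
      using k by (simp add: sum.remove[of "{..<n}" k])
    hence "(\<integral>x. \<bar>?f x - (\<Sum>i\<in>{..<n}-{k}. a i * x i)\<bar> ^ (2*p) \<partial>C n) = (\<integral>x. ((a k)\<^sup>2)^p * \<bar>x k\<bar> ^ (2*p) \<partial>C n)"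
      by (simp add: abs_mult power_mult_distrib power_mult)
    also have "\<dots> = ((a k)\<^sup>2)^p * Mo (2*p)" using k by (simp only: integral_mult_right_zero) (simp add: moment_coord)
    also have "\<dots> \<le> ((a k)\<^sup>2)^p * ?K ^ p"
    proof (rule mult_left_mono)
      have "Mo (2*p) \<le> ?K ^ 1" by simp
      also have "\<dots> \<le> ?K ^ p" using p Mo_nonneg[of "2*p"] by (intro power_increasing) auto
      finally show "Mo (2*p) \<le> ?K ^ p" .
    qed simp
    finally show "(\<integral>x. \<bar>?f x - (\<Sum>i\<in>{..<n}-{k}. a i * x i)\<bar> ^ (2*p) \<partial>C n) \<le> ((a k)\<^sup>2 * ?K) ^ p"
      by (simp add: power_mult_distrib)
  qed (use allmom_linear p in \<open>auto\<close>)
  thus ?thesis unfolding E by (simp add: LC_def sum_distrib_right[symmetric] power_mult_distrib mult_ac)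
qed

definition QC :: "nat \<Rightarrow> real" where
  "QC p = ES p * (4 * (4 ^ p * (Mo (4*p) + sqrt (Mo (4*p)) * sqrt (LC (2*p))) + 1)) ^ p"

lemma QC_nonneg [simp]: "QC p \<ge> 0" by (simp add: QC_def)

lemma allmom_quadratic: "allmom (C n) (\<lambda>x. \<Sum>i<n. \<Sum>j<n. A i j * x i * x j)"
proof -
  interpret finite_measure "C n" by (rule finite_C)
  show ?thesis by (intro allmom_sum allmom_mult allmom_const allmom_coord) auto
qed

lemma add_power_ge:
  fixes a b :: real
  assumes "a \<ge> 0" "b \<ge> 0" "1 \<le> p"
  shows "a ^ p + b ^ p \<le> (a + b) ^ p"
  using assms(3)
proof (induction p rule: dec_induct)
  case (step q)
  have "a ^ Suc q + b ^ Suc q \<le> a ^ q * (a + b) + b ^ q * (a + b)"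
    using assms by (auto simp: algebra_simps)
  also have "\<dots> = (a ^ q + b ^ q) * (a + b)" by (simp add: algebra_simps)
  also have "\<dots> \<le> (a + b) ^ q * (a + b)" using step assms by (intro mult_right_mono) auto
  finally show ?case by (simp add: mult.commute)
qed simp

text \<open>Deleting row and column k changes the form by A k k x_k^2 plus x_k times a linear form
  in the other coordinates. Cauchy-Schwarz separates x_k from that form,
  \<open>linear_moment\<close> bounds it by the entries of row and column k, and the sum over k is
  controlled by the squared Frobenius norm, as in a Hanson-Wright inequality.\<close>

lemma quadratic_moment:
  assumes p: "1 \<le> p"
  shows "(\<integral>x. \<bar>(\<Sum>i<n. \<Sum>j<n. A i j * x i * x j) - (\<Sum>i<n. A i i)\<bar> ^ (2*p) \<partial>C n)
           \<le> QC p * (\<Sum>i<n. \<Sum>j<n. (A i j)\<^sup>2) ^ p"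
proof -
  interpret prod_space "\<lambda>_::nat. P" "{..<n}" by (rule col)
  let ?f = "\<lambda>x. \<Sum>i<n. \<Sum>j<n. A i j * x i * x j"
  define K where "K = 4 ^ p * (Mo (4*p) + sqrt (Mo (4*p)) * sqrt (LC (2*p))) + 1"
  have K1: "K \<ge> 1" by (simp add: K_def)
  have E: "(\<integral>x. ?f x \<partial>C n) = (\<Sum>i<n. A i i)"
  proof -
    have "(\<integral>x. ?f x \<partial>C n) = (\<Sum>i<n. \<Sum>j<n. (\<integral>x. A i j * (x i * x j) \<partial>C n))"
      unfolding mult.assoc
      by (subst Bochner_Integration.integral_sum, (intro allmom_integrable Om.allmom_sum Om.allmom_cmult allmom_mult allmom_coord; simp),
          intro sum.cong refl, subst Bochner_Integration.integral_sum)
         (auto intro!: allmom_integrable Om.allmom_cmult allmom_mult allmom_coord)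
    also have "\<dots> = (\<Sum>i<n. \<Sum>j<n. A i j * (if i = j then 1 else 0))"
      by (intro sum.cong refl) (simp add: cov_coord)
    finally show ?thesis by (simp add: if_distrib[of "\<lambda>x. _ * x"] sum.delta cong: if_cong)
  qed
  \<comment> \<open>Coefficients of the linear form multiplying x k; the zero at j = k leaves the
    square of x k as a separate term.\<close>
  define d where "d k j = (if j = k then 0 else A k j + A j k)" for k j
  define c where "c k = K * ((A k k)\<^sup>2 + (\<Sum>j<n. (d k j)\<^sup>2))" for k
  have c0: "c k \<ge> 0" for k using K1 by (simp add: c_def sum_nonneg)
  have "(\<integral>x. \<bar>?f x - (\<integral>x. ?f x \<partial>C n)\<bar> ^ (2*p) \<partial>C n) \<le> ES p * (\<Sum>k<n. c k) ^ p"
  proof (rule moment_Efron_Stein[where fk = "\<lambda>k x. \<Sum>i\<in>{..<n}-{k}. \<Sum>j\<in>{..<n}-{k}. A i j * x i * x j"])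
    fix k assume k: "k \<in> {..<n}"
    let ?g = "\<lambda>x. \<Sum>i\<in>{..<n}-{k}. \<Sum>j\<in>{..<n}-{k}. A i j * x i * x j"
    let ?l = "\<lambda>x. \<Sum>j<n. d k j * x j"
    show "allmom (C n) ?g"
      by (intro Om.allmom_sum allmom_mult Om.allmom_const allmom_coord) auto
    show "free_of k ?g"
      by (auto simp: free_of_def intro!: sum.cong)
    have diff: "?f x - ?g x = A k k * (x k)\<^sup>2 + x k * ?l x" for x :: "nat \<Rightarrow> real"
    proof -
      let ?S = "{..<n} - {k}"
      have 1: "?f x = (\<Sum>j<n. A k j * x k * x j) + (\<Sum>i\<in>?S. A i k * x i * x k + (\<Sum>j\<in>?S. A i j * x i * x j))"
        using k by (subst sum.remove[of _ k]) (auto intro!: sum.cong simp: sum.remove[of "{..<n}" k])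
      have 2: "(\<Sum>j<n. A k j * x k * x j) = A k k * x k * x k + (\<Sum>j\<in>?S. A k j * x k * x j)"
        using k by (subst sum.remove[of _ k]) auto
      have 3: "?l x = (\<Sum>j\<in>?S. (A k j + A j k) * x j)"
        using k by (subst sum.remove[of _ k]) (auto simp: d_def intro!: sum.cong)
      show ?thesis unfolding 1 2 3
        by (simp add: sum.distrib distrib_right sum_distrib_left power2_eq_square algebra_simps)
    qed
    have am_l: "allmom (C n) ?l" by (rule allmom_linear)
    have am_k: "allmom (C n) (\<lambda>x. x k)" using k allmom_coord by auto
    have CS: "(\<integral>x. \<bar>\<bar>x k\<bar>^(2*p) * \<bar>?l x\<bar>^(2*p)\<bar> \<partial>C n) \<le> sqrt (\<integral>x. (\<bar>x k\<bar>^(2*p))\<^sup>2 \<partial>C n) * sqrt (\<integral>x. (\<bar>?l x\<bar>^(2*p))\<^sup>2 \<partial>C n)"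
      using am_k am_l by (intro Cauchy_Schwarz_allmom Om.allmom_power Om.allmom_abs)
    have p4: "(u ^ (2*p))\<^sup>2 = u ^ (4*p)" "(u ^ (2*p))\<^sup>2 = u ^ (2*(2*p))" for u :: real
      by (simp_all add: power_mult[symmetric] mult.commute)
    have "sqrt (\<integral>x. (\<bar>?l x\<bar>^(2*p))\<^sup>2 \<partial>C n) \<le> sqrt (LC (2*p) * (\<Sum>j<n. (d k j)\<^sup>2) ^ (2*p))"
      unfolding p4(2) using p linear_moment[of "2*p" n "d k"] by (intro real_sqrt_le_mono) simp
    also have "\<dots> = sqrt (LC (2*p)) * (\<Sum>j<n. (d k j)\<^sup>2) ^ p"
    proof -
      have "(\<Sum>j<n. (d k j)\<^sup>2) ^ (2*p) = ((\<Sum>j<n. (d k j)\<^sup>2) ^ p)\<^sup>2" by (simp add: power_mult[symmetric] mult.commute)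
      moreover have "(\<Sum>j<n. (d k j)\<^sup>2) ^ p \<ge> 0" by (simp add: sum_nonneg)
      ultimately show ?thesis by (simp add: real_sqrt_mult)
    qed
    finally have sl: "sqrt (\<integral>x. (\<bar>?l x\<bar>^(2*p))\<^sup>2 \<partial>C n) \<le> sqrt (LC (2*p)) * (\<Sum>j<n. (d k j)\<^sup>2) ^ p" .
    have sk: "sqrt (\<integral>x. (\<bar>x k\<bar>^(2*p))\<^sup>2 \<partial>C n) = sqrt (Mo (4*p))"
      unfolding p4(1) using k by (simp add: moment_coord)
    have xl: "(\<integral>x. \<bar>x k\<bar>^(2*p) * \<bar>?l x\<bar>^(2*p) \<partial>C n) \<le> sqrt (Mo (4*p)) * (sqrt (LC (2*p)) * (\<Sum>j<n. (d k j)\<^sup>2) ^ p)"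
    proof -
      have "(\<integral>x. \<bar>x k\<bar>^(2*p) * \<bar>?l x\<bar>^(2*p) \<partial>C n) \<le> sqrt (Mo (4*p)) * sqrt (\<integral>x. (\<bar>?l x\<bar>^(2*p))\<^sup>2 \<partial>C n)"
        using CS unfolding sk by (simp add: abs_mult)
      also have "\<dots> \<le> sqrt (Mo (4*p)) * (sqrt (LC (2*p)) * (\<Sum>j<n. (d k j)\<^sup>2) ^ p)"
        by (intro mult_left_mono sl) simp
      finally show ?thesis .
    qed
    have i1: "integrable (C n) (\<lambda>x. ((A k k)\<^sup>2)^p * \<bar>x k\<bar>^(4*p))"
      using am_k by (intro integrable_mult_right allmom_abs_power)
    have i2: "integrable (C n) (\<lambda>x. \<bar>x k\<bar>^(2*p) * \<bar>?l x\<bar>^(2*p))"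
      using am_k am_l by (intro allmom_integrable allmom_mult Om.allmom_power Om.allmom_abs)
    have "(\<integral>x. \<bar>?f x - ?g x\<bar> ^ (2*p) \<partial>C n) \<le> (\<integral>x. 4^p * (((A k k)\<^sup>2)^p * \<bar>x k\<bar>^(4*p) + \<bar>x k\<bar>^(2*p) * \<bar>?l x\<bar>^(2*p)) \<partial>C n)"
    proof (rule integral_mono)
      show "integrable (C n) (\<lambda>x. \<bar>?f x - ?g x\<bar> ^ (2*p))"
        unfolding diff using am_k am_l by (intro allmom_abs_power allmom_add allmom_mult Om.allmom_cmult Om.allmom_power)
      show "integrable (C n) (\<lambda>x. 4^p * (((A k k)\<^sup>2)^p * \<bar>x k\<bar>^(4*p) + \<bar>x k\<bar>^(2*p) * \<bar>?l x\<bar>^(2*p)))"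
        by (intro integrable_mult_right Bochner_Integration.integrable_add i1 i2)
      fix x :: "nat \<Rightarrow> real"
      have "\<bar>?f x - ?g x\<bar> ^ (2*p) \<le> 2^(2*p) * (\<bar>A k k * (x k)\<^sup>2\<bar>^(2*p) + \<bar>x k * ?l x\<bar>^(2*p))"
        unfolding diff by (rule abs_add_power_le)
      also have "\<bar>A k k * (x k)\<^sup>2\<bar>^(2*p) = ((A k k)\<^sup>2)^p * \<bar>x k\<bar>^(4*p)"
        by (simp add: abs_mult power_mult_distrib power_mult[of _ 2 p] power_mult[of _ 4 p])
      also have "\<bar>x k * ?l x\<bar>^(2*p) = \<bar>x k\<bar>^(2*p) * \<bar>?l x\<bar>^(2*p)"
        by (simp only: abs_mult power_mult_distrib)
      also have "(2::real)^(2*p) = 4^p" by (simp add: power_mult)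
      finally show "\<bar>?f x - ?g x\<bar> ^ (2*p) \<le> 4^p * (((A k k)\<^sup>2)^p * \<bar>x k\<bar>^(4*p) + \<bar>x k\<bar>^(2*p) * \<bar>?l x\<bar>^(2*p))" .
    qed
    also have "\<dots> = 4^p * (((A k k)\<^sup>2)^p * (\<integral>x. \<bar>x k\<bar>^(4*p) \<partial>C n) + (\<integral>x. \<bar>x k\<bar>^(2*p) * \<bar>?l x\<bar>^(2*p) \<partial>C n))"
      by (simp only: integral_mult_right_zero Bochner_Integration.integral_add[OF i1 i2])
    also have "\<dots> \<le> 4^p * (((A k k)\<^sup>2)^p * Mo (4*p) + sqrt (Mo (4*p)) * (sqrt (LC (2*p)) * (\<Sum>j<n. (d k j)\<^sup>2) ^ p))"
      using xl k by (intro mult_left_mono add_mono) (auto simp: moment_coord)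
    also have "\<dots> \<le> K * (((A k k)\<^sup>2)^p + (\<Sum>j<n. (d k j)\<^sup>2) ^ p)"
    proof -
      let ?a = "((A k k)\<^sup>2)^p" and ?b = "(\<Sum>j<n. (d k j)\<^sup>2) ^ p" and ?M = "Mo (4*p)" and ?N = "sqrt (Mo (4*p)) * sqrt (LC (2*p))"
      have nn: "?a \<ge> 0" "?b \<ge> 0" "?M \<ge> 0" "?N \<ge> 0" using LC_nonneg by (auto intro!: sum_nonneg zero_le_power[of "sum _ _"] mult_nonneg_nonneg)
      have "?a * ?M + ?N * ?b \<le> (?M + ?N) * (?a + ?b)" using nn by (simp add: algebra_simps)
      hence "4^p * (?a * ?M + ?N * ?b) \<le> 4^p * ((?M + ?N) * (?a + ?b))" by (intro mult_left_mono) auto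
      also have "\<dots> = (4^p * (?M + ?N)) * (?a + ?b)" by (simp only: mult.assoc)
      also have "\<dots> \<le> K * (?a + ?b)"
        using nn by (intro mult_right_mono) (simp_all add: K_def)
      finally show ?thesis by (simp add: mult.assoc)
    qed
    also have "\<dots> \<le> K^p * ((A k k)\<^sup>2 + (\<Sum>j<n. (d k j)\<^sup>2)) ^ p"
    proof (intro mult_mono add_power_ge)
      have nn: "0 \<le> (\<Sum>j<n. (d k j)\<^sup>2)" by (intro sum_nonneg) auto
      show "0 \<le> (\<Sum>j<n. (d k j)\<^sup>2)" by (rule nn)
      show "0 \<le> ((A k k)\<^sup>2) ^ p + (\<Sum>j<n. (d k j)\<^sup>2) ^ p" using nn by (simp only: add_nonneg_nonneg zero_le_power zero_le_power2)
    qed (use K1 p self_le_power[of K p] in auto)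
    finally show "(\<integral>x. \<bar>?f x - ?g x\<bar> ^ (2*p) \<partial>C n) \<le> c k ^ p"
      by (simp add: c_def power_mult_distrib)
  qed (use allmom_quadratic p c0 in \<open>auto\<close>)
  also have "\<dots> \<le> ES p * (4 * K * (\<Sum>i<n. \<Sum>j<n. (A i j)\<^sup>2)) ^ p"
  proof (intro mult_left_mono power_mono)
    \<comment> \<open>Each entry is met once through its row and once through its column, each time
      with the factor 2 from squaring a sum; hence the 4 in \<open>QC\<close>.\<close>
    have dk: "(A k k)\<^sup>2 + (\<Sum>j<n. (d k j)\<^sup>2) \<le> (\<Sum>j<n. 2 * (A k j)\<^sup>2 + 2 * (A j k)\<^sup>2)" if "k < n" for k
    proof -
      have "(A k k)\<^sup>2 = (\<Sum>j<n. if j = k then (A k k)\<^sup>2 else 0)" using that by simp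
      hence "(A k k)\<^sup>2 + (\<Sum>j<n. (d k j)\<^sup>2) = (\<Sum>j<n. (if j = k then (A k k)\<^sup>2 else 0) + (d k j)\<^sup>2)"
        by (simp only: sum.distrib)
      also have "\<dots> \<le> (\<Sum>j<n. 2 * (A k j)\<^sup>2 + 2 * (A j k)\<^sup>2)"
      proof (rule sum_mono)
        fix j
        have "(A k j + A j k)\<^sup>2 \<le> 2 * (A k j)\<^sup>2 + 2 * (A j k)\<^sup>2"
          using sum_squares_bound[of "A k j" "A j k"] by (simp add: power2_sum)
        thus "(if j = k then (A k k)\<^sup>2 else 0) + (d k j)\<^sup>2 \<le> 2 * (A k j)\<^sup>2 + 2 * (A j k)\<^sup>2"
          by (simp add: d_def)
      qed
      finally show ?thesis .
    qed
    have "(\<Sum>k<n. c k) = K * (\<Sum>k<n. (A k k)\<^sup>2 + (\<Sum>j<n. (d k j)\<^sup>2))"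
      unfolding c_def by (rule sum_distrib_left[symmetric])
    also have "\<dots> \<le> K * (\<Sum>k<n. \<Sum>j<n. 2 * (A k j)\<^sup>2 + 2 * (A j k)\<^sup>2)"
      using K1 dk by (intro mult_left_mono sum_mono) auto
    also have "(\<Sum>k<n. \<Sum>j<n. 2 * (A k j)\<^sup>2 + 2 * (A j k)\<^sup>2) = 4 * (\<Sum>i<n. \<Sum>j<n. (A i j)\<^sup>2)"
      using sum.swap[of "\<lambda>k j. (A j k)\<^sup>2" "{..<n}" "{..<n}"] by (simp add: sum.distrib sum_distrib_left[symmetric])
    finally show "(\<Sum>k<n. c k) \<le> 4 * K * (\<Sum>i<n. \<Sum>j<n. (A i j)\<^sup>2)" by (simp add: mult_ac)
  qed (auto intro: sum_nonneg c0)
  finally show ?thesis unfolding E by (simp add: QC_def K_def power_mult_distrib mult_ac)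
qed

definition LCc :: "nat \<Rightarrow> real" where "LCc p = 2 ^ p * 2 * LC p"
definition QCc :: "nat \<Rightarrow> real" where "QCc p = 2 ^ p * 2 * QC p"

lemma LCc_nonneg [simp]: "LCc p \<ge> 0" and QCc_nonneg [simp]: "QCc p \<ge> 0"
  by (simp_all add: LCc_def QCc_def)

lemma coord_borel [measurable]: "i < n \<Longrightarrow> (\<lambda>x. x i) \<in> borel_measurable (C n)"
  by (rule allmom_measurable[OF allmom_coord])

lemma cmod_moment_from_Re_Im:
  assumes f: "allmom (C n) (\<lambda>x. Re (f x))" "allmom (C n) (\<lambda>x. Im (f x))"
    and R: "(\<integral>x. \<bar>Re (f x)\<bar> ^ (2*p) \<partial>C n) \<le> K * a ^ p" and I: "(\<integral>x. \<bar>Im (f x)\<bar> ^ (2*p) \<partial>C n) \<le> K * b ^ p"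
    and ab: "0 \<le> a" "0 \<le> b" "a \<le> s" "b \<le> s" and K: "0 \<le> K"
  shows "(\<integral>x. cmod (f x) ^ (2*p) \<partial>C n) \<le> 2 ^ p * 2 * K * s ^ p"
proof -
  interpret finite_measure "C n" by (rule finite_C)
  have iR: "integrable (C n) (\<lambda>x. \<bar>Re (f x)\<bar> ^ (2*p))" and iI: "integrable (C n) (\<lambda>x. \<bar>Im (f x)\<bar> ^ (2*p))"
    using f by (auto intro: allmom_abs_power)
  have "(\<integral>x. cmod (f x) ^ (2*p) \<partial>C n) \<le> (\<integral>x. 2 ^ p * (\<bar>Re (f x)\<bar> ^ (2*p) + \<bar>Im (f x)\<bar> ^ (2*p)) \<partial>C n)"
    by (rule integral_mono_AE') (auto intro!: integrable_mult_right Bochner_Integration.integrable_add iR iI cmod_even_power_le)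
  also have "\<dots> = 2 ^ p * ((\<integral>x. \<bar>Re (f x)\<bar> ^ (2*p) \<partial>C n) + (\<integral>x. \<bar>Im (f x)\<bar> ^ (2*p) \<partial>C n))"
    by (simp only: integral_mult_right_zero Bochner_Integration.integral_add[OF iR iI])
  also have "\<dots> \<le> 2 ^ p * (K * s ^ p + K * s ^ p)"
    using ab K R I power_mono[of a s p] power_mono[of b s p]
    by (intro mult_left_mono add_mono) (auto intro: order_trans[OF _ mult_left_mono])
  finally show ?thesis by (simp add: mult_ac)
qed

lemma linear_moment_complex:
  assumes p: "1 \<le> p"
  shows "(\<integral>x. cmod (cdot n u (cx x)) ^ (2*p) \<partial>C n) \<le> LCc p * nrm2 n u ^ p"
    and "allmom (C n) (\<lambda>x. cmod (cdot n u (cx x)))"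
    and "(\<lambda>x. cdot n u (cx x)) \<in> borel_measurable (C n)"
proof -
  interpret finite_measure "C n" by (rule finite_C)
  have R: "Re (cdot n u (cx x)) = (\<Sum>i<n. Re (u i) * x i)" and I: "Im (cdot n u (cx x)) = (\<Sum>i<n. Im (u i) * x i)" for x
    by (simp_all add: cdot_def cx_def)
  have aR: "allmom (C n) (\<lambda>x. Re (cdot n u (cx x)))" and aI: "allmom (C n) (\<lambda>x. Im (cdot n u (cx x)))"
    unfolding R I by (rule allmom_linear)+
  show m: "(\<lambda>x. cdot n u (cx x)) \<in> borel_measurable (C n)"
    unfolding cdot_def cx_def by measurable
  show "allmom (C n) (\<lambda>x. cmod (cdot n u (cx x)))" by (rule allmom_cmod_of_Re_Im[OF aR aI m])
  show "(\<integral>x. cmod (cdot n u (cx x)) ^ (2*p) \<partial>C n) \<le> LCc p * nrm2 n u ^ p"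
    unfolding LCc_def
  proof (rule cmod_moment_from_Re_Im[OF aR aI])
    show "(\<integral>x. \<bar>Re (cdot n u (cx x))\<bar> ^ (2*p) \<partial>C n) \<le> LC p * (\<Sum>i<n. (Re (u i))\<^sup>2) ^ p"
      unfolding R by (rule linear_moment[OF p])
    show "(\<integral>x. \<bar>Im (cdot n u (cx x))\<bar> ^ (2*p) \<partial>C n) \<le> LC p * (\<Sum>i<n. (Im (u i))\<^sup>2) ^ p"
      unfolding I by (rule linear_moment[OF p])
  qed (auto simp: nrm2_def cmod_power2 intro!: sum_nonneg sum_mono)
qed

lemma quadratic_moment_complex:
  assumes p: "1 \<le> p"
  shows "(\<integral>x. cmod (quad n A x - (\<Sum>i<n. A i i)) ^ (2*p) \<partial>C n) \<le> QCc p * (\<Sum>i<n. \<Sum>j<n. (cmod (A i j))\<^sup>2) ^ p"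
    and "allmom (C n) (\<lambda>x. cmod (quad n A x))"
    and "quad n A \<in> borel_measurable (C n)"
proof -
  interpret finite_measure "C n" by (rule finite_C)
  have R: "Re (quad n A x) = (\<Sum>i<n. \<Sum>j<n. Re (A i j) * x i * x j)"
    and I: "Im (quad n A x) = (\<Sum>i<n. \<Sum>j<n. Im (A i j) * x i * x j)" for x
    by (simp_all add: quad_def mult_ac)
  have aR: "allmom (C n) (\<lambda>x. Re (quad n A x))" and aI: "allmom (C n) (\<lambda>x. Im (quad n A x))"
    unfolding R I by (rule allmom_quadratic)+
  show m: "quad n A \<in> borel_measurable (C n)"
    unfolding quad_def[abs_def] by measurable
  show "allmom (C n) (\<lambda>x. cmod (quad n A x))" by (rule allmom_cmod_of_Re_Im[OF aR aI m])
  have aR': "allmom (C n) (\<lambda>x. Re (quad n A x - (\<Sum>i<n. A i i)))" and aI': "allmom (C n) (\<lambda>x. Im (quad n A x - (\<Sum>i<n. A i i)))"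
    unfolding minus_complex.sel using aR aI by (intro allmom_diff allmom_const; simp)+
  show "(\<integral>x. cmod (quad n A x - (\<Sum>i<n. A i i)) ^ (2*p) \<partial>C n) \<le> QCc p * (\<Sum>i<n. \<Sum>j<n. (cmod (A i j))\<^sup>2) ^ p"
    unfolding QCc_def
  proof (rule cmod_moment_from_Re_Im[OF aR' aI'])
    show "(\<integral>x. \<bar>Re (quad n A x - (\<Sum>i<n. A i i))\<bar> ^ (2*p) \<partial>C n) \<le> QC p * (\<Sum>i<n. \<Sum>j<n. (Re (A i j))\<^sup>2) ^ p"
      using quadratic_moment[OF p, of n "\<lambda>i j. Re (A i j)"] by (simp add: R)
    show "(\<integral>x. \<bar>Im (quad n A x - (\<Sum>i<n. A i i))\<bar> ^ (2*p) \<partial>C n) \<le> QC p * (\<Sum>i<n. \<Sum>j<n. (Im (A i j))\<^sup>2) ^ p"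
      using quadratic_moment[OF p, of n "\<lambda>i j. Im (A i j)"] by (simp add: I)
  qed (auto simp: cmod_power2 intro!: sum_nonneg sum_mono)
qed

end

text \<open>For a unit vector v and \<tau> = sqrt \<theta> - 1 this is the action of \<Sigma>^(1/2);
  \<open>ycol\<close> below is a column of X after this map, scaled by 1 / sqrt n.\<close>

definition bt :: "nat \<Rightarrow> real \<Rightarrow> (nat \<Rightarrow> real) \<Rightarrow> (nat \<Rightarrow> complex) \<Rightarrow> nat \<Rightarrow> complex" where
  "bt n \<tau> v u = (\<lambda>i. u i + of_real \<tau> * cdot n u (cx v) * cx v i)"

definition ycol :: "nat \<Rightarrow> real \<Rightarrow> (nat \<Rightarrow> real) \<Rightarrow> (nat \<Rightarrow> real) \<Rightarrow> nat \<Rightarrow> real" where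
  "ycol n \<tau> v x = (\<lambda>i. (x i + \<tau> * (\<Sum>j<n. x j * v j) * v i) / sqrt (real n))"

lemma cx_ycol: "cx (ycol n \<tau> v x) i = bt n \<tau> v (cx x) i / of_real (sqrt (real n))"
  by (simp add: cx_def ycol_def bt_def cdot_def)

lemma cdot_bt: "cdot n u (bt n \<tau> v w) = cdot n (bt n \<tau> v u) w"
proof -
  have "cdot n u (bt n \<tau> v w) = cdot n u w + of_real \<tau> * cdot n w (cx v) * cdot n u (cx v)"
    unfolding bt_def by (simp add: cdot_add_right cdot_cmult_right)
  moreover have "cdot n (bt n \<tau> v u) w = cdot n w u + of_real \<tau> * cdot n u (cx v) * cdot n w (cx v)"
    unfolding bt_def by (subst cdot_commute) (simp add: cdot_add_right cdot_cmult_right)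
  ultimately show ?thesis by (simp add: cdot_commute[of n w u])
qed

lemma cdot_ycol: "cdot n u (cx (ycol n \<tau> v x)) = cdot n (bt n \<tau> v u) (cx x) / of_real (sqrt (real n))"
proof -
  have "cdot n u (cx (ycol n \<tau> v x)) = cdot n u (bt n \<tau> v (cx x)) / of_real (sqrt (real n))"
    by (simp add: cdot_def cx_ycol sum_divide_distrib)
  thus ?thesis by (simp add: cdot_bt)
qed

lemma nrm2_cx: "nrm2 n (cx y) = (\<Sum>i<n. (y i)\<^sup>2)"
  by (simp add: nrm2_def cx_def)

lemma nrm2_bt_le:
  assumes v: "(\<Sum>i<n. (v i)\<^sup>2) = 1"
  shows "nrm2 n (bt n \<tau> v u) \<le> (1 + \<bar>\<tau>\<bar>)\<^sup>2 * nrm2 n u"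
proof -
  let ?t = "\<bar>\<tau>\<bar>" and ?c = "cmod (cdot n u (cx v))"
  have pt: "(cmod (bt n \<tau> v u i))\<^sup>2 \<le> (1 + ?t) * ((cmod (u i))\<^sup>2 + ?t * (?c\<^sup>2 * (v i)\<^sup>2))" for i
  proof -
    have "cmod (bt n \<tau> v u i) \<le> cmod (u i) + ?t * (?c * \<bar>v i\<bar>)"
      unfolding bt_def by (rule order_trans[OF norm_triangle_ineq]) (simp add: norm_mult cx_def)
    hence "(cmod (bt n \<tau> v u i))\<^sup>2 \<le> (cmod (u i) + ?t * (?c * \<bar>v i\<bar>))\<^sup>2" by (intro power_mono) auto
    also have "\<dots> \<le> (1 + ?t) * ((cmod (u i))\<^sup>2 + ?t * (?c * \<bar>v i\<bar>)\<^sup>2)"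
    proof -
      have "0 \<le> ?t * (cmod (u i) - ?c * \<bar>v i\<bar>)\<^sup>2" by simp
      thus ?thesis by (simp add: power2_eq_square algebra_simps)
    qed
    finally show ?thesis by (simp add: power_mult_distrib)
  qed
  have c: "?c\<^sup>2 \<le> nrm2 n u" using cmod_cdot_le[of n u "cx v"] v by (simp add: nrm2_cx)
  have "nrm2 n (bt n \<tau> v u) \<le> (\<Sum>i<n. (1 + ?t) * ((cmod (u i))\<^sup>2 + ?t * (?c\<^sup>2 * (v i)\<^sup>2)))"
    unfolding nrm2_def[of n "bt n \<tau> v u"] by (intro sum_mono pt)
  also have "\<dots> = (1 + ?t) * (nrm2 n u + ?t * ?c\<^sup>2)"
    by (simp add: sum_distrib_left[symmetric] sum.distrib nrm2_def v)
  also have "\<dots> \<le> (1 + ?t) * (nrm2 n u + ?t * nrm2 n u)"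
    using c by (intro mult_left_mono add_left_mono) auto
  finally show ?thesis by (simp add: power2_eq_square algebra_simps)
qed

text \<open>The entries of (1 + \<tau> v v^T) R (1 + \<tau> v v^T): the quadratic form of R in a
  transformed column is a form in the independent entries with this matrix.\<close>

definition amat :: "nat \<Rightarrow> real \<Rightarrow> (nat \<Rightarrow> real) \<Rightarrow> (nat \<Rightarrow> nat \<Rightarrow> complex) \<Rightarrow> nat \<Rightarrow> nat \<Rightarrow> complex" where
  "amat n \<tau> v R i j = bt n \<tau> v (\<lambda>k. bt n \<tau> v (R k) j) i"

lemma quad_ycol:
  "cdot n (cx (ycol n \<tau> v x)) (mv n R (cx (ycol n \<tau> v x))) = quad n (amat n \<tau> v R) x / of_nat n"
  (is "?L = _")
proof (cases "n = 0")
  case True thus ?thesis by (simp add: cdot_def)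
next
  case n: False
  let ?s = "complex_of_real (sqrt (real n))" and ?X = "cx x"
  have ss: "?s * ?s = of_nat n" by (simp add: of_real_mult[symmetric] del: of_real_mult)
  have m: "mv n R (cx (ycol n \<tau> v x)) k = (\<Sum>j<n. bt n \<tau> v (R k) j * ?X j) / ?s" for k
    using cdot_ycol[of n "R k" \<tau> v x] by (simp add: mv_def cdot_def)
  have "?L = cdot n (bt n \<tau> v (mv n R (cx (ycol n \<tau> v x)))) ?X / ?s"
    by (subst cdot_commute) (rule cdot_ycol)
  also have "cdot n (bt n \<tau> v (mv n R (cx (ycol n \<tau> v x)))) ?X = (\<Sum>i<n. (\<Sum>j<n. amat n \<tau> v R i j * ?X j) / ?s * ?X i)"
    unfolding cdot_def[of n "bt n \<tau> v (mv n R (cx (ycol n \<tau> v x)))"]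
  proof (intro sum.cong refl arg_cong2[where f = "(*)"])
    fix i
    have "cdot n (mv n R (cx (ycol n \<tau> v x))) (cx v) = (\<Sum>j<n. cdot n (\<lambda>k. bt n \<tau> v (R k) j) (cx v) * ?X j) / ?s"
      unfolding cdot_def[of n _ "cx v"] m
      by (simp add: sum_distrib_right sum_divide_distrib) (subst sum.swap, simp add: mult_ac)
    hence "bt n \<tau> v (mv n R (cx (ycol n \<tau> v x))) i = (\<Sum>j<n. bt n \<tau> v (R i) j * ?X j) / ?s
        + of_real \<tau> * ((\<Sum>j<n. cdot n (\<lambda>k. bt n \<tau> v (R k) j) (cx v) * ?X j) / ?s) * cx v i"
      unfolding bt_def[of n \<tau> v "mv n R _"] by (simp add: m)
    also have "\<dots> = (\<Sum>j<n. amat n \<tau> v R i j * ?X j) / ?s"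
      unfolding amat_def bt_def[of n \<tau> v "\<lambda>k. bt n \<tau> v (R k) _"]
      by (simp only: distrib_right sum.distrib add_divide_distrib)
         (simp add: sum_distrib_left sum_distrib_right sum_divide_distrib mult_ac)
    finally show "bt n \<tau> v (mv n R (cx (ycol n \<tau> v x))) i = (\<Sum>j<n. amat n \<tau> v R i j * ?X j) / ?s" .
  qed
  also have "\<dots> / ?s = (\<Sum>i<n. \<Sum>j<n. amat n \<tau> v R i j * of_real (x i * x j)) / (?s * ?s)"
    by (simp add: sum_divide_distrib sum_distrib_right sum_distrib_left cx_def mult_ac)
  finally show ?thesis by (simp only: ss quad_def)
qed

text \<open>In essence cyclicity: this is the trace of R (1 + \<tau> v v^T)^2, and the square is 1 +
  ((1 + \<tau>)^2 - 1) v v^T for a unit vector v.\<close>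

lemma trace_amat:
  assumes v: "(\<Sum>i<n. (v i)\<^sup>2) = 1"
  shows "(\<Sum>i<n. amat n \<tau> v R i i) = (\<Sum>i<n. R i i) + of_real ((1 + \<tau>)\<^sup>2 - 1) * cdot n (cx v) (mv n R (cx v))"
proof -
  let ?V = "cx v" and ?g = "cdot n (cx v) (mv n R (cx v))"
  have vv: "(\<Sum>i<n. ?V i * ?V i) = 1"
    using v by (simp add: cx_def power2_eq_square of_real_mult[symmetric] of_real_sum[symmetric] del: of_real_mult of_real_sum)
  have g1: "(\<Sum>i<n. cdot n (R i) ?V * ?V i) = ?g"
    by (simp add: cdot_def mv_def mult.commute)
  have g2: "(\<Sum>i<n. (\<Sum>k<n. R k i * ?V k) * ?V i) = ?g"
    unfolding cdot_mv_bilinear by (subst sum.swap) (simp add: sum_distrib_right sum_distrib_left mult_ac)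
  have 1: "cdot n (\<lambda>k. bt n \<tau> v (R k) i) ?V = (\<Sum>k<n. R k i * ?V k) + of_real \<tau> * ?V i * ?g" for i
  proof -
    have "cdot n (\<lambda>k. bt n \<tau> v (R k) i) ?V = (\<Sum>k<n. (R k i + of_real \<tau> * cdot n (R k) ?V * ?V i) * ?V k)"
      by (subst cdot_def) (simp only: bt_def)
    also have "\<dots> = (\<Sum>k<n. R k i * ?V k) + (\<Sum>k<n. of_real \<tau> * ?V i * (cdot n (R k) ?V * ?V k))"
      by (simp only: distrib_right sum.distrib) (simp add: mult_ac)
    finally have "cdot n (\<lambda>k. bt n \<tau> v (R k) i) ?V = (\<Sum>k<n. R k i * ?V k) + (\<Sum>k<n. of_real \<tau> * ?V i * (cdot n (R k) ?V * ?V k))" .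
    thus ?thesis by (simp only: sum_distrib_left[symmetric] g1)
  qed
  have "(\<Sum>i<n. amat n \<tau> v R i i) = (\<Sum>i<n. R i i) + (\<Sum>i<n. of_real \<tau> * (cdot n (R i) ?V * ?V i))
      + (\<Sum>i<n. of_real \<tau> * ((\<Sum>k<n. R k i * ?V k) * ?V i)) + (\<Sum>i<n. of_real \<tau> * of_real \<tau> * ?g * (?V i * ?V i))"
    unfolding amat_def bt_def[of n \<tau> v "\<lambda>k. bt n \<tau> v (R k) _"] 1 unfolding bt_def sum.distrib[symmetric]
    by (rule sum.cong[OF refl]) (simp add: algebra_simps)
  also have "\<dots> = (\<Sum>i<n. R i i) + of_real \<tau> * ?g + of_real \<tau> * ?g + of_real \<tau> * of_real \<tau> * ?g"
    by (simp only: sum_distrib_left[symmetric] g1 g2 vv) simp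
  also have "\<dots> = (\<Sum>i<n. R i i) + of_real ((1 + \<tau>)\<^sup>2 - 1) * ?g"
    by (simp add: power2_eq_square algebra_simps)
  finally show ?thesis .
qed

lemma frobenius_amat:
  assumes v: "(\<Sum>i<n. (v i)\<^sup>2) = 1"
  shows "(\<Sum>i<n. \<Sum>j<n. (cmod (amat n \<tau> v R i j))\<^sup>2) \<le> (1 + \<bar>\<tau>\<bar>) ^ 4 * (\<Sum>i<n. \<Sum>j<n. (cmod (R i j))\<^sup>2)"
proof -
  have "(\<Sum>i<n. \<Sum>j<n. (cmod (amat n \<tau> v R i j))\<^sup>2) = (\<Sum>j<n. nrm2 n (bt n \<tau> v (\<lambda>k. bt n \<tau> v (R k) j)))"
    by (subst sum.swap) (simp add: nrm2_def amat_def)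
  also have "\<dots> \<le> (\<Sum>j<n. (1 + \<bar>\<tau>\<bar>)\<^sup>2 * nrm2 n (\<lambda>k. bt n \<tau> v (R k) j))"
    by (intro sum_mono nrm2_bt_le v)
  also have "\<dots> = (1 + \<bar>\<tau>\<bar>)\<^sup>2 * (\<Sum>k<n. nrm2 n (bt n \<tau> v (R k)))"
    unfolding nrm2_def sum_distrib_left[symmetric] by (subst sum.swap) simp
  also have "\<dots> \<le> (1 + \<bar>\<tau>\<bar>)\<^sup>2 * (\<Sum>k<n. (1 + \<bar>\<tau>\<bar>)\<^sup>2 * nrm2 n (R k))"
    by (intro mult_left_mono sum_mono nrm2_bt_le v) auto
  also have "\<dots> = (1 + \<bar>\<tau>\<bar>) ^ 4 * (\<Sum>i<n. \<Sum>j<n. (cmod (R i j))\<^sup>2)"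
    by (simp add: sum_distrib_left[symmetric] nrm2_def power_numeral_reduce mult_ac)
  finally show ?thesis .
qed

section \<open>Moments of forms in the transformed columns\<close>

context entry_law
begin

lemma linear_ycol_moment:
  assumes p: "1 \<le> p" and n: "1 \<le> n" and v: "(\<Sum>i<n. (v i)\<^sup>2) = 1"
  shows "(\<integral>x. cmod (cdot n u (cx (ycol n \<tau> v x))) ^ (2*p) \<partial>C n) \<le> LCc p * ((1 + \<bar>\<tau>\<bar>)\<^sup>2 * nrm2 n u / n) ^ p"
proof -
  have "cmod (cdot n u (cx (ycol n \<tau> v x))) ^ (2*p) = cmod (cdot n (bt n \<tau> v u) (cx x)) ^ (2*p) / real n ^ p" for x
    using n by (simp add: cdot_ycol norm_divide power_divide power_mult)
  hence "(\<integral>x. cmod (cdot n u (cx (ycol n \<tau> v x))) ^ (2*p) \<partial>C n) = (\<integral>x. cmod (cdot n (bt n \<tau> v u) (cx x)) ^ (2*p) \<partial>C n) / real n ^ p"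
    by simp
  also have "\<dots> \<le> (LCc p * nrm2 n (bt n \<tau> v u) ^ p) / real n ^ p"
    by (intro divide_right_mono linear_moment_complex p) auto
  also have "\<dots> \<le> (LCc p * ((1 + \<bar>\<tau>\<bar>)\<^sup>2 * nrm2 n u) ^ p) / real n ^ p"
    by (intro divide_right_mono mult_left_mono power_mono nrm2_bt_le v) auto
  finally show ?thesis by (simp add: power_divide)
qed

lemma quadratic_ycol_moment:
  assumes p: "1 \<le> p" and n: "1 \<le> n" and v: "(\<Sum>i<n. (v i)\<^sup>2) = 1"
  shows "(\<integral>x. cmod (cdot n (cx (ycol n \<tau> v x)) (mv n R (cx (ycol n \<tau> v x)))
        - ((\<Sum>i<n. R i i) + of_real ((1 + \<tau>)\<^sup>2 - 1) * cdot n (cx v) (mv n R (cx v))) / of_nat n) ^ (2*p) \<partial>C n)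
     \<le> QCc p * ((1 + \<bar>\<tau>\<bar>) ^ 4 * (\<Sum>i<n. \<Sum>j<n. (cmod (R i j))\<^sup>2) / (real n)\<^sup>2) ^ p"
proof -
  let ?A = "amat n \<tau> v R"
  have "cmod (cdot n (cx (ycol n \<tau> v x)) (mv n R (cx (ycol n \<tau> v x)))
        - ((\<Sum>i<n. R i i) + of_real ((1 + \<tau>)\<^sup>2 - 1) * cdot n (cx v) (mv n R (cx v))) / of_nat n) ^ (2*p)
      = cmod (quad n ?A x - (\<Sum>i<n. ?A i i)) ^ (2*p) / ((real n)\<^sup>2) ^ p" for x
    unfolding quad_ycol trace_amat[OF v] diff_divide_distrib[symmetric]
    using n by (simp add: norm_divide power_divide power_mult)
  hence "(\<integral>x. cmod (cdot n (cx (ycol n \<tau> v x)) (mv n R (cx (ycol n \<tau> v x)))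
        - ((\<Sum>i<n. R i i) + of_real ((1 + \<tau>)\<^sup>2 - 1) * cdot n (cx v) (mv n R (cx v))) / of_nat n) ^ (2*p) \<partial>C n)
      = (\<integral>x. cmod (quad n ?A x - (\<Sum>i<n. ?A i i)) ^ (2*p) \<partial>C n) / ((real n)\<^sup>2) ^ p"
    by simp
  also have "\<dots> \<le> (QCc p * (\<Sum>i<n. \<Sum>j<n. (cmod (?A i j))\<^sup>2) ^ p) / ((real n)\<^sup>2) ^ p"
    by (intro divide_right_mono quadratic_moment_complex p) auto
  also have "\<dots> \<le> (QCc p * ((1 + \<bar>\<tau>\<bar>) ^ 4 * (\<Sum>i<n. \<Sum>j<n. (cmod (R i j))\<^sup>2)) ^ p) / ((real n)\<^sup>2) ^ p"
    by (intro divide_right_mono mult_left_mono power_mono frobenius_amat v) (auto intro!: sum_nonneg)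
  finally show ?thesis by (simp add: power_divide)
qed

lemma cross_moment_complex:
  "(\<integral>x. cdot n u (cx x) * cdot n w (cx x) \<partial>C n) = cdot n u w"
proof -
  interpret finite_measure "C n" by (rule finite_C)
  have i: "integrable (C n) (\<lambda>x. complex_of_real (x i * x j))" if "i < n" "j < n" for i j
    using that by (intro integrable_of_real allmom_integrable allmom_mult allmom_coord)
  have "(\<integral>x. cdot n u (cx x) * cdot n w (cx x) \<partial>C n) = (\<integral>x. (\<Sum>i<n. \<Sum>j<n. (u i * w j) * of_real (x i * x j)) \<partial>C n)"
    by (simp add: cdot_def cx_def sum_product mult_ac)
  also have "\<dots> = (\<Sum>i<n. \<Sum>j<n. (u i * w j) * (\<integral>x. of_real (x i * x j) \<partial>C n))"
    using i by (subst Bochner_Integration.integral_sum, (auto intro!: Bochner_Integration.integrable_sum integrable_mult_right)[1],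
      intro sum.cong refl, subst Bochner_Integration.integral_sum) (auto intro!: integrable_mult_right)
  also have "\<dots> = (\<Sum>i<n. \<Sum>j<n. (u i * w j) * (if i = j then 1 else 0))"
    by (intro sum.cong refl) (simp add: cov_coord del: of_real_mult)
  also have "\<dots> = cdot n u w" by (simp add: cdot_def if_distrib[of "\<lambda>x. _ * x"] sum.delta cong: if_cong)
  finally show ?thesis .
qed

text \<open>The covariance matrix of a transformed column is (1 + \<tau> v v^T)^2 / n, of which v is
  an eigenvector with eigenvalue (1 + \<tau>)^2 / n. This is the source of \<theta> in the second
  self-consistent equation.\<close>

lemma cross_ycol:
  assumes n: "1 \<le> n" and v: "(\<Sum>i<n. (v i)\<^sup>2) = 1"
  shows "(\<integral>x. cdot n (cx v) (cx (ycol n \<tau> v x)) * cdot n w (cx (ycol n \<tau> v x)) \<partial>C n) = of_real ((1 + \<tau>)\<^sup>2 / n) * cdot n (cx v) w"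
proof -
  let ?s = "complex_of_real (sqrt (real n))"
  have ss: "?s * ?s = of_nat n" by (simp add: of_real_mult[symmetric] del: of_real_mult)
  have vv: "cdot n (cx v) (cx v) = 1"
    using v by (simp add: cdot_def cx_def power2_eq_square of_real_mult[symmetric] of_real_sum[symmetric] del: of_real_mult of_real_sum)
  have bv: "bt n \<tau> v (cx v) = (\<lambda>i. of_real (1 + \<tau>) * cx v i)"
    by (simp add: bt_def vv distrib_right)
  have "(\<integral>x. cdot n (cx v) (cx (ycol n \<tau> v x)) * cdot n w (cx (ycol n \<tau> v x)) \<partial>C n)
      = (\<integral>x. cdot n (bt n \<tau> v (cx v)) (cx x) * cdot n (bt n \<tau> v w) (cx x) \<partial>C n) / of_nat n"
    by (simp add: cdot_ycol ss)
  also have "\<dots> = cdot n (bt n \<tau> v (bt n \<tau> v (cx v))) w / of_nat n"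
    by (simp add: cross_moment_complex cdot_bt)
  also have "bt n \<tau> v (bt n \<tau> v (cx v)) = (\<lambda>i. of_real (1 + \<tau>) * of_real (1 + \<tau>) * cx v i)"
  proof -
    have "cdot n (\<lambda>i. of_real (1 + \<tau>) * cx v i) (cx v) = of_real (1 + \<tau>)"
      by (subst cdot_commute) (simp add: cdot_cmult_right vv del: of_real_add)
    thus ?thesis unfolding bv by (simp add: bt_def algebra_simps)
  qed
  also have "cdot n \<dots> w = of_real ((1 + \<tau>)\<^sup>2) * cdot n (cx v) w"
    by (subst cdot_commute) (simp add: cdot_cmult_right power2_eq_square cdot_commute[of n w])
  finally show ?thesis by simp
qed

end

text \<open>Joint measurability in the columns and in the spectral parameter; the latter becomes an
  integration variable when Fubini is applied on the segment.\<close>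

lemma res_measurable:
  assumes "\<And>a i. a \<in> set as \<Longrightarrow> i < n \<Longrightarrow> (\<lambda>w. a w i) \<in> borel_measurable M"
    and [measurable]: "Z \<in> borel_measurable M" and ij: "i < n" "j < n"
  shows "(\<lambda>w. res n (Z w) (map (\<lambda>a. a w) as) i j) \<in> borel_measurable M"
  using assms(1) ij
proof (induction as arbitrary: i j)
  case Nil
  show ?case by simp
next
  case (Cons a as)
  have [measurable]: "(\<lambda>w. a w i) \<in> borel_measurable M" if "i < n" for i using Cons.prems that by simp
  have R [measurable]: "(\<lambda>w. res n (Z w) (map (\<lambda>a. a w) as) i j) \<in> borel_measurable M" if "i < n" "j < n" for i j
    using Cons.prems that by (intro Cons.IH) auto
  have mvm [measurable]: "(\<lambda>w. mv n (res n (Z w) (map (\<lambda>a. a w) as)) (cx (a w)) i) \<in> borel_measurable M" if "i < n" for i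
    unfolding mv_def cx_def using that by measurable
  have [measurable]: "(\<lambda>w. cdot n (cx (a w)) (mv n (res n (Z w) (map (\<lambda>a. a w) as)) (cx (a w)))) \<in> borel_measurable M"
  proof -
    have *: "(\<lambda>w. cdot n (cx (a w)) (F w)) = (\<lambda>w. \<Sum>i<n. complex_of_real (a w i) * F w i)" for F
      by (simp add: cdot_def cx_def)
    show ?thesis unfolding * by measurable
  qed
  show ?case using Cons.prems by (simp add: res.simps(2)) measurable
qed

section \<open>Leave-one-out identities\<close>

text \<open>Here v is deterministic; the bounds are uniform in it, so that a random v independent of
  X can be inserted at the end.\<close>

locale model = entry_law +
  fixes n m :: nat and \<tau> :: real and v :: "nat \<Rightarrow> real" and z :: complex
  assumes n1: "1 \<le> n" and v_unit: "(\<Sum>i<n. (v i)\<^sup>2) = 1" and z: "Im z > 0"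
begin

sublocale PS: prod_space "\<lambda>_::nat. C n" "{..<m}"
  by (simp add: prod_space_def prob_C)

abbreviation Om :: "(nat \<Rightarrow> nat \<Rightarrow> real) measure" where "Om \<equiv> PiM {..<m} (\<lambda>_. C n)"

definition Y :: "(nat \<Rightarrow> nat \<Rightarrow> real) \<Rightarrow> nat \<Rightarrow> nat \<Rightarrow> real" where "Y X k = ycol n \<tau> v (X k)"
definition cols where "cols X = map (Y X) [0..<m]"
definition colk where "colk k X = map (Y X) (remove1 k [0..<m])"
definition s where "s X = trn n z (cols X)"
text \<open>\<open>sk\<close>, \<open>wk\<close>, \<open>gk\<close> and \<open>qh\<close> belong to
  the resolvent without column k and do not see that column; \<open>q\<close>, \<open>vy\<close>,
  \<open>wy\<close> and \<open>be\<close> involve column k itself.\<close>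

definition sk where "sk k X = trn n z (colk k X)"
definition g where "g X = cdot n (cx v) (mv n (res n z (cols X)) (cx v))"
definition wk where "wk k X = mv n (res n z (colk k X)) (cx v)"
definition gk where "gk k X = cdot n (cx v) (wk k X)"
definition q where "q k X = qf n z (colk k X) (Y X k)"
definition vy where "vy k X = cdot n (cx v) (cx (Y X k))"
definition wy where "wy k X = cdot n (wk k X) (cx (Y X k))"
definition be where "be k X = 1 / (1 + q k X)"
text \<open>The conditional mean of \<open>q k\<close> given the other columns, tr (R \<Sigma>) / n
  for the resolvent R without column k. Unlike \<open>q k\<close> it can be pulled out of an average
  over column k.\<close>

definition qh where "qh k X = sk k X + of_real ((1 + \<tau>)\<^sup>2 - 1) * gk k X / of_nat n"

lemma nrm2_v: "nrm2 n (cx v) = 1"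
  using v_unit by (simp add: nrm2_cx)

lemma mset_cols: "k < m \<Longrightarrow> mset (cols X) = mset (Y X k # colk k X)"
proof -
  assume k: "k < m"
  have "mset [0..<m] = mset (k # remove1 k [0..<m])" using k by simp
  hence "mset (map (Y X) [0..<m]) = mset (map (Y X) (k # remove1 k [0..<m]))" by (simp only: mset_map)
  thus ?thesis by (simp add: cols_def colk_def)
qed

lemma colk_upd: "colk k (X(k := x)) = colk k X"
  unfolding colk_def by (rule map_cong[OF refl]) (simp add: Y_def)

lemma Y_upd: "Y (X(k := x)) k = ycol n \<tau> v x"
  by (simp add: Y_def)

lemma free_sk: "PS.free_of k (sk k)" and free_gk: "PS.free_of k (gk k)" and free_qh: "PS.free_of k (qh k)"
  by (auto simp: PS.free_of_def sk_def gk_def wk_def qh_def colk_upd)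

lemma s_diff: "k < m \<Longrightarrow> cmod (s X - sk k X) \<le> 1 / (n * Im z)"
  using trn_Cons_diff[OF z, of n "Y X k" "colk k X"] trn_perm[OF z mset_cols]
  by (simp add: s_def sk_def)

lemma one_plus_q: "1 + q k X \<noteq> 0" "cmod (be k X) \<le> cmod z / Im z"
  using one_plus_qf[OF z] by (auto simp: q_def be_def)

lemma g_diff: "k < m \<Longrightarrow> gk k X - g X = (wy k X)\<^sup>2 * be k X"
proof -
  assume k: "k < m"
  have "g X = cdot n (cx v) (mv n (res n z (Y X k # colk k X)) (cx v))"
    unfolding g_def by (rule cdot_res_perm[OF z mset_cols[OF k]])
  thus ?thesis
    by (simp add: cdot_res_Cons[OF z] gk_def wk_def wy_def be_def q_def power2_eq_square cdot_commute[of n "cx (Y X k)"])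
qed

lemma sum_cols: "(\<Sum>a\<leftarrow>cols X. f a) = (\<Sum>k<m. f (Y X k))"
  by (simp add: cols_def interv_sum_list_conv_sum_set_nat atLeast0LessThan o_def)

text \<open>Each y_k^T R y_k equals q / (1 + q) = 1 - 1 / (1 + q), where q is formed with the
  resolvent without y_k: in every term column k is now separated from an independent matrix.\<close>

lemma one_plus_z_s: "of_nat n * (1 + z * s X) = (\<Sum>k<m. 1 - be k X)"
proof -
  have "of_nat n * (1 + z * s X) = (\<Sum>k<m. qf n z (cols X) (Y X k))"
    using one_plus_z_trace[OF z, of n "cols X"] by (simp add: s_def sum_cols)
  also have "\<dots> = (\<Sum>k<m. 1 - be k X)"
  proof (intro sum.cong refl)
    fix k assume "k \<in> {..<m}" hence k: "k < m" by simp
    have "qf n z (cols X) (Y X k) = cdot n (cx (Y X k)) (mv n (res n z (Y X k # colk k X)) (cx (Y X k)))"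
      unfolding qf_def by (rule cdot_res_perm[OF z mset_cols[OF k]])
    also have "\<dots> = q k X / (1 + q k X)"
      by (simp add: cdot_res_Cons_same[OF z] q_def) (simp add: qf_def)
    also have "\<dots> = 1 - be k X" using one_plus_q(1)[of k X] by (simp add: be_def field_simps)
    finally show "qf n z (cols X) (Y X k) = 1 - be k X" .
  qed
  finally show ?thesis .
qed

lemma one_plus_z_g: "1 + z * g X = (\<Sum>k<m. vy k X * wy k X * be k X)"
proof -
  have vv: "cdot n (cx v) (cx v) = 1"
    using v_unit by (simp add: cdot_def cx_def power2_eq_square of_real_mult[symmetric] of_real_sum[symmetric] del: of_real_mult of_real_sum)
  have "1 + z * g X = (\<Sum>k<m. cdot n (cx v) (cx (Y X k)) * cdot n (cx (Y X k)) (mv n (res n z (cols X)) (cx v)))"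
    using one_plus_z_quadratic[OF z, of n "cx v" "cols X" "cx v"] by (simp add: g_def sum_cols vv)
  also have "\<dots> = (\<Sum>k<m. vy k X * wy k X * be k X)"
  proof (intro sum.cong refl)
    fix k assume "k \<in> {..<m}" hence k: "k < m" by simp
    have "cdot n (cx (Y X k)) (mv n (res n z (cols X)) (cx v)) = cdot n (cx (Y X k)) (mv n (res n z (Y X k # colk k X)) (cx v))"
      by (rule cdot_res_perm[OF z mset_cols[OF k]])
    also have "\<dots> = wy k X * be k X"
      by (simp add: cdot_res_Cons_same[OF z] wy_def wk_def be_def q_def cdot_commute[of n "cx (Y X k)"])
    finally show "cdot n (cx v) (cx (Y X k)) * cdot n (cx (Y X k)) (mv n (res n z (cols X)) (cx v)) = vy k X * wy k X * be k X"
      by (simp add: vy_def)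
  qed
  finally show ?thesis .
qed

lemma bounds: "cmod (s X) \<le> 1 / Im z" "cmod (sk k X) \<le> 1 / Im z" "cmod (g X) \<le> 1 / Im z" "cmod (gk k X) \<le> 1 / Im z"
  "Im (s X) \<ge> 0" "Im (sk k X) \<ge> 0" "Im (gk k X) \<ge> 0" "Im (z * s X) \<ge> 0"
  using cmod_trn_le[OF z] cmod_qf_le[OF z, of n _ v] Im_trn_nonneg[OF z] Im_qf_nonneg[OF z, of n _ v] Im_z_trn_nonneg[OF z]
  by (auto simp: s_def sk_def g_def gk_def wk_def qf_def nrm2_v)

lemma Ward_w: "nrm2 n (wk k X) = Im (gk k X) / Im z"
  using Im_qf[OF z, of n "colk k X" v] z by (simp add: gk_def wk_def qf_def)

lemma Ward_R: "(\<Sum>i<n. \<Sum>j<n. (cmod (res n z (colk k X) i j))\<^sup>2) = n * Im (sk k X) / Im z"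
  unfolding sk_def by (rule frobenius_res[OF z])

section \<open>Measurability and integrability on the product of the columns\<close>

lemma coord_Om: "k < m \<Longrightarrow> (\<lambda>X. X k) \<in> Om \<rightarrow>\<^sub>M C n"
  by (rule measurable_component_singleton) simp

lemma distr_Om: "k < m \<Longrightarrow> distr Om (C n) (\<lambda>X. X k) = C n"
  using distr_PiM_component[of "{..<m}" "\<lambda>_. C n" k] prob_C by simp

lemma allmom_entry: "k < m \<Longrightarrow> i < n \<Longrightarrow> allmom Om (\<lambda>X. X k i)"
proof -
  assume k: "k < m" and i: "i < n"
  have a: "allmom (C n) (\<lambda>x. x i)" by (rule allmom_coord[OF i])
  have m: "(\<lambda>x. x i) \<in> borel_measurable (C n)" using a by (simp add: allmom_def)
  show ?thesis unfolding allmom_def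
  proof (intro conjI allI)
    show "(\<lambda>X. X k i) \<in> borel_measurable Om" by (rule measurable_compose[OF coord_Om[OF k] m])
    fix p :: nat
    have "integrable (distr Om (C n) (\<lambda>X. X k)) (\<lambda>x. \<bar>x i\<bar> ^ p)"
      using allmom_abs_power[OF a] by (simp only: distr_Om[OF k])
    thus "integrable Om (\<lambda>X. \<bar>X k i\<bar> ^ p)"
      by (rule integrable_distr[OF coord_Om[OF k]])
  qed
qed

lemma allmom_Y: "k < m \<Longrightarrow> i < n \<Longrightarrow> allmom Om (\<lambda>X. Y X k i)"
proof -
  assume k: "k < m" and i: "i < n"
  have "allmom Om (\<lambda>X. (1 / sqrt n) * (X k i + (\<tau> * (\<Sum>j<n. X k j * v j)) * v i))"
    using k i by (intro PS.Om.allmom_cmult allmom_add allmom_mult PS.Om.allmom_sum PS.Om.allmom_const allmom_entry) auto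
  thus ?thesis by (simp add: Y_def ycol_def)
qed

lemma Y_measurable [measurable]: "k < m \<Longrightarrow> i < n \<Longrightarrow> (\<lambda>X. Y X k i) \<in> borel_measurable Om"
  by (rule allmom_measurable[OF allmom_Y])

lemma res_meas:
  assumes "set ks \<subseteq> {..<m}" "i < n" "j < n"
  shows "(\<lambda>X. res n z (map (Y X) ks) i j) \<in> borel_measurable Om"
proof -
  have "(\<lambda>X. res n z (map (\<lambda>a. a X) (map (\<lambda>k X. Y X k) ks)) i j) \<in> borel_measurable Om"
    using assms by (intro res_measurable) auto
  thus ?thesis by (simp add: o_def)
qed

lemma set_remove1_upt: "set (remove1 k [0..<m]) \<subseteq> {..<m}"
  using set_remove1_subset[of k "[0..<m]"] by auto

lemma measurables [measurable]:
  shows s_meas: "s \<in> borel_measurable Om" and sk_meas: "sk k \<in> borel_measurable Om"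
    and g_meas: "g \<in> borel_measurable Om" and gk_meas: "gk k \<in> borel_measurable Om"
proof -
  have [measurable]: "(\<lambda>X. res n z (cols X) i j) \<in> borel_measurable Om" "(\<lambda>X. res n z (colk k X) i j) \<in> borel_measurable Om"
    if "i < n" "j < n" for i j
    unfolding cols_def colk_def using that set_remove1_upt by (auto intro!: res_meas)
  show "s \<in> borel_measurable Om" "sk k \<in> borel_measurable Om"
    unfolding s_def[abs_def] sk_def[abs_def] trn_def by measurable
  show "g \<in> borel_measurable Om" "gk k \<in> borel_measurable Om"
    unfolding g_def[abs_def] gk_def[abs_def] wk_def mv_def cdot_def cx_def by measurable
qed

lemma measurables_k [measurable]:
  assumes k: "k < m"
  shows q_meas: "q k \<in> borel_measurable Om" and vy_meas: "vy k \<in> borel_measurable Om" and wy_meas: "wy k \<in> borel_measurable Om"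
    and be_meas: "be k \<in> borel_measurable Om"
proof -
  have [measurable]: "(\<lambda>X. res n z (colk k X) i j) \<in> borel_measurable Om" if "i < n" "j < n" for i j
    unfolding colk_def using that set_remove1_upt by (auto intro!: res_meas)
  show m: "q k \<in> borel_measurable Om" "vy k \<in> borel_measurable Om" "wy k \<in> borel_measurable Om"
    unfolding q_def[abs_def] vy_def[abs_def] wy_def[abs_def] wk_def qf_def mv_def cdot_def cx_def using k by measurable
  show "be k \<in> borel_measurable Om" unfolding be_def[abs_def] using m(1) by measurable
qed

lemma qh_meas [measurable]: "qh k \<in> borel_measurable Om"
  unfolding qh_def[abs_def] by measurable

lemma allmom_bdd:
  assumes "f \<in> borel_measurable Om" "\<And>X. cmod (f X) \<le> B"
  shows "allmom Om (\<lambda>X. cmod (f X))"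
  using assms by (intro PS.Om.allmom_bounded[where B = B]) auto

lemma allmom_sg: "allmom Om (\<lambda>X. cmod (s X))" "allmom Om (\<lambda>X. cmod (sk k X))" "allmom Om (\<lambda>X. cmod (g X))" "allmom Om (\<lambda>X. cmod (gk k X))"
  by (rule allmom_bdd, measurable, rule bounds)+

lemma allmom_cmod_add:
  assumes "allmom Om (\<lambda>X. cmod (f X))" "allmom Om (\<lambda>X. cmod (h X))" "f \<in> borel_measurable Om" "h \<in> borel_measurable Om"
  shows "allmom Om (\<lambda>X. cmod (f X + h X))" "allmom Om (\<lambda>X. cmod (f X - h X))"
  using assms(3,4)
  by (auto intro!: allmom_mono[OF allmom_add[OF assms(1,2)]] norm_triangle_ineq norm_triangle_ineq4)

lemma allmom_cmod_mult:
  assumes "allmom Om (\<lambda>X. cmod (f X))" "allmom Om (\<lambda>X. cmod (h X))"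
  shows "allmom Om (\<lambda>X. cmod (f X * h X))"
  using allmom_mult[OF assms] by (simp add: norm_mult)

lemma allmom_nrm2_Y: "k < m \<Longrightarrow> allmom Om (\<lambda>X. nrm2 n (cx (Y X k)))"
  unfolding nrm2_cx by (intro PS.Om.allmom_sum PS.Om.allmom_power allmom_Y) auto

lemma le_one_plus_sq:
  assumes "a\<^sup>2 \<le> b" "0 \<le> (a::real)"
  shows "a \<le> 1 + b"
proof -
  have "0 \<le> (a - 1)\<^sup>2" by simp
  thus ?thesis using assms by (simp add: power2_diff)
qed

lemma allmom_k:
  assumes k: "k < m"
  shows "allmom Om (\<lambda>X. cmod (q k X))" "allmom Om (\<lambda>X. cmod (vy k X))" "allmom Om (\<lambda>X. cmod (wy k X))"
    "allmom Om (\<lambda>X. cmod (be k X))"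
proof -
  have a: "allmom Om (\<lambda>X. (1 / Im z) * nrm2 n (cx (Y X k)))" "allmom Om (\<lambda>X. 1 + nrm2 n (cx (Y X k)))"
     "allmom Om (\<lambda>X. 1 + (1 / (Im z)\<^sup>2) * nrm2 n (cx (Y X k)))"
    using allmom_nrm2_Y[OF k] by (intro allmom_add PS.Om.allmom_cmult PS.Om.allmom_const; simp)+
  show "allmom Om (\<lambda>X. cmod (q k X))"
  proof (rule allmom_mono[OF a(1)])
    fix X show "\<bar>cmod (q k X)\<bar> \<le> \<bar>(1 / Im z) * nrm2 n (cx (Y X k))\<bar>"
      using z cmod_qf_le[OF z, of n "colk k X" "Y X k"] by (simp add: q_def)
  qed (use k in measurable)
  show "allmom Om (\<lambda>X. cmod (vy k X))"
  proof (rule allmom_mono[OF a(2)])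
    fix X
    have "(cmod (vy k X))\<^sup>2 \<le> nrm2 n (cx (Y X k))"
      using cmod_cdot_le[of n "cx v" "cx (Y X k)"] by (simp add: vy_def nrm2_v)
    from le_one_plus_sq[OF this] show "\<bar>cmod (vy k X)\<bar> \<le> \<bar>1 + nrm2 n (cx (Y X k))\<bar>" by simp
  qed (use k in measurable)
  show "allmom Om (\<lambda>X. cmod (wy k X))"
  proof (rule allmom_mono[OF a(3)])
    fix X
    have "(cmod (wy k X))\<^sup>2 \<le> nrm2 n (wk k X) * nrm2 n (cx (Y X k))"
      using cmod_cdot_le[of n "wk k X" "cx (Y X k)"] by (simp add: wy_def)
    also have "\<dots> \<le> (1 / (Im z)\<^sup>2) * nrm2 n (cx (Y X k))"
      using nrm2_mv_res_le[OF z, of n "colk k X" "cx v"] by (intro mult_right_mono) (auto simp: wk_def nrm2_v)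
    finally show "\<bar>cmod (wy k X)\<bar> \<le> \<bar>1 + (1 / (Im z)\<^sup>2) * nrm2 n (cx (Y X k))\<bar>"
      using le_one_plus_sq by fastforce
  qed (use k in measurable)
  show "allmom Om (\<lambda>X. cmod (be k X))"
    by (rule allmom_bdd[OF be_meas[OF k] one_plus_q(2)])
qed

lemma allmom_qh: "allmom Om (\<lambda>X. cmod (qh k X))"
  unfolding qh_def
proof (rule allmom_cmod_add(1))
  have "allmom Om (\<lambda>X. (\<bar>(1+\<tau>)\<^sup>2 - 1\<bar> / n) * cmod (gk k X))" using allmom_sg by (intro PS.Om.allmom_cmult)
  thus "allmom Om (\<lambda>X. cmod (of_real ((1 + \<tau>)\<^sup>2 - 1) * gk k X / of_nat n))"
    by (simp add: norm_mult norm_divide del: of_real_diff)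
qed (use allmom_sg in \<open>auto\<close>)

lemma resample_le:
  fixes F G :: "_ \<Rightarrow> real"
  assumes k: "k < m" and F: "integrable Om F" and G: "integrable Om G"
    and le: "\<And>X. X \<in> space Om \<Longrightarrow> (\<integral>x. F (X(k := x)) \<partial>C n) \<le> G X"
  shows "(\<integral>X. F X \<partial>Om) \<le> (\<integral>X. G X \<partial>Om)"
proof -
  have kI: "k \<in> {..<m}" using k by simp
  have "(\<integral>X. F X \<partial>Om) = (\<integral>X. PS.avg k F X \<partial>Om)" by (rule PS.integral_resample(1)[OF kI F])
  also have "\<dots> \<le> (\<integral>X. G X \<partial>Om)"
    using le by (intro integral_mono PS.integral_resample(2)[OF kI F] G) (simp add: PS.avg_def)
  finally show ?thesis .
qed

abbreviation EE :: "((nat \<Rightarrow> nat \<Rightarrow> real) \<Rightarrow> real) \<Rightarrow> real" where "EE f \<equiv> (\<integral>X. f X \<partial>Om)"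

lemma integrable_pow: "allmom Om (\<lambda>X. cmod (f X)) \<Longrightarrow> integrable Om (\<lambda>X. cmod (f X) ^ p)"
  using allmom_abs_power[of Om "\<lambda>X. cmod (f X)" p] by simp

abbreviation t4 :: real where "t4 \<equiv> (1 + \<bar>\<tau>\<bar>) ^ 4"

lemma allmom_Im: "allmom Om (\<lambda>X. Im (sk k X))" "allmom Om (\<lambda>X. Im (gk k X))"
proof -
  show "allmom Om (\<lambda>X. Im (sk k X))" by (rule allmom_mono[OF allmom_sg(2)[of k]]) (auto intro: abs_Im_le_cmod)
  show "allmom Om (\<lambda>X. Im (gk k X))" by (rule allmom_mono[OF allmom_sg(4)[of k]]) (auto intro: abs_Im_le_cmod)
qed

lemma integrable_Im_pow: "integrable Om (\<lambda>X. c * (d * Im (sk k X) / e) ^ p)" "integrable Om (\<lambda>X. c * (d * Im (gk k X) / e) ^ p)"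
proof -
  have "integrable Om (\<lambda>X. (c * d^p / e^p) * Im (sk k X) ^ p)" "integrable Om (\<lambda>X. (c * d^p / e^p) * Im (gk k X) ^ p)"
    by (intro integrable_mult_right allmom_integrable PS.Om.allmom_power allmom_Im)+
  thus "integrable Om (\<lambda>X. c * (d * Im (sk k X) / e) ^ p)" "integrable Om (\<lambda>X. c * (d * Im (gk k X) / e) ^ p)"
    by (simp_all add: power_divide power_mult_distrib mult_ac)
qed

text \<open>The quadratic form concentrates at its conditional mean on the scale of the Frobenius
  norm, which \<open>Ward_R\<close> expresses by the trace: the squared deviation is of order Im sk
  / (n Im z).\<close>

lemma inner_q:
  assumes p: "1 \<le> p"
  shows "(\<integral>x. cmod (q k (X(k := x)) - qh k (X(k := x))) ^ (2*p) \<partial>C n) \<le> QCc p * (t4 * Im (sk k X) / (n * Im z)) ^ p"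
proof -
  let ?R = "res n z (colk k X)"
  have "(\<integral>x. cmod (q k (X(k := x)) - qh k (X(k := x))) ^ (2*p) \<partial>C n)
     = (\<integral>x. cmod (cdot n (cx (ycol n \<tau> v x)) (mv n ?R (cx (ycol n \<tau> v x)))
        - ((\<Sum>i<n. ?R i i) + of_real ((1 + \<tau>)\<^sup>2 - 1) * cdot n (cx v) (mv n ?R (cx v))) / of_nat n) ^ (2*p) \<partial>C n)"
    by (simp add: q_def qf_def qh_def sk_def gk_def wk_def colk_upd Y_upd trn_def add_divide_distrib)
  also have "\<dots> \<le> QCc p * (t4 * (\<Sum>i<n. \<Sum>j<n. (cmod (?R i j))\<^sup>2) / (real n)\<^sup>2) ^ p"
    by (rule quadratic_ycol_moment[OF p n1 v_unit])
  also have "\<dots> = QCc p * (t4 * (n * Im (sk k X) / Im z) / (real n)\<^sup>2) ^ p"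
    by (simp only: Ward_R)
  also have "\<dots> = QCc p * (t4 * Im (sk k X) / (n * Im z)) ^ p"
    using n1 by (simp add: power2_eq_square mult.commute[of "Im z"])
  finally show ?thesis .
qed

text \<open>The squared norm of \<open>wk\<close> is Im gk / Im z by Ward's identity, so the moments
  of \<open>wy\<close> are bounded by g itself. This self-bounding shape lets the variance of g be
  absorbed later.\<close>

lemma inner_wy:
  assumes p: "1 \<le> p"
  shows "(\<integral>x. cmod (wy k (X(k := x))) ^ (2*p) \<partial>C n) \<le> LCc p * ((1 + \<bar>\<tau>\<bar>)\<^sup>2 * Im (gk k X) / (n * Im z)) ^ p"
  using linear_ycol_moment[OF p n1 v_unit, of "wk k X" \<tau>]
  by (simp add: wy_def wk_def colk_upd Y_upd Ward_w[unfolded wk_def] mult_ac)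

lemma inner_vy:
  assumes p: "1 \<le> p"
  shows "(\<integral>x. cmod (vy k (X(k := x))) ^ (2*p) \<partial>C n) \<le> LCc p * ((1 + \<bar>\<tau>\<bar>)\<^sup>2 / n) ^ p"
  using linear_ycol_moment[OF p n1 v_unit, of "cx v" \<tau>]
  by (simp add: vy_def Y_upd nrm2_v)

lemma moment_q:
  assumes k: "k < m" and p: "1 \<le> p"
  shows "EE (\<lambda>X. cmod (q k X - qh k X) ^ (2*p)) \<le> EE (\<lambda>X. QCc p * (t4 * Im (sk k X) / (n * Im z)) ^ p)"
  using k p by (intro resample_le[OF k] inner_q integrable_Im_pow integrable_pow allmom_cmod_add allmom_k allmom_qh) auto

lemma moment_wy:
  assumes k: "k < m" and p: "1 \<le> p"
  shows "EE (\<lambda>X. cmod (wy k X) ^ (2*p)) \<le> EE (\<lambda>X. LCc p * ((1 + \<bar>\<tau>\<bar>)\<^sup>2 * Im (gk k X) / (n * Im z)) ^ p)"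
  using k p by (intro resample_le[OF k] inner_wy integrable_Im_pow integrable_pow allmom_k)

lemma moment_vy:
  assumes k: "k < m" and p: "1 \<le> p"
  shows "EE (\<lambda>X. cmod (vy k X) ^ (2*p)) \<le> LCc p * ((1 + \<bar>\<tau>\<bar>)\<^sup>2 / n) ^ p"
proof -
  have "EE (\<lambda>X. cmod (vy k X) ^ (2*p)) \<le> EE (\<lambda>X. LCc p * ((1 + \<bar>\<tau>\<bar>)\<^sup>2 / n) ^ p)"
    using k p by (intro resample_le[OF k] inner_vy integrable_pow allmom_k) auto
  thus ?thesis by (simp add: PS.Om.prob_space)
qed

text \<open>A factor h that does not see column k leaves the average over that column, and the
  remaining pair averages to (1 + \<tau>)^2 / n times \<open>gk\<close> exactly. This produces the
  main term of the equation for g.\<close>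

lemma cross_moment_k:
  fixes h :: "_ \<Rightarrow> complex"
  assumes k: "k < m" and h: "allmom Om (\<lambda>X. cmod (h X))" "h \<in> borel_measurable Om" "PS.free_of k h"
  shows "(\<integral>X. vy k X * wy k X * h X \<partial>Om) = of_real ((1 + \<tau>)\<^sup>2 / n) * (\<integral>X. gk k X * h X \<partial>Om)"
proof -
  have kI: "k \<in> {..<m}" using k by simp
  have i: "integrable Om (\<lambda>X. vy k X * wy k X * h X)"
    using k h by (intro integrable_of_allmom_cmod allmom_cmod_mult allmom_k) measurable
  have "(\<integral>X. vy k X * wy k X * h X \<partial>Om) = (\<integral>X. PS.avg k (\<lambda>X. vy k X * wy k X * h X) X \<partial>Om)"
    by (rule PS.integral_resample(1)[OF kI i])
  also have "\<dots> = (\<integral>X. of_real ((1 + \<tau>)\<^sup>2 / n) * (gk k X * h X) \<partial>Om)"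
  proof (intro Bochner_Integration.integral_cong refl)
    fix X assume X: "X \<in> space Om"
    have "PS.avg k (\<lambda>X. vy k X * wy k X * h X) X
        = (\<integral>x. (cdot n (cx v) (cx (ycol n \<tau> v x)) * cdot n (wk k X) (cx (ycol n \<tau> v x))) * h X \<partial>C n)"
      unfolding PS.avg_def using X h(3)
      by (intro Bochner_Integration.integral_cong refl) (simp add: PS.free_of_def vy_def wy_def wk_def colk_upd Y_upd)
    also have "\<dots> = of_real ((1 + \<tau>)\<^sup>2 / n) * cdot n (cx v) (wk k X) * h X"
      by (simp only: integral_mult_left_zero cross_ycol[OF n1 v_unit])
    finally show "PS.avg k (\<lambda>X. vy k X * wy k X * h X) X = of_real ((1 + \<tau>)\<^sup>2 / n) * (gk k X * h X)"
      by (simp add: gk_def)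
  qed
  also have "\<dots> = of_real ((1 + \<tau>)\<^sup>2 / n) * (\<integral>X. gk k X * h X \<partial>Om)"
    by (rule integral_mult_right_zero)
  finally show ?thesis .
qed

section \<open>Fluctuations of the trace and of the isotropic form\<close>

definition sb :: complex where "sb = (\<integral>X. s X \<partial>Om)"
definition gb :: complex where "gb = (\<integral>X. g X \<partial>Om)"

lemma integrable_sg: "integrable Om s" "integrable Om g" "integrable Om (sk k)" "integrable Om (gk k)"
  using allmom_sg by (auto intro!: integrable_of_allmom_cmod)

text \<open>Leaving out a column moves s by at most 1 / (n Im z), deterministically; the m squared
  increments add up to the order 1 / (n (Im z)^2).\<close>

lemma concentration_s:
  assumes p: "1 \<le> p"
  shows "EE (\<lambda>X. cmod (s X - sb) ^ (2*p)) \<le> ES2 p * (m / (n * Im z)\<^sup>2) ^ p"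
proof -
  have "EE (\<lambda>X. cmod (s X - sb) ^ (2*p)) \<le> ES2 p * (\<Sum>k<m. (1 / (n * Im z))\<^sup>2) ^ p"
    unfolding sb_def
  proof (rule PS.moment_Efron_Stein_complex[where fk = sk])
    fix k assume "k \<in> {..<m}" hence k: "k < m" by simp
    have "EE (\<lambda>X. cmod (s X - sk k X) ^ (2*p)) \<le> EE (\<lambda>X. (1 / (n * Im z)) ^ (2*p))"
      using s_diff[OF k] by (intro integral_mono integrable_pow allmom_cmod_add allmom_sg power_mono) auto
    thus "EE (\<lambda>X. cmod (s X - sk k X) ^ (2*p)) \<le> ((1 / (n * Im z))\<^sup>2) ^ p"
      by (simp add: PS.Om.prob_space power_mult)
  qed (use allmom_sg p free_sk in auto)
  thus ?thesis by (simp add: power_divide)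
qed

text \<open>The increments of g have no small deterministic bound as those of s do, so they stay as
  second moments here. The case p = 1 is enough for the L^1 control of g.\<close>

lemma variance_g:
  shows "EE (\<lambda>X. (cmod (g X - gb))\<^sup>2) \<le> ES2 1 * (\<Sum>k<m. EE (\<lambda>X. (cmod (g X - gk k X))\<^sup>2))"
proof -
  have "EE (\<lambda>X. cmod (g X - gb) ^ (2*1)) \<le> ES2 1 * (\<Sum>k<m. EE (\<lambda>X. (cmod (g X - gk k X))\<^sup>2)) ^ 1"
    unfolding gb_def
    by (rule PS.moment_Efron_Stein_complex[where fk = gk])
       (use allmom_sg free_gk in auto)
  thus ?thesis by simp
qed

end

section \<open>The self-consistent equations\<close>

text \<open>Here \<open>1 / u\<^sup>2 = n (Im z)\<^sup>2\<close>; the hypothesis \<open>nN\<close> says that this is at least a small power of \<open>n\<close>,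
  so that high powers of \<open>u\<close> beat every power of \<open>n\<close>.\<close>

locale bulk = model +
  fixes C0 Z c1 S0 :: real and r :: nat
  assumes C0: "1 \<le> C0" "real m \<le> C0 * n" and Z: "1 \<le> Z" "cmod z \<le> Z" and zi: "Im z \<le> 2"
    and c1: "0 < c1" "c1 \<le> cmod (1 + sb)" and r1: "1 \<le> r" and S0: "cmod sb \<le> S0"
    and nN: "real n ^ 4 \<le> (n * (Im z)\<^sup>2) ^ r"
begin

definition NN :: real where "NN = n * (Im z)\<^sup>2"
definition u :: real where "u = 1 / sqrt NN"

lemma NN1: "1 \<le> NN"
proof (rule ccontr)
  assume "\<not> 1 \<le> NN"
  moreover have "0 < NN" using n1 z by (simp add: NN_def)
  ultimately have "NN ^ r < 1" using r1 by (simp add: power_Suc_less_one power_less_one_iff)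
  moreover have "1 \<le> real n ^ 4" using n1 by simp
  ultimately show False using nN by (simp add: NN_def)
qed

lemma u: "0 < u" "u \<le> 1" "u\<^sup>2 = 1 / NN"
  using NN1 by (auto simp: u_def power_divide real_le_rsqrt)

lemma ur: "u ^ (2 * r) \<le> 1 / real n ^ 4"
proof -
  have "u ^ (2*r) = 1 / NN ^ r" by (simp add: power_mult u power_divide)
  also have "\<dots> \<le> 1 / real n ^ 4" using nN n1 by (intro divide_left_mono) (auto simp: NN_def z less_imp_neq[OF z, symmetric])
  finally show ?thesis .
qed

lemma inv_Im_z: "1 / Im z = sqrt n * u" "1 / Im z \<le> n" "(1 / Im z)\<^sup>2 \<le> n"
proof -
  have "sqrt NN = sqrt n * Im z" using z by (simp add: NN_def real_sqrt_mult)
  thus 1: "1 / Im z = sqrt n * u" using n1 by (simp add: u_def)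
  have "(1 / Im z)\<^sup>2 = n * u\<^sup>2" unfolding 1 by (simp add: power_mult_distrib)
  also have "\<dots> \<le> real n * 1" using u by (intro mult_left_mono power_le_one) auto
  finally show 2: "(1 / Im z)\<^sup>2 \<le> n" by simp
  also have "\<dots> \<le> (real n)\<^sup>2" using n1 by (simp add: power2_eq_square)
  finally show "1 / Im z \<le> n" by (rule power2_le_imp_le) simp
qed

text \<open>A bound from below: it lets error terms that come as inverse powers of n be charged to
  u.\<close>

lemma u_lower: "1 / (2 * real n) \<le> u"
proof -
  have "sqrt NN \<le> 2 * real n"
  proof (rule real_le_lsqrt)
    have "NN \<le> real n * 2\<^sup>2" unfolding NN_def using z zi by (intro mult_left_mono power_mono) auto
    also have "\<dots> \<le> (2 * real n)\<^sup>2" using n1 by (simp add: power2_eq_square)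
    finally show "NN \<le> (2 * real n)\<^sup>2" .
  qed (use NN1 in auto)
  thus ?thesis unfolding u_def using NN1 n1 by (intro divide_left_mono mult_pos_pos) auto
qed

lemma inv_nz: "(1 / (n * Im z))\<^sup>2 = u\<^sup>2 / n" "1 / (n * Im z) \<le> u"
proof -
  have "(1 / (n * Im z))\<^sup>2 = (1 / Im z)\<^sup>2 / (real n)\<^sup>2" by (simp add: power_divide power_mult_distrib)
  also have "(1 / Im z)\<^sup>2 = n * u\<^sup>2" unfolding inv_Im_z(1) by (simp add: power_mult_distrib)
  also have "n * u\<^sup>2 / (real n)\<^sup>2 = u\<^sup>2 / n" using n1 by (simp add: power2_eq_square)
  finally show 1: "(1 / (n * Im z))\<^sup>2 = u\<^sup>2 / n" .
  have "u\<^sup>2 / n \<le> u\<^sup>2 / 1" using n1 by (intro divide_left_mono) auto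
  hence "(1 / (n * Im z))\<^sup>2 \<le> u\<^sup>2" unfolding 1 by simp
  thus "1 / (n * Im z) \<le> u" by (rule power2_le_imp_le) (use u in auto)
qed

lemma sqrt_sq: "0 \<le> a \<Longrightarrow> sqrt (c * a\<^sup>2) = sqrt c * a"
  by (simp add: real_sqrt_mult)

lemma CS:
  assumes "allmom Om f" "allmom Om h" "EE (\<lambda>X. (f X)\<^sup>2) \<le> a" "EE (\<lambda>X. (h X)\<^sup>2) \<le> b"
  shows "EE (\<lambda>X. \<bar>f X * h X\<bar>) \<le> sqrt a * sqrt b"
proof -
  have "EE (\<lambda>X. \<bar>f X * h X\<bar>) \<le> sqrt (EE (\<lambda>X. (f X)\<^sup>2)) * sqrt (EE (\<lambda>X. (h X)\<^sup>2))"
    by (rule Cauchy_Schwarz_allmom[OF assms(1,2)])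
  also have "\<dots> \<le> sqrt a * sqrt b"
    using assms(3,4) order_trans[OF _ assms(3), of 0] by (intro mult_mono) auto
  finally show ?thesis .
qed

lemma CS1:
  assumes "allmom Om f" "EE (\<lambda>X. (f X)\<^sup>2) \<le> a"
  shows "EE (\<lambda>X. \<bar>f X\<bar>) \<le> sqrt a"
  using CS[OF assms(1) PS.Om.allmom_const[of 1] assms(2), of 1] by (simp add: PS.Om.prob_space)

text \<open>The constants \<open>Th\<close>, \<open>Kh\<close>, \<open>Kd\<close>,
  \<open>Kq\<close>, \<open>Kw\<close> and those built from them later depend on the law P, on
  \<tau> and on the parameters C0, Z, c1, S0 and r, but not on n, m, v or z. Uniformity of the
  estimates rests on this.\<close>

definition Th :: real where "Th = \<bar>(1+\<tau>)\<^sup>2 - 1\<bar>"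
definition Kh :: "nat \<Rightarrow> real" where "Kh p = 2^(2*p) * ((1 + Th)^(2*p) + ES2 p * C0 ^ p)"
definition Kd :: "nat \<Rightarrow> real" where "Kd p = QCc p * t4 ^ p"
definition Kq :: "nat \<Rightarrow> real" where "Kq p = 2^(2*p) * (Kd p + Kh p)"
definition Kw :: "nat \<Rightarrow> real" where "Kw p = LCc p * ((1 + \<bar>\<tau>\<bar>)\<^sup>2) ^ p"

lemma K_nonneg [simp]: "Kh p \<ge> 0" "Kd p \<ge> 0" "Kq p \<ge> 0" "Kw p \<ge> 0" "Th \<ge> 0"
  using C0 by (auto simp: Kh_def Kd_def Kq_def Kw_def Th_def)

lemma conc_s: "1 \<le> p \<Longrightarrow> EE (\<lambda>X. cmod (s X - sb) ^ (2*p)) \<le> ES2 p * C0 ^ p * u ^ (2*p)"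
proof -
  assume p: "1 \<le> p"
  have "real m / (n * Im z)\<^sup>2 = m * (1 / (n * Im z))\<^sup>2" by (simp add: power_divide)
  also have "\<dots> = m * (u\<^sup>2 / n)" by (simp only: inv_nz(1))
  also have "\<dots> \<le> (C0 * n) * (u\<^sup>2 / n)" using C0 by (intro mult_right_mono) auto
  also have "\<dots> = C0 * u\<^sup>2" using n1 by simp
  finally have 1: "real m / (n * Im z)\<^sup>2 \<le> C0 * u\<^sup>2" .
  have "EE (\<lambda>X. cmod (s X - sb) ^ (2*p)) \<le> ES2 p * (m / (n * Im z)\<^sup>2) ^ p" by (rule concentration_s[OF p])
  also have "\<dots> \<le> ES2 p * (C0 * u\<^sup>2) ^ p" using 1 by (intro mult_left_mono power_mono) auto
  finally show ?thesis by (simp only: power_mult_distrib power_mult mult.assoc)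
qed

lemma am [simp]:
  shows am_s: "allmom Om (\<lambda>X. cmod (s X - sb))" and am_qh: "allmom Om (\<lambda>X. cmod (qh k X - sb))"
    and am_g: "allmom Om (\<lambda>X. cmod (g X - gb))" and am_gk: "allmom Om (\<lambda>X. cmod (g X - gk k X))" "allmom Om (\<lambda>X. cmod (gk k X - g X))"
    and am_g0: "allmom Om (\<lambda>X. cmod (g X))" and am_gk0: "allmom Om (\<lambda>X. cmod (gk k X))"
  by (auto intro!: allmom_cmod_add allmom_sg allmom_qh)

lemma am_k [simp]:
  assumes k: "k < m"
  shows "allmom Om (\<lambda>X. cmod (q k X - sb))" "allmom Om (\<lambda>X. cmod (q k X - qh k X))"
    "allmom Om (\<lambda>X. cmod (wy k X))" "allmom Om (\<lambda>X. cmod (vy k X))" "allmom Om (\<lambda>X. cmod (be k X))"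
  using k by (auto intro!: allmom_cmod_add allmom_k allmom_qh)

lemma abs_cmod_add_le: "cmod (a + b) ^ p \<le> 2 ^ p * (cmod a ^ p + cmod b ^ p)"
  using power_mono[OF norm_triangle_ineq[of a b], of p] abs_add_power_le[of "cmod a" "cmod b" p] by simp

lemma mom_qh:
  assumes k: "k < m" and p: "1 \<le> p"
  shows "EE (\<lambda>X. cmod (qh k X - sb) ^ (2*p)) \<le> Kh p * u ^ (2*p)"
proof -
  have d: "cmod (qh k X - s X) \<le> (1 + Th) * u" for X
  proof -
    have "cmod (of_real ((1 + \<tau>)\<^sup>2 - 1) * gk k X / of_nat n) \<le> Th * (1 / Im z) / n"
    proof -
      have "cmod (of_real ((1 + \<tau>)\<^sup>2 - 1) * gk k X / of_nat n) = Th * cmod (gk k X) / n"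
        by (simp add: norm_mult norm_divide Th_def del: of_real_diff)
      also have "\<dots> \<le> Th * (1 / Im z) / n"
        by (intro divide_right_mono mult_left_mono bounds) auto
      finally show ?thesis .
    qed
    moreover have "cmod (qh k X - s X) \<le> cmod (s X - sk k X) + cmod (of_real ((1 + \<tau>)\<^sup>2 - 1) * gk k X / of_nat n)"
      unfolding qh_def using norm_triangle_ineq4[of "of_real ((1 + \<tau>)\<^sup>2 - 1) * gk k X / of_nat n" "s X - sk k X"]
      by (simp add: algebra_simps)
    ultimately have "cmod (qh k X - s X) \<le> 1 / (n * Im z) + Th * (1 / Im z) / n"
      using s_diff[OF k, of X] by linarith
    also have "\<dots> = (1 + Th) * (1 / (n * Im z))" by (simp add: add_divide_distrib mult.commute)
    also have "\<dots> \<le> (1 + Th) * u" by (intro mult_left_mono inv_nz) simp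
    finally show ?thesis .
  qed
  have "EE (\<lambda>X. cmod (qh k X - sb) ^ (2*p)) \<le> EE (\<lambda>X. 2^(2*p) * (((1 + Th) * u)^(2*p) + cmod (s X - sb) ^ (2*p)))"
  proof (rule integral_mono)
    fix X
    have "cmod (qh k X - sb) ^ (2*p) \<le> 2^(2*p) * (cmod (qh k X - s X) ^ (2*p) + cmod (s X - sb) ^ (2*p))"
      using abs_cmod_add_le[of "qh k X - s X" "s X - sb" "2*p"] by simp
    also have "\<dots> \<le> 2^(2*p) * (((1 + Th) * u)^(2*p) + cmod (s X - sb) ^ (2*p))"
      using d[of X] by (intro mult_left_mono add_right_mono power_mono) auto
    finally show "cmod (qh k X - sb) ^ (2*p) \<le> 2^(2*p) * (((1 + Th) * u)^(2*p) + cmod (s X - sb) ^ (2*p))" .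
  qed (intro integrable_pow integrable_mult_right Bochner_Integration.integrable_add PS.Om.integrable_const am_s am_qh)+
  also have "\<dots> = 2^(2*p) * (((1 + Th) * u)^(2*p) + EE (\<lambda>X. cmod (s X - sb) ^ (2*p)))"
    using integrable_pow[OF am_s] by (simp add: PS.Om.prob_space)
  also have "\<dots> \<le> 2^(2*p) * (((1 + Th) * u)^(2*p) + ES2 p * C0 ^ p * u ^ (2*p))"
    by (intro mult_left_mono add_left_mono conc_s p) auto
  also have "\<dots> = Kh p * u ^ (2*p)" by (simp only: Kh_def power_mult_distrib) (simp add: algebra_simps)
  finally show ?thesis .
qed

lemma mom_d:
  assumes k: "k < m" and p: "1 \<le> p"
  shows "EE (\<lambda>X. cmod (q k X - qh k X) ^ (2*p)) \<le> Kd p * u ^ (2*p)"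
proof -
  have b: "t4 * Im (sk k X) / (n * Im z) \<le> t4 * u\<^sup>2" for X
  proof -
    have "Im (sk k X) \<le> 1 / Im z" using abs_Im_le_cmod[of "sk k X"] bounds(2)[of k X] by linarith
    hence "Im (sk k X) / (n * Im z) \<le> (1 / Im z) / (n * Im z)" using z by (intro divide_right_mono) auto
    also have "\<dots> = u\<^sup>2" unfolding u(3) NN_def by (simp add: power2_eq_square mult_ac)
    finally have "t4 * (Im (sk k X) / (n * Im z)) \<le> t4 * u\<^sup>2" by (intro mult_left_mono) auto
    thus ?thesis by simp
  qed
  have "EE (\<lambda>X. cmod (q k X - qh k X) ^ (2*p)) \<le> EE (\<lambda>X. QCc p * (t4 * Im (sk k X) / (n * Im z)) ^ p)"
    by (rule moment_q[OF k p])
  also have "\<dots> \<le> EE (\<lambda>X. QCc p * (t4 * u\<^sup>2) ^ p)"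
    using b bounds(6) z by (intro integral_mono integrable_Im_pow mult_left_mono power_mono) auto
  also have "\<dots> = QCc p * (t4 * u\<^sup>2) ^ p" by (simp add: PS.Om.prob_space)
  also have "\<dots> = Kd p * u ^ (2*p)" by (simp only: Kd_def power_mult_distrib power_mult mult.assoc)
  finally show ?thesis .
qed

lemma mom_q:
  assumes k: "k < m" and p: "1 \<le> p"
  shows "EE (\<lambda>X. cmod (q k X - sb) ^ (2*p)) \<le> Kq p * u ^ (2*p)"
proof -
  have "EE (\<lambda>X. cmod (q k X - sb) ^ (2*p)) \<le> EE (\<lambda>X. 2^(2*p) * (cmod (q k X - qh k X) ^ (2*p) + cmod (qh k X - sb) ^ (2*p)))"
  proof (rule integral_mono)
    show "cmod (q k X - sb) ^ (2*p) \<le> 2^(2*p) * (cmod (q k X - qh k X) ^ (2*p) + cmod (qh k X - sb) ^ (2*p))" for X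
      using abs_cmod_add_le[of "q k X - qh k X" "qh k X - sb" "2*p"] by simp
  qed (intro integrable_pow integrable_mult_right Bochner_Integration.integrable_add am_qh am_k k)+
  also have "\<dots> = 2^(2*p) * (EE (\<lambda>X. cmod (q k X - qh k X) ^ (2*p)) + EE (\<lambda>X. cmod (qh k X - sb) ^ (2*p)))"
    using integrable_pow[OF am_qh] integrable_pow[OF am_k(2)[OF k]] by simp
  also have "\<dots> \<le> 2^(2*p) * (Kd p * u ^ (2*p) + Kh p * u ^ (2*p))"
    by (intro mult_left_mono add_mono mom_d mom_qh k p) auto
  finally show ?thesis by (simp add: Kq_def algebra_simps)
qed

text \<open>Only |gk| \<le> 1 / Im z enters. This is good enough wherever \<open>wy\<close> is
  multiplied by a high power of u.\<close>

lemma mom_wy_crude: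
  assumes k: "k < m" and p: "1 \<le> p"
  shows "EE (\<lambda>X. cmod (wy k X) ^ (2*p)) \<le> Kw p"
proof -
  have b: "(1 + \<bar>\<tau>\<bar>)\<^sup>2 * Im (gk k X) / (n * Im z) \<le> (1 + \<bar>\<tau>\<bar>)\<^sup>2" for X
  proof -
    have "Im (gk k X) \<le> 1 / Im z" using abs_Im_le_cmod[of "gk k X"] bounds(4)[of k X] by linarith
    hence "Im (gk k X) / (n * Im z) \<le> (1 / Im z) / (n * Im z)" using z by (intro divide_right_mono) auto
    also have "\<dots> = u\<^sup>2" unfolding u(3) NN_def by (simp add: power2_eq_square mult_ac)
    also have "\<dots> \<le> 1" using u by (intro power_le_one) auto
    finally have "(1 + \<bar>\<tau>\<bar>)\<^sup>2 * (Im (gk k X) / (n * Im z)) \<le> (1 + \<bar>\<tau>\<bar>)\<^sup>2 * 1" by (intro mult_left_mono) auto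
    thus ?thesis by simp
  qed
  have "EE (\<lambda>X. cmod (wy k X) ^ (2*p)) \<le> EE (\<lambda>X. LCc p * ((1 + \<bar>\<tau>\<bar>)\<^sup>2 * Im (gk k X) / (n * Im z)) ^ p)"
    by (rule moment_wy[OF k p])
  also have "\<dots> \<le> EE (\<lambda>X. LCc p * ((1 + \<bar>\<tau>\<bar>)\<^sup>2) ^ p)"
    using b bounds(7) z by (intro integral_mono integrable_Im_pow mult_left_mono power_mono) auto
  finally show ?thesis by (simp add: PS.Om.prob_space Kw_def)
qed

lemma mom_wy2:
  assumes k: "k < m"
  shows "EE (\<lambda>X. cmod (wy k X) ^ 2) \<le> Kw 1 * EE (\<lambda>X. cmod (gk k X)) / (n * Im z)"
proof -
  have i: "integrable Om (\<lambda>X. cmod (gk k X))" using allmom_integrable[OF am_gk0] .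
  have "EE (\<lambda>X. cmod (wy k X) ^ 2) \<le> EE (\<lambda>X. LCc 1 * ((1 + \<bar>\<tau>\<bar>)\<^sup>2 * Im (gk k X) / (n * Im z)) ^ 1)"
    using moment_wy[OF k, of 1] by simp
  also have "\<dots> \<le> EE (\<lambda>X. (Kw 1 / (n * Im z)) * cmod (gk k X))"
  proof (intro integral_mono integrable_Im_pow integrable_mult_right i)
    fix X
    have "LCc 1 * ((1 + \<bar>\<tau>\<bar>)\<^sup>2 * Im (gk k X) / (n * Im z)) ^ 1 = (Kw 1 / (n * Im z)) * Im (gk k X)"
      by (simp add: Kw_def)
    also have "\<dots> \<le> (Kw 1 / (n * Im z)) * cmod (gk k X)"
      using z abs_Im_le_cmod[of "gk k X"] by (intro mult_left_mono) auto
    finally show "LCc 1 * ((1 + \<bar>\<tau>\<bar>)\<^sup>2 * Im (gk k X) / (n * Im z)) ^ 1 \<le> (Kw 1 / (n * Im z)) * cmod (gk k X)" .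
  qed
  finally show ?thesis by simp
qed

text \<open>Keeping \<open>gk\<close> inside the expectation gains the factor u^2 / n: summed over
  the m columns, the variance of g is at most of order u^2 times its second moment.\<close>

lemma mom_wy4:
  assumes k: "k < m"
  shows "EE (\<lambda>X. cmod (wy k X) ^ 4) \<le> Kw 2 * (u\<^sup>2 / n) * EE (\<lambda>X. (cmod (gk k X))\<^sup>2)"
proof -
  have i: "integrable Om (\<lambda>X. (cmod (gk k X))\<^sup>2)" by (rule integrable_pow[OF am_gk0])
  have "EE (\<lambda>X. cmod (wy k X) ^ 4) \<le> EE (\<lambda>X. LCc 2 * ((1 + \<bar>\<tau>\<bar>)\<^sup>2 * Im (gk k X) / (n * Im z)) ^ 2)"
    using moment_wy[OF k, of 2] by simp
  also have "\<dots> \<le> EE (\<lambda>X. (Kw 2 * (u\<^sup>2 / n)) * (cmod (gk k X))\<^sup>2)"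
  proof (intro integral_mono integrable_Im_pow integrable_mult_right i)
    fix X
    have "LCc 2 * ((1 + \<bar>\<tau>\<bar>)\<^sup>2 * Im (gk k X) / (n * Im z)) ^ 2 = (Kw 2 * (1 / (n * Im z))\<^sup>2) * (Im (gk k X))\<^sup>2"
      by (simp add: Kw_def power_mult_distrib power_divide)
    also have "\<dots> \<le> (Kw 2 * (1 / (n * Im z))\<^sup>2) * (cmod (gk k X))\<^sup>2"
      using abs_Im_le_cmod[of "gk k X"] bounds(7)[of k X] by (intro mult_left_mono power_mono) auto
    finally show "LCc 2 * ((1 + \<bar>\<tau>\<bar>)\<^sup>2 * Im (gk k X) / (n * Im z)) ^ 2 \<le> (Kw 2 * (u\<^sup>2 / n)) * (cmod (gk k X))\<^sup>2"
      unfolding inv_nz(1) .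
  qed
  finally show ?thesis by simp
qed

lemma mom_vy: "k < m \<Longrightarrow> 1 \<le> p \<Longrightarrow> EE (\<lambda>X. cmod (vy k X) ^ (2*p)) \<le> Kw p / n ^ p"
  using moment_vy[of k p] by (simp add: Kw_def power_divide)

definition b0 :: real where "b0 = 2 / c1"

lemma b0: "0 < b0" "1 / c1 \<le> b0"
  using c1 by (auto simp: b0_def divide_right_mono)

lemma one_plus_ne: "1 + sb \<noteq> 0"
  using c1 by auto

lemma cmod_inv_le:
  assumes "cmod (x - sb) \<le> c1 / 2"
  shows "cmod (1 / (1 + x)) \<le> b0" "1 + x \<noteq> 0"
proof -
  have "cmod (1 + sb) \<le> cmod (1 + x) + cmod (x - sb)"
    using norm_triangle_ineq4[of "1 + x" "x - sb"] by simp
  hence *: "c1 / 2 \<le> cmod (1 + x)" using assms c1 by linarith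
  thus "1 + x \<noteq> 0" using c1 by auto
  have "1 / cmod (1 + x) \<le> 1 / (c1 / 2)" using * c1 by (intro divide_left_mono mult_pos_pos) auto
  thus "cmod (1 / (1 + x)) \<le> b0" by (simp add: norm_divide b0_def)
qed

text \<open>Off the event |x - sb| \<le> c1 / 2, on which \<open>cmod_inv_le\<close> applies, the
  indicator is dominated by any power of b0 |x - sb|. Rare events thus become moments, without
  separate probability bounds.\<close>

lemma one_le_pow:
  assumes "\<not> cmod (x - sb) \<le> c1 / 2"
  shows "1 \<le> (b0 * cmod (x - sb)) ^ p"
proof (rule one_le_power)
  have "b0 * (c1 / 2) \<le> b0 * cmod (x - sb)" using assms b0 by (intro mult_left_mono) auto
  thus "1 \<le> b0 * cmod (x - sb)" using c1 by (simp add: b0_def)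
qed

text \<open>The deterministic bound |z| / Im z is paid only where q is far from sb, hence with a
  factor whose expectation is of order u^(2 r), and this outweighs 1 / Im z.\<close>

lemma be_le: "cmod (be k X) \<le> b0 + (Z / Im z) * (b0 * cmod (q k X - sb)) ^ (2*r)"
proof (cases "cmod (q k X - sb) \<le> c1 / 2")
  case True
  hence "cmod (be k X) \<le> b0" unfolding be_def by (rule cmod_inv_le)
  moreover have "0 \<le> (Z / Im z) * (b0 * cmod (q k X - sb)) ^ (2*r)" using Z z by simp
  ultimately show ?thesis by linarith
next
  case False
  have "cmod (be k X) \<le> cmod z / Im z" by (rule one_plus_q)
  also have "\<dots> \<le> (Z / Im z) * 1" using Z z by (simp add: divide_right_mono)
  also have "\<dots> \<le> (Z / Im z) * (b0 * cmod (q k X - sb)) ^ (2*r)"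
    using Z z by (intro mult_left_mono one_le_pow False) auto
  finally show ?thesis using b0 by linarith
qed

definition K1 :: real where "K1 = C0 * b0 * (b0 * sqrt (Kq 1) + Z * b0 ^ (2*r) * (sqrt (Kq 1) * sqrt (Kq (2*r))))"

text \<open>In the mean of \<open>one_plus_z_s\<close> only E (1 / (1 + q_k)) has to be replaced by
  1 / (1 + sb). The difference carries a factor q_k - sb, of order u in L^2; the first order
  suffices, so no cancellation of its mean is exploited.\<close>

theorem trace_equation: "cmod (1 + z * sb - of_real (m / n) * (sb / (1 + sb))) \<le> K1 * u"
proof -
  let ?b = "1 / (1 + sb)"
  have ib: "integrable Om (be k)" if "k < m" for k
    using that by (intro integrable_of_allmom_cmod am_k be_meas)
  have E: "of_nat n * (1 + z * sb) = (\<Sum>k<m. 1 - (\<integral>X. be k X \<partial>Om))"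
  proof -
    have "of_nat n * (1 + z * sb) = (\<integral>X. of_nat n * (1 + z * s X) \<partial>Om)"
      unfolding sb_def using integrable_sg(1) by (simp add: PS.Om.prob_space)
    also have "\<dots> = (\<integral>X. (\<Sum>k<m. 1 - be k X) \<partial>Om)" by (simp only: one_plus_z_s)
    also have "\<dots> = (\<Sum>k<m. (\<integral>X. 1 - be k X \<partial>Om))"
      by (rule Bochner_Integration.integral_sum) (use ib in auto)
    also have "\<dots> = (\<Sum>k<m. 1 - (\<integral>X. be k X \<partial>Om))"
      using ib by (intro sum.cong refl) (simp add: PS.Om.prob_space)
    finally show ?thesis .
  qed
  have "of_nat n * (1 + z * sb - of_real (m / n) * (sb / (1 + sb))) = (\<Sum>k<m. 1 - (\<integral>X. be k X \<partial>Om)) - of_nat m * (1 - ?b)"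
  proof -
    have "of_nat n * complex_of_real (m / n) = of_nat m" using n1 by simp
    hence X: "of_nat n * (complex_of_real (m / n) * w) = of_nat m * w" for w by (metis mult.assoc)
    have B: "sb / (1 + sb) = 1 - ?b" using one_plus_ne by (simp add: field_simps)
    have "of_nat n * (1 + z * sb - of_real (m / n) * (sb / (1 + sb)))
        = of_nat n * (1 + z * sb) - of_nat n * (of_real (m / n) * (sb / (1 + sb)))"
      by (simp only: right_diff_distrib)
    thus ?thesis by (simp only: E X B)
  qed
  also have "\<dots> = (\<Sum>k<m. ?b - (\<integral>X. be k X \<partial>Om))" by (simp add: sum_subtractf algebra_simps)
  finally have e: "of_nat n * (1 + z * sb - of_real (m / n) * (sb / (1 + sb))) = (\<Sum>k<m. ?b - (\<integral>X. be k X \<partial>Om))" .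
  have d: "cmod (?b - (\<integral>X. be k X \<partial>Om)) \<le> K1 / C0 * u" if k: "k < m" for k
  proof -
    let ?f = "\<lambda>X. cmod (q k X - sb)"
    have am_f: "allmom Om ?f" using k by simp
    have pt: "cmod (?b - be k X) \<le> b0 * (b0 * ?f X + (Z / Im z) * b0 ^ (2*r) * (?f X * ?f X ^ (2*r)))" for X
    proof -
      have "?b - be k X = (q k X - sb) * ?b * be k X"
        using one_plus_ne one_plus_q(1)[of k X] by (simp add: be_def field_simps)
      hence "cmod (?b - be k X) = ?f X * cmod ?b * cmod (be k X)" by (simp only: norm_mult)
      also have "\<dots> \<le> ?f X * b0 * (b0 + (Z / Im z) * (b0 * ?f X) ^ (2*r))"
        using b0 be_le c1 by (intro mult_mono cmod_inv_le(1)[of sb]) auto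
      also have "\<dots> = b0 * (b0 * ?f X + (Z / Im z) * b0 ^ (2*r) * (?f X * ?f X ^ (2*r)))"
        by (simp add: power_mult_distrib algebra_simps)
      finally show ?thesis .
    qed
    have E1: "EE ?f \<le> sqrt (Kq 1) * u"
    proof -
      have "EE (\<lambda>X. \<bar>?f X\<bar>) \<le> sqrt (Kq 1 * u\<^sup>2)" using mom_q[OF k, of 1] by (intro CS1 am_f) simp
      thus ?thesis using u(1) by (simp add: sqrt_sq)
    qed
    have E2: "EE (\<lambda>X. ?f X * ?f X ^ (2*r)) \<le> sqrt (Kq 1) * sqrt (Kq (2*r)) * (u * u ^ (2*r))"
    proof -
      have "EE (\<lambda>X. \<bar>?f X * ?f X ^ (2*r)\<bar>) \<le> sqrt (Kq 1 * u\<^sup>2) * sqrt (Kq (2*r) * (u ^ (2*r))\<^sup>2)"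
      proof (intro CS am_f PS.Om.allmom_power)
        show "EE (\<lambda>X. (?f X)\<^sup>2) \<le> Kq 1 * u\<^sup>2" using mom_q[OF k, of 1] by simp
        show "EE (\<lambda>X. (?f X ^ (2*r))\<^sup>2) \<le> Kq (2*r) * (u ^ (2*r))\<^sup>2"
          using mom_q[OF k, of "2*r"] r1 by (simp add: power_mult[symmetric] mult_ac)
      qed
      also have "\<dots> = (sqrt (Kq 1) * u) * (sqrt (Kq (2*r)) * u ^ (2*r))"
        using u(1) by (subst (1 2) sqrt_sq) auto
      finally show ?thesis by (simp add: mult_ac)
    qed
    \<comment> \<open>On the bad event 1 / Im z \<le> n is beaten by u^(2 r) \<le> n^(-4).\<close>
    have iu: "(Z / Im z) * u ^ (2*r) \<le> Z"
    proof -
      have "(1 / Im z) * u ^ (2*r) \<le> n * (1 / real n ^ 4)"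
        using inv_Im_z(2) ur u by (intro mult_mono) auto
      also have "\<dots> \<le> 1" using n1 by (simp add: field_simps self_le_power)
      finally have "Z * ((1 / Im z) * u ^ (2*r)) \<le> Z * 1" using Z by (intro mult_left_mono) auto
      thus ?thesis by simp
    qed
    have "cmod (?b - (\<integral>X. be k X \<partial>Om)) = cmod (\<integral>X. ?b - be k X \<partial>Om)"
      using ib[OF k] by (simp add: PS.Om.prob_space)
    also have "\<dots> \<le> EE (\<lambda>X. cmod (?b - be k X))" by (rule integral_norm_bound)
    also have "\<dots> \<le> EE (\<lambda>X. b0 * (b0 * ?f X + (Z / Im z) * b0 ^ (2*r) * (?f X * ?f X ^ (2*r))))"
    proof (rule integral_mono[OF _ _ pt])
      show "integrable Om (\<lambda>X. cmod (?b - be k X))" using ib[OF k] by auto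
      show "integrable Om (\<lambda>X. b0 * (b0 * ?f X + (Z / Im z) * b0 ^ (2*r) * (?f X * ?f X ^ (2*r))))"
        by (intro allmom_integrable PS.Om.allmom_cmult allmom_add allmom_mult PS.Om.allmom_power am_f)
    qed
    also have "\<dots> = b0 * (b0 * EE ?f + (Z / Im z) * b0 ^ (2*r) * EE (\<lambda>X. ?f X * ?f X ^ (2*r)))"
    proof -
      have "integrable Om ?f" "integrable Om (\<lambda>X. ?f X * ?f X ^ (2*r))"
        by (intro allmom_integrable allmom_mult PS.Om.allmom_power am_f)+
      thus ?thesis by (simp del: power_mult)
    qed
    also have "\<dots> \<le> b0 * (b0 * (sqrt (Kq 1) * u) + (Z / Im z) * b0 ^ (2*r) * (sqrt (Kq 1) * sqrt (Kq (2*r)) * (u * u ^ (2*r))))"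
      using b0 Z z by (intro mult_left_mono add_mono E1 E2) auto
    also have "\<dots> = b0 * (b0 * (sqrt (Kq 1) * u) + ((Z / Im z) * u ^ (2*r)) * (b0 ^ (2*r) * (sqrt (Kq 1) * sqrt (Kq (2*r)) * u)))"
      by (simp add: mult_ac)
    also have "\<dots> \<le> b0 * (b0 * (sqrt (Kq 1) * u) + Z * (b0 ^ (2*r) * (sqrt (Kq 1) * sqrt (Kq (2*r)) * u)))"
      using b0 u by (intro mult_left_mono add_left_mono mult_right_mono iu) auto
    also have "\<dots> = (b0 * (b0 * sqrt (Kq 1) + Z * b0 ^ (2*r) * (sqrt (Kq 1) * sqrt (Kq (2*r))))) * u"
      by (simp only: distrib_left distrib_right mult_ac)
    also have "b0 * (b0 * sqrt (Kq 1) + Z * b0 ^ (2*r) * (sqrt (Kq 1) * sqrt (Kq (2*r)))) = K1 / C0"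
      using C0 by (simp add: K1_def)
    finally show ?thesis .
  qed
  have K1: "K1 \<ge> 0" using b0 C0 Z by (simp add: K1_def)
  have "n * cmod (1 + z * sb - of_real (m / n) * (sb / (1 + sb))) = cmod (\<Sum>k<m. ?b - (\<integral>X. be k X \<partial>Om))"
    unfolding e[symmetric] by (simp add: norm_mult)
  also have "\<dots> \<le> (\<Sum>k<m. K1 / C0 * u)" by (rule sum_norm_le, rule d) simp
  also have "\<dots> = m * (K1 / C0 * u)" by simp
  also have "\<dots> \<le> (C0 * n) * (K1 / C0 * u)" using C0 u K1 by (intro mult_right_mono) auto
  also have "\<dots> = n * (K1 * u)" using C0 by simp
  finally show ?thesis using n1 by simp
qed

end

section \<open>Second moments of the isotropic form\<close>

context bulk
begin

definition KA :: real where
  "KA = 2 * b0\<^sup>2 * Kw 2 + 8 * Z\<^sup>2 * b0 ^ (4*r) * (sqrt (Kw 4) * sqrt (Kq (4*r)))"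
definition KV :: real where "KV = 2 * KA * C0 * ES2 1"
text \<open>The scale against which errors for g are measured. No bound on \<open>gb\<close> uniform
  in Im z is available at this stage; it is extracted from the linear equation afterwards.\<close>

definition \<Gamma> :: real where "\<Gamma> = 1 + cmod gb"

lemma KA_nonneg: "KA \<ge> 0" and KV_nonneg: "KV \<ge> 0"
proof -
  show "KA \<ge> 0" unfolding KA_def using b0 Z by (intro add_nonneg_nonneg mult_nonneg_nonneg) auto
  thus "KV \<ge> 0" using C0 by (simp add: KV_def)
qed

lemma Gamma1: "\<Gamma> \<ge> 1" "cmod gb \<le> \<Gamma>"
  by (auto simp: \<Gamma>_def)

lemma sq_add_le: "(a + b)\<^sup>2 \<le> 2 * a\<^sup>2 + 2 * (b::real)\<^sup>2"
  using sum_squares_bound[of a b] by (simp add: power2_sum)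

lemma un: "u\<^sup>2 / n \<le> u\<^sup>2"
  using divide_left_mono[of 1 "real n" "u\<^sup>2"] n1 by simp

text \<open>The increment is the square of \<open>wy\<close> times \<open>be\<close> in modulus.
  Where q is close to sb, \<open>mom_wy4\<close> gives u^2 / n times the second moment of
  \<open>gk\<close>; the rest costs a high power of u and accounts for the summand 1.\<close>

lemma increment_g:
  assumes k: "k < m"
  shows "EE (\<lambda>X. (cmod (g X - gk k X))\<^sup>2) \<le> (u\<^sup>2 / n) * KA * (EE (\<lambda>X. (cmod (gk k X))\<^sup>2) + 1)"
proof -
  let ?w = "\<lambda>X. cmod (wy k X)" and ?f = "\<lambda>X. cmod (q k X - sb)" and ?G = "EE (\<lambda>X. (cmod (gk k X))\<^sup>2)"
  have am: "allmom Om ?w" "allmom Om ?f" using k by auto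
  let ?c = "2 * (Z / Im z)\<^sup>2 * b0 ^ (4*r)"
  have pt: "(cmod (g X - gk k X))\<^sup>2 \<le> 2 * b0\<^sup>2 * ?w X ^ 4 + ?c * (?w X ^ 4 * ?f X ^ (4*r))" for X
  proof -
    have "cmod (g X - gk k X) = (?w X)\<^sup>2 * cmod (be k X)"
      using g_diff[OF k, of X] by (metis norm_minus_commute norm_mult norm_power)
    hence "(cmod (g X - gk k X))\<^sup>2 = ?w X ^ 4 * (cmod (be k X))\<^sup>2"
      by (simp add: power_mult_distrib)
    also have "\<dots> \<le> ?w X ^ 4 * (2 * b0\<^sup>2 + 2 * ((Z / Im z) * (b0 * ?f X) ^ (2*r))\<^sup>2)"
      using power_mono[OF be_le[of k X], of 2] sq_add_le[of b0 "(Z / Im z) * (b0 * ?f X) ^ (2*r)"]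
      by (intro mult_left_mono) auto
    also have "((Z / Im z) * (b0 * ?f X) ^ (2*r))\<^sup>2 = (Z / Im z)\<^sup>2 * (b0 ^ (4*r) * ?f X ^ (4*r))"
      by (simp only: power_mult_distrib power_mult[symmetric]) simp
    finally show ?thesis by (simp only: distrib_left mult_ac)
  qed
  have e2: "EE (\<lambda>X. ?w X ^ 4 * ?f X ^ (4*r)) \<le> sqrt (Kw 4) * sqrt (Kq (4*r)) * u ^ (4*r)"
  proof -
    have "EE (\<lambda>X. \<bar>?w X ^ 4 * ?f X ^ (4*r)\<bar>) \<le> sqrt (Kw 4) * sqrt (Kq (4*r) * (u ^ (4*r))\<^sup>2)"
    proof (intro CS PS.Om.allmom_power am)
      show "EE (\<lambda>X. (?w X ^ 4)\<^sup>2) \<le> Kw 4"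
        using mom_wy_crude[OF k, of 4] by (simp add: power_mult[symmetric])
      show "EE (\<lambda>X. (?f X ^ (4*r))\<^sup>2) \<le> Kq (4*r) * (u ^ (4*r))\<^sup>2"
        using mom_q[OF k, of "4*r"] r1 by (simp add: power_mult[symmetric])
    qed
    thus ?thesis using u(1) by (simp add: sqrt_sq)
  qed
  \<comment> \<open>The bad part is at most n (n^(-4))^2 \<le> n^(-3) up to constants, and
    \<open>u_lower\<close> converts n^(-3) into 4 u^2 / n, the same order as the main part.\<close>
  have cu: "?c * u ^ (4*r) \<le> (u\<^sup>2 / n) * (8 * Z\<^sup>2 * b0 ^ (4*r))"
  proof -
    have "u ^ (4*r) = (u ^ (2*r))\<^sup>2" by (simp add: power_mult[symmetric])
    also have "\<dots> \<le> (1 / real n ^ 4)\<^sup>2" using ur u by (intro power_mono) auto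
    finally have "(1 / Im z)\<^sup>2 * u ^ (4*r) \<le> n * (1 / real n ^ 4)\<^sup>2" using inv_Im_z(3) u by (intro mult_mono) auto
    also have "\<dots> \<le> 1 / real n ^ 3"
    proof -
      have "real n * real n ^ 3 \<le> real n ^ 8"
        using n1 power_increasing[of 4 8 "real n"] by (simp add: power_Suc[symmetric] del: power_Suc)
      thus ?thesis using n1 by (simp add: field_simps power_mult[symmetric])
    qed
    also have "\<dots> = 4 * (1 / (2 * real n))\<^sup>2 / n" by (simp add: power2_eq_square power3_eq_cube)
    also have "\<dots> \<le> 4 * u\<^sup>2 / n" using u_lower by (intro divide_right_mono mult_left_mono power_mono) auto
    finally have "(2 * Z\<^sup>2 * b0 ^ (4*r)) * ((1 / Im z)\<^sup>2 * u ^ (4*r)) \<le> (2 * Z\<^sup>2 * b0 ^ (4*r)) * (4 * u\<^sup>2 / n)"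
      using b0 by (intro mult_left_mono) auto
    thus ?thesis by (simp add: power_divide mult_ac)
  qed
  have i1: "integrable Om (\<lambda>X. ?w X ^ 4)" and i2: "integrable Om (\<lambda>X. ?w X ^ 4 * ?f X ^ (4*r))"
    by (intro allmom_integrable allmom_mult PS.Om.allmom_power am)+
  have "EE (\<lambda>X. (cmod (g X - gk k X))\<^sup>2) \<le> EE (\<lambda>X. 2 * b0\<^sup>2 * ?w X ^ 4 + ?c * (?w X ^ 4 * ?f X ^ (4*r)))"
    by (rule integral_mono[OF _ _ pt]) (intro integrable_pow am_gk Bochner_Integration.integrable_add integrable_mult_right i1 i2)+
  also have "\<dots> = 2 * b0\<^sup>2 * EE (\<lambda>X. ?w X ^ 4) + ?c * EE (\<lambda>X. ?w X ^ 4 * ?f X ^ (4*r))"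
    by (simp only: integral_mult_right_zero Bochner_Integration.integral_add[OF integrable_mult_right[OF i1] integrable_mult_right[OF i2]])
  also have "\<dots> \<le> 2 * b0\<^sup>2 * (Kw 2 * (u\<^sup>2 / n) * ?G) + ?c * (sqrt (Kw 4) * sqrt (Kq (4*r)) * u ^ (4*r))"
    using b0 by (intro add_mono mult_left_mono mom_wy4 k e2) auto
  also have "\<dots> = (u\<^sup>2 / n) * (2 * b0\<^sup>2 * Kw 2) * ?G + (?c * u ^ (4*r)) * (sqrt (Kw 4) * sqrt (Kq (4*r)))"
    by (simp only: mult_ac)
  also have "\<dots> \<le> (u\<^sup>2 / n) * (2 * b0\<^sup>2 * Kw 2) * ?G + ((u\<^sup>2 / n) * (8 * Z\<^sup>2 * b0 ^ (4*r))) * (sqrt (Kw 4) * sqrt (Kq (4*r)))"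
    by (intro add_left_mono mult_right_mono cu) auto
  also have "\<dots> = (u\<^sup>2 / n) * ((2 * b0\<^sup>2 * Kw 2) * ?G + 8 * Z\<^sup>2 * b0 ^ (4*r) * (sqrt (Kw 4) * sqrt (Kq (4*r))))"
    by (simp only: distrib_left mult_ac)
  also have "\<dots> \<le> (u\<^sup>2 / n) * (KA * (?G + 1))"
  proof (intro mult_left_mono)
    let ?x = "2 * b0\<^sup>2 * Kw 2" and ?y = "8 * Z\<^sup>2 * b0 ^ (4*r) * (sqrt (Kw 4) * sqrt (Kq (4*r)))"
    have nn: "?x \<ge> 0" "?y \<ge> 0" "?G \<ge> 0" using b0 by (auto intro!: mult_nonneg_nonneg)
    have "KA = ?x + ?y" by (simp only: KA_def)
    thus "?x * ?G + ?y \<le> KA * (?G + 1)" using nn by (simp only: distrib_left distrib_right) (simp add: mult_nonneg_nonneg)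
  qed auto
  finally show ?thesis by (simp only: mult.assoc)
qed

end

text \<open>Smallness of u lets multiples of the unknown second moments be moved to the left-hand
  side in the two absorption steps that follow.\<close>

locale bulk_small = bulk +
  assumes small: "8 * (KA + KV) * u\<^sup>2 \<le> 1"
begin

lemma second_moment_triangle:
  assumes a: "allmom Om (\<lambda>X. cmod (a X - b X))" and b: "allmom Om (\<lambda>X. cmod (b X))" and c: "allmom Om (\<lambda>X. cmod (a X))"
  shows "EE (\<lambda>X. (cmod (a X))\<^sup>2) \<le> 2 * EE (\<lambda>X. (cmod (b X))\<^sup>2) + 2 * EE (\<lambda>X. (cmod (a X - b X))\<^sup>2)"
proof -
  have i: "integrable Om (\<lambda>X. 2 * (cmod (b X))\<^sup>2)" "integrable Om (\<lambda>X. 2 * (cmod (a X - b X))\<^sup>2)"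
    using a b by (auto intro!: integrable_pow)
  have "EE (\<lambda>X. (cmod (a X))\<^sup>2) \<le> EE (\<lambda>X. 2 * (cmod (b X))\<^sup>2 + 2 * (cmod (a X - b X))\<^sup>2)"
  proof (rule integral_mono)
    fix X
    have "cmod (a X) \<le> cmod (b X) + cmod (a X - b X)" by (metis add_diff_cancel_left' diff_add_cancel norm_triangle_ineq add.commute)
    hence "(cmod (a X))\<^sup>2 \<le> (cmod (b X) + cmod (a X - b X))\<^sup>2" by (intro power_mono) auto
    thus "(cmod (a X))\<^sup>2 \<le> 2 * (cmod (b X))\<^sup>2 + 2 * (cmod (a X - b X))\<^sup>2"
      using sq_add_le[of "cmod (b X)" "cmod (a X - b X)"] by linarith
  qed (use i c in \<open>auto intro!: integrable_pow Bochner_Integration.integrable_add\<close>)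
  also have "\<dots> = 2 * EE (\<lambda>X. (cmod (b X))\<^sup>2) + 2 * EE (\<lambda>X. (cmod (a X - b X))\<^sup>2)"
    by (simp only: Bochner_Integration.integral_add[OF i] integral_mult_right_zero)
  finally show ?thesis .
qed

lemma small': "8 * KA * u\<^sup>2 \<le> 1" "8 * KV * u\<^sup>2 \<le> 1"
proof -
  have "0 \<le> KA * u\<^sup>2" "0 \<le> KV * u\<^sup>2" using KA_nonneg KV_nonneg by auto
  thus "8 * KA * u\<^sup>2 \<le> 1" "8 * KV * u\<^sup>2 \<le> 1" using small by (auto simp: algebra_simps)
qed

abbreviation "G2 \<equiv> EE (\<lambda>X. (cmod (g X))\<^sup>2)"
abbreviation "Vg \<equiv> EE (\<lambda>X. (cmod (g X - gb))\<^sup>2)"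
abbreviation "ek k \<equiv> EE (\<lambda>X. (cmod (g X - gk k X))\<^sup>2)"

lemma Gk_le: "EE (\<lambda>X. (cmod (gk k X))\<^sup>2) \<le> 2 * G2 + 2 * ek k"
  using second_moment_triangle[of "gk k" g] by (simp add: norm_minus_commute)

text \<open>The second moment of \<open>gk\<close> is at most twice that of g plus twice
  \<open>ek k\<close>, which puts \<open>ek k\<close> on both sides; by smallness of u the copy on
  the right is at most half of it.\<close>

lemma ek_le: "k < m \<Longrightarrow> ek k \<le> 2 * KA * (u\<^sup>2 / n) * (2 * G2 + 1)"
proof -
  assume k: "k < m"
  let ?a = "(u\<^sup>2 / n) * KA"
  have a0: "0 \<le> ?a" using KA_nonneg by simp
  have "?a \<le> u\<^sup>2 * KA" using un KA_nonneg by (intro mult_right_mono)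
  moreover have "8 * (u\<^sup>2 * KA) \<le> 1" using small'(1) by (simp add: mult_ac)
  ultimately have a8: "8 * ?a \<le> 1" by linarith
  have e0: "0 \<le> ek k" by simp
  have "ek k \<le> ?a * (EE (\<lambda>X. (cmod (gk k X))\<^sup>2) + 1)" by (rule increment_g[OF k])
  also have "\<dots> \<le> ?a * ((2 * G2 + 2 * ek k) + 1)" using Gk_le a0 by (intro mult_left_mono add_right_mono) auto
  finally have "ek k \<le> ?a * (2 * G2 + 1) + (2 * ?a) * ek k" by (simp add: algebra_simps)
  moreover have "(2 * ?a) * ek k \<le> (1/2) * ek k" using a8 e0 by (intro mult_right_mono) auto
  ultimately have "ek k \<le> 2 * (?a * (2 * G2 + 1))" by linarith
  thus ?thesis by (simp only: mult_ac)
qed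

text \<open>The second absorption: the variance is at most KV u^2 (2 G2 + 1), while G2 \<le> 2
  |gb|^2 + 2 Vg. The copy of the variance on the right is again at most half of it.\<close>

lemma Vg_le: "Vg \<le> 8 * KV * u\<^sup>2 * \<Gamma>\<^sup>2" and G2_le: "G2 \<le> 4 * \<Gamma>\<^sup>2"
proof -
  have "Vg \<le> ES2 1 * (\<Sum>k<m. ek k)" by (rule variance_g)
  also have "\<dots> \<le> ES2 1 * (\<Sum>k<m. 2 * KA * (u\<^sup>2 / n) * (2 * G2 + 1))"
    by (intro mult_left_mono sum_mono ek_le) auto
  also have "\<dots> = ES2 1 * (m * (2 * KA * (u\<^sup>2 / n) * (2 * G2 + 1)))" by simp
  also have "\<dots> \<le> ES2 1 * ((C0 * n) * (2 * KA * (u\<^sup>2 / n) * (2 * G2 + 1)))"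
    using C0 KA_nonneg by (intro mult_left_mono mult_right_mono) auto
  also have "\<dots> = KV * u\<^sup>2 * (2 * G2 + 1)" using n1 by (simp add: KV_def)
  finally have V: "Vg \<le> KV * u\<^sup>2 * (2 * G2 + 1)" .
  have G: "G2 \<le> 2 * (cmod gb)\<^sup>2 + 2 * Vg"
    using second_moment_triangle[of g "\<lambda>_. gb"] by (simp add: PS.Om.prob_space)
  have k0: "0 \<le> KV * u\<^sup>2" using KV_nonneg by simp
  have V0: "0 \<le> Vg" by simp
  have "Vg \<le> KV * u\<^sup>2 * (2 * (2 * (cmod gb)\<^sup>2 + 2 * Vg) + 1)"
  proof (rule order_trans[OF V], rule mult_left_mono[OF _ k0])
    show "2 * G2 + 1 \<le> 2 * (2 * (cmod gb)\<^sup>2 + 2 * Vg) + 1"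
      using G by (intro add_right_mono mult_left_mono) auto
  qed
  hence "Vg \<le> KV * u\<^sup>2 * (4 * (cmod gb)\<^sup>2 + 1) + (4 * (KV * u\<^sup>2)) * Vg" by (simp add: algebra_simps)
  moreover have "(4 * (KV * u\<^sup>2)) * Vg \<le> (1/2) * Vg" using small'(2) V0 by (intro mult_right_mono) auto
  ultimately have "Vg \<le> 2 * (KV * u\<^sup>2) * (4 * (cmod gb)\<^sup>2 + 1)" by linarith
  also have "\<dots> \<le> 2 * (KV * u\<^sup>2) * (4 * \<Gamma>\<^sup>2)"
    using k0 by (intro mult_left_mono) (auto simp: \<Gamma>_def power2_eq_square algebra_simps)
  finally show V8: "Vg \<le> 8 * KV * u\<^sup>2 * \<Gamma>\<^sup>2" by simp
  also have "\<dots> \<le> 1 * \<Gamma>\<^sup>2" using small'(2) by (intro mult_right_mono) auto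
  finally have "Vg \<le> \<Gamma>\<^sup>2" by simp
  moreover have "(cmod gb)\<^sup>2 \<le> \<Gamma>\<^sup>2" using Gamma1 by (intro power_mono) auto
  ultimately show "G2 \<le> 4 * \<Gamma>\<^sup>2" using G by linarith
qed

lemma ek_final: "k < m \<Longrightarrow> ek k \<le> 18 * KA * u\<^sup>2 * \<Gamma>\<^sup>2"
  and Gk_final: "k < m \<Longrightarrow> EE (\<lambda>X. (cmod (gk k X))\<^sup>2) \<le> 25 * \<Gamma>\<^sup>2"
proof -
  assume k: "k < m"
  have g1: "1 \<le> \<Gamma>\<^sup>2" using Gamma1 by simp
  have "ek k \<le> 2 * KA * (u\<^sup>2 / n) * (2 * G2 + 1)" by (rule ek_le[OF k])
  also have "\<dots> \<le> 2 * KA * u\<^sup>2 * (9 * \<Gamma>\<^sup>2)"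
  proof (intro mult_mono)
    show "2 * G2 + 1 \<le> 9 * \<Gamma>\<^sup>2" using G2_le g1 by linarith
  qed (use KA_nonneg un in auto)
  finally show e: "ek k \<le> 18 * KA * u\<^sup>2 * \<Gamma>\<^sup>2" by simp
  have "ek k \<le> 18 * (KA * u\<^sup>2) * \<Gamma>\<^sup>2" using e by (simp only: mult.assoc)
  also have "\<dots> \<le> 3 * \<Gamma>\<^sup>2"
  proof (rule mult_right_mono)
    have "8 * (KA * u\<^sup>2) \<le> 1" using small'(1) by (simp only: mult.assoc)
    thus "18 * (KA * u\<^sup>2) \<le> 3" by linarith
  qed simp
  finally have "ek k \<le> 3 * \<Gamma>\<^sup>2" .
  thus "EE (\<lambda>X. (cmod (gk k X))\<^sup>2) \<le> 25 * \<Gamma>\<^sup>2" using Gk_le[of k] G2_le g1 by linarith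
qed

lemma Gk_abs: "k < m \<Longrightarrow> EE (\<lambda>X. cmod (gk k X)) \<le> 5 * \<Gamma>"
proof -
  assume k: "k < m"
  have "EE (\<lambda>X. \<bar>cmod (gk k X)\<bar>) \<le> sqrt (25 * \<Gamma>\<^sup>2)"
    by (rule CS1[OF am_gk0 Gk_final[OF k]])
  also have "\<dots> = 5 * \<Gamma>" using Gamma1 by (simp add: real_sqrt_mult real_sqrt_unique)
  finally show ?thesis by simp
qed

text \<open>The value \<open>0\<close> off the good event keeps \<open>bh\<close> bounded there.\<close>

definition bh where "bh k X = (if cmod (qh k X - sb) \<le> c1 / 2 then 1 / (1 + qh k X) else 0)"

lemma bh_meas [measurable]: "bh k \<in> borel_measurable Om"
  unfolding bh_def[abs_def] by measurable

lemma free_bh: "PS.free_of k (bh k)"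
  using free_qh[of k] by (auto simp: PS.free_of_def bh_def)

lemma bh_le: "cmod (bh k X) \<le> b0"
  using cmod_inv_le(1) b0 by (simp add: bh_def)

lemma am_bh: "allmom Om (\<lambda>X. cmod (bh k X))"
  by (rule allmom_bdd[OF bh_meas bh_le])

text \<open>The first term is the difference of two reciprocals when both are controlled, the second
  arises when q is far from sb, and the third when \<open>qh\<close> is, where \<open>bh\<close> is
  0 and \<open>be\<close> has only its deterministic bound.\<close>

lemma be_bh: "cmod (be k X - bh k X) \<le> b0\<^sup>2 * cmod (q k X - qh k X)
    + (Z / Im z) * (b0 * b0 ^ (2*r) * (cmod (q k X - qh k X) * cmod (q k X - sb) ^ (2*r)) + b0 ^ (2*r) * cmod (qh k X - sb) ^ (2*r))"
  (is "_ \<le> ?T1 + ?zi * (?T2 + ?T3)")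
proof -
  have nn: "0 \<le> ?T1" "0 \<le> ?zi" "0 \<le> ?T2" "0 \<le> ?T3" using b0 Z z by auto
  show ?thesis
  proof (cases "cmod (qh k X - sb) \<le> c1 / 2")
    case True
    have "be k X - bh k X = - (q k X - qh k X) * bh k X * be k X"
      using True cmod_inv_le(2)[OF True] one_plus_q(1)[of k X] by (simp add: bh_def be_def field_simps)
    hence "cmod (be k X - bh k X) = cmod (q k X - qh k X) * cmod (bh k X) * cmod (be k X)"
      by (simp only: norm_mult norm_minus_cancel)
    also have "\<dots> \<le> cmod (q k X - qh k X) * b0 * (b0 + ?zi * (b0 * cmod (q k X - sb)) ^ (2*r))"
      using b0 by (intro mult_mono bh_le be_le) auto
    also have "\<dots> = ?T1 + ?zi * ?T2" by (simp add: power_mult_distrib power2_eq_square algebra_simps)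
    finally show ?thesis using nn mult_nonneg_nonneg[OF nn(2,4)] by (simp only: distrib_left)
  next
    case False
    have "cmod (be k X - bh k X) = cmod (be k X)" using False by (simp add: bh_def)
    also have "\<dots> \<le> cmod z / Im z" by (rule one_plus_q)
    also have "\<dots> \<le> ?zi * 1" using Z z by (simp add: divide_right_mono)
    also have "\<dots> \<le> ?zi * (b0 * cmod (qh k X - sb)) ^ (2*r)"
      using nn by (intro mult_left_mono one_le_pow False) auto
    also have "\<dots> = ?zi * ?T3" by (simp add: power_mult_distrib)
    finally show ?thesis using nn mult_nonneg_nonneg[OF nn(2,3)] by (simp only: distrib_left)
  qed
qed

definition S2 :: real where "S2 = 3 * S0\<^sup>2 + 3 * (ES2 1 * C0) + 3"

text \<open>With sb bounded by S0, the variance of q - qh is of order 1 / (n Im z) and not only 1 /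
  (n (Im z)^2). \<open>T1_le\<close> needs this gain.\<close>

lemma S2_le: "k < m \<Longrightarrow> EE (\<lambda>X. (cmod (sk k X))\<^sup>2) \<le> S2"
proof -
  assume k: "k < m"
  have "(cmod (sk k X))\<^sup>2 \<le> 3 * S0\<^sup>2 + 3 * (cmod (s X - sb))\<^sup>2 + 3" for X
  proof -
    have d: "cmod (s X - sk k X) \<le> 1" using s_diff[OF k, of X] inv_nz(2) u by linarith
    have "cmod (sk k X) \<le> cmod sb + cmod (s X - sb) + cmod (s X - sk k X)"
      using norm_triangle_ineq4[of "sb + (s X - sb)" "s X - sk k X"] norm_triangle_ineq[of sb "s X - sb"] by simp
    hence "cmod (sk k X) \<le> S0 + cmod (s X - sb) + 1" using S0 d by linarith
    hence "(cmod (sk k X))\<^sup>2 \<le> (S0 + cmod (s X - sb) + 1)\<^sup>2" by (intro power_mono) auto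
    also have "\<dots> \<le> 3 * S0\<^sup>2 + 3 * (cmod (s X - sb))\<^sup>2 + 3"
    proof -
      let ?c = "cmod (s X - sb)"
      have "0 \<le> (S0 - ?c)\<^sup>2 + (S0 - 1)\<^sup>2 + (?c - 1)\<^sup>2" by simp
      thus ?thesis by (simp add: power2_eq_square algebra_simps)
    qed
    finally show ?thesis .
  qed
  hence "EE (\<lambda>X. (cmod (sk k X))\<^sup>2) \<le> EE (\<lambda>X. 3 * S0\<^sup>2 + 3 * (cmod (s X - sb))\<^sup>2 + 3)"
    by (intro integral_mono) (auto intro!: integrable_pow allmom_sg Bochner_Integration.integrable_add integrable_mult_right am_s)
  also have "\<dots> = 3 * S0\<^sup>2 + 3 * EE (\<lambda>X. (cmod (s X - sb))\<^sup>2) + 3"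
    using integrable_pow[OF am_s, of 2] by (simp add: PS.Om.prob_space)
  also have "\<dots> \<le> 3 * S0\<^sup>2 + 3 * (ES2 1 * C0) + 3"
  proof -
    have "EE (\<lambda>X. (cmod (s X - sb))\<^sup>2) \<le> ES2 1 * C0 * u\<^sup>2" using conc_s[of 1] by simp
    also have "\<dots> \<le> ES2 1 * C0 * 1" using C0 u by (intro mult_left_mono power_le_one) auto
    finally show ?thesis by simp
  qed
  finally show ?thesis by (simp add: S2_def)
qed

lemma S2_nonneg: "0 \<le> S2"
  using C0 by (simp add: S2_def)

lemma mom_d4: "k < m \<Longrightarrow> EE (\<lambda>X. cmod (q k X - qh k X) ^ 4) \<le> Kd 2 * (u\<^sup>2 / n) * S2"
proof -
  assume k: "k < m"
  have "EE (\<lambda>X. cmod (q k X - qh k X) ^ 4) \<le> EE (\<lambda>X. QCc 2 * (t4 * Im (sk k X) / (n * Im z)) ^ 2)"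
    using moment_q[OF k, of 2] by simp
  also have "\<dots> \<le> EE (\<lambda>X. (Kd 2 * (u\<^sup>2 / n)) * (cmod (sk k X))\<^sup>2)"
  proof (intro integral_mono integrable_Im_pow integrable_mult_right integrable_pow allmom_sg)
    fix X
    have "QCc 2 * (t4 * Im (sk k X) / (n * Im z)) ^ 2 = (Kd 2 * (1 / (n * Im z))\<^sup>2) * (Im (sk k X))\<^sup>2"
      by (simp add: Kd_def power_mult_distrib power_divide)
    also have "\<dots> \<le> (Kd 2 * (1 / (n * Im z))\<^sup>2) * (cmod (sk k X))\<^sup>2"
      using abs_Im_le_cmod[of "sk k X"] bounds(6)[of k X] by (intro mult_left_mono power_mono) auto
    finally show "QCc 2 * (t4 * Im (sk k X) / (n * Im z)) ^ 2 \<le> (Kd 2 * (u\<^sup>2 / n)) * (cmod (sk k X))\<^sup>2"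
      unfolding inv_nz(1) .
  qed
  also have "\<dots> = (Kd 2 * (u\<^sup>2 / n)) * EE (\<lambda>X. (cmod (sk k X))\<^sup>2)" by simp
  also have "\<dots> \<le> (Kd 2 * (u\<^sup>2 / n)) * S2" by (intro mult_left_mono S2_le k) auto
  finally show ?thesis .
qed

section \<open>Error terms of the isotropic equation\<close>

definition KT1 :: real where "KT1 = sqrt (5 * Kw 1) * sqrt (sqrt (Kw 2) * sqrt (Kd 2 * S2))"
definition KT2 :: real where "KT2 = sqrt (Kw 2) * sqrt (sqrt (Kd 2) * sqrt (Kq (4*r)))"
definition KT3 :: real where "KT3 = sqrt (Kw 2) * sqrt (Kh (2*r))"
definition KE :: real where "KE = b0\<^sup>2 * KT1 + 2 * Z * (b0 * b0 ^ (2*r) * KT2 + b0 ^ (2*r) * KT3)"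

lemma KT_nonneg: "0 \<le> KT1" "0 \<le> KT2" "0 \<le> KT3" "0 \<le> KE"
proof -
  show "0 \<le> KT1" "0 \<le> KT2" "0 \<le> KT3" using S2_nonneg by (auto simp: KT1_def KT2_def KT3_def)
  thus "0 \<le> KE" using b0 Z by (auto simp: KE_def)
qed

lemma inv_nz': "1 / (n * Im z) = u / sqrt n"
proof -
  have "(sqrt n * u) / (sqrt n * sqrt n) = u / sqrt n"
    using n1 by (intro nonzero_mult_divide_mult_cancel_left) simp
  moreover have "1 / (n * Im z) = (1 / Im z) / n" by simp
  ultimately show ?thesis unfolding inv_Im_z(1) by simp
qed

text \<open>In orders of magnitude, \<open>vy\<close> is n^(-1/2), \<open>wy\<close> is sqrt
  \<Gamma> (n Im z)^(-1/2) and q - qh is (n Im z)^(-1/2). As 1 / (n Im z) = u / sqrt n, the product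
  is of order u / n up to \<Gamma>, which can be summed over m columns.\<close>

lemma T1_le:
  assumes k: "k < m"
  shows "EE (\<lambda>X. cmod (vy k X) * cmod (wy k X) * cmod (q k X - qh k X)) \<le> KT1 * \<Gamma> * (u / n)"
proof -
  let ?v = "\<lambda>X. cmod (vy k X)" and ?w = "\<lambda>X. cmod (wy k X)" and ?d = "\<lambda>X. cmod (q k X - qh k X)"
  have am: "allmom Om ?v" "allmom Om ?w" "allmom Om ?d" using k by auto
  have vd: "EE (\<lambda>X. (?v X * ?d X)\<^sup>2) \<le> sqrt (Kw 2) * sqrt (Kd 2 * S2) * (u / (n * sqrt n))"
  proof -
    have "EE (\<lambda>X. \<bar>(?v X)\<^sup>2 * (?d X)\<^sup>2\<bar>) \<le> sqrt (Kw 2 * (1 / n)\<^sup>2) * sqrt ((Kd 2 * S2) * (u / sqrt n)\<^sup>2)"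
    proof (intro CS PS.Om.allmom_power am)
      show "EE (\<lambda>X. ((?v X)\<^sup>2)\<^sup>2) \<le> Kw 2 * (1 / n)\<^sup>2"
        using mom_vy[OF k, of 2] by (simp add: power_divide)
      show "EE (\<lambda>X. ((?d X)\<^sup>2)\<^sup>2) \<le> (Kd 2 * S2) * (u / sqrt n)\<^sup>2"
        using mom_d4[OF k] by (simp add: power_divide mult_ac)
    qed
    also have "\<dots> = (sqrt (Kw 2) * (1 / n)) * (sqrt (Kd 2 * S2) * (u / sqrt n))"
      using u(1) by (subst (1 2) sqrt_sq) auto
    finally show ?thesis by (simp add: power_mult_distrib)
  qed
  have w2: "EE (\<lambda>X. (?w X)\<^sup>2) \<le> 5 * Kw 1 * \<Gamma> * (u / sqrt n)"
  proof -
    have "EE (\<lambda>X. (?w X)\<^sup>2) \<le> Kw 1 * EE (\<lambda>X. cmod (gk k X)) / (n * Im z)" by (rule mom_wy2[OF k])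
    also have "\<dots> = Kw 1 * EE (\<lambda>X. cmod (gk k X)) * (1 / (n * Im z))" by simp
    also have "\<dots> \<le> Kw 1 * (5 * \<Gamma>) * (1 / (n * Im z))"
      using z by (intro mult_right_mono mult_left_mono Gk_abs k) auto
    finally show ?thesis unfolding inv_nz' by (simp add: mult_ac)
  qed
  have "EE (\<lambda>X. \<bar>?w X * (?v X * ?d X)\<bar>) \<le> sqrt (5 * Kw 1 * \<Gamma> * (u / sqrt n)) * sqrt (sqrt (Kw 2) * sqrt (Kd 2 * S2) * (u / (n * sqrt n)))"
    by (intro CS allmom_mult am w2 vd)
  also have "\<dots> = sqrt (5 * Kw 1) * sqrt \<Gamma> * sqrt (sqrt (Kw 2) * sqrt (Kd 2 * S2)) * (sqrt (u / sqrt n) * sqrt (u / (n * sqrt n)))"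
    by (simp only: real_sqrt_mult mult_ac)
  also have "sqrt (u / sqrt n) * sqrt (u / (n * sqrt n)) = u / n"
  proof -
    have "(u / sqrt n) * (u / (n * sqrt n)) = (u / n)\<^sup>2"
      using n1 by (simp add: power2_eq_square)
    thus ?thesis using u by (simp add: real_sqrt_mult[symmetric])
  qed
  also have "sqrt (5 * Kw 1) * sqrt \<Gamma> * sqrt (sqrt (Kw 2) * sqrt (Kd 2 * S2)) * (u / n) = (KT1 * (u / n)) * sqrt \<Gamma>"
    by (simp add: KT1_def mult_ac)
  also have "\<dots> \<le> (KT1 * (u / n)) * \<Gamma>"
  proof (rule mult_left_mono)
    have "\<Gamma> * 1 \<le> \<Gamma> * \<Gamma>" using Gamma1 by (intro mult_left_mono) auto
    thus "sqrt \<Gamma> \<le> \<Gamma>" using Gamma1 by (intro real_le_lsqrt) (auto simp: power2_eq_square)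
  qed (use KT_nonneg u in auto)
  finally show ?thesis by (simp add: mult_ac)
qed

lemma P2_le:
  assumes k: "k < m"
  shows "EE (\<lambda>X. (cmod (vy k X) * cmod (wy k X))\<^sup>2) \<le> Kw 2"
proof -
  let ?v = "\<lambda>X. cmod (vy k X)" and ?w = "\<lambda>X. cmod (wy k X)"
  have am: "allmom Om ?v" "allmom Om ?w" using k by auto
  have "EE (\<lambda>X. \<bar>(?v X)\<^sup>2 * (?w X)\<^sup>2\<bar>) \<le> sqrt (Kw 2) * sqrt (Kw 2)"
  proof (intro CS PS.Om.allmom_power am)
    have "Kw 2 / real n ^ 2 \<le> Kw 2 / 1" using n1 by (intro divide_left_mono) auto
    thus "EE (\<lambda>X. ((?v X)\<^sup>2)\<^sup>2) \<le> Kw 2"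
      using mom_vy[OF k, of 2] by simp
    show "EE (\<lambda>X. ((?w X)\<^sup>2)\<^sup>2) \<le> Kw 2" using mom_wy_crude[OF k, of 2] by simp
  qed
  thus ?thesis by (simp add: power_mult_distrib)
qed

lemma T2_le:
  assumes k: "k < m"
  shows "EE (\<lambda>X. cmod (vy k X) * cmod (wy k X) * (cmod (q k X - qh k X) * cmod (q k X - sb) ^ (2*r))) \<le> KT2 * u ^ (2*r)"
proof -
  let ?d = "\<lambda>X. cmod (q k X - qh k X)" and ?f = "\<lambda>X. cmod (q k X - sb)"
  have am: "allmom Om ?d" "allmom Om ?f" "allmom Om (\<lambda>X. cmod (vy k X))" "allmom Om (\<lambda>X. cmod (wy k X))" using k by auto
  have df: "EE (\<lambda>X. (?d X * ?f X ^ (2*r))\<^sup>2) \<le> (sqrt (Kd 2) * sqrt (Kq (4*r))) * (u ^ (2*r))\<^sup>2"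
  proof -
    have "EE (\<lambda>X. \<bar>(?d X)\<^sup>2 * ?f X ^ (4*r)\<bar>) \<le> sqrt (Kd 2) * sqrt (Kq (4*r) * (u ^ (4*r))\<^sup>2)"
    proof (intro CS PS.Om.allmom_power am)
      have "EE (\<lambda>X. ((?d X)\<^sup>2)\<^sup>2) \<le> Kd 2 * u ^ 4" using mom_d[OF k, of 2] by simp
      also have "\<dots> \<le> Kd 2 * 1" using u by (intro mult_left_mono power_le_one) auto
      finally show "EE (\<lambda>X. ((?d X)\<^sup>2)\<^sup>2) \<le> Kd 2" by simp
      show "EE (\<lambda>X. (?f X ^ (4*r))\<^sup>2) \<le> Kq (4*r) * (u ^ (4*r))\<^sup>2"
        using mom_q[OF k, of "4*r"] r1 by (simp add: power_mult[symmetric])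
    qed
    also have "\<dots> = sqrt (Kd 2) * (sqrt (Kq (4*r)) * u ^ (4*r))" using u(1) by (subst sqrt_sq) auto
    finally show ?thesis by (simp add: power_mult_distrib power_mult[symmetric])
  qed
  have "EE (\<lambda>X. \<bar>(cmod (vy k X) * cmod (wy k X)) * (?d X * ?f X ^ (2*r))\<bar>) \<le> sqrt (Kw 2) * sqrt ((sqrt (Kd 2) * sqrt (Kq (4*r))) * (u ^ (2*r))\<^sup>2)"
    by (intro CS allmom_mult PS.Om.allmom_power am P2_le k df)
  also have "\<dots> = KT2 * u ^ (2*r)" using u(1) by (subst sqrt_sq) (auto simp: KT2_def)
  finally show ?thesis by simp
qed

lemma T3_le:
  assumes k: "k < m"
  shows "EE (\<lambda>X. cmod (vy k X) * cmod (wy k X) * cmod (qh k X - sb) ^ (2*r)) \<le> KT3 * u ^ (2*r)"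
proof -
  have am: "allmom Om (\<lambda>X. cmod (vy k X))" "allmom Om (\<lambda>X. cmod (wy k X))" using k by auto
  have "EE (\<lambda>X. \<bar>(cmod (vy k X) * cmod (wy k X)) * cmod (qh k X - sb) ^ (2*r)\<bar>) \<le> sqrt (Kw 2) * sqrt (Kh (2*r) * (u ^ (2*r))\<^sup>2)"
  proof (intro CS allmom_mult PS.Om.allmom_power am am_qh P2_le k)
    show "EE (\<lambda>X. (cmod (qh k X - sb) ^ (2*r))\<^sup>2) \<le> Kh (2*r) * (u ^ (2*r))\<^sup>2"
      using mom_qh[OF k, of "2*r"] r1 by (simp add: power_mult[symmetric] mult_ac)
  qed
  also have "\<dots> = KT3 * u ^ (2*r)" using u(1) by (subst sqrt_sq) (auto simp: KT3_def)
  finally show ?thesis by simp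
qed

text \<open>Because m such errors are summed, the bad event must cost u / n and not merely u: n
  times n^(-4) is at most n^(-2), and \<open>u_lower\<close> turns one factor 1 / n into u.\<close>

lemma bad_small: "(Z / Im z) * u ^ (2*r) \<le> 2 * Z * (u / n)"
proof -
  have "(1 / Im z) * u ^ (2*r) \<le> n * (1 / real n ^ 4)"
    using inv_Im_z(2) ur u by (intro mult_mono) auto
  also have "\<dots> \<le> 1 / (real n)\<^sup>2"
  proof -
    have "real n * (real n)\<^sup>2 \<le> real n ^ 4"
      using n1 power_increasing[of 3 4 "real n"] by (simp add: power_Suc[symmetric] del: power_Suc)
    thus ?thesis using n1 by (simp add: field_simps)
  qed
  also have "\<dots> = 2 * (1 / (2 * real n)) / n" by (simp add: power2_eq_square)
  also have "\<dots> \<le> 2 * u / n" using u_lower by (intro divide_right_mono mult_left_mono) auto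
  finally have "Z * ((1 / Im z) * u ^ (2*r)) \<le> Z * (2 * u / n)" using Z by (intro mult_left_mono) auto
  thus ?thesis by (simp add: mult_ac)
qed

lemma integral_combination:
  fixes a b c :: "_ \<Rightarrow> real"
  assumes "integrable Om a" "integrable Om b" "integrable Om c"
  shows "EE (\<lambda>X. x1 * a X + x2 * (x3 * b X + x4 * c X)) = x1 * EE a + x2 * (x3 * EE b + x4 * EE c)"
  using assms by simp

text \<open>\<open>be k\<close> sees column k and \<open>bh k\<close> does not. After this
  replacement \<open>cross_moment_k\<close> evaluates the expectation exactly, and the errors of all
  columns add up to order u.\<close>

lemma replace_be:
  assumes k: "k < m"
  shows "cmod ((\<integral>X. vy k X * wy k X * be k X \<partial>Om) - (\<integral>X. vy k X * wy k X * bh k X \<partial>Om)) \<le> KE * \<Gamma> * (u / n)"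
proof -
  let ?P = "\<lambda>X. cmod (vy k X) * cmod (wy k X)"
  let ?d = "\<lambda>X. cmod (q k X - qh k X)" and ?f = "\<lambda>X. cmod (q k X - sb)" and ?h = "\<lambda>X. cmod (qh k X - sb)"
  let ?b2 = "b0 * b0 ^ (2*r)" and ?b3 = "b0 ^ (2*r)"
  have am: "allmom Om ?d" "allmom Om ?f" "allmom Om ?P" "allmom Om ?h" using k by auto
  have [measurable]: "vy k \<in> borel_measurable Om" "wy k \<in> borel_measurable Om" "be k \<in> borel_measurable Om"
    using k by measurable
  have ib: "integrable Om (\<lambda>X. vy k X * wy k X * be k X)" "integrable Om (\<lambda>X. vy k X * wy k X * bh k X)"
    using k am_bh by (auto intro!: integrable_of_allmom_cmod allmom_cmod_mult)
  have i: "integrable Om (\<lambda>X. ?P X * ?d X)" "integrable Om (\<lambda>X. ?P X * (?d X * ?f X ^ (2*r)))" "integrable Om (\<lambda>X. ?P X * ?h X ^ (2*r))"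
    by (intro allmom_integrable allmom_mult PS.Om.allmom_power am)+
  have "(\<integral>X. vy k X * wy k X * be k X \<partial>Om) - (\<integral>X. vy k X * wy k X * bh k X \<partial>Om) = (\<integral>X. vy k X * wy k X * (be k X - bh k X) \<partial>Om)"
    using ib by (simp add: right_diff_distrib)
  hence "cmod ((\<integral>X. vy k X * wy k X * be k X \<partial>Om) - (\<integral>X. vy k X * wy k X * bh k X \<partial>Om)) \<le> EE (\<lambda>X. cmod (vy k X * wy k X * (be k X - bh k X)))"
    by (simp only: integral_norm_bound)
  also have "\<dots> \<le> EE (\<lambda>X. b0\<^sup>2 * (?P X * ?d X) + (Z / Im z) * (?b2 * (?P X * (?d X * ?f X ^ (2*r))) + ?b3 * (?P X * ?h X ^ (2*r))))"
  proof (rule integral_mono)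
    show "integrable Om (\<lambda>X. cmod (vy k X * wy k X * (be k X - bh k X)))"
      using k am_bh by (intro allmom_integrable allmom_cmod_mult allmom_cmod_add am_k) auto
    show "integrable Om (\<lambda>X. b0\<^sup>2 * (?P X * ?d X) + (Z / Im z) * (?b2 * (?P X * (?d X * ?f X ^ (2*r))) + ?b3 * (?P X * ?h X ^ (2*r))))"
      by (intro Bochner_Integration.integrable_add integrable_mult_right i)
    fix X
    have "cmod (vy k X * wy k X * (be k X - bh k X)) \<le> ?P X * (b0\<^sup>2 * ?d X + (Z / Im z) * (?b2 * (?d X * ?f X ^ (2*r)) + ?b3 * ?h X ^ (2*r)))"
      unfolding norm_mult by (intro mult_left_mono be_bh) auto
    thus "cmod (vy k X * wy k X * (be k X - bh k X)) \<le> b0\<^sup>2 * (?P X * ?d X) + (Z / Im z) * (?b2 * (?P X * (?d X * ?f X ^ (2*r))) + ?b3 * (?P X * ?h X ^ (2*r)))"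
      by (simp only: distrib_left mult_ac)
  qed
  also have "\<dots> = b0\<^sup>2 * EE (\<lambda>X. ?P X * ?d X) + (Z / Im z) * (?b2 * EE (\<lambda>X. ?P X * (?d X * ?f X ^ (2*r))) + ?b3 * EE (\<lambda>X. ?P X * ?h X ^ (2*r)))"
    by (rule integral_combination[OF i])
  also have "\<dots> \<le> b0\<^sup>2 * (KT1 * \<Gamma> * (u / n)) + (Z / Im z) * (?b2 * (KT2 * u ^ (2*r)) + ?b3 * (KT3 * u ^ (2*r)))"
    using b0 Z z by (intro add_mono mult_left_mono T1_le T2_le T3_le k) auto
  also have "\<dots> = b0\<^sup>2 * (KT1 * \<Gamma> * (u / n)) + ((Z / Im z) * u ^ (2*r)) * (?b2 * KT2 + ?b3 * KT3)"
    by (simp add: algebra_simps)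
  also have "\<dots> \<le> b0\<^sup>2 * (KT1 * \<Gamma> * (u / n)) + (2 * Z * (u / n)) * (?b2 * KT2 + ?b3 * KT3)"
    using b0 KT_nonneg by (intro add_left_mono mult_right_mono bad_small) auto
  also have "\<dots> \<le> b0\<^sup>2 * (KT1 * \<Gamma> * (u / n)) + (2 * Z * (u / n)) * (?b2 * KT2 + ?b3 * KT3) * \<Gamma>"
  proof -
    have "0 \<le> (2 * Z * (u / n)) * (?b2 * KT2 + ?b3 * KT3)" using b0 KT_nonneg Z u by auto
    from mult_left_mono[OF Gamma1(1) this] show ?thesis by simp
  qed
  also have "\<dots> = KE * \<Gamma> * (u / n)"
    by (simp only: KE_def distrib_left distrib_right mult_ac)
  finally show ?thesis .
qed

definition KG :: real where "KG = 5 * (b0 / c1) * sqrt (Kh 1) + (1 / c1) * sqrt (18 * KA)"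

text \<open>The factor (1 + \<tau>)^2 / n has already been extracted, so order u suffices here. One
  part of the error comes from \<open>bh\<close> against 1 / (1 + sb), the other from
  \<open>gk\<close> against g.\<close>

lemma replace_bh:
  assumes k: "k < m"
  shows "cmod ((\<integral>X. gk k X * bh k X \<partial>Om) - gb / (1 + sb)) \<le> KG * \<Gamma> * u"
proof -
  let ?b = "1 / (1 + sb)"
  have bb: "cmod ?b \<le> 1 / c1" using c1 by (simp add: norm_divide divide_left_mono mult_pos_pos one_plus_ne)
  have pt: "cmod (bh k X - ?b) \<le> (b0 / c1) * cmod (qh k X - sb)" for X
  proof (cases "cmod (qh k X - sb) \<le> c1 / 2")
    case True
    have "bh k X - ?b = - (qh k X - sb) * bh k X * ?b"
      using True cmod_inv_le(2)[OF True] one_plus_ne by (simp add: bh_def field_simps)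
    hence "cmod (bh k X - ?b) = cmod (qh k X - sb) * cmod (bh k X) * cmod ?b"
      by (simp only: norm_mult norm_minus_cancel)
    also have "\<dots> \<le> cmod (qh k X - sb) * b0 * (1 / c1)" using b0 bb by (intro mult_mono bh_le) auto
    finally show ?thesis by (simp add: mult_ac)
  next
    case False
    have "cmod (bh k X - ?b) = cmod ?b" using False by (simp add: bh_def)
    also have "\<dots> \<le> (1 / c1) * 1" using bb by simp
    also have "\<dots> \<le> (1 / c1) * (b0 * cmod (qh k X - sb)) ^ 1" using c1 by (intro mult_left_mono one_le_pow False) auto
    finally show ?thesis by (simp add: mult_ac)
  qed
  have iG: "integrable Om (\<lambda>X. gk k X * bh k X)" "integrable Om (gk k)"
    using am_bh by (auto intro!: integrable_of_allmom_cmod allmom_cmod_mult integrable_sg)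
  have amd: "allmom Om (\<lambda>X. cmod (bh k X - ?b))" using am_bh by (auto intro!: allmom_cmod_add)
  have "(\<integral>X. gk k X * bh k X \<partial>Om) - gb * ?b = (\<integral>X. gk k X * (bh k X - ?b) \<partial>Om) + (\<integral>X. gk k X - g X \<partial>Om) * ?b"
    using iG integrable_sg by (simp add: gb_def right_diff_distrib left_diff_distrib diff_divide_distrib)
  hence "cmod ((\<integral>X. gk k X * bh k X \<partial>Om) - gb * ?b) = cmod ((\<integral>X. gk k X * (bh k X - ?b) \<partial>Om) + (\<integral>X. gk k X - g X \<partial>Om) * ?b)"
    by (rule arg_cong)
  also have "\<dots> \<le> cmod (\<integral>X. gk k X * (bh k X - ?b) \<partial>Om) + cmod (\<integral>X. gk k X - g X \<partial>Om) * cmod ?b"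
    by (rule order_trans[OF norm_triangle_ineq]) (simp only: norm_mult order_refl)
  also have "\<dots> \<le> 5 * \<Gamma> * ((b0 / c1) * sqrt (Kh 1) * u) + (sqrt (18 * KA) * u * \<Gamma>) * (1 / c1)"
  proof (intro add_mono mult_mono bb)
    have "cmod (\<integral>X. gk k X * (bh k X - ?b) \<partial>Om) \<le> EE (\<lambda>X. cmod (gk k X * (bh k X - ?b)))" by (rule integral_norm_bound)
    also have "\<dots> = EE (\<lambda>X. \<bar>cmod (gk k X) * cmod (bh k X - ?b)\<bar>)" by (simp add: norm_mult)
    also have "\<dots> \<le> sqrt (25 * \<Gamma>\<^sup>2) * sqrt ((b0 / c1)\<^sup>2 * (Kh 1 * u\<^sup>2))"
    proof (intro CS Gk_final k amd am_gk0)
      have "EE (\<lambda>X. (cmod (bh k X - ?b))\<^sup>2) \<le> EE (\<lambda>X. (b0 / c1)\<^sup>2 * (cmod (qh k X - sb))\<^sup>2)"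
      proof (intro integral_mono integrable_mult_right integrable_pow amd am_qh)
        show "(cmod (bh k X - ?b))\<^sup>2 \<le> (b0 / c1)\<^sup>2 * (cmod (qh k X - sb))\<^sup>2" for X
          unfolding power_mult_distrib[symmetric] by (intro power_mono pt) simp
      qed
      also have "\<dots> \<le> (b0 / c1)\<^sup>2 * (Kh 1 * u\<^sup>2)"
        using mom_qh[OF k, of 1] by (simp only: integral_mult_right_zero) (intro mult_left_mono, auto)
      finally show "EE (\<lambda>X. (cmod (bh k X - ?b))\<^sup>2) \<le> (b0 / c1)\<^sup>2 * (Kh 1 * u\<^sup>2)" .
    qed
    also have "\<dots> = 5 * \<Gamma> * ((b0 / c1) * sqrt (Kh 1) * u)"
    proof -
      have "sqrt (25 * \<Gamma>\<^sup>2) = 5 * \<Gamma>" using Gamma1 by (simp add: sqrt_sq)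
      moreover have "(b0 / c1)\<^sup>2 * (Kh 1 * u\<^sup>2) = Kh 1 * ((b0 / c1) * u)\<^sup>2"
        by (simp only: power_mult_distrib mult_ac)
      moreover have "sqrt (Kh 1 * ((b0 / c1) * u)\<^sup>2) = sqrt (Kh 1) * ((b0 / c1) * u)"
        using b0 c1 u(1) by (intro sqrt_sq) auto
      ultimately show ?thesis by (simp only: mult_ac)
    qed
    finally show "cmod (\<integral>X. gk k X * (bh k X - ?b) \<partial>Om) \<le> 5 * \<Gamma> * ((b0 / c1) * sqrt (Kh 1) * u)" .
    have "cmod (\<integral>X. gk k X - g X \<partial>Om) \<le> EE (\<lambda>X. cmod (gk k X - g X))" by (rule integral_norm_bound)
    also have "\<dots> = EE (\<lambda>X. \<bar>cmod (g X - gk k X)\<bar>)" by (simp add: norm_minus_commute)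
    also have "\<dots> \<le> sqrt (18 * KA * u\<^sup>2 * \<Gamma>\<^sup>2)" by (intro CS1 am_gk ek_final k)
    also have "\<dots> = sqrt (18 * KA) * u * \<Gamma>" using u(1) Gamma1 by (subst sqrt_sq, simp, subst sqrt_sq) auto
    finally show "cmod (\<integral>X. gk k X - g X \<partial>Om) \<le> sqrt (18 * KA) * u * \<Gamma>" .
  qed (use u(1) Gamma1 KA_nonneg in auto)
  also have "\<dots> = KG * \<Gamma> * u" by (simp add: KG_def algebra_simps)
  finally show ?thesis by simp
qed

definition K2 :: real where "K2 = C0 * (KE + (1 + \<tau>)\<^sup>2 * KG)"

text \<open>Each column is treated by \<open>replace_be\<close>, \<open>cross_moment_k\<close> and
  \<open>replace_bh\<close> in turn. The factor \<Gamma> in the error still contains |gb|; it is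
  removed in \<open>linear_perturbation\<close>.\<close>

theorem isotropic_equation:
  "cmod (1 + z * gb - of_real (m / n * (1 + \<tau>)\<^sup>2) * (gb / (1 + sb))) \<le> K2 * u * \<Gamma>"
proof -
  let ?th = "(1 + \<tau>)\<^sup>2"
  have [measurable]: "vy k \<in> borel_measurable Om" "wy k \<in> borel_measurable Om" "be k \<in> borel_measurable Om" if "k < m" for k
    using that by measurable
  have ib: "integrable Om (\<lambda>X. vy k X * wy k X * be k X)" if "k < m" for k
    using that by (auto intro!: integrable_of_allmom_cmod allmom_cmod_mult)
  have "1 + z * gb = (\<integral>X. 1 + z * g X \<partial>Om)"
    unfolding gb_def using integrable_sg(2) by (simp add: PS.Om.prob_space)
  also have "\<dots> = (\<integral>X. (\<Sum>k<m. vy k X * wy k X * be k X) \<partial>Om)" by (simp only: one_plus_z_g)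
  also have "\<dots> = (\<Sum>k<m. (\<integral>X. vy k X * wy k X * be k X \<partial>Om))"
    by (rule Bochner_Integration.integral_sum) (use ib in auto)
  finally have e: "1 + z * gb = (\<Sum>k<m. (\<integral>X. vy k X * wy k X * be k X \<partial>Om))" .
  have "of_real (m / n * ?th) * (gb / (1 + sb)) = (\<Sum>k<m. of_real (?th / n) * (gb / (1 + sb)))"
    by simp
  hence "cmod (1 + z * gb - of_real (m / n * ?th) * (gb / (1 + sb))) = cmod (\<Sum>k<m. (\<integral>X. vy k X * wy k X * be k X \<partial>Om) - of_real (?th / n) * (gb / (1 + sb)))"
    by (simp only: e sum_subtractf)
  also have "\<dots> \<le> (\<Sum>k<m. (KE + ?th * KG) * \<Gamma> * (u / n))"
  proof (rule sum_norm_le)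
    fix k assume "k \<in> {..<m}" hence k: "k < m" by simp
    have 1: "(\<integral>X. vy k X * wy k X * bh k X \<partial>Om) = of_real (?th / n) * (\<integral>X. gk k X * bh k X \<partial>Om)"
      by (rule cross_moment_k[OF k am_bh bh_meas free_bh])
    have "(\<integral>X. vy k X * wy k X * be k X \<partial>Om) - of_real (?th / n) * (gb / (1 + sb))
       = ((\<integral>X. vy k X * wy k X * be k X \<partial>Om) - (\<integral>X. vy k X * wy k X * bh k X \<partial>Om)) + of_real (?th / n) * ((\<integral>X. gk k X * bh k X \<partial>Om) - gb / (1 + sb))"
      (is "?l = ?r")
      unfolding 1 by (simp only: right_diff_distrib) simp
    hence "cmod ?l = cmod ?r" by (rule arg_cong)
    also have "\<dots> \<le> KE * \<Gamma> * (u / n) + (?th / n) * (KG * \<Gamma> * u)"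
    proof (rule order_trans[OF norm_triangle_ineq add_mono[OF replace_be[OF k]]])
      show "cmod (of_real (?th / n) * ((\<integral>X. gk k X * bh k X \<partial>Om) - gb / (1 + sb))) \<le> (?th / n) * (KG * \<Gamma> * u)"
        unfolding norm_mult norm_of_real by (intro mult_mono replace_bh k) auto
    qed
    also have "\<dots> = (KE + ?th * KG) * \<Gamma> * (u / n)"
    proof -
      have "a * G * (w / k) + (t / k) * (b * G * w) = (a + t * b) * G * (w / k)" for a G w k t b :: real
        by (simp add: add_divide_distrib[symmetric]) (simp add: algebra_simps)
      thus ?thesis .
    qed
    finally show "cmod ((\<integral>X. vy k X * wy k X * be k X \<partial>Om) - of_real (?th / n) * (gb / (1 + sb))) \<le> (KE + ?th * KG) * \<Gamma> * (u / n)" .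
  qed
  also have "\<dots> = m * ((KE + ?th * KG) * \<Gamma> * (u / n))" by simp
  also have "\<dots> \<le> (C0 * n) * ((KE + ?th * KG) * \<Gamma> * (u / n))"
  proof (rule mult_right_mono[OF C0(2)])
    have "0 \<le> KG" using b0 c1 KA_nonneg by (simp add: KG_def)
    thus "0 \<le> (KE + ?th * KG) * \<Gamma> * (u / n)" using KT_nonneg Gamma1 u by auto
  qed
  also have "\<dots> = K2 * u * \<Gamma>" using n1 by (simp add: K2_def)
  finally show ?thesis .
qed

lemma variance_final: "EE (\<lambda>X. cmod (g X - gb)) \<le> sqrt (8 * KV) * u * \<Gamma>"
proof -
  have "EE (\<lambda>X. \<bar>cmod (g X - gb)\<bar>) \<le> sqrt (8 * KV * u\<^sup>2 * \<Gamma>\<^sup>2)" by (intro CS1 am_g Vg_le)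
  also have "\<dots> = sqrt (8 * KV) * u * \<Gamma>" using u(1) Gamma1 by (subst sqrt_sq, simp, subst sqrt_sq) auto
  finally show ?thesis by simp
qed

end

section \<open>The Marchenko--Pastur root and the local law\<close>

text \<open>The discriminant of the quadratic with its sign reversed: its real part is positive when
  Re z lies in the bulk, where the principal branch of \<open>csqrt\<close> is continuous. The
  factor i in \<open>mp\<close> restores the sign.\<close>

definition mpD :: "real \<Rightarrow> complex \<Rightarrow> complex" where
  "mpD \<alpha> z = 4 * z - (z + 1 - of_real \<alpha>)\<^sup>2"

text \<open>The Stieltjes transform of the Marchenko--Pastur law, as the root of
  \<open>z m\<^sup>2 + (z + 1 - \<alpha>) m + 1 = 0\<close> in the upper half plane (for \<open>Re z\<close> in the bulk).\<close>

definition mp :: "real \<Rightarrow> complex \<Rightarrow> complex" where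
  "mp \<alpha> z = (- (z + 1 - of_real \<alpha>) + \<i> * csqrt (mpD \<alpha> z)) / (2 * z)"

lemma Re_mpD: "Re (mpD \<alpha> z) = 4 * Re z - (Re z + 1 - \<alpha>)\<^sup>2 + (Im z)\<^sup>2"
  by (simp add: mpD_def power2_eq_square)

lemma bulk_discriminant_pos:
  assumes "0 < \<alpha>" "(1 - sqrt \<alpha>)\<^sup>2 < x" "x < (1 + sqrt \<alpha>)\<^sup>2"
  shows "0 < 4 * x - (x + 1 - \<alpha>)\<^sup>2"
proof -
  have "0 < (x - (1 - sqrt \<alpha>)\<^sup>2) * ((1 + sqrt \<alpha>)\<^sup>2 - x)" using assms by simp
  also have "\<dots> = 4 * x - (x + 1 - \<alpha>)\<^sup>2"
  proof -
    define b where "b = sqrt \<alpha>"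
    have "\<alpha> = b * b" using assms by (simp add: b_def)
    thus ?thesis unfolding b_def[symmetric] by (simp add: power2_eq_square algebra_simps)
  qed
  finally show ?thesis .
qed

lemma mp_root:
  assumes "z \<noteq> 0"
  shows "z * mp \<alpha> z * mp \<alpha> z + (z + 1 - of_real \<alpha>) * mp \<alpha> z + 1 = 0"
proof -
  define w where "w = csqrt (mpD \<alpha> z)"
  define B where "B = z + 1 - of_real \<alpha>"
  have w: "w * w = 4 * z - B * B"
    using power2_csqrt[of "mpD \<alpha> z"] by (simp add: w_def B_def mpD_def power2_eq_square)
  have m: "z * mp \<alpha> z = (- B + \<i> * w) / 2" using assms by (simp add: mp_def w_def B_def)
  have "z * (z * mp \<alpha> z * mp \<alpha> z + B * mp \<alpha> z + 1) = (z * mp \<alpha> z) * (z * mp \<alpha> z) + B * (z * mp \<alpha> z) + z"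
    by (simp add: algebra_simps)
  also have "\<dots> = z - (B * B + w * w) / 4" unfolding m by (simp add: field_simps)
  also have "\<dots> = 0" unfolding w by simp
  finally show ?thesis using assms by (simp add: B_def)
qed

text \<open>In terms of e = 1 + m the quadratic reads e (z e - z + 1 - \<alpha>) + \<alpha> = 0. Its
  constant term \<alpha> keeps e away from 0; the case |e| > 1 is immediate.\<close>

lemma one_plus_mp_lower:
  assumes "z \<noteq> 0" "cmod z \<le> Z" "0 < \<alpha>" "0 \<le> Z"
  shows "\<alpha> / (2 * Z + 1 + \<alpha>) \<le> cmod (1 + mp \<alpha> z)"
proof -
  let ?e = "1 + mp \<alpha> z"
  have d: "0 < 2 * Z + 1 + \<alpha>" using assms by simp
  show ?thesis
  proof (cases "cmod ?e \<le> 1")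
    case True
    have eq: "z * mp \<alpha> z * mp \<alpha> z + (z + 1 - of_real \<alpha>) * mp \<alpha> z + 1 = ?e * (z * ?e - z + 1 - of_real \<alpha>) + of_real \<alpha>"
      by (simp add: algebra_simps)
    have "of_real \<alpha> = - (?e * (z * ?e - z + 1 - of_real \<alpha>))"
      using mp_root[OF assms(1), of \<alpha>] unfolding eq by (simp add: add_eq_0_iff)
    hence "\<alpha> = cmod (?e * (z * ?e - z + 1 - of_real \<alpha>))"
      using assms(3) by (metis abs_of_pos norm_minus_cancel norm_of_real)
    also have "\<dots> = cmod ?e * cmod ((z * ?e - z) + (1 - of_real \<alpha>))" by (simp only: norm_mult add_diff_eq)
    also have "\<dots> \<le> cmod ?e * (2 * Z + 1 + \<alpha>)"
    proof (rule mult_left_mono)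
      have "cmod (z * ?e - z) \<le> cmod z * cmod ?e + cmod z" using norm_triangle_ineq4[of "z * ?e" z] by (simp add: norm_mult)
      also have "\<dots> \<le> Z * 1 + Z" using True assms by (intro add_mono mult_mono) auto
      finally have "cmod (z * ?e - z) \<le> 2 * Z" by simp
      moreover have "cmod (1 - of_real \<alpha>) \<le> 1 + \<alpha>" using norm_triangle_ineq4[of "1::complex" "of_real \<alpha>"] assms by simp
      ultimately show "cmod ((z * ?e - z) + (1 - of_real \<alpha>)) \<le> 2 * Z + 1 + \<alpha>"
        using norm_triangle_ineq[of "z * ?e - z" "1 - of_real \<alpha>"] by linarith
    qed simp
    finally show ?thesis using d by (simp add: divide_le_eq)
  next
    case False
    have "\<alpha> / (2 * Z + 1 + \<alpha>) \<le> 1" using assms by simp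
    thus ?thesis using False by simp
  qed
qed

definition Kst :: "real \<Rightarrow> real \<Rightarrow> real \<Rightarrow> real \<Rightarrow> real" where
  "Kst \<alpha> Z \<kappa> u0 = (1 + (3 * Z + 1 + \<alpha>) * 2 / \<kappa>) / u0"

text \<open>The second root \<open>m'\<close> satisfies \<open>Im (z m') < 0 \<le> Im (z s)\<close>, so in the bulk \<open>s\<close> stays away
  from it and the quadratic equation is stable without any a priori knowledge of \<open>s\<close>.\<close>

lemma mp_stability:
  assumes \<kappa>: "0 < \<kappa>" "\<kappa>\<^sup>2 \<le> 4 * Re z - (Re z + 1 - \<alpha>)\<^sup>2" and u0: "0 < u0" "u0 \<le> Re z"
    and Z: "1 \<le> Z" "cmod z \<le> Z" and iz: "0 \<le> Im z" and \<alpha>: "0 < \<alpha>"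
    and s: "0 \<le> Im (z * s)" "1 + s \<noteq> 0" and e: "cmod (1 + z * s - of_real \<alpha> * (s / (1 + s))) \<le> e"
  shows "cmod (s - mp \<alpha> z) \<le> Kst \<alpha> Z \<kappa> u0 * e"
proof -
  define w where "w = csqrt (mpD \<alpha> z)"
  define B where "B = z + 1 - of_real \<alpha>"
  define a where "a = (- B + \<i> * w) / 2"
  define a' where "a' = (- B - \<i> * w) / 2"
  have z0: "z \<noteq> 0" using u0 by auto
  have ww: "w * w = 4 * z - B * B"
    using power2_csqrt[of "mpD \<alpha> z"] by (simp add: w_def B_def mpD_def power2_eq_square)
  have zm: "z * mp \<alpha> z = a" using z0 by (simp add: mp_def w_def B_def a_def)
  \<comment> \<open>a and a' are z times the two roots, so the defect of the equation factors into
    the distances of z s from both.\<close>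
  have fac: "(z * s - a) * (z * s - a') = z * ((1 + s) * (1 + z * s - of_real \<alpha> * (s / (1 + s))))"
  proof -
    have "(z * s - a) * (z * s - a') = z * s * (z * s) + B * (z * s) + (B * B + w * w) / 4"
      by (simp add: a_def a'_def field_simps)
    also have "\<dots> = z * (z * s * s + B * s + 1)" unfolding ww by (simp add: algebra_simps)
    also have "z * s * s + B * s + 1 = (1 + s) * (1 + z * s) - of_real \<alpha> * s" by (simp add: B_def algebra_simps)
    also have "\<dots> = (1 + s) * (1 + z * s - of_real \<alpha> * (s / (1 + s)))" using s(2) by (simp add: right_diff_distrib)
    finally show ?thesis .
  qed
  have e0: "0 \<le> e" using e norm_ge_zero order_trans by blast
  have Rew: "\<kappa> \<le> Re w"
  proof (rule power2_le_imp_le)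
    have "(Re w)\<^sup>2 = Re (mpD \<alpha> z) + (Im w)\<^sup>2"
      using arg_cong[OF power2_csqrt[of "mpD \<alpha> z"], of Re] by (simp add: w_def power2_eq_square)
    thus "\<kappa>\<^sup>2 \<le> (Re w)\<^sup>2" using \<kappa>(2) by (simp add: Re_mpD add_increasing2)
    show "0 \<le> Re w" using csqrt_principal[of "mpD \<alpha> z"] unfolding w_def by linarith
  qed
  have lower: "\<kappa> / 2 \<le> cmod (z * s - a')"
  proof -
    have "Im a' = - (Im z + Re w) / 2" by (simp add: a'_def B_def)
    hence "\<kappa> / 2 \<le> Im (z * s - a')" using s(1) Rew iz by simp
    also have "\<dots> \<le> cmod (z * s - a')" using abs_Im_le_cmod[of "z * s - a'"] by linarith
    finally show ?thesis .
  qed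
  have Bn: "cmod B \<le> Z + 1 + \<alpha>"
  proof -
    have "cmod B \<le> cmod z + cmod (1 - of_real \<alpha>)" using norm_triangle_ineq[of z "1 - of_real \<alpha>"] by (simp add: B_def algebra_simps)
    also have "cmod (1 - of_real \<alpha>) \<le> 1 + \<alpha>" using norm_triangle_ineq4[of "1::complex" "of_real \<alpha>"] \<alpha> by simp
    finally show ?thesis using Z by simp
  qed
  have wn: "cmod w \<le> 2 * Z + cmod B"
  proof (rule power2_le_imp_le)
    have "(cmod w)\<^sup>2 = cmod (w * w)" by (simp add: norm_mult power2_eq_square)
    also have "\<dots> \<le> cmod (4 * z) + cmod (B * B)" unfolding ww by (rule norm_triangle_ineq4)
    also have "\<dots> \<le> 4 * Z + (cmod B)\<^sup>2" using Z by (simp add: norm_mult power2_eq_square)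
    also have "\<dots> \<le> (2 * Z + cmod B)\<^sup>2"
    proof -
      have "4 * Z * 1 \<le> 4 * Z * Z" using Z by (intro mult_left_mono) auto
      moreover have "0 \<le> 4 * Z * cmod B" using Z by simp
      ultimately show ?thesis by (simp add: power2_eq_square algebra_simps)
    qed
    finally show "(cmod w)\<^sup>2 \<le> (2 * Z + cmod B)\<^sup>2" .
  qed (use Z in auto)
  have a'n: "cmod a' \<le> 2 * Z + 1 + \<alpha>"
  proof -
    have "2 * cmod a' = cmod (- B - \<i> * w)" by (simp add: a'_def norm_divide)
    also have "\<dots> \<le> cmod B + cmod w"
      using norm_triangle_ineq4[of "- B" "\<i> * w"] by (simp add: norm_mult)
    also have "\<dots> \<le> 2 * (Z + cmod B)" using wn by simp
    also have "\<dots> \<le> 2 * (Z + (Z + 1 + \<alpha>))" using Bn by simp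
    finally show ?thesis by simp
  qed
  have "cmod (z * (1 + s)) \<le> cmod z + cmod a' + cmod (z * s - a')"
    using norm_triangle_ineq[of "z + a'" "z * s - a'"] norm_triangle_ineq[of z a'] by (simp add: algebra_simps)
  also have "\<dots> \<le> (3 * Z + 1 + \<alpha>) + cmod (z * s - a')" using a'n Z by simp
  \<comment> \<open>The constant part is absorbed because (2 / \<kappa>) |z s - a'| is at least 1.
    The whole factor is then proportional to the distance from a', which cancels even when s is
    large.\<close>
  also have "\<dots> \<le> (3 * Z + 1 + \<alpha>) * (2 / \<kappa> * cmod (z * s - a')) + cmod (z * s - a')"
  proof -
    have "(3 * Z + 1 + \<alpha>) * 1 \<le> (3 * Z + 1 + \<alpha>) * (2 / \<kappa> * cmod (z * s - a'))"
      using lower \<kappa> Z \<alpha> by (intro mult_left_mono) (auto simp: field_simps)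
    thus ?thesis by simp
  qed
  also have "\<dots> = (1 + (3 * Z + 1 + \<alpha>) * 2 / \<kappa>) * cmod (z * s - a')" by (simp add: algebra_simps)
  finally have zs: "cmod (z * (1 + s)) \<le> (1 + (3 * Z + 1 + \<alpha>) * 2 / \<kappa>) * cmod (z * s - a')" .
  have pos: "0 < cmod (z * s - a')" using lower \<kappa> by linarith
  have "cmod (z * s - a) * cmod (z * s - a') = cmod (z * (1 + s)) * cmod (1 + z * s - of_real \<alpha> * (s / (1 + s)))"
    using arg_cong[OF fac, of cmod] by (simp only: norm_mult mult.assoc)
  also have "\<dots> \<le> ((1 + (3 * Z + 1 + \<alpha>) * 2 / \<kappa>) * cmod (z * s - a')) * e"
    using zs e e0 \<kappa> Z \<alpha> by (intro mult_mono) auto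
  finally have "cmod (z * s - a) * cmod (z * s - a') \<le> ((1 + (3 * Z + 1 + \<alpha>) * 2 / \<kappa>) * e) * cmod (z * s - a')"
    by (simp only: mult_ac)
  hence 1: "cmod (z * s - a) \<le> (1 + (3 * Z + 1 + \<alpha>) * 2 / \<kappa>) * e"
    using pos mult_right_le_imp_le by blast
  have "u0 * cmod (s - mp \<alpha> z) \<le> cmod z * cmod (s - mp \<alpha> z)"
    using u0 complex_Re_le_cmod[of z] by (intro mult_right_mono) auto
  also have "\<dots> = cmod (z * s - a)" by (simp add: norm_mult[symmetric] zm[symmetric] right_diff_distrib)
  finally have "u0 * cmod (s - mp \<alpha> z) \<le> (1 + (3 * Z + 1 + \<alpha>) * 2 / \<kappa>) * e" using 1 by linarith
  thus ?thesis using u0 by (simp add: Kst_def field_simps)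
qed

section \<open>The mean trace down to small imaginary parts\<close>

context entry_law
begin

abbreviation Omm where "Omm n m \<equiv> PiM {..<m::nat} (\<lambda>_. C n)"

lemma modelI: "1 \<le> n \<Longrightarrow> (\<Sum>i<n. (v i)\<^sup>2) = 1 \<Longrightarrow> 0 < Im z \<Longrightarrow> model P n v z"
  by (simp add: model_def model_axioms_def entry_law_axioms)

lemma sb_lipschitz:
  assumes n: "1 \<le> n" and v: "(\<Sum>i<n. (v i)\<^sup>2) = 1" and e: "0 < e" "e \<le> Im z1" "e \<le> Im z2"
  shows "cmod (model.sb P n m \<tau> v z1 - model.sb P n m \<tau> v z2) \<le> cmod (z1 - z2) / e\<^sup>2"
proof -
  interpret M1: model P n m \<tau> v z1 using e by (intro modelI n v) auto
  interpret M2: model P n m \<tau> v z2 using e by (intro modelI n v) auto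
  have "cmod (M1.sb - M2.sb) = cmod (\<integral>X. M1.s X - M2.s X \<partial>Omm n m)"
    unfolding M1.sb_def M2.sb_def using M1.integrable_sg(1) M2.integrable_sg(1) by simp
  also have "\<dots> \<le> (\<integral>X. cmod (M1.s X - M2.s X) \<partial>Omm n m)" by (rule integral_norm_bound)
  also have "\<dots> \<le> (\<integral>X. cmod (z1 - z2) / e\<^sup>2 \<partial>Omm n m)"
  proof (rule integral_mono)
    show "integrable (Omm n m) (\<lambda>X. cmod (M1.s X - M2.s X))"
      using M1.integrable_sg(1) M2.integrable_sg(1) by auto
    show "cmod (M1.s X - M2.s X) \<le> cmod (z1 - z2) / e\<^sup>2" for X
      unfolding M1.s_def M2.s_def M1.cols_def M2.cols_def M1.Y_def M2.Y_def
      using e by (intro trn_lipschitz)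
  qed simp
  also have "\<dots> = cmod (z1 - z2) / e\<^sup>2" by (simp add: M1.PS.Om.prob_space)
  finally show ?thesis .
qed

lemma sb_properties:
  assumes n: "1 \<le> n" and v: "(\<Sum>i<n. (v i)\<^sup>2) = 1" and z: "0 < Im z"
  shows "cmod (model.sb P n m \<tau> v z) \<le> 1 / Im z" "0 \<le> Im (z * model.sb P n m \<tau> v z)"
proof -
  interpret M: model P n m \<tau> v z by (intro modelI n v z)
  have "cmod M.sb \<le> (\<integral>X. cmod (M.s X) \<partial>Omm n m)" unfolding M.sb_def by (rule integral_norm_bound)
  also have "\<dots> \<le> (\<integral>X. 1 / Im z \<partial>Omm n m)"
    using M.integrable_sg(1) by (intro integral_mono M.bounds) auto
  finally show "cmod M.sb \<le> 1 / Im z" by (simp add: M.PS.Om.prob_space)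
  have "Im (z * M.sb) = (\<integral>X. Im (z * M.s X) \<partial>Omm n m)"
    unfolding M.sb_def using M.integrable_sg(1) by (simp del: times_complex.sel)
  thus "0 \<le> Im (z * M.sb)" by (simp only:) (intro integral_nonneg_AE AE_I2 M.bounds)
qed

text \<open>A bootstrap: if |1 + sb| \<ge> c1, the equation and its stability put sb within E \<le>
  c1 / 2 of the Marchenko-Pastur root, which is at distance at least 2 c1 from -1, and hence |1 +
  sb| \<ge> 3/2 c1. A continuous function that is at least c1 at height 2 and never equals c1 in
  between cannot drop below c1. The term |m / n - \<alpha>| in E pays for writing \<alpha> in the
  equation.\<close>

lemma local_law_trace:
  assumes n: "1 \<le> n" and v: "(\<Sum>i<n. (v i)\<^sup>2) = 1"
    and C0: "1 \<le> C0" "real m \<le> C0 * n" and Z: "1 \<le> Z" "\<bar>a\<bar> + 2 \<le> Z" and \<alpha>: "0 < \<alpha>"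
    and \<kappa>: "0 < \<kappa>" "\<kappa>\<^sup>2 \<le> 4 * a - (a + 1 - \<alpha>)\<^sup>2" and u0: "0 < u0" "u0 \<le> a"
    and \<eta>0: "0 < \<eta>0" "real n ^ 4 \<le> (n * \<eta>0\<^sup>2) ^ r" and r: "1 \<le> r"
    and c1_def: "c1 = \<alpha> / (2 * Z + 1 + \<alpha>) / 2"
    and E_def: "E = Kst \<alpha> Z \<kappa> u0 * (\<bar>bulk.K1 P \<tau> C0 Z c1 r\<bar> * (1 / sqrt (n * \<eta>0\<^sup>2)) + \<bar>m / n - \<alpha>\<bar> * (1 + 1 / c1))"
    and small: "E \<le> c1 / 2"
    and \<eta>: "\<eta>0 \<le> \<eta>" "\<eta> \<le> 2"
  shows "c1 \<le> cmod (1 + model.sb P n m \<tau> v (Complex a \<eta>))"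
    "cmod (model.sb P n m \<tau> v (Complex a \<eta>) - mp \<alpha> (Complex a \<eta>)) \<le> E"
proof -
  define f where "f y = model.sb P n m \<tau> v (Complex a y)" for y
  have c1: "0 < c1" using \<alpha> Z by (simp add: c1_def)
  have zn: "cmod (Complex a y) \<le> Z" if "\<bar>y\<bar> \<le> 2" for y
    using Z that cmod_le[of "Complex a y"] by simp
  have step: "cmod (f y - mp \<alpha> (Complex a y)) \<le> E" if y: "\<eta>0 \<le> y" "y \<le> 2" and c: "c1 \<le> cmod (1 + f y)" for y
  proof -
    let ?z = "Complex a y"
    have iz: "0 < Im ?z" using y \<eta>0 by simp
    have "real n * \<eta>0\<^sup>2 \<le> n * (Im ?z)\<^sup>2" using y \<eta>0 by (intro mult_left_mono power_mono) auto
    hence mono: "(n * \<eta>0\<^sup>2) ^ r \<le> (n * (Im ?z)\<^sup>2) ^ r" "sqrt (n * \<eta>0\<^sup>2) \<le> sqrt (n * (Im ?z)\<^sup>2)"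
      by (auto intro!: power_mono)
    have big: "real n ^ 4 \<le> (n * (Im ?z)\<^sup>2) ^ r" using mono(1) \<eta>0(2) by linarith
    interpret B: bulk P n m \<tau> v ?z C0 Z c1 "cmod (f y)" r
      unfolding bulk_def bulk_axioms_def
      using modelI[OF n v iz] C0 Z(1) zn[of y] y \<eta>0 c1 c r big by (auto simp: f_def)
    have ne: "1 + f y \<noteq> 0" using c c1 by auto
    have u: "B.u \<le> 1 / sqrt (n * \<eta>0\<^sup>2)"
      unfolding B.u_def B.NN_def using mono \<eta>0 n y by (intro divide_left_mono mult_pos_pos) auto
    have q: "cmod (f y / (1 + f y)) \<le> 1 + 1 / c1"
    proof -
      have "f y / (1 + f y) = 1 - 1 / (1 + f y)" using ne by (simp add: field_simps)
      hence "cmod (f y / (1 + f y)) \<le> 1 + 1 / cmod (1 + f y)"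
        using norm_triangle_ineq4[of 1 "1 / (1 + f y)"] by (simp add: norm_divide)
      also have "\<dots> \<le> 1 + 1 / c1" using c c1 by (intro add_left_mono divide_left_mono mult_pos_pos) auto
      finally show ?thesis .
    qed
    have "cmod (1 + ?z * f y - of_real \<alpha> * (f y / (1 + f y))) \<le> cmod (1 + ?z * f y - of_real (m / n) * (f y / (1 + f y))) + cmod (of_real (m / n - \<alpha>) * (f y / (1 + f y)))"
      by (rule order_trans[OF _ norm_triangle_ineq]) (simp add: algebra_simps)
    also have "\<dots> \<le> bulk.K1 P \<tau> C0 Z c1 r * B.u + \<bar>m / n - \<alpha>\<bar> * (1 + 1 / c1)"
      unfolding norm_mult[of "of_real _"] norm_of_real using B.trace_equation
      by (intro add_mono mult_left_mono q) (auto simp: f_def)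
    also have "\<dots> \<le> \<bar>bulk.K1 P \<tau> C0 Z c1 r\<bar> * (1 / sqrt (n * \<eta>0\<^sup>2)) + \<bar>m / n - \<alpha>\<bar> * (1 + 1 / c1)"
      using u B.u(1) by (intro add_right_mono mult_mono) auto
    finally have "cmod (1 + ?z * f y - of_real \<alpha> * (f y / (1 + f y))) \<le> \<bar>bulk.K1 P \<tau> C0 Z c1 r\<bar> * (1 / sqrt (n * \<eta>0\<^sup>2)) + \<bar>m / n - \<alpha>\<bar> * (1 + 1 / c1)" .
    thus ?thesis unfolding E_def
      using \<kappa> u0 Z zn[of y] y \<eta>0 iz \<alpha> ne sb_properties(2)[OF n v iz]
      by (intro mp_stability) (auto simp: f_def)
  qed
  have up: "3/2 * c1 \<le> cmod (1 + f y)" if y: "\<eta>0 \<le> y" "y \<le> 2" and c: "c1 \<le> cmod (1 + f y)" for y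
  proof -
    have tw: "2 * (X / 2) = X" for X :: real by simp
    have "2 * c1 = \<alpha> / (2 * Z + 1 + \<alpha>)" unfolding c1_def by (rule tw)
    also have "\<dots> \<le> cmod (1 + mp \<alpha> (Complex a y))"
      using zn[of y] y \<eta>0 \<alpha> Z u0 by (intro one_plus_mp_lower) (auto simp: complex_eq_iff)
    finally have "2 * c1 \<le> cmod (1 + mp \<alpha> (Complex a y))" .
    moreover have "cmod (1 + mp \<alpha> (Complex a y)) \<le> cmod (1 + f y) + cmod (f y - mp \<alpha> (Complex a y))"
      using norm_triangle_ineq4[of "1 + f y" "f y - mp \<alpha> (Complex a y)"] by simp
    ultimately show ?thesis using step[OF y c] small by linarith
  qed
  have cont: "continuous_on {\<eta>..2} (\<lambda>y. cmod (1 + f y))"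
  proof (rule continuous_on_norm, rule continuous_on_add[OF continuous_on_const])
    show "continuous_on {\<eta>..2} f"
    proof (rule lipschitz_on_continuous_on)
      show "(1 / \<eta>0\<^sup>2)-lipschitz_on {\<eta>..2} f"
      proof (rule lipschitz_onI)
        fix y y' assume "y \<in> {\<eta>..2}" "y' \<in> {\<eta>..2}"
        hence "cmod (f y - f y') \<le> cmod (Complex a y - Complex a y') / \<eta>0\<^sup>2"
          unfolding f_def using \<eta>0 \<eta> by (intro sb_lipschitz n v) auto
        also have "Complex a y - Complex a y' = \<i> * of_real (y - y')" by (simp add: complex_eq_iff)
        finally show "dist (f y) (f y') \<le> 1 / \<eta>0\<^sup>2 * dist y y'"
          by (simp add: dist_norm norm_mult del: of_real_diff)
      qed (use \<eta>0 in auto)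
    qed
  qed
  \<comment> \<open>The starting point is height 2, where |sb| \<le> 1 / Im z = 1 / 2 keeps 1 + sb
    away from 0.\<close>
  have f2: "c1 \<le> cmod (1 + f 2)"
  proof -
    have "cmod (f 2) \<le> 1 / 2" unfolding f_def using sb_properties(1)[OF n v, of "Complex a 2"] by simp
    hence "1 / 2 \<le> cmod (1 + f 2)" using norm_triangle_ineq4[of "1 + f 2" "f 2"] by simp
    moreover have "c1 \<le> 1 / 2"
    proof -
      have "\<alpha> / (2 * Z + 1 + \<alpha>) \<le> 1" using \<alpha> Z by simp
      thus ?thesis unfolding c1_def by (rule divide_right_mono) simp
    qed
    ultimately show ?thesis by linarith
  qed
  show c: "c1 \<le> cmod (1 + model.sb P n m \<tau> v (Complex a \<eta>))"
  proof (rule ccontr)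
    assume "\<not> ?thesis"
    hence "cmod (1 + f \<eta>) \<le> c1" by (simp add: f_def)
    from IVT'[OF this f2 \<eta>(2) cont] obtain y where y: "\<eta> \<le> y" "y \<le> 2" "cmod (1 + f y) = c1" by auto
    from up[of y] y \<eta> c1 show False by simp
  qed
  show "cmod (model.sb P n m \<tau> v (Complex a \<eta>) - mp \<alpha> (Complex a \<eta>)) \<le> E"
    using step[of \<eta>] \<eta> c by (simp add: f_def)
qed

end

lemma linear_perturbation:
  fixes w D D' :: complex
  assumes "cmod (1 + w * D) \<le> e * (1 + cmod w)" "cmod (D - D') \<le> e'" "0 < c2" "cmod D' = c2"
    "0 \<le> e" "0 \<le> e'" "e + e' \<le> c2 / 2" "e + e' \<le> 1"
  shows "cmod w \<le> 4 / c2" "cmod (w + 1 / D') \<le> (e + e') * (1 + 4 / c2) / c2"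
proof -
  have "1 + w * D' = (1 + w * D) - w * (D - D')" by (simp add: algebra_simps)
  hence "cmod (1 + w * D') \<le> cmod (1 + w * D) + cmod w * cmod (D - D')"
    by (metis norm_mult norm_triangle_ineq4)
  also have "\<dots> \<le> e * (1 + cmod w) + cmod w * e'" using assms by (intro add_mono mult_left_mono) auto
  also have "\<dots> \<le> (e + e') * (1 + cmod w)" using assms by (simp add: algebra_simps)
  finally have 1: "cmod (1 + w * D') \<le> (e + e') * (1 + cmod w)" .
  have "cmod w * c2 = cmod (w * D')" using assms by (simp add: norm_mult)
  also have "\<dots> \<le> cmod (1 + w * D') + 1" using norm_triangle_ineq4[of "1 + w * D'" 1] by simp
  also have "\<dots> \<le> (e + e') * (1 + cmod w) + 1" using 1 by simp
  also have "\<dots> = (e + e') + (e + e') * cmod w + 1" by (simp add: algebra_simps)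
  also have "\<dots> \<le> 1 + (c2 / 2) * cmod w + 1" using assms by (intro add_mono mult_right_mono) auto
  finally have "cmod w * (c2 / 2) \<le> 2" by (simp add: algebra_simps)
  thus w: "cmod w \<le> 4 / c2" using assms by (simp add: field_simps)
  have D': "D' \<noteq> 0" using assms by auto
  have "w + 1 / D' = (1 + w * D') / D'" using D' by (simp add: field_simps)
  hence "cmod (w + 1 / D') = cmod (1 + w * D') / c2" using assms by (simp add: norm_divide)
  also have "\<dots> \<le> (e + e') * (1 + cmod w) / c2" using 1 assms by (intro divide_right_mono) auto
  also have "\<dots> \<le> (e + e') * (1 + 4 / c2) / c2"
    using w assms by (intro divide_right_mono mult_left_mono) auto
  finally show "cmod (w + 1 / D') \<le> (e + e') * (1 + 4 / c2) / c2" .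
qed

lemma isCont_mp:
  assumes "0 < Re (mpD \<alpha> z)" "z \<noteq> 0"
  shows "isCont (mp \<alpha>) z"
proof -
  have "mpD \<alpha> z \<notin> \<real>\<^sub>\<le>\<^sub>0" using assms by (auto simp: complex_nonpos_Reals_iff)
  hence c: "isCont csqrt (mpD \<alpha> z)" by (rule continuous_at_csqrt)
  have "isCont (mpD \<alpha>) z" unfolding mpD_def[abs_def] by (intro continuous_intros)
  hence "isCont (\<lambda>z. csqrt (mpD \<alpha> z)) z" using isCont_o2 c by blast
  thus ?thesis unfolding mp_def[abs_def] using assms by (intro continuous_intros) auto
qed

lemma Im_mp_real:
  assumes "0 < x" "0 < 4 * x - (x + 1 - \<alpha>)\<^sup>2"
  shows "mp \<alpha> (of_real x) = Complex (- (x + 1 - \<alpha>) / (2 * x)) (sqrt (4 * x - (x + 1 - \<alpha>)\<^sup>2) / (2 * x))"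
proof -
  have "mpD \<alpha> (of_real x) = of_real (4 * x - (x + 1 - \<alpha>)\<^sup>2)" by (simp add: mpD_def)
  hence "csqrt (mpD \<alpha> (of_real x)) = of_real (sqrt (4 * x - (x + 1 - \<alpha>)\<^sup>2))"
    using assms by (simp only: csqrt_of_real)
  hence "mp \<alpha> (of_real x) = (of_real (- (x + 1 - \<alpha>)) + \<i> * of_real (sqrt (4 * x - (x + 1 - \<alpha>)\<^sup>2))) / of_real (2 * x)"
    by (simp add: mp_def)
  thus ?thesis by (simp add: complex_eq_iff)
qed

text \<open>The isotropic equation is 1 + gb D = small with D = z - (m / n) \<theta> / (1 + sb).
  This is the limit of D as n grows and z approaches x, so g tends to -1 /
  \<open>Dlim\<close>.\<close>

definition Dlim :: "real \<Rightarrow> real \<Rightarrow> real \<Rightarrow> complex" where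
  "Dlim \<alpha> \<theta> x = of_real x - of_real (\<alpha> * \<theta>) / (1 + mp \<alpha> (of_real x))"

text \<open>For \<theta> > 0 the imaginary part is positive because that of the Marchenko-Pastur
  root is positive in the bulk; for \<theta> = 0 the value is x.\<close>

lemma Dlim_nonzero:
  assumes x: "0 < x" "0 < 4 * x - (x + 1 - \<alpha>)\<^sup>2" and "0 < \<alpha>" "0 \<le> \<theta>"
  shows "Dlim \<alpha> \<theta> x \<noteq> 0"
proof (cases "\<theta> = 0")
  case True thus ?thesis using x by (simp add: Dlim_def)
next
  case False
  let ?m = "1 + mp \<alpha> (of_real x)"
  have im: "Im ?m = sqrt (4 * x - (x + 1 - \<alpha>)\<^sup>2) / (2 * x)" by (simp add: Im_mp_real[OF x])
  hence ip: "0 < Im ?m" using x by simp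
  hence "0 < (Re ?m)\<^sup>2 + (Im ?m)\<^sup>2" by (intro add_nonneg_pos) auto
  hence "0 < \<alpha> * \<theta> * Im ?m / ((Re ?m)\<^sup>2 + (Im ?m)\<^sup>2)" using assms False ip by simp
  moreover have "Im (Dlim \<alpha> \<theta> x) = \<alpha> * \<theta> * Im ?m / ((Re ?m)\<^sup>2 + (Im ?m)\<^sup>2)"
    unfolding Dlim_def by (simp add: Im_divide)
  ultimately show ?thesis by auto
qed

section \<open>Convergence in mean of both Stieltjes transforms\<close>

context entry_law
begin

lemma mean_deviation_s:
  assumes "bulk P n m \<tau> v z C0 Z c1 S0 r"
  shows "(\<integral>X. cmod (model.s n m \<tau> v z X - c) \<partial>Omm n m) \<le> sqrt (ES2 1 * C0) * bulk.u n z + cmod (model.sb P n m \<tau> v z - c)"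
proof -
  interpret B: bulk P n m \<tau> v z C0 Z c1 S0 r by fact
  have "(\<integral>X. \<bar>cmod (B.s X - B.sb)\<bar> \<partial>Omm n m) \<le> sqrt (ES2 1 * C0 * B.u\<^sup>2)"
    using B.conc_s[of 1] by (intro B.CS1 B.am_s) simp
  also have "\<dots> = sqrt (ES2 1 * C0) * B.u" using B.u(1) by (intro B.sqrt_sq) simp
  finally have 1: "(\<integral>X. cmod (B.s X - B.sb) \<partial>Omm n m) \<le> sqrt (ES2 1 * C0) * B.u" by simp
  have i: "integrable (Omm n m) (\<lambda>X. cmod (B.s X - B.sb))" by (rule allmom_integrable[OF B.am_s])
  have "(\<integral>X. cmod (B.s X - c) \<partial>Omm n m) \<le> (\<integral>X. cmod (B.s X - B.sb) + cmod (B.sb - c) \<partial>Omm n m)"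
  proof (rule integral_mono)
    show "integrable (Omm n m) (\<lambda>X. cmod (B.s X - c))" using B.integrable_sg(1) by auto
    show "cmod (B.s X - c) \<le> cmod (B.s X - B.sb) + cmod (B.sb - c)" for X
      using norm_triangle_ineq[of "B.s X - B.sb" "B.sb - c"] by simp
  qed (use i in auto)
  also have "\<dots> = (\<integral>X. cmod (B.s X - B.sb) \<partial>Omm n m) + cmod (B.sb - c)"
    using i by (simp add: B.PS.Om.prob_space)
  finally show ?thesis using 1 by linarith
qed

lemma mean_deviation_g:
  assumes "bulk_small P n m \<tau> v z C0 Z c1 S0 r"
  shows "(\<integral>X. cmod (model.g n m \<tau> v z X - c) \<partial>Omm n m)
     \<le> sqrt (8 * bulk.KV P \<tau> C0 Z c1 r) * bulk.u n z * (1 + cmod (model.gb P n m \<tau> v z)) + cmod (model.gb P n m \<tau> v z - c)"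
proof -
  interpret B: bulk_small P n m \<tau> v z C0 Z c1 S0 r by fact
  have i: "integrable (Omm n m) (\<lambda>X. cmod (B.g X - B.gb))" by (rule allmom_integrable[OF B.am_g])
  have "(\<integral>X. cmod (B.g X - c) \<partial>Omm n m) \<le> (\<integral>X. cmod (B.g X - B.gb) + cmod (B.gb - c) \<partial>Omm n m)"
  proof (rule integral_mono)
    show "integrable (Omm n m) (\<lambda>X. cmod (B.g X - c))" using B.integrable_sg(2) by auto
    show "cmod (B.g X - c) \<le> cmod (B.g X - B.gb) + cmod (B.gb - c)" for X
      using norm_triangle_ineq[of "B.g X - B.gb" "B.gb - c"] by simp
  qed (use i in auto)
  also have "\<dots> = (\<integral>X. cmod (B.g X - B.gb) \<partial>Omm n m) + cmod (B.gb - c)"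
    using i by (simp add: B.PS.Om.prob_space)
  finally show ?thesis using B.variance_final by (simp add: B.\<Gamma>_def)
qed

text \<open>Collects finitely many smallness conditions, given as pairs of a coefficient and a
  bound, so that a single t serves all of them.\<close>

lemma exists_small:
  fixes f :: "nat \<Rightarrow> real \<times> real"
  assumes "\<And>i. i < k \<Longrightarrow> 0 < snd (f i)"
  shows "\<exists>t>0. t \<le> (1::real) \<and> (\<forall>i<k. fst (f i) * t \<le> snd (f i))"
proof -
  have "\<forall>\<^sub>F t in at_right (0::real). fst (f i) * t \<le> snd (f i)" if "i < k" for i
  proof -
    have "((\<lambda>t. fst (f i) * t) \<longlongrightarrow> fst (f i) * 0) (at_right 0)" by (intro tendsto_mult tendsto_const tendsto_ident_at)
    hence "\<forall>\<^sub>F t in at_right 0. fst (f i) * t < snd (f i)" using assms[OF that] by (intro order_tendstoD) auto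
    thus ?thesis by eventually_elim auto
  qed
  hence "\<forall>\<^sub>F t in at_right (0::real). \<forall>i\<in>{..<k}. fst (f i) * t \<le> snd (f i)"
    by (intro eventually_ball_finite) auto
  moreover have "\<forall>\<^sub>F t in at_right (0::real). t < 1" by (rule eventually_at_right_real[THEN eventually_mono]) auto
  moreover have "\<forall>\<^sub>F t in at_right (0::real). 0 < t" by (rule eventually_at_right_less)
  ultimately have "\<forall>\<^sub>F t in at_right (0::real). 0 < t \<and> t \<le> 1 \<and> (\<forall>i<k. fst (f i) * t \<le> snd (f i))"
    by eventually_elim auto
  thus ?thesis using eventually_happens'[OF trivial_limit_at_right_real] by blast
qed

text \<open>The strip is a fixed neighbourhood of x, so the limits at x itself serve for all z in
  it; only its lower edge depends on n. The bounds concern the expectation for each v and z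
  separately, uniformly in both, and no supremum stands inside the integral.\<close>

theorem local_law:
  fixes m :: "nat \<Rightarrow> nat" and \<eta> :: "nat \<Rightarrow> real"
  assumes \<alpha>: "0 < \<alpha>" and x: "(1 - sqrt \<alpha>)\<^sup>2 < x" "x < (1 + sqrt \<alpha>)\<^sup>2"
    and m: "(\<lambda>n. real (m n) / real n) \<longlonglongrightarrow> \<alpha>"
    and \<eta>: "\<And>n. 1 \<le> n \<Longrightarrow> 0 < \<eta> n" and d: "0 < d" "\<forall>\<^sub>F n in sequentially. real n powr d \<le> n * (\<eta> n)\<^sup>2"
    and e: "0 < e" and \<theta>: "\<theta> = (1 + \<tau>)\<^sup>2"
  shows "\<exists>\<rho>>0. \<forall>\<^sub>F n in sequentially. \<forall>v z. (\<Sum>i<n. (v i)\<^sup>2) = 1 \<longrightarrow> \<bar>Re z - x\<bar> \<le> \<rho> \<longrightarrow> \<eta> n \<le> Im z \<longrightarrow> Im z \<le> \<rho> \<longrightarrow>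
     (\<integral>X. cmod (model.s n (m n) \<tau> v z X - mp \<alpha> (of_real x)) \<partial>Omm n (m n)) \<le> e \<and>
     (\<integral>X. cmod (model.g n (m n) \<tau> v z X + 1 / Dlim \<alpha> \<theta> x) \<partial>Omm n (m n)) \<le> e"
proof -
  define F where "F a = 4 * a - (a + 1 - \<alpha>)\<^sup>2" for a
  have F0: "0 < F x" unfolding F_def by (rule bulk_discriminant_pos[OF \<alpha> x])
  have x0: "0 < x" using x(1) zero_le_power2[of "1 - sqrt \<alpha>"] by linarith
  have "isCont F x" unfolding F_def[abs_def] by (intro continuous_intros)
  hence "\<forall>\<^sub>F a in at x. F x / 2 < F a"
    using F0 by (intro order_tendstoD(1)[of F "F x"]) (auto simp: isCont_def)
  then obtain \<rho>0 where \<rho>0: "0 < \<rho>0" "\<And>a. a \<noteq> x \<Longrightarrow> dist a x < \<rho>0 \<Longrightarrow> F x / 2 < F a"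
    unfolding eventually_at by blast
  have Fa: "F x / 2 \<le> F a" if "\<bar>a - x\<bar> < \<rho>0" for a
    using \<rho>0(2)[of a] that F0 by (cases "a = x") (auto simp: dist_real_def less_imp_le)
  define \<kappa> where "\<kappa> = sqrt (F x / 2)"
  have \<kappa>: "0 < \<kappa>" "\<kappa>\<^sup>2 = F x / 2" using F0 by (auto simp: \<kappa>_def)
  \<comment> \<open>Z exceeds |Re z| + 2 once |Re z - x| \<le> x / 2, C0 bounds m / n as soon as |m
    / n - \<alpha>| \<le> 1, and c1 is half of the lower bound of
    \<open>one_plus_mp_lower\<close>.\<close>
  define C0 Z c1 where "C0 = \<alpha> + 1" and "Z = 2 * x + 3" and "c1 = \<alpha> / (2 * Z + 1 + \<alpha>) / 2"
  \<comment> \<open>With d r \<ge> 4, the hypothesis n \<eta>^2 \<ge> n^d gives (n \<eta>^2)^r \<ge>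
    n^4, as \<open>bulk\<close> requires.\<close>
  obtain r :: nat where r: "4 / d \<le> r" "1 \<le> r"
    by (metis max.bounded_iff of_nat_1 of_nat_le_iff real_arch_simple)
  have rd: "4 \<le> d * r" using r d by (simp add: field_simps)
  define m0 where "m0 = mp \<alpha> (of_real x)"
  define S0 where "S0 = cmod m0 + 2"
  define K1 where "K1 = \<bar>bulk.K1 P \<tau> C0 Z c1 r\<bar>"
  define K2 where "K2 = \<bar>bulk_small.K2 P \<tau> C0 Z c1 S0 r\<bar>"
  define KK where "KK = 8 * (bulk.KA P \<tau> C0 Z c1 r + bulk.KV P \<tau> C0 Z c1 r)"
  define c2 where "c2 = cmod (Dlim \<alpha> \<theta> x)"
  have \<theta>0: "0 \<le> \<theta>" by (simp add: \<theta>)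
  have c2: "0 < c2" using Dlim_nonzero[OF x0 F0[unfolded F_def] \<alpha> \<theta>0] by (simp add: c2_def)
  have pos: "1 \<le> C0" "1 \<le> Z" "0 < c1" using \<alpha> x0 by (auto simp: C0_def Z_def c1_def)
  \<comment> \<open>A1 t will bound |sb - mp z|, A2 t the distance of D from \<open>Dlim\<close>,
    and A3 t and A4 t the mean deviations of s and g; t controls u, |m / n - \<alpha>| and the
    oscillation of \<open>mp\<close> at once.\<close>
  define A1 where "A1 = Kst \<alpha> Z \<kappa> (x / 2) * (K1 + (1 + 1 / c1))"
  have Kst0: "0 \<le> Kst \<alpha> Z \<kappa> (x/2)" using pos \<kappa> x0 \<alpha> by (simp add: Kst_def)
  have A10: "0 \<le> A1" unfolding A1_def using Kst0 pos by (intro mult_nonneg_nonneg) (auto simp: K1_def)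
  define A2 where "A2 = 1 + \<theta> / c1 + \<alpha> * \<theta> * (A1 + 1) / (c1 * c1)"
  have A20: "0 \<le> A2" using \<theta>0 pos \<alpha> A10 by (simp add: A2_def)
  define A3 where "A3 = sqrt (ES2 1 * C0) + A1 + 1"
  define A4 where "A4 = sqrt (8 * bulk.KV P \<tau> C0 Z c1 r) * (1 + 4 / c2) + (K2 + A2) * (1 + 4 / c2) / c2"
  define f where "f i = ([(A1, c1 / 2), (A1, 1), (K2 + A2, c2 / 2), (K2 + A2, 1), (A3, e), (A4, e), (KK, 1)] ! i)" for i
  have "\<exists>t>0. t \<le> (1::real) \<and> (\<forall>i<7. fst (f i) * t \<le> snd (f i))"
  proof (rule exists_small)
    fix i :: nat assume "i < 7"
    hence "i \<in> {0,1,2,3,4,5,6}" by auto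
    thus "0 < snd (f i)" using pos c2 e by (auto simp: f_def)
  qed
  then obtain t where t: "0 < t" "t \<le> 1" and tf: "\<And>i. i < 7 \<Longrightarrow> fst (f i) * t \<le> snd (f i)" by auto
  have tA: "A1 * t \<le> c1 / 2" "A1 * t \<le> 1" "(K2 + A2) * t \<le> c2 / 2" "(K2 + A2) * t \<le> 1" "A3 * t \<le> e" "A4 * t \<le> e" "KK * t \<le> 1"
    using tf[of 0] tf[of 1] tf[of 2] tf[of 3] tf[of 4] tf[of 5] tf[of 6] by (simp_all add: f_def)
  have "0 < Re (mpD \<alpha> (of_real x))" using F0 by (simp add: Re_mpD F_def)
  hence "isCont (mp \<alpha>) (of_real x)" using x0 by (intro isCont_mp) auto
  hence "\<exists>\<rho>>0. \<forall>z. dist z (of_real x) < \<rho> \<longrightarrow> dist (mp \<alpha> z) m0 < t"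
    using t by (auto simp: continuous_at_eps_delta m0_def)
  then obtain \<rho>1 where \<rho>1: "0 < \<rho>1" "\<And>z. dist z (of_real x) < \<rho>1 \<Longrightarrow> dist (mp \<alpha> z) m0 < t" by auto
  \<comment> \<open>In order, the bounds keep the discriminant above half its value, z within reach
    of the continuity of \<open>mp\<close>, Re z \<ge> x / 2, |z - x| \<le> t, and Im z \<le>
    2.\<close>
  define \<rho> where "\<rho> = Min {\<rho>0 / 2, \<rho>1 / 3, x / 2, t / 2, 1}"
  have \<rho>: "0 < \<rho>" "\<rho> \<le> \<rho>0 / 2" "\<rho> \<le> \<rho>1 / 3" "\<rho> \<le> x / 2" "\<rho> \<le> t / 2" "\<rho> \<le> 1"
    using \<rho>0 \<rho>1 x0 t by (auto simp: \<rho>_def)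
  have ev1: "\<forall>\<^sub>F n in sequentially. 1 \<le> n" by (rule eventually_ge_at_top)
  have "(\<lambda>n. \<bar>real (m n) / real n - \<alpha>\<bar>) \<longlonglongrightarrow> \<bar>\<alpha> - \<alpha>\<bar>" using m by (intro tendsto_intros)
  hence ev2: "\<forall>\<^sub>F n in sequentially. \<bar>real (m n) / real n - \<alpha>\<bar> < t" using t by (intro order_tendstoD) auto
  have "filterlim (\<lambda>n. real n powr d) at_top sequentially" using d(1) by real_asymp
  hence ev3: "\<forall>\<^sub>F n in sequentially. 1 / t\<^sup>2 \<le> real n powr d" by (simp add: filterlim_at_top)
  show ?thesis
  proof (rule exI[of _ \<rho>], rule conjI[OF \<rho>(1)])
    show "\<forall>\<^sub>F n in sequentially. \<forall>v z. (\<Sum>i<n. (v i)\<^sup>2) = 1 \<longrightarrow> \<bar>Re z - x\<bar> \<le> \<rho> \<longrightarrow> \<eta> n \<le> Im z \<longrightarrow> Im z \<le> \<rho> \<longrightarrow>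
     (\<integral>X. cmod (model.s n (m n) \<tau> v z X - mp \<alpha> (of_real x)) \<partial>Omm n (m n)) \<le> e \<and>
     (\<integral>X. cmod (model.g n (m n) \<tau> v z X + 1 / Dlim \<alpha> \<theta> x) \<partial>Omm n (m n)) \<le> e"
      using ev1 ev2 ev3 d(2)
    proof eventually_elim
      case (elim n)
      have n: "1 \<le> n" by fact
      have a: "\<bar>real (m n) / real n - \<alpha>\<bar> \<le> t" using elim by simp
      have N: "1 / t\<^sup>2 \<le> n * (\<eta> n)\<^sup>2" using elim by linarith
      have h0: "0 < \<eta> n" using \<eta>[OF n] .
      have "1 / t \<le> sqrt (n * (\<eta> n)\<^sup>2)" using N t by (intro real_le_rsqrt) (simp add: power_divide)
      hence sq: "1 / sqrt (n * (\<eta> n)\<^sup>2) \<le> t" using t n h0 by (simp add: field_simps)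
      have "real n ^ 4 = real n powr 4" using n by simp
      also have "\<dots> \<le> real n powr (d * r)" using n rd by (intro powr_mono) auto
      also have "\<dots> = (real n powr d) ^ r" using n by (simp add: powr_powr[symmetric] powr_realpow)
      also have "\<dots> \<le> (n * (\<eta> n)\<^sup>2) ^ r" using elim by (intro power_mono) auto
      finally have big: "real n ^ 4 \<le> (n * (\<eta> n)\<^sup>2) ^ r" .
      have mC: "real (m n) \<le> C0 * n"
      proof -
        have "real (m n) / n \<le> C0" using a t by (simp add: C0_def)
        thus ?thesis using n by (simp add: field_simps)
      qed
      show ?case
      proof (intro allI impI)
        fix v :: "nat \<Rightarrow> real" and z :: complex
        assume v: "(\<Sum>i<n. (v i)\<^sup>2) = 1" and z: "\<bar>Re z - x\<bar> \<le> \<rho>" "\<eta> n \<le> Im z" "Im z \<le> \<rho>"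
        define sb where "sb = model.sb P n (m n) \<tau> v z"
        define gb where "gb = model.gb P n (m n) \<tau> v z"
        have zc: "Complex (Re z) (Im z) = z" by simp
        have iz: "0 < Im z" "Im z \<le> 2" using z h0 \<rho> by auto
        define E where "E = Kst \<alpha> Z \<kappa> (x / 2) * (\<bar>bulk.K1 P \<tau> C0 Z c1 r\<bar> * (1 / sqrt (n * (\<eta> n)\<^sup>2)) + \<bar>m n / n - \<alpha>\<bar> * (1 + 1 / c1))"
        have zx: "dist z (of_real x) \<le> 2 * \<rho>"
        proof -
          have "cmod (z - of_real x) \<le> \<bar>Re z - x\<bar> + \<bar>Im z\<bar>" using cmod_le[of "z - of_real x"] by simp
          thus ?thesis using z iz by (simp add: dist_norm)
        qed
        have "E \<le> Kst \<alpha> Z \<kappa> (x / 2) * (K1 * t + t * (1 + 1 / c1))"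
          unfolding E_def using Kst0 sq a t pos
          by (intro mult_left_mono add_mono mult_mono mult_right_mono) (auto simp: K1_def)
        also have "\<dots> = A1 * t" by (simp add: A1_def algebra_simps)
        finally have EA: "E \<le> A1 * t" .
        have law: "c1 \<le> cmod (1 + sb)" "cmod (sb - mp \<alpha> z) \<le> E"
        proof -
          have F: "\<kappa>\<^sup>2 \<le> 4 * Re z - (Re z + 1 - \<alpha>)\<^sup>2"
            using Fa[of "Re z"] z \<rho> \<rho>0 by (simp add: \<kappa> F_def)
          have Zr: "\<bar>Re z\<bar> + 2 \<le> Z" "x / 2 \<le> Re z" using z \<rho> x0 unfolding Z_def by linarith+
          have El: "E \<le> c1 / 2" using EA tA(1) by linarith
          note L = local_law_trace[OF n v pos(1) mC pos(2) Zr(1) \<alpha> \<kappa>(1) F half_gt_zero[OF x0] Zr(2) h0 big r(2) c1_def E_def El z(2) iz(2)]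
          show "c1 \<le> cmod (1 + sb)" "cmod (sb - mp \<alpha> z) \<le> E"
            using L by (simp_all only: zc sb_def)
        qed
        have sm: "cmod (sb - m0) \<le> (A1 + 1) * t"
        proof -
          have "cmod (mp \<alpha> z - m0) < t" using \<rho>1(2)[of z] zx \<rho> \<rho>1(1) by (simp add: dist_norm)
          thus ?thesis using norm_triangle_ineq[of "sb - mp \<alpha> z" "mp \<alpha> z - m0"] law(2) EA by (simp add: algebra_simps)
        qed
        have S: "cmod sb \<le> S0"
        proof -
          have "cmod (sb - m0) \<le> 2" using sm tA(2) t by (simp add: algebra_simps)
          thus ?thesis using norm_triangle_ineq[of "sb - m0" m0] by (simp add: S0_def)
        qed
        have zZ: "cmod z \<le> Z"
          using cmod_le[of z] z \<rho> x0 iz unfolding Z_def by linarith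
        have mono: "n * (\<eta> n)\<^sup>2 \<le> n * (Im z)\<^sup>2" using z h0 by (intro mult_left_mono power_mono) auto
        have bigz: "real n ^ 4 \<le> (n * (Im z)\<^sup>2) ^ r"
          using power_mono[OF mono, of r] big by simp
        have bulk: "bulk P n (m n) \<tau> v z C0 Z c1 S0 r"
          unfolding bulk_def bulk_axioms_def
          using modelI[OF n v iz(1)] pos mC zZ iz law(1) S r(2) bigz by (auto simp: sb_def)
        interpret B: bulk P n "m n" \<tau> v z C0 Z c1 S0 r by (rule bulk)
        have u: "B.u \<le> t"
        proof -
          have "B.u \<le> 1 / sqrt (n * (\<eta> n)\<^sup>2)"
            unfolding B.u_def B.NN_def using mono h0 n iz by (intro divide_left_mono mult_pos_pos real_sqrt_le_mono) auto
          thus ?thesis using sq by linarith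
        qed
        have KV0: "0 \<le> bulk.KV P \<tau> C0 Z c1 r" "0 \<le> KK" using B.KV_nonneg B.KA_nonneg by (auto simp: KK_def)
        have "KK * B.u\<^sup>2 \<le> 1"
        proof -
          have "B.u\<^sup>2 \<le> t * 1" unfolding power2_eq_square using u B.u t by (intro mult_mono) auto
          hence "KK * B.u\<^sup>2 \<le> KK * t" using KV0 by (intro mult_left_mono) auto
          thus ?thesis using tA(7) by linarith
        qed
        hence bs: "bulk_small P n (m n) \<tau> v z C0 Z c1 S0 r"
          using bulk by (simp add: bulk_small_def bulk_small_axioms_def KK_def)
        interpret B: bulk_small P n "m n" \<tau> v z C0 Z c1 S0 r by (rule bs)
        have part1: "(\<integral>X. cmod (model.s n (m n) \<tau> v z X - m0) \<partial>Omm n (m n)) \<le> e"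
        proof -
          have "(\<integral>X. cmod (model.s n (m n) \<tau> v z X - m0) \<partial>Omm n (m n)) \<le> sqrt (ES2 1 * C0) * B.u + cmod (sb - m0)"
            unfolding sb_def by (rule mean_deviation_s[OF bulk])
          also have "\<dots> \<le> sqrt (ES2 1 * C0) * t + (A1 + 1) * t"
            using u sm pos by (intro add_mono mult_left_mono) auto
          also have "\<dots> = A3 * t" by (simp add: A3_def algebra_simps)
          finally show ?thesis using tA(5) by linarith
        qed
        have one_m0: "c1 \<le> cmod (1 + m0)"
        proof -
          have "\<alpha> / (2 * Z + 1 + \<alpha>) \<le> cmod (1 + m0)"
            unfolding m0_def using x0 \<alpha> by (intro one_plus_mp_lower) (auto simp: Z_def)
          moreover have "c1 \<le> \<alpha> / (2 * Z + 1 + \<alpha>)"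
          proof -
            have half: "y / 2 \<le> y" if "0 \<le> y" for y :: real using that by simp
            show ?thesis unfolding c1_def by (rule half) (use \<alpha> pos(2) in simp)
          qed
          ultimately show ?thesis by linarith
        qed
        define D where "D = z - of_real (m n / n * \<theta>) / (1 + sb)"
        have DD: "cmod (D - Dlim \<alpha> \<theta> x) \<le> A2 * t"
        proof -
          have ne: "1 + sb \<noteq> 0" "1 + m0 \<noteq> 0" using law(1) one_m0 pos by auto
          have "D - Dlim \<alpha> \<theta> x = (z - of_real x) - of_real ((m n / n - \<alpha>) * \<theta>) / (1 + sb) + of_real (\<alpha> * \<theta>) * ((sb - m0) / ((1 + sb) * (1 + m0)))"
          proof -
            have "(w - A / (1 + p)) - (y - B / (1 + q)) = (w - y) - (A - B) / (1 + p) + B * ((p - q) / ((1 + p) * (1 + q)))"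
              if "1 + p \<noteq> 0" "1 + q \<noteq> 0" for w y A B p q :: complex
            proof -
              have "(p - q) / ((1 + p) * (1 + q)) = 1 / (1 + q) - 1 / (1 + p)"
                using that by (simp add: divide_simps)
              thus ?thesis by (simp only:) (simp add: diff_divide_distrib right_diff_distrib)
            qed
            thus ?thesis unfolding D_def Dlim_def m0_def[symmetric] left_diff_distrib of_real_diff using ne by blast
          qed
          hence "cmod (D - Dlim \<alpha> \<theta> x) = cmod ((z - of_real x) - of_real ((m n / n - \<alpha>) * \<theta>) / (1 + sb) + of_real (\<alpha> * \<theta>) * ((sb - m0) / ((1 + sb) * (1 + m0))))"
            by (rule arg_cong)
          also have "\<dots> \<le> cmod (z - of_real x) + cmod (of_real ((m n / n - \<alpha>) * \<theta>) / (1 + sb)) + cmod (of_real (\<alpha> * \<theta>) * ((sb - m0) / ((1 + sb) * (1 + m0))))"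
            by (rule order_trans[OF norm_triangle_ineq add_right_mono[OF norm_triangle_ineq4]])
          also have "\<dots> \<le> t + t * \<theta> / c1 + \<alpha> * \<theta> * ((A1 + 1) * t / (c1 * c1))"
          proof (intro add_mono)
            show "cmod (z - of_real x) \<le> t" using zx \<rho> by (simp add: dist_norm)
            have "cmod (of_real ((m n / n - \<alpha>) * \<theta>) / (1 + sb)) = \<bar>m n / n - \<alpha>\<bar> * \<theta> / cmod (1 + sb)"
              unfolding norm_divide norm_of_real using \<theta>0 by (simp add: abs_mult)
            also have "\<dots> \<le> t * \<theta> / c1" using a law(1) pos \<theta>0 t by (intro frac_le mult_right_mono) auto
            finally show "cmod (of_real ((m n / n - \<alpha>) * \<theta>) / (1 + sb)) \<le> t * \<theta> / c1" .
            have "cmod (of_real (\<alpha> * \<theta>) * ((sb - m0) / ((1 + sb) * (1 + m0)))) = \<alpha> * \<theta> * (cmod (sb - m0) / (cmod (1 + sb) * cmod (1 + m0)))"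
              unfolding norm_mult norm_divide norm_of_real using \<alpha> \<theta>0 by (simp add: abs_mult)
            also have "\<dots> \<le> \<alpha> * \<theta> * ((A1 + 1) * t / (c1 * c1))"
              using sm law(1) one_m0 pos \<alpha> \<theta>0 A10 t by (intro mult_left_mono frac_le mult_mono) auto
            finally show "cmod (of_real (\<alpha> * \<theta>) * ((sb - m0) / ((1 + sb) * (1 + m0)))) \<le> \<alpha> * \<theta> * ((A1 + 1) * t / (c1 * c1))" .
          qed
          also have "\<dots> = A2 * t" by (simp add: A2_def algebra_simps)
          finally show ?thesis .
        qed
        have iso: "cmod (1 + gb * D) \<le> (K2 * t) * (1 + cmod gb)"
        proof -
          have "1 + gb * D = 1 + z * gb - of_real (m n / n * (1 + \<tau>)\<^sup>2) * (gb / (1 + sb))"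
            by (simp add: D_def \<theta> algebra_simps)
          hence "cmod (1 + gb * D) = cmod (1 + z * gb - of_real (m n / n * (1 + \<tau>)\<^sup>2) * (gb / (1 + sb)))"
            by (rule arg_cong)
          also have "\<dots> \<le> bulk_small.K2 P \<tau> C0 Z c1 S0 r * B.u * (1 + cmod gb)"
            using B.isotropic_equation unfolding gb_def sb_def B.\<Gamma>_def .
          also have "\<dots> \<le> K2 * t * (1 + cmod gb)"
            using u B.u by (intro mult_right_mono mult_mono) (auto simp: K2_def)
          finally show ?thesis .
        qed
        have lp: "cmod gb \<le> 4 / c2" "cmod (gb + 1 / Dlim \<alpha> \<theta> x) \<le> (K2 * t + A2 * t) * (1 + 4 / c2) / c2"
          using linear_perturbation[OF iso DD c2 c2_def[symmetric]] tA t A20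
          by (auto simp: K2_def algebra_simps)
        have part2: "(\<integral>X. cmod (model.g n (m n) \<tau> v z X + 1 / Dlim \<alpha> \<theta> x) \<partial>Omm n (m n)) \<le> e"
        proof -
          have "(\<integral>X. cmod (model.g n (m n) \<tau> v z X - (- (1 / Dlim \<alpha> \<theta> x))) \<partial>Omm n (m n))
            \<le> sqrt (8 * bulk.KV P \<tau> C0 Z c1 r) * B.u * (1 + cmod gb) + cmod (gb - (- (1 / Dlim \<alpha> \<theta> x)))"
            unfolding gb_def by (rule mean_deviation_g[OF bs])
          also have "\<dots> \<le> sqrt (8 * bulk.KV P \<tau> C0 Z c1 r) * t * (1 + 4 / c2) + (K2 * t + A2 * t) * (1 + 4 / c2) / c2"
            using u B.u lp KV0 t by (intro add_mono mult_mono) auto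
          also have "\<dots> = A4 * t" by (simp add: A4_def algebra_simps add_divide_distrib)
          finally show ?thesis using tA(6) by simp
        qed
        show "(\<integral>X. cmod (model.s n (m n) \<tau> v z X - mp \<alpha> (of_real x)) \<partial>Omm n (m n)) \<le> e \<and>
           (\<integral>X. cmod (model.g n (m n) \<tau> v z X + 1 / Dlim \<alpha> \<theta> x) \<partial>Omm n (m n)) \<le> e"
          using part1 part2 by (simp add: m0_def)
      qed
    qed
  qed
qed

end

section \<open>From Stieltjes transforms to windows\<close>

text \<open>The weights 1 / n give s and the squared overlaps with v give g;
  \<open>window_mass\<close> serves both.\<close>

definition stj :: "nat \<Rightarrow> (nat \<Rightarrow> real) \<Rightarrow> (nat \<Rightarrow> real) \<Rightarrow> complex \<Rightarrow> complex" where
  "stj n w l z = (\<Sum>k<n. of_real (w k) / (of_real (l k) - z))"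

lemma stj_denom: "0 < Im z \<Longrightarrow> of_real l - z \<noteq> 0"
  by (auto simp: complex_eq_iff)

lemma Im_stj:
  assumes "0 < e"
  shows "Im (stj n w l (Complex a e)) = (\<Sum>k<n. w k * (e / ((l k - a)\<^sup>2 + e\<^sup>2)))"
  by (simp add: stj_def Im_divide)

lemma arctan_diff_le:
  assumes "b \<le> a"
  shows "arctan a - arctan b \<le> a - b"
proof (cases "a = b")
  case False
  hence "b < a" using assms by simp
  moreover have "\<And>x. DERIV arctan x :> inverse (1 + x\<^sup>2)" by (rule DERIV_arctan)
  ultimately obtain c where "arctan a - arctan b = (a - b) * inverse (1 + c\<^sup>2)"
    using MVT2[of b a arctan "\<lambda>x. inverse (1 + x\<^sup>2)"] by auto
  moreover have "inverse (1 + c\<^sup>2) \<le> 1" by (simp add: inverse_le_1_iff)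
  ultimately show ?thesis using assms mult_left_mono[of "inverse (1 + c\<^sup>2)" 1 "a - b"] by simp
qed simp

lemma poisson_has_integral:
  assumes "0 < e" "a \<le> b"
  shows "((\<lambda>u. e / ((l - u)\<^sup>2 + e\<^sup>2)) has_integral (arctan ((b - l) / e) - arctan ((a - l) / e))) {a..b}"
proof (rule fundamental_theorem_of_calculus[OF assms(2)])
  fix u assume "u \<in> {a..b}"
  have "((\<lambda>u. arctan ((u - l) / e)) has_real_derivative inverse (1 + ((u - l) / e)\<^sup>2) * (1 / e)) (at u within {a..b})"
    using assms(1) by (auto intro!: derivative_eq_intros)
  also have "inverse (1 + ((u - l) / e)\<^sup>2) * (1 / e) = e / ((l - u)\<^sup>2 + e\<^sup>2)"
  proof -
    have "(l - u)\<^sup>2 + e\<^sup>2 = e\<^sup>2 * (1 + ((u - l) / e)\<^sup>2)"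
      using assms(1) by (simp add: power_divide distrib_left power2_commute)
    thus ?thesis using assms(1) by (simp add: power2_eq_square inverse_eq_divide)
  qed
  finally show "((\<lambda>u. arctan ((u - l) / e)) has_vector_derivative e / ((l - u)\<^sup>2 + e\<^sup>2)) (at u within {a..b})"
    by (simp add: has_real_derivative_iff_has_vector_derivative)
qed

text \<open>The value at \<open>Complex x eps\<close> controls the Poisson tails of the mass outside the window.\<close>

lemma window_mass:
  fixes w l :: "nat \<Rightarrow> real" and c :: complex
  assumes w: "\<And>k. k < n \<Longrightarrow> 0 \<le> w k" and a: "0 < a" "a \<le> 1 / 2" and e: "0 < e" "e \<le> a\<^sup>2 * eps" and eps: "0 < eps"
    and J: "(\<integral>\<^sup>+u\<in>{x - 2 * eps..x + 2 * eps}. ennreal (cmod (stj n w l (Complex u e) - c)) \<partial>lborel) \<le> ennreal (a * eps)"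
    and p: "cmod (stj n w l (Complex x eps) - c) \<le> 1"
  shows "\<bar>pi * (\<Sum>k\<in>window n l x eps. w k) / (2 * eps) - Im c\<bar> \<le> 4 * a * (cmod c + 1)"
proof -
  define G where "G u = stj n w l (Complex u e)" for u
  define I where "I = window n l x eps"
  define mu where "mu = (\<Sum>k\<in>I. w k)"
  \<comment> \<open>The margin by which the integration interval is enlarged or shrunk. As e / h
    \<le> a, the Poisson kernel at height e is almost concentrated within distance h.\<close>
  define h where "h = a * eps"
  have h: "0 < h" "h < eps" using a eps by (auto simp: h_def)
  have eh: "e / h \<le> a" using e a eps by (simp add: h_def field_simps power2_eq_square)
  have IN: "I \<subseteq> {..<n}" by (auto simp: I_def window_def)
  have mu0: "0 \<le> mu" unfolding mu_def using w IN by (intro sum_nonneg) auto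
  have contG: "continuous_on S G" for S
    unfolding G_def stj_def using e(1) stj_denom[of "Complex _ e"]
    by (auto intro!: continuous_intros simp: Complex_eq)
  have J': "integral {x - 2 * eps..x + 2 * eps} (\<lambda>u. cmod (G u - c)) \<le> a * eps"
  proof -
    let ?S = "{x - 2 * eps..x + 2 * eps}"
    have cn: "continuous_on S (\<lambda>u. cmod (G u - c))" for S
      by (intro continuous_intros contG)
    have hi: "((\<lambda>u. cmod (G u - c)) has_integral integral ?S (\<lambda>u. cmod (G u - c))) ?S"
      by (intro integrable_integral integrable_continuous_real cn)
    have meas: "(\<lambda>u. cmod (G u - c)) \<in> borel_measurable borel"
      by (rule borel_measurable_continuous_onI[OF cn])
    have "(\<integral>\<^sup>+u. ennreal (cmod (G u - c) * indicator ?S u) \<partial>lborel) = ennreal (integral ?S (\<lambda>u. cmod (G u - c)))"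
    proof (rule nn_integral_has_integral_lborel)
      show "((\<lambda>u. cmod (G u - c) * indicator ?S u) has_integral integral ?S (\<lambda>u. cmod (G u - c))) UNIV"
      proof -
        have eq: "(\<lambda>u. cmod (G u - c) * indicator ?S u) = (\<lambda>u. if u \<in> ?S then cmod (G u - c) else 0)"
          by (auto simp: indicator_def fun_eq_iff)
        show ?thesis unfolding eq has_integral_restrict_UNIV by (rule hi)
      qed
      show "(\<lambda>u. cmod (G u - c) * indicator ?S u) \<in> borel_measurable borel"
        by (intro borel_measurable_times meas borel_measurable_indicator) simp
    qed auto
    moreover have "(\<integral>\<^sup>+u. ennreal (cmod (G u - c) * indicator ?S u) \<partial>lborel) = (\<integral>\<^sup>+u\<in>?S. ennreal (cmod (G u - c)) \<partial>lborel)"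
      by (intro nn_integral_cong) (simp add: indicator_def)
    ultimately have "ennreal (integral ?S (\<lambda>u. cmod (G u - c))) \<le> ennreal (a * eps)"
      using J by (simp add: G_def)
    thus ?thesis using a eps by (subst (asm) ennreal_le_iff) auto
  qed
  \<comment> \<open>Integrated over a subinterval, the kernels give arctangent differences; the L^1
    bound on the whole segment controls every such subinterval with the same error.\<close>
  have int: "\<bar>(\<Sum>k<n. w k * (arctan ((r - l k) / e) - arctan ((q - l k) / e))) - (r - q) * Im c\<bar> \<le> a * eps"
    if q: "x - 2 * eps \<le> q" "q \<le> r" "r \<le> x + 2 * eps" for q r
  proof -
    let ?A = "\<Sum>k<n. w k * (arctan ((r - l k) / e) - arctan ((q - l k) / e))"
    have "((\<lambda>u. \<Sum>k<n. w k * (e / ((l k - u)\<^sup>2 + e\<^sup>2))) has_integral ?A) {q..r}"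
      by (intro has_integral_sum has_integral_mult_right poisson_has_integral e q) auto
    hence 1: "((\<lambda>u. Im (G u)) has_integral ?A) {q..r}" by (simp add: G_def Im_stj[OF e(1)])
    have 2: "((\<lambda>u. Im c) has_integral ((r - q) * Im c)) {q..r}"
      using has_integral_const_real[of "Im c" q r] q by simp
    have 3: "((\<lambda>u. Im (G u) - Im c) has_integral (?A - (r - q) * Im c)) {q..r}"
      by (rule has_integral_diff[OF 1 2])
    have cn: "continuous_on S (\<lambda>u. cmod (G u - c))" for S
      by (intro continuous_intros contG)
    have "norm (?A - (r - q) * Im c) \<le> integral {q..r} (\<lambda>u. cmod (G u - c))"
      unfolding integral_unique[OF 3, symmetric]
    proof (rule integral_norm_bound_integral)
      show "(\<lambda>u. Im (G u) - Im c) integrable_on {q..r}" using 3 by (rule has_integral_integrable)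
      show "(\<lambda>u. cmod (G u - c)) integrable_on {q..r}" by (intro integrable_continuous_real cn)
      show "norm (Im (G u) - Im c) \<le> cmod (G u - c)" for u
        using abs_Im_le_cmod[of "G u - c"] by simp
    qed
    also have "\<dots> \<le> integral {x - 2 * eps..x + 2 * eps} (\<lambda>u. cmod (G u - c))"
      using q by (intro integral_subset_le integrable_continuous_real cn) auto
    finally show ?thesis using J' by simp
  qed
  have arct: "pi / 2 - 1 / t \<le> arctan t" if "0 < t" for t
    using arctan_inverse[of t] that arctan_le_self[of "1 / t"] by (simp add: inverse_eq_divide)
  \<comment> \<open>Upper bound on the mass: over the interval enlarged by h, a point of the window
    contributes at least pi - 2 a, any other point a nonnegative amount.\<close>
  have "(pi - 2 * a) * mu \<le> (2 * eps + 2 * h) * Im c + a * eps"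
  proof -
    let ?f = "\<lambda>k. arctan ((x + eps + h - l k) / e) - arctan ((x - eps - h - l k) / e)"
    have f0: "0 \<le> ?f k" for k
    proof -
      have "(x - eps - h - l k) / e \<le> (x + eps + h - l k) / e" using h eps e by (intro divide_right_mono) auto
      thus ?thesis by (simp add: arctan_monotone')
    qed
    have fI: "pi - 2 * a \<le> ?f k" if "k \<in> I" for k
    proof -
      have k: "\<bar>l k - x\<bar> \<le> eps" using that by (simp add: I_def window_def)
      have "h / e \<le> (x + eps + h - l k) / e" using k e by (intro divide_right_mono) auto
      hence 1: "arctan (h / e) \<le> arctan ((x + eps + h - l k) / e)" by (rule arctan_monotone')
      have "(x - eps - h - l k) / e \<le> (- h) / e" using k e by (intro divide_right_mono) auto
      hence "(x - eps - h - l k) / e \<le> - (h / e)" by simp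
      hence 2: "arctan ((x - eps - h - l k) / e) \<le> - arctan (h / e)" using arctan_monotone' arctan_minus by metis
      have "pi / 2 - 1 / (h / e) \<le> arctan (h / e)" using h e by (intro arct) auto
      thus ?thesis using 1 2 eh by simp
    qed
    have "(pi - 2 * a) * mu = (\<Sum>k\<in>I. w k * (pi - 2 * a))" by (simp add: mu_def sum_distrib_right mult.commute)
    also have "\<dots> \<le> (\<Sum>k\<in>I. w k * ?f k)" using w IN fI by (intro sum_mono mult_left_mono) auto
    also have "\<dots> \<le> (\<Sum>k<n. w k * ?f k)" using w IN f0 by (intro sum_mono2 mult_nonneg_nonneg) auto
    also have "\<dots> \<le> ((x + eps + h) - (x - eps - h)) * Im c + a * eps"
      using int[of "x - eps - h" "x + eps + h"] h eps by simp
    finally show ?thesis by (simp add: algebra_simps)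
  qed
  hence up: "(1 - a) * (pi * mu) \<le> (2 * eps + 2 * h) * Im c + a * eps"
  proof -
    have "2 \<le> pi" using pi_ge_two .
    hence "2 * a * mu \<le> pi * a * mu" using a mu0 by (intro mult_right_mono) auto
    hence "(1 - a) * (pi * mu) \<le> (pi - 2 * a) * mu" by (simp add: algebra_simps)
    thus ?thesis using \<open>(pi - 2 * a) * mu \<le> _\<close> by linarith
  qed
  \<comment> \<open>Lower bound on the mass: over the interval shrunk by h, a point of the window
    contributes at most pi. A point outside contributes at most 4 a eps times the Poisson kernel of
    width eps, and the sum of these kernels is Im stj at x + i eps, bounded by hypothesis.\<close>
  have low: "(2 * eps - 2 * h) * Im c - a * eps \<le> pi * mu + 4 * a * eps * (cmod c + 1)"
  proof -
    let ?f = "\<lambda>k. arctan ((x + eps - h - l k) / e) - arctan ((x - eps + h - l k) / e)"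
    have fpi: "?f k \<le> pi" for k
      using arctan_ubound[of "(x + eps - h - l k) / e"] arctan_lbound[of "(x - eps + h - l k) / e"] by linarith
    have fout: "?f k \<le> 4 * a * eps * (eps / ((l k - x)\<^sup>2 + eps\<^sup>2))" if "k \<in> {..<n} - I" for k
    proof -
      define D where "D = \<bar>l k - x\<bar>"
      have D: "eps < D" using that by (auto simp: I_def window_def D_def)
      have sym: "?f k = arctan ((D + (eps - h)) / e) - arctan ((D - (eps - h)) / e)"
      proof (cases "x \<le> l k")
        case True
        have "(x + eps - h - l k) / e = - ((D - (eps - h)) / e)" "(x - eps + h - l k) / e = - ((D + (eps - h)) / e)"
          using True by (simp_all add: D_def minus_divide_left)
        thus ?thesis by (simp only: arctan_minus)
      next
        case False
        have "(x + eps - h - l k) = D + (eps - h)" "(x - eps + h - l k) = D - (eps - h)"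
          using False by (simp_all add: D_def)
        thus ?thesis by (simp only:)
      qed
      have P: "0 < D - (eps - h)" "0 < D + (eps - h)" using D h by auto
      have inv: "arctan t = pi / 2 - arctan (1 / t)" if "0 < t" for t
        using arctan_inverse[of t] that by (simp add: inverse_eq_divide)
      \<comment> \<open>Both arguments are positive, so passing to reciprocals cancels the two
        values pi / 2 and leaves a difference of order e.\<close>
      have "?f k = arctan (e / (D - (eps - h))) - arctan (e / (D + (eps - h)))"
      proof -
        have "arctan ((D + (eps - h)) / e) = pi / 2 - arctan (e / (D + (eps - h)))"
          "arctan ((D - (eps - h)) / e) = pi / 2 - arctan (e / (D - (eps - h)))"
          using inv[of "(D + (eps - h)) / e"] inv[of "(D - (eps - h)) / e"] P e by simp_all
        thus ?thesis unfolding sym by linarith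
      qed
      also have "\<dots> \<le> e / (D - (eps - h)) - e / (D + (eps - h))"
        using P e h by (intro arctan_diff_le divide_left_mono mult_pos_pos) auto
      also have "\<dots> = e * (2 * (eps - h)) / (D\<^sup>2 - (eps - h)\<^sup>2)"
        using P by (simp add: field_simps power2_eq_square)
      also have "\<dots> \<le> (e * (2 * eps)) / (a * D\<^sup>2)"
      proof (rule frac_le)
        show "e * (2 * (eps - h)) \<le> e * (2 * eps)" using e h by simp
        have "0 < D\<^sup>2" using D eps by simp
        thus "0 < a * D\<^sup>2" using a by simp
        have "(eps - h)\<^sup>2 = (1 - a)\<^sup>2 * eps\<^sup>2" by (simp add: h_def power2_eq_square algebra_simps)
        also have "\<dots> \<le> (1 - a)\<^sup>2 * D\<^sup>2" using D eps by (intro mult_left_mono power_mono) auto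
        also have "\<dots> \<le> (1 - a) * D\<^sup>2"
          using a by (intro mult_right_mono) (auto simp: power2_eq_square mult_left_le)
        finally show "a * D\<^sup>2 \<le> D\<^sup>2 - (eps - h)\<^sup>2" by (simp add: algebra_simps)
      qed (use e eps in auto)
      also have "\<dots> = 2 * eps * (e / a) * (1 / D\<^sup>2)" by simp
      also have "\<dots> \<le> 2 * eps * (a * eps) * (2 / (D\<^sup>2 + eps\<^sup>2))"
      proof (intro mult_mono mult_left_mono)
        show "e / a \<le> a * eps" using e a by (simp add: field_simps power2_eq_square)
        have "eps\<^sup>2 \<le> D\<^sup>2" using D eps by (intro power_mono) auto
        moreover have "0 < D\<^sup>2" using D eps by simp
        ultimately have "2 / (2 * D\<^sup>2) \<le> 2 / (D\<^sup>2 + eps\<^sup>2)"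
          by (intro divide_left_mono mult_pos_pos add_pos_nonneg) auto
        thus "1 / D\<^sup>2 \<le> 2 / (D\<^sup>2 + eps\<^sup>2)" by simp
      qed (use eps a e in auto)
      also have "\<dots> = 4 * a * eps * (eps / ((l k - x)\<^sup>2 + eps\<^sup>2))" by (simp add: D_def)
      finally show ?thesis .
    qed
    have "(2 * eps - 2 * h) * Im c - a * eps \<le> (\<Sum>k<n. w k * ?f k)"
      using int[of "x - eps + h" "x + eps - h"] h eps by (simp add: algebra_simps)
    also have "\<dots> = (\<Sum>k\<in>{..<n} - I. w k * ?f k) + (\<Sum>k\<in>I. w k * ?f k)"
      using IN by (simp add: sum.subset_diff)
    also have "\<dots> \<le> (\<Sum>k\<in>{..<n} - I. w k * (4 * a * eps * (eps / ((l k - x)\<^sup>2 + eps\<^sup>2)))) + (\<Sum>k\<in>I. w k * pi)"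
      using w IN fpi fout by (intro add_mono sum_mono mult_left_mono) auto
    also have "(\<Sum>k\<in>I. w k * pi) = pi * mu" by (simp add: mu_def sum_distrib_left mult.commute)
    also have "(\<Sum>k\<in>{..<n} - I. w k * (4 * a * eps * (eps / ((l k - x)\<^sup>2 + eps\<^sup>2)))) \<le> (\<Sum>k<n. w k * (4 * a * eps * (eps / ((l k - x)\<^sup>2 + eps\<^sup>2))))"
      using w a eps by (intro sum_mono2 mult_nonneg_nonneg) auto
    also have "\<dots> = 4 * a * eps * Im (stj n w l (Complex x eps))"
      unfolding Im_stj[OF eps] sum_distrib_left by (simp add: mult_ac)
    also have "\<dots> \<le> 4 * a * eps * (cmod c + 1)"
    proof (rule mult_left_mono)
      have "Im (stj n w l (Complex x eps)) \<le> cmod (stj n w l (Complex x eps))"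
        using abs_Im_le_cmod[of "stj n w l (Complex x eps)"] by linarith
      also have "\<dots> \<le> cmod c + 1"
        using p norm_triangle_ineq[of c "stj n w l (Complex x eps) - c"] by simp
      finally show "Im (stj n w l (Complex x eps)) \<le> cmod c + 1" .
    qed (use a eps in auto)
    finally show ?thesis by simp
  qed
  define B where "B = pi * mu / (2 * eps)"
  have B0: "0 \<le> B" using mu0 eps by (simp add: B_def)
  have pm: "pi * mu = 2 * eps * B" using eps by (simp add: B_def)
  have ic: "\<bar>Im c\<bar> \<le> cmod c" by (rule abs_Im_le_cmod)
  have "eps * ((1 - a) * (2 * B)) \<le> eps * ((2 + 2 * a) * Im c + a)"
    using up unfolding pm h_def by (simp add: algebra_simps)
  hence U: "(1 - a) * (2 * B) \<le> (2 + 2 * a) * Im c + a" using eps by simp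
  have "eps * ((2 - 2 * a) * Im c - a) \<le> eps * (2 * B + 4 * a * (cmod c + 1))"
    using low unfolding pm h_def by (simp add: algebra_simps)
  hence L: "(2 - 2 * a) * Im c - a \<le> 2 * B + 4 * a * (cmod c + 1)" using eps by simp
  have aI: "a * Im c \<le> a * cmod c" using ic a by (intro mult_left_mono) auto
  have ac: "0 \<le> a * cmod c" using a by simp
  have e4: "4 * a * (cmod c + 1) = 4 * (a * cmod c) + 4 * a" by (simp add: algebra_simps)
  have "2 * Im c - 2 * (a * Im c) - a \<le> 2 * B + (4 * (a * cmod c) + 4 * a)"
    using L unfolding e4 by (simp add: algebra_simps)
  hence L': "Im c - B \<le> 4 * a * (cmod c + 1)" unfolding e4 using aI ac a by linarith
  have U': "B - Im c \<le> 4 * a * (cmod c + 1)"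
  proof -
    have "(1 - a) * (B - Im c) * 2 = ((1 - a) * (2 * B)) - (1 - a) * Im c * 2" by (simp add: algebra_simps)
    also have "\<dots> \<le> ((2 + 2 * a) * Im c + a) - (1 - a) * Im c * 2" using U by simp
    also have "\<dots> = 4 * (a * Im c) + a" by (simp add: algebra_simps)
    also have "\<dots> \<le> 4 * (a * cmod c) + 4 * a" using aI a by linarith
    also have "\<dots> = (2 * a * (cmod c + 1)) * 2" by (simp add: algebra_simps)
    finally have 1: "(1 - a) * (B - Im c) \<le> 2 * a * (cmod c + 1)" by linarith
    show ?thesis
    proof (cases "B - Im c \<le> 0")
      case True
      have "0 \<le> 4 * a * (cmod c + 1)" using a by simp
      thus ?thesis using True by linarith
    next
      case False
      hence "(1 / 2) * (B - Im c) \<le> (1 - a) * (B - Im c)" using a by (intro mult_right_mono) auto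
      thus ?thesis using 1 by simp
    qed
  qed
  show ?thesis using L' U' unfolding B_def mu_def I_def by linarith
qed

section \<open>The sample covariance matrix of a spiked population\<close>

definition trc :: "real mat \<Rightarrow> real" where
  "trc A = (\<Sum>i<dim_row A. A $$ (i, i))"

lemma index_mult_sum:
  assumes "A \<in> carrier_mat n k" "B \<in> carrier_mat k l" "i < n" "j < l"
  shows "(A * B) $$ (i, j) = (\<Sum>p<k. A $$ (i, p) * B $$ (p, j))"
  using assms by (auto simp: scalar_prod_def atLeast0LessThan intro!: sum.cong)

lemma trc_mult_sum:
  fixes A B :: "real mat"
  assumes "A \<in> carrier_mat n n" "B \<in> carrier_mat n n"
  shows "trc (A * B) = (\<Sum>i<n. \<Sum>p<n. A $$ (i, p) * B $$ (p, i))"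
proof -
  have "dim_row (A * B) = n" using assms by simp
  thus ?thesis unfolding trc_def
    by (intro sum.cong) (simp_all add: index_mult_sum[OF assms(1) assms(2)] del: index_mult_mat)
qed

lemma trc_mult_commute:
  fixes A B :: "real mat"
  assumes "A \<in> carrier_mat n n" "B \<in> carrier_mat n n"
  shows "trc (A * B) = trc (B * A)"
  unfolding trc_mult_sum[OF assms] trc_mult_sum[OF assms(2) assms(1)]
  by (subst sum.swap) (simp add: mult.commute)

lemma trc_similar:
  assumes c: "B \<in> carrier_mat n n" "P \<in> carrier_mat n n" "Q \<in> carrier_mat n n" and QP: "Q * P = 1\<^sub>m n"
  shows "trc (P * B * Q) = trc B"
proof -
  have PB: "P * B \<in> carrier_mat n n" using c by simp
  have "trc (P * B * Q) = trc (Q * (P * B))" by (rule trc_mult_commute[OF PB c(3)])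
  also have "Q * (P * B) = Q * P * B" using assoc_mult_mat[OF c(3) c(2) c(1)] by simp
  also have "\<dots> = B" unfolding QP using c by simp
  finally show ?thesis .
qed

text \<open>A Schur decomposition puts the given roots on the diagonal of a triangular B; in the
  trace of B B only squares of diagonal entries survive.\<close>

lemma trc_char_poly:
  assumes A: "A \<in> carrier_mat n n" and cp: "char_poly A = (\<Prod>e\<leftarrow>es. [:- e, 1:])"
  shows "trc A = sum_list es" "trc (A * A) = (\<Sum>e\<leftarrow>es. e\<^sup>2)"
proof -
  obtain B P Q where s: "schur_decomposition A es = (B, P, Q)" by (metis prod_cases3)
  have sim: "similar_mat_wit A B P Q" and ut: "upper_triangular B" and dg: "diag_mat B = es"
    using schur_decomposition[OF A cp s] by auto
  have B: "B \<in> carrier_mat n n" and P: "P \<in> carrier_mat n n" and Q: "Q \<in> carrier_mat n n"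
    and QP: "Q * P = 1\<^sub>m n" and AB: "A = P * B * Q"
    using sim A by (auto simp: similar_mat_wit_def Let_def)
  have es: "es = map (\<lambda>i. B $$ (i, i)) [0..<n]" using dg B by (simp add: diag_mat_def)
  have "trc B = sum_list es" using B by (simp add: es trc_def interv_sum_list_conv_sum_set_nat atLeast0LessThan)
  thus "trc A = sum_list es" unfolding AB using trc_similar[OF B P Q QP] by simp
  have PB: "P * B \<in> carrier_mat n n" using P B by simp
  have BQ: "B * Q \<in> carrier_mat n n" using Q B by simp
  have "A * A = P * B * (Q * (P * (B * Q)))"
  proof -
    have "P * B * Q \<in> carrier_mat n n" using PB Q by simp
    hence "A * A = P * B * (Q * (P * B * Q))" unfolding AB by (rule assoc_mult_mat[OF PB Q])
    thus ?thesis unfolding assoc_mult_mat[OF P B Q] .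
  qed
  also have "Q * (P * (B * Q)) = B * Q"
    using assoc_mult_mat[OF Q P BQ] unfolding QP left_mult_one_mat[OF BQ] by simp
  also have "P * B * (B * Q) = P * (B * B) * Q"
    using assoc_mult_mat[OF PB B Q] assoc_mult_mat[OF P B B] by simp
  finally have "trc (A * A) = trc (B * B)" using trc_similar[of "B * B" n P Q] B P Q QP by simp
  also have "\<dots> = (\<Sum>i<n. \<Sum>p<n. B $$ (i, p) * B $$ (p, i))" by (rule trc_mult_sum[OF B B])
  also have "\<dots> = (\<Sum>i<n. \<Sum>p<n. if p = i then (B $$ (i, i))\<^sup>2 else 0)"
  proof (intro sum.cong refl)
    fix i p assume ip: "i \<in> {..<n}" "p \<in> {..<n}"
    have z: "B $$ (r, c) = 0" if "c < r" "r < n" for r c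
      using ut that B by (auto simp: upper_triangular_def)
    consider "p < i" | "p = i" | "i < p" by linarith
    thus "B $$ (i, p) * B $$ (p, i) = (if p = i then (B $$ (i, i))\<^sup>2 else 0)"
      by cases (use z[of p i] z[of i p] ip in \<open>auto simp: power2_eq_square\<close>)
  qed
  also have "\<dots> = (\<Sum>i<n. (B $$ (i, i))\<^sup>2)" by simp
  also have "\<dots> = (\<Sum>e\<leftarrow>es. e\<^sup>2)"
    by (simp add: es interv_sum_list_conv_sum_set_nat atLeast0LessThan comp_def)
  finally show "trc (A * A) = (\<Sum>e\<leftarrow>es. e\<^sup>2)" .
qed

section \<open>Entries of the spiked matrix and of its square root\<close>

lemma double_sum_square: "(\<Sum>i<n. \<Sum>j<n. (u i * u j)\<^sup>2) = ((\<Sum>i<n. (u i)\<^sup>2)::real)\<^sup>2"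
  by (simp add: power2_eq_square[of "sum _ _"] sum_product power_mult_distrib)

lemma delta_sum: "(i::nat) < n \<Longrightarrow> (\<Sum>j<n. (if i = j then 1 else 0) * f j) = (f i::real)"
  by (simp add: if_distrib[of "\<lambda>x. x * _"] sum.delta sum.delta' cong: if_cong)

text \<open>The first two traces determine the rank one perturbation: the Frobenius norm of the difference vanishes.\<close>

lemma rank_one_perturbation:
  fixes S :: "real mat" and v :: "nat \<Rightarrow> real"
  assumes n: "1 \<le> n" and sym: "sym_mat n S"
    and cp: "char_poly S = (\<Prod>e\<leftarrow>\<theta> # replicate (n - 1) 1. [:- e, 1:])"
    and vu: "(\<Sum>i<n. (v i)\<^sup>2) = 1"
    and ve: "\<And>i. i < n \<Longrightarrow> (\<Sum>j<n. S $$ (i, j) * v j) = \<theta> * v i"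
    and ij: "i < n" "j < n"
  shows "S $$ (i, j) = (if i = j then 1 else 0) + (\<theta> - 1) * v i * v j"
proof -
  have S: "S \<in> carrier_mat n n" using sym by (simp add: sym_mat_def)
  have St: "S $$ (j, i) = S $$ (i, j)" if "i < n" "j < n" for i j
    using sym that S unfolding sym_mat_def by (metis carrier_matD index_transpose_mat(1))
  have 1: "(\<Sum>i<n. S $$ (i, i)) = \<theta> + (real n - 1)"
    using trc_char_poly(1)[OF S cp] S n by (simp add: trc_def sum_list_replicate of_nat_diff)
  have 2: "(\<Sum>i<n. \<Sum>j<n. (S $$ (i, j))\<^sup>2) = \<theta>\<^sup>2 + (real n - 1)"
  proof -
    have "trc (S * S) = \<theta>\<^sup>2 + (real n - 1)"
      using trc_char_poly(2)[OF S cp] n by (simp add: sum_list_replicate of_nat_diff)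
    moreover have "trc (S * S) = (\<Sum>i<n. \<Sum>j<n. (S $$ (i, j))\<^sup>2)"
      unfolding trc_mult_sum[OF S S] by (intro sum.cong refl) (simp add: St power2_eq_square)
    ultimately show ?thesis by simp
  qed
  define c where "c = \<theta> - 1"
  define d where "d i j = (if i = j then 1 else 0::real)" for i j :: nat
  have 3: "(\<Sum>i<n. \<Sum>j<n. d i j * d i j) = real n"
    and 4: "(\<Sum>i<n. \<Sum>j<n. d i j * S $$ (i, j)) = \<theta> + (real n - 1)"
    and 5: "(\<Sum>i<n. \<Sum>j<n. d i j * (v i * v j)) = 1"
    using 1 vu by (simp_all add: d_def delta_sum power2_eq_square)
  have 6: "(\<Sum>i<n. \<Sum>j<n. v i * (S $$ (i, j) * v j)) = \<theta>"
  proof -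
    have "(\<Sum>i<n. \<Sum>j<n. v i * (S $$ (i, j) * v j)) = (\<Sum>i<n. \<theta> * (v i)\<^sup>2)"
      by (intro sum.cong refl) (simp add: sum_distrib_left[symmetric] ve power2_eq_square)
    thus ?thesis by (simp add: sum_distrib_left[symmetric] vu)
  qed
  \<comment> \<open>All terms of the expanded norm are known: the traces of S and of its square, the
    length of v, and v^T S v = \<theta>.\<close>
  define D where "D i j = S $$ (i, j) - d i j - c * (v i * v j)" for i j
  have "(\<Sum>i<n. \<Sum>j<n. (D i j)\<^sup>2) = (\<Sum>i<n. \<Sum>j<n. (S $$ (i, j))\<^sup>2 + d i j * d i j + c\<^sup>2 * (v i * v j)\<^sup>2
      - 2 * (d i j * S $$ (i, j)) - (2 * c) * (v i * (S $$ (i, j) * v j)) + (2 * c) * (d i j * (v i * v j)))"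
    by (intro sum.cong refl) (simp add: D_def power2_eq_square algebra_simps)
  also have "\<dots> = (\<Sum>i<n. \<Sum>j<n. (S $$ (i, j))\<^sup>2) + (\<Sum>i<n. \<Sum>j<n. d i j * d i j) + c\<^sup>2 * (\<Sum>i<n. \<Sum>j<n. (v i * v j)\<^sup>2)
      - 2 * (\<Sum>i<n. \<Sum>j<n. d i j * S $$ (i, j)) - (2 * c) * (\<Sum>i<n. \<Sum>j<n. v i * (S $$ (i, j) * v j))
      + (2 * c) * (\<Sum>i<n. \<Sum>j<n. d i j * (v i * v j))"
    by (simp only: sum.distrib sum_subtractf sum_distrib_left)
  also have "\<dots> = 0" unfolding 2 3 4 5 6 double_sum_square vu by (simp add: c_def power2_eq_square algebra_simps)
  finally have "(\<Sum>i<n. \<Sum>j<n. (D i j)\<^sup>2) = 0" .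
  hence "\<forall>i\<in>{..<n}. (\<Sum>j<n. (D i j)\<^sup>2) = 0"
    by (subst (asm) sum_nonneg_eq_0_iff) (auto intro: sum_nonneg)
  hence "(\<Sum>j<n. (D i j)\<^sup>2) = 0" using ij by auto
  hence "\<forall>j\<in>{..<n}. (D i j)\<^sup>2 = 0" by (subst (asm) sum_nonneg_eq_0_iff) auto
  hence "D i j = 0" using ij by auto
  thus ?thesis by (simp add: D_def d_def c_def)
qed

text \<open>Here w minimises a nonnegative form. Moving by -s u with u = B w changes the value to -2
  s N + s^2 K, which for s = N / (K + 1) is negative unless N = 0; the summand 1 covers K =
  0.\<close>

lemma psd_form_kernel:
  fixes B :: "nat \<Rightarrow> nat \<Rightarrow> real"
  assumes sym: "\<And>i j. i < n \<Longrightarrow> j < n \<Longrightarrow> B i j = B j i"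
    and psd: "\<And>w. 0 \<le> (\<Sum>i<n. \<Sum>j<n. w i * B i j * w j)"
    and z: "(\<Sum>i<n. \<Sum>j<n. w i * B i j * w j) = 0" and i: "i < n"
  shows "(\<Sum>j<n. B i j * w j) = 0"
proof -
  define u where "u i = (\<Sum>j<n. B i j * w j)" for i
  define N where "N = (\<Sum>i<n. (u i)\<^sup>2)"
  define K where "K = (\<Sum>i<n. \<Sum>j<n. u i * B i j * u j)"
  have N0: "0 \<le> N" and K0: "0 \<le> K" unfolding N_def K_def by (auto intro!: sum_nonneg psd)
  have uw: "(\<Sum>i<n. \<Sum>j<n. u i * B i j * w j) = N"
    by (simp add: N_def power2_eq_square mult.assoc sum_distrib_left[symmetric]) (simp add: u_def)
  have wu: "(\<Sum>i<n. \<Sum>j<n. w i * B i j * u j) = N"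
  proof -
    have "(\<Sum>i<n. \<Sum>j<n. w i * B i j * u j) = (\<Sum>j<n. \<Sum>i<n. w i * B i j * u j)" by (rule sum.swap)
    also have "\<dots> = (\<Sum>j<n. \<Sum>i<n. u j * B j i * w i)" by (intro sum.cong refl) (simp add: sym mult_ac)
    finally show ?thesis using uw by simp
  qed
  define s where "s = N / (K + 1)"
  have "0 \<le> (\<Sum>i<n. \<Sum>j<n. (w i - s * u i) * B i j * (w j - s * u j))" by (rule psd)
  also have "\<dots> = (\<Sum>i<n. \<Sum>j<n. w i * B i j * w j - s * (u i * B i j * w j) - s * (w i * B i j * u j) + s\<^sup>2 * (u i * B i j * u j))"
    by (intro sum.cong refl) (simp add: power2_eq_square algebra_simps)
  also have "\<dots> = 0 - s * N - s * N + s\<^sup>2 * K"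
    unfolding K_def by (simp only: sum.distrib sum_subtractf sum_distrib_left[symmetric] z uw wu)
  finally have "2 * (s * N) \<le> s * (s * K)" by (simp add: power2_eq_square mult_ac)
  moreover have "s * K \<le> N" unfolding s_def using N0 K0 by (simp add: field_simps)
  hence "s * (s * K) \<le> s * N" using N0 K0 by (intro mult_left_mono) (auto simp: s_def)
  ultimately have "s * N \<le> 0" by linarith
  hence "N\<^sup>2 / (K + 1) \<le> 0" by (simp add: s_def power2_eq_square)
  hence "N = 0" using K0 by (simp add: divide_le_0_iff)
  hence "\<forall>i\<in>{..<n}. (u i)\<^sup>2 = 0" unfolding N_def by (subst (asm) sum_nonneg_eq_0_iff) auto
  thus ?thesis using i by (auto simp: u_def)
qed

text \<open>Put D = B - C. Equal squares give B D + D C = 0, and multiplying by D and taking the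
  trace writes 0 as a sum of values of the two nonnegative forms on the columns of D. All of them
  vanish, so B D = C D = 0 by \<open>psd_form_kernel\<close>, hence D D = 0 and D = 0. This
  justifies the definite description in \<open>psd_sqrt\<close>.\<close>

lemma psd_form_root_unique:
  fixes B C :: "nat \<Rightarrow> nat \<Rightarrow> real"
  assumes B: "\<And>i j. i < n \<Longrightarrow> j < n \<Longrightarrow> B i j = B j i" "\<And>w. 0 \<le> (\<Sum>i<n. \<Sum>j<n. w i * B i j * w j)"
    and C: "\<And>i j. i < n \<Longrightarrow> j < n \<Longrightarrow> C i j = C j i" "\<And>w. 0 \<le> (\<Sum>i<n. \<Sum>j<n. w i * C i j * w j)"
    and eq: "\<And>i j. i < n \<Longrightarrow> j < n \<Longrightarrow> (\<Sum>k<n. B i k * B k j) = (\<Sum>k<n. C i k * C k j)"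
    and ij: "i < n" "j < n"
  shows "B i j = C i j"
proof -
  define D where "D i j = B i j - C i j" for i j
  have Ds: "D i j = D j i" if "i < n" "j < n" for i j using B(1) C(1) that by (simp add: D_def)
  define qB where "qB j = (\<Sum>i<n. \<Sum>k<n. D i j * B i k * D k j)" for j
  define qC where "qC j = (\<Sum>i<n. \<Sum>k<n. D i j * C i k * D k j)" for j
  have pos: "0 \<le> qB j" "0 \<le> qC j" for j unfolding qB_def qC_def by (rule B(2) C(2))+
  have z: "(\<Sum>k<n. B i k * D k j) + (\<Sum>k<n. D i k * C k j) = 0" if "i < n" "j < n" for i j
  proof -
    have "(\<Sum>k<n. B i k * D k j) + (\<Sum>k<n. D i k * C k j) = (\<Sum>k<n. B i k * B k j) - (\<Sum>k<n. C i k * C k j)"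
    proof -
      have "(\<Sum>k<n. B i k * D k j + D i k * C k j) = (\<Sum>k<n. B i k * B k j - C i k * C k j)"
        by (rule sum.cong[OF refl]) (simp add: D_def left_diff_distrib right_diff_distrib)
      thus ?thesis by (simp only: sum.distrib sum_subtractf)
    qed
    thus ?thesis using eq[OF that] by simp
  qed
  have "(\<Sum>j<n. qB j) + (\<Sum>j<n. qC j) = 0"
  proof -
    have 1: "(\<Sum>j<n. qB j) = (\<Sum>j<n. \<Sum>i<n. D i j * (\<Sum>k<n. B i k * D k j))"
      by (simp add: qB_def sum_distrib_left mult.assoc)
    have "(\<Sum>j<n. qC j) = (\<Sum>j<n. \<Sum>i<n. D j i * (\<Sum>k<n. D j k * C k i))"
    proof (rule sum.cong[OF refl])
      fix j assume "j \<in> {..<n}"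
      hence "qC j = (\<Sum>i<n. \<Sum>k<n. D j i * (D j k * C k i))" unfolding qC_def
        by (intro sum.cong refl) (simp add: Ds[of _ j] C(1) mult_ac)
      thus "qC j = (\<Sum>i<n. D j i * (\<Sum>k<n. D j k * C k i))" by (simp add: sum_distrib_left)
    qed
    also have "\<dots> = (\<Sum>i<n. \<Sum>j<n. D j i * (\<Sum>k<n. D j k * C k i))" by (rule sum.swap)
    finally have 2: "(\<Sum>j<n. qC j) = (\<Sum>j<n. \<Sum>i<n. D i j * (\<Sum>k<n. D i k * C k j))" .
    have "(\<Sum>j<n. \<Sum>i<n. D i j * ((\<Sum>k<n. B i k * D k j) + (\<Sum>k<n. D i k * C k j))) = 0"
      by (intro sum.neutral ballI) (simp add: z)
    thus ?thesis unfolding 1 2 by (simp add: distrib_left sum.distrib)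
  qed
  moreover have "0 \<le> (\<Sum>j<n. qB j)" "0 \<le> (\<Sum>j<n. qC j)" by (intro sum_nonneg pos)+
  ultimately have s0: "(\<Sum>j<n. qB j) = 0" "(\<Sum>j<n. qC j) = 0" by linarith+
  have "qB j = 0" "qC j = 0"
    using s0 ij pos by (simp_all add: sum_nonneg_eq_0_iff)
  hence "(\<Sum>k<n. B i k * D k j) = 0" "(\<Sum>k<n. C i k * D k j) = 0" if "i < n" for i
    using psd_form_kernel[of n B "\<lambda>k. D k j", OF B] psd_form_kernel[of n C "\<lambda>k. D k j", OF C] that
    by (simp_all add: qB_def qC_def)
  hence "(\<Sum>k<n. B j k * D k j) - (\<Sum>k<n. C j k * D k j) = 0" using ij by simp
  hence "(\<Sum>k<n. D j k * D k j) = 0" by (simp add: D_def sum_subtractf[symmetric] algebra_simps)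
  moreover have "(\<Sum>k<n. D j k * D k j) = (\<Sum>k<n. (D k j)\<^sup>2)"
    using ij by (intro sum.cong refl) (simp add: Ds[of j] power2_eq_square)
  ultimately have "\<forall>k\<in>{..<n}. (D k j)\<^sup>2 = 0" by (simp add: sum_nonneg_eq_0_iff)
  hence "D i j = 0" using ij by auto
  thus ?thesis by (simp add: D_def)
qed

lemma scalar_prod_mult_mat_vec:
  fixes A :: "real mat"
  assumes "A \<in> carrier_mat n n" "w \<in> carrier_vec n"
  shows "scalar_prod w (A *\<^sub>v w) = (\<Sum>i<n. \<Sum>j<n. w $ i * A $$ (i, j) * w $ j)"
  using assms by (auto simp: scalar_prod_def atLeast0LessThan sum_distrib_left mult.assoc intro!: sum.cong)

lemma psd_mat_form:
  assumes "psd_mat n A"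
  shows "A \<in> carrier_mat n n" "i < n \<Longrightarrow> j < n \<Longrightarrow> A $$ (i, j) = A $$ (j, i)"
    "0 \<le> (\<Sum>i<n. \<Sum>j<n. w i * A $$ (i, j) * w j)"
proof -
  show A: "A \<in> carrier_mat n n" using assms by (simp add: psd_mat_def sym_mat_def)
  show "i < n \<Longrightarrow> j < n \<Longrightarrow> A $$ (i, j) = A $$ (j, i)"
    using assms A unfolding psd_mat_def sym_mat_def by (metis carrier_matD index_transpose_mat(1))
  have "0 \<le> scalar_prod (Matrix.vec n w) (A *\<^sub>v Matrix.vec n w)" using assms by (auto simp: psd_mat_def)
  thus "0 \<le> (\<Sum>i<n. \<Sum>j<n. w i * A $$ (i, j) * w j)"
    by (subst (asm) scalar_prod_mult_mat_vec[OF A]) auto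
qed

lemma psd_sqrt_eqI:
  assumes A: "A \<in> carrier_mat n n" and C: "psd_mat n C" "C * C = A"
  shows "psd_sqrt A = C"
  unfolding psd_sqrt_def
proof (rule the_equality)
  show "psd_mat (dim_row A) C \<and> C * C = A" using A C by simp
  fix B assume "psd_mat (dim_row A) B \<and> B * B = A"
  hence B: "psd_mat n B" "B * B = A" using A by auto
  note cB = psd_mat_form[OF B(1)] and cC = psd_mat_form[OF C(1)]
  show "B = C"
  proof (rule eq_matI)
    fix i j assume "i < dim_row C" "j < dim_col C"
    hence ij: "i < n" "j < n" using cC(1) by auto
    show "B $$ (i, j) = C $$ (i, j)"
    proof (rule psd_form_root_unique[of n "\<lambda>i j. B $$ (i, j)" "\<lambda>i j. C $$ (i, j)"])
      fix i j assume ij: "i < n" "j < n"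
      show "(\<Sum>k<n. B $$ (i, k) * B $$ (k, j)) = (\<Sum>k<n. C $$ (i, k) * C $$ (k, j))"
        unfolding index_mult_sum[OF cB(1) cB(1) ij, symmetric] index_mult_sum[OF cC(1) cC(1) ij, symmetric]
        by (simp only: B(2) C(2))
    qed (use cB cC ij in auto)
  qed (use cB(1) cC(1) in auto)
qed

text \<open>With r = sqrt \<theta> - 1 one has r^2 + 2 r = \<theta> - 1, so the candidate squares to
  S. It is positive semidefinite because the component along v is at most the norm of w, by
  Cauchy-Schwarz.\<close>

lemma psd_sqrt_rank_one:
  fixes v :: "nat \<Rightarrow> real"
  assumes S: "S \<in> carrier_mat n n" and th: "0 \<le> \<theta>" and vu: "(\<Sum>i<n. (v i)\<^sup>2) = 1"
    and Sv: "\<And>i j. i < n \<Longrightarrow> j < n \<Longrightarrow> S $$ (i, j) = (if i = j then 1 else 0) + (\<theta> - 1) * v i * v j"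
  shows "psd_sqrt S = mat n n (\<lambda>(i, j). (if i = j then 1 else 0) + (sqrt \<theta> - 1) * v i * v j)" (is "_ = ?C")
proof (rule psd_sqrt_eqI[OF S])
  let ?d = "\<lambda>i j. if i = j then 1 else (0::real)"
  have C: "?C \<in> carrier_mat n n" by simp
  show "psd_mat n ?C" unfolding psd_mat_def sym_mat_def
  proof (intro conjI ballI C)
    show "transpose_mat ?C = ?C" by (rule eq_matI) (auto simp: mult_ac)
    fix w :: "real Matrix.vec" assume w: "w \<in> carrier_vec n"
    define p where "p = (\<Sum>i<n. w $ i * v i)"
    have "scalar_prod w (?C *\<^sub>v w) = (\<Sum>i<n. \<Sum>j<n. ?d i j * (w $ i * w $ j) + (sqrt \<theta> - 1) * ((w $ i * v i) * (w $ j * v j)))"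
      unfolding scalar_prod_mult_mat_vec[OF C w] by (intro sum.cong refl) (simp add: algebra_simps)
    also have "\<dots> = (\<Sum>i<n. (w $ i)\<^sup>2) + (sqrt \<theta> - 1) * p\<^sup>2"
      by (simp add: sum.distrib delta_sum sum_distrib_left[symmetric] power2_eq_square p_def sum_product)
    also have "\<dots> \<ge> 0"
    proof -
      have "p\<^sup>2 \<le> (\<Sum>i<n. (w $ i)\<^sup>2) * (\<Sum>i<n. (v i)\<^sup>2)" unfolding p_def by (rule Cauchy_Schwarz_ineq_sum)
      moreover have "0 \<le> sqrt \<theta> * p\<^sup>2" using th by simp
      ultimately show ?thesis by (simp add: vu algebra_simps)
    qed
    finally show "0 \<le> scalar_prod w (?C *\<^sub>v w)" .
  qed
  show "?C * ?C = S"
  proof (rule eq_matI)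
    fix i j assume "i < dim_row S" "j < dim_col S"
    hence ij: "i < n" "j < n" using S by auto
    define r where "r = sqrt \<theta> - 1"
    have r: "r\<^sup>2 + 2 * r = \<theta> - 1" using th by (simp add: r_def power2_eq_square algebra_simps)
    have "(?C * ?C) $$ (i, j) = (\<Sum>k<n. (?d i k + r * v i * v k) * (?d k j + r * v k * v j))"
      unfolding index_mult_sum[OF C C ij] r_def by (intro sum.cong refl) (use ij in auto)
    also have "\<dots> = (\<Sum>k<n. ?d i k * (?d k j + r * v k * v j) + ?d j k * (r * v i * v k) + (r\<^sup>2 * v i * v j) * (v k)\<^sup>2)"
      by (intro sum.cong refl) (auto simp: algebra_simps power2_eq_square)
    also have "\<dots> = (?d i j + r * v i * v j) + r * v i * v j + r\<^sup>2 * v i * v j"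
      unfolding sum.distrib sum_distrib_left[symmetric] vu using ij by (simp only: delta_sum mult_1_right)
    also have "\<dots> = ?d i j + (r\<^sup>2 + 2 * r) * v i * v j" by (simp add: algebra_simps)
    finally show "(?C * ?C) $$ (i, j) = S $$ (i, j)" unfolding r Sv[OF ij] .
  qed (use S in auto)
qed

lemma sample_cov_index:
  fixes v :: "nat \<Rightarrow> real"
  assumes n: "1 \<le> n" and X: "X \<in> carrier_mat n m"
    and W: "psd_sqrt S = mat n n (\<lambda>(i, j). (if i = j then 1 else 0) + \<tau> * v i * v j)"
    and XX: "\<And>k i. k < m \<Longrightarrow> i < n \<Longrightarrow> XX k i = X $$ (i, k)" and ij: "i < n" "j < n"
  shows "sample_cov n S X $$ (i, j) = (\<Sum>k<m. ycol n \<tau> v (XX k) i * ycol n \<tau> v (XX k) j)"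
proof -
  define R where "R = psd_sqrt S"
  have R: "R \<in> carrier_mat n n" by (simp add: R_def W)
  have Rij: "R $$ (i, j) = (if i = j then 1 else 0) + \<tau> * v i * v j" if "i < n" "j < n" for i j
    using that by (simp add: R_def W)
  have Rs: "R $$ (i, j) = R $$ (j, i)" if "i < n" "j < n" for i j
    using that by (simp add: Rij)
  define Z where "Z = R * X"
  have Z: "Z \<in> carrier_mat n m" using R X by (simp add: Z_def)
  have Zik: "Z $$ (i, k) = sqrt (real n) * ycol n \<tau> v (XX k) i" if "i < n" "k < m" for i k
  proof -
    have "Z $$ (i, k) = (\<Sum>j<n. (if i = j then 1 else 0) * X $$ (j, k) + \<tau> * (X $$ (j, k) * v j) * v i)"
      unfolding Z_def index_mult_sum[OF R X that]
      by (intro sum.cong refl) (use that in \<open>auto simp: Rij algebra_simps\<close>)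
    also have "\<dots> = XX k i + \<tau> * (\<Sum>j<n. XX k j * v j) * v i"
      using that by (simp add: sum.distrib delta_sum XX sum_distrib_left sum_distrib_right)
    finally show ?thesis using n by (simp add: ycol_def)
  qed
  have XtR: "transpose_mat X * R \<in> carrier_mat m n" using X R by simp
  have "psd_sqrt S * X * transpose_mat X * psd_sqrt S = Z * (transpose_mat X * R)"
    unfolding R_def[symmetric] Z_def[symmetric] using assoc_mult_mat[OF Z _ R, of "transpose_mat X"] X by simp
  hence "sample_cov n S X $$ (i, j) = (1 / real n) * (Z * (transpose_mat X * R)) $$ (i, j)"
    unfolding sample_cov_def using ij carrier_matD[OF Z] carrier_matD[OF R] by simp
  also have "(Z * (transpose_mat X * R)) $$ (i, j) = (\<Sum>k<m. Z $$ (i, k) * Z $$ (j, k))"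
  proof -
    have "(transpose_mat X * R) $$ (k, j) = Z $$ (j, k)" if "k < m" for k
    proof -
      have Xt: "transpose_mat X \<in> carrier_mat m n" using X by simp
      show ?thesis unfolding Z_def index_mult_sum[OF R X ij(2) that] index_mult_sum[OF Xt R that ij(2)]
        by (intro sum.cong refl) (use X that ij in \<open>auto simp: Rs\<close>)
    qed
    thus ?thesis unfolding index_mult_sum[OF Z XtR ij] by (intro sum.cong) auto
  qed
  also have "(1 / real n) * (\<Sum>k<m. Z $$ (i, k) * Z $$ (j, k)) = (\<Sum>k<m. ycol n \<tau> v (XX k) i * ycol n \<tau> v (XX k) j)"
    unfolding sum_distrib_left
  proof (intro sum.cong refl)
    fix k assume "k \<in> {..<m}"
    hence "Z $$ (i, k) * Z $$ (j, k) = (sqrt (real n) * sqrt (real n)) * (ycol n \<tau> v (XX k) i * ycol n \<tau> v (XX k) j)"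
      using ij by (simp add: Zik)
    thus "(1 / real n) * (Z $$ (i, k) * Z $$ (j, k)) = ycol n \<tau> v (XX k) i * ycol n \<tau> v (XX k) j"
      using n by simp
  qed
  finally show ?thesis .
qed

text \<open>A one-sided inverse of a square matrix is two-sided, so orthonormal rows have
  orthonormal columns.\<close>

lemma orthonormal_complete:
  fixes \<phi> :: "nat \<Rightarrow> real Matrix.vec"
  assumes c: "\<And>k. k < n \<Longrightarrow> \<phi> k \<in> carrier_vec n"
    and o: "\<And>k l. k < n \<Longrightarrow> l < n \<Longrightarrow> scalar_prod (\<phi> k) (\<phi> l) = (if k = l then 1 else 0)"
    and ij: "i < n" "j < n"
  shows "(\<Sum>k<n. \<phi> k $ i * \<phi> k $ j) = (if i = j then 1 else 0)"
proof -
  define F where "F = mat n n (\<lambda>(k, i). \<phi> k $ i)"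
  define G where "G = mat n n (\<lambda>(i, k). \<phi> k $ i)"
  have F: "F \<in> carrier_mat n n" and G: "G \<in> carrier_mat n n" by (auto simp: F_def G_def)
  have "F * G = 1\<^sub>m n"
  proof (rule eq_matI)
    fix k l assume "k < dim_row (1\<^sub>m n :: real mat)" "l < dim_col (1\<^sub>m n :: real mat)"
    hence kl: "k < n" "l < n" by auto
    have "(F * G) $$ (k, l) = scalar_prod (\<phi> k) (\<phi> l)"
      unfolding index_mult_sum[OF F G kl] using c[OF kl(2)] kl
      by (auto simp: F_def G_def scalar_prod_def atLeast0LessThan intro!: sum.cong)
    thus "(F * G) $$ (k, l) = (1\<^sub>m n) $$ (k, l)" using kl o by simp
  qed (use F G in auto)
  hence "G * F = 1\<^sub>m n" by (rule mat_mult_left_right_inverse[OF F G])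
  hence "(G * F) $$ (i, j) = (if i = j then 1 else 0)" using ij by simp
  thus ?thesis unfolding index_mult_sum[OF G F ij] using ij by (simp add: F_def G_def)
qed

text \<open>The bridge from matrices to lists of columns, for one fixed outcome. Only entries in
  range are prescribed for \<open>XX\<close> and \<open>v\<close>, since these will be restricted
  functions, the points of the product spaces.\<close>

lemma (in entry_law) spectral_identity:
  fixes S X :: "real mat" and vv :: "real Matrix.vec" and XX :: "nat \<Rightarrow> nat \<Rightarrow> real" and v :: "nat \<Rightarrow> real"
  assumes n: "1 \<le> n" and th: "0 \<le> \<theta>" and sym: "sym_mat n S"
    and cp: "char_poly S = (\<Prod>e\<leftarrow>\<theta> # replicate (n - 1) 1. [:- e, 1:])"
    and vu: "scalar_prod vv vv = 1" and ve: "eigenvector S vv \<theta>"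
    and X: "X \<in> carrier_mat n m" and eb: "ordered_eigenbasis n (sample_cov n S X) lam \<phi>"
    and XX: "\<And>k i. k < m \<Longrightarrow> i < n \<Longrightarrow> XX k i = X $$ (i, k)" and v: "\<And>i. i < n \<Longrightarrow> v i = vv $ i"
    and z: "0 < Im z"
  shows "model.s n m (sqrt \<theta> - 1) v z XX = stj n (\<lambda>_. 1 / real n) lam z"
    and "model.g n m (sqrt \<theta> - 1) v z XX = stj n (\<lambda>k. (scalar_prod (\<phi> k) vv)\<^sup>2) lam z"
    and "(\<Sum>i<n. (v i)\<^sup>2) = 1"
proof -
  let ?\<tau> = "sqrt \<theta> - 1"
  have S: "S \<in> carrier_mat n n" using sym by (simp add: sym_mat_def)
  have vc: "vv \<in> carrier_vec n" using ve S by (simp add: eigenvector_def)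
  have "scalar_prod vv vv = (\<Sum>i<n. (v i)\<^sup>2)"
    using vc v by (auto simp: scalar_prod_def atLeast0LessThan power2_eq_square intro!: sum.cong)
  thus v1: "(\<Sum>i<n. (v i)\<^sup>2) = 1" using vu by simp
  have "(\<Sum>j<n. S $$ (i, j) * v j) = \<theta> * v i" if i: "i < n" for i
  proof -
    have "(S *\<^sub>v vv) $ i = (\<theta> \<cdot>\<^sub>v vv) $ i" using ve by (simp add: eigenvector_def)
    thus ?thesis using i vc S v by (simp add: scalar_prod_def atLeast0LessThan)
  qed
  note Sij = rank_one_perturbation[OF n sym cp v1 this]
  have W: "psd_sqrt S = mat n n (\<lambda>(i, j). (if i = j then 1 else 0) + ?\<tau> * v i * v j)"
    by (rule psd_sqrt_rank_one[OF S th v1 Sij])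
  define A where "A = sample_cov n S X"
  have A: "A \<in> carrier_mat n n" using X by (auto simp: A_def sample_cov_def W)
  have Aij: "A $$ (i, j) = (\<Sum>k<m. ycol n ?\<tau> v (XX k) i * ycol n ?\<tau> v (XX k) j)" if "i < n" "j < n" for i j
    unfolding A_def by (rule sample_cov_index[OF n X W XX that])
  have fc: "\<phi> k \<in> carrier_vec n" and fe: "eigenvector A (\<phi> k) (lam k)" if "k < n" for k
    using eb that by (auto simp: ordered_eigenbasis_def A_def)
  have fo: "scalar_prod (\<phi> k) (\<phi> l) = (if k = l then 1 else 0)" if "k < n" "l < n" for k l
    using eb that by (auto simp: ordered_eigenbasis_def)
  define ys where "ys = map (\<lambda>k. ycol n ?\<tau> v (XX k)) [0..<m]"
  define f where "f k i = \<phi> k $ i" for k i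
  have e: "(\<Sum>a\<leftarrow>ys. cx a i * cdot n (cx a) (cx (f k))) = of_real (lam k) * cx (f k) i" if "k < n" "i < n" for k i
  proof -
    have "(\<Sum>a\<leftarrow>ys. cx a i * cdot n (cx a) (cx (f k)))
        = of_real (\<Sum>p<m. \<Sum>j<n. ycol n ?\<tau> v (XX p) i * ycol n ?\<tau> v (XX p) j * f k j)"
      by (simp add: ys_def comp_def interv_sum_list_conv_sum_set_nat atLeast0LessThan cdot_def cx_def sum_distrib_left mult.assoc)
    also have "(\<Sum>p<m. \<Sum>j<n. ycol n ?\<tau> v (XX p) i * ycol n ?\<tau> v (XX p) j * f k j) = (\<Sum>j<n. A $$ (i, j) * f k j)"
      using that by (subst sum.swap) (simp add: Aij sum_distrib_right)
    also have "\<dots> = (A *\<^sub>v \<phi> k) $ i"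
      using that A fc[OF that(1)] by (simp add: scalar_prod_def atLeast0LessThan f_def)
    also have "\<dots> = lam k * f k i" using fe[OF that(1)] fc[OF that(1)] that by (simp add: eigenvector_def f_def)
    finally show ?thesis by (simp add: cx_def)
  qed
  have compl: "(\<Sum>k<n. f k i * f k j) = (if i = j then 1 else 0)" if "i < n" "j < n" for i j
    unfolding f_def by (rule orthonormal_complete[OF fc fo that])
  have ortho: "(\<Sum>i<n. (f k i)\<^sup>2) = 1" if "k < n" for k
    using fo[OF that that] fc[OF that] by (simp add: scalar_prod_def atLeast0LessThan f_def power2_eq_square)
  have cd: "(cdot n (cx v) (cx (f k)))\<^sup>2 = of_real ((scalar_prod (\<phi> k) vv)\<^sup>2)" if "k < n" for k
  proof -
    have "cdot n (cx v) (cx (f k)) = of_real (\<Sum>i<n. v i * f k i)" by (simp add: cdot_def cx_def)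
    also have "(\<Sum>i<n. v i * f k i) = scalar_prod (\<phi> k) vv"
      using vc v by (auto simp: scalar_prod_def atLeast0LessThan f_def intro!: sum.cong)
    finally show ?thesis by simp
  qed
  have mod: "model P n v z" by (rule modelI[OF n v1 z])
  have co: "model.cols n m ?\<tau> v XX = ys"
    by (simp add: model.cols_def[OF mod] model.Y_def[OF mod] ys_def)
  show "model.s n m ?\<tau> v z XX = stj n (\<lambda>_. 1 / real n) lam z"
  proof -
    have "model.s n m ?\<tau> v z XX = (\<Sum>k<n. 1 / (of_real (lam k) - z)) / of_nat n"
      unfolding model.s_def[OF mod] co by (rule spectral_sums(2)[OF z e compl ortho])
    also have "\<dots> = stj n (\<lambda>_. 1 / real n) lam z"
      unfolding stj_def sum_divide_distrib by (intro sum.cong refl) (simp add: divide_divide_eq_left mult.commute)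
    finally show ?thesis .
  qed
  show "model.g n m ?\<tau> v z XX = stj n (\<lambda>k. (scalar_prod (\<phi> k) vv)\<^sup>2) lam z"
  proof -
    have "model.g n m ?\<tau> v z XX = (\<Sum>k<n. (cdot n (cx v) (cx (f k)))\<^sup>2 / (of_real (lam k) - z))"
      unfolding model.g_def[OF mod] co by (rule spectral_sums(1)[OF z e compl ortho])
    also have "\<dots> = stj n (\<lambda>k. (scalar_prod (\<phi> k) vv)\<^sup>2) lam z"
      unfolding stj_def by (intro sum.cong refl) (simp add: cd del: of_real_power)
    finally show ?thesis .
  qed
qed

section \<open>Independence and the high probability event\<close>

text \<open>Preimages of rectangles lie in the two generated sigma-algebras, where independence
  factorises, and rectangles determine the product law. The maps f and h carry matrices and vectors
  into product spaces of their entries.\<close>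

lemma distr_indep_rvs:
  assumes M: "prob_space M" and ind: "indep_rvs M S X T Y" and f: "f \<in> measurable S S'" and h: "h \<in> measurable T T'"
  shows "distr M (S' \<Otimes>\<^sub>M T') (\<lambda>\<omega>. (f (X \<omega>), h (Y \<omega>))) = distr M S' (\<lambda>\<omega>. f (X \<omega>)) \<Otimes>\<^sub>M distr M T' (\<lambda>\<omega>. h (Y \<omega>))"
proof -
  interpret prob_space M by (rule M)
  have X: "X \<in> measurable M S" and Y: "Y \<in> measurable M T" using ind by (auto simp: indep_rvs_def)
  have fX [measurable]: "(\<lambda>\<omega>. f (X \<omega>)) \<in> measurable M S'" and hY [measurable]: "(\<lambda>\<omega>. h (Y \<omega>)) \<in> measurable M T'"
    using measurable_compose[OF X f] measurable_compose[OF Y h] by auto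
  show ?thesis
  proof (rule pair_measure_eqI[symmetric])
    show "sigma_finite_measure (distr M S' (\<lambda>\<omega>. f (X \<omega>)))" "sigma_finite_measure (distr M T' (\<lambda>\<omega>. h (Y \<omega>)))"
      by (rule prob_space_imp_sigma_finite, rule prob_space_distr, measurable)+
    show "sets (distr M S' (\<lambda>\<omega>. f (X \<omega>)) \<Otimes>\<^sub>M distr M T' (\<lambda>\<omega>. h (Y \<omega>))) = sets (distr M (S' \<Otimes>\<^sub>M T') (\<lambda>\<omega>. (f (X \<omega>), h (Y \<omega>))))"
      by (simp cong: sets_pair_measure_cong)
    fix A B assume "A \<in> sets (distr M S' (\<lambda>\<omega>. f (X \<omega>)))" "B \<in> sets (distr M T' (\<lambda>\<omega>. h (Y \<omega>)))"
    hence A: "A \<in> sets S'" and B: "B \<in> sets T'" by auto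
    define a where "a = X -` (f -` A \<inter> space S) \<inter> space M"
    define b where "b = Y -` (h -` B \<inter> space T) \<inter> space M"
    have "a \<in> sets (vimage_algebra (space M) X S)" "b \<in> sets (vimage_algebra (space M) Y T)"
      unfolding a_def b_def by (intro in_vimage_algebra measurable_sets[OF f A] measurable_sets[OF h B])+
    hence ab: "prob (a \<inter> b) = prob a * prob b"
      using ind by (intro indep_setD) (auto simp: indep_rvs_def)
    have "(\<lambda>\<omega>. f (X \<omega>)) -` A \<inter> space M = a" "(\<lambda>\<omega>. h (Y \<omega>)) -` B \<inter> space M = b"
      "(\<lambda>\<omega>. (f (X \<omega>), h (Y \<omega>))) -` (A \<times> B) \<inter> space M = a \<inter> b"
      using measurable_space[OF X] measurable_space[OF Y] by (auto simp: a_def b_def)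
    thus "emeasure (distr M S' (\<lambda>\<omega>. f (X \<omega>))) A * emeasure (distr M T' (\<lambda>\<omega>. h (Y \<omega>))) B
        = emeasure (distr M (S' \<Otimes>\<^sub>M T') (\<lambda>\<omega>. (f (X \<omega>), h (Y \<omega>)))) (A \<times> B)"
      using A B ab by (simp add: emeasure_distr emeasure_eq_measure ennreal_mult)
  qed
qed

lemma nn_integral_le_of_sections:
  fixes F :: "'b \<times> 'c \<Rightarrow> ennreal"
  assumes law: "distr M (A \<Otimes>\<^sub>M B) W = A \<Otimes>\<^sub>M D" and W: "W \<in> measurable M (A \<Otimes>\<^sub>M B)"
    and A: "prob_space A" and D: "prob_space D" and sD: "sets D = sets B"
    and F: "F \<in> borel_measurable (A \<Otimes>\<^sub>M B)" and le: "\<And>v. (\<integral>\<^sup>+X. F (X, v) \<partial>A) \<le> c"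
  shows "(\<integral>\<^sup>+\<omega>. F (W \<omega>) \<partial>M) \<le> c"
proof -
  interpret A: prob_space A by (rule A)
  interpret D: prob_space D by (rule D)
  interpret pair_sigma_finite A D ..
  have F': "F \<in> borel_measurable (A \<Otimes>\<^sub>M D)"
    using F measurable_cong_sets[OF sets_pair_measure_cong[OF refl sD] refl] by blast
  have "(\<integral>\<^sup>+\<omega>. F (W \<omega>) \<partial>M) = integral\<^sup>N (distr M (A \<Otimes>\<^sub>M B) W) F"
    using F by (simp add: nn_integral_distr[OF W])
  also have "\<dots> = (\<integral>\<^sup>+v. (\<integral>\<^sup>+X. F (X, v) \<partial>A) \<partial>D)" unfolding law by (rule nn_integral_snd[OF F', symmetric])
  also have "\<dots> \<le> (\<integral>\<^sup>+v. c \<partial>D)" by (intro nn_integral_mono le)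
  also have "\<dots> = c" by (simp add: D.emeasure_space_1)
  finally show ?thesis .
qed

text \<open>Independence passes to the columns, as functions of disjoint blocks of entries, and
  within a column the joint law is again a product. The bounds n, m \<ge> 1 keep the index sets
  nonempty where independence is translated into product laws.\<close>

lemma (in entry_law) array_law:
  fixes Z :: "nat \<times> nat \<Rightarrow> 'a \<Rightarrow> real"
  assumes M: "prob_space M" and ind: "prob_space.indep_vars M (\<lambda>_. borel) Z ({..<n} \<times> {..<m})"
    and law: "\<And>i j. i < n \<Longrightarrow> j < m \<Longrightarrow> distr M borel (Z (i, j)) = P" and nm: "1 \<le> n" "1 \<le> m"
  shows "distr M (Omm n m) (\<lambda>\<omega>. \<lambda>k\<in>{..<m}. \<lambda>i\<in>{..<n}. Z (i, k) \<omega>) = Omm n m"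
proof -
  interpret M: prob_space M by (rule M)
  define K where "K k = {..<n} \<times> {k}" for k :: nat
  define h where "h k f = (\<lambda>i\<in>{..<n}. f (i, k))" for k :: nat and f :: "nat \<times> nat \<Rightarrow> real"
  define col where "col k \<omega> = (\<lambda>i\<in>{..<n}. Z (i, k) \<omega>)" for k :: nat and \<omega>
  have hm: "h k \<in> measurable (PiM (K k) (\<lambda>_. borel)) (C n)" for k
  proof -
    have "h k \<in> measurable (PiM (K k) (\<lambda>_. borel)) (PiM {..<n} (\<lambda>_. borel))"
      unfolding h_def by (intro measurable_restrict measurable_component_singleton) (auto simp: K_def)
    thus ?thesis using measurable_cong_sets[OF refl sets_PiM_cong[OF refl sets_P]] by blast
  qed
  have hcol: "h k (\<lambda>ij\<in>K k. Z ij \<omega>) = col k \<omega>" for k \<omega>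
    by (auto simp: h_def col_def K_def fun_eq_iff)
  have "M.indep_vars (\<lambda>k. PiM (K k) (\<lambda>_. borel)) (\<lambda>k \<omega>. restrict (\<lambda>ij. Z ij \<omega>) (K k)) {..<m}"
    by (rule M.indep_vars_restrict[OF ind]) (auto simp: K_def disjoint_family_on_def)
  hence "M.indep_vars (\<lambda>_. C n) (\<lambda>k \<omega>. h k (restrict (\<lambda>ij. Z ij \<omega>) (K k))) {..<m}"
    by (rule M.indep_vars_compose2) (rule hm)
  hence ic: "M.indep_vars (\<lambda>_. C n) col {..<m}" unfolding hcol by simp
  have cl: "distr M (C n) (col k) = C n" if k: "k < m" for k
  proof -
    have ik: "M.indep_vars (\<lambda>_. borel) Z (K k)"
      by (rule M.indep_vars_subset[OF ind]) (use k in \<open>auto simp: K_def\<close>)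
    have rv: "Z ij \<in> borel_measurable M" if "ij \<in> K k" for ij
      using ik that by (auto simp: M.indep_vars_def)
    have "(0, k) \<in> K k" using nm by (simp add: K_def)
    hence "K k \<noteq> {}" by blast
    hence "distr M (PiM (K k) (\<lambda>_. borel)) (\<lambda>x. \<lambda>ij\<in>K k. Z ij x) = PiM (K k) (\<lambda>ij. distr M borel (Z ij))"
      using M.indep_vars_iff_distr_eq_PiM'[where I = "K k" and M' = "\<lambda>_. borel" and X = Z] rv ik by blast
    also have "\<dots> = PiM (K k) (\<lambda>_. P)"
      by (intro PiM_cong refl) (use law k in \<open>auto simp: K_def\<close>)
    finally have 1: "distr M (PiM (K k) (\<lambda>_. borel)) (\<lambda>x. \<lambda>ij\<in>K k. Z ij x) = PiM (K k) (\<lambda>_. P)" .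
    have "distr M (C n) (col k) = distr (distr M (PiM (K k) (\<lambda>_. borel)) (\<lambda>x. \<lambda>ij\<in>K k. Z ij x)) (C n) (h k)"
      by (subst distr_distr[OF hm]) (auto simp: comp_def hcol intro!: measurable_restrict rv)
    also have "\<dots> = distr (PiM (K k) (\<lambda>_. P)) (C n) (\<lambda>w. \<lambda>i\<in>{..<n}. w (i, k))"
      unfolding 1 by (simp add: h_def[abs_def])
    also have "\<dots> = C n"
      by (rule distr_PiM_reindex) (auto simp: K_def inj_on_def prob_space_axioms)
    finally show ?thesis .
  qed
  have "0 \<in> {..<m}" using nm by simp
  hence "{..<m} \<noteq> {}" by blast
  moreover have "col k \<in> measurable M (C n)" if "k \<in> {..<m}" for k using ic that by (auto simp: M.indep_vars_def)
  ultimately have "distr M (Omm n m) (\<lambda>x. \<lambda>k\<in>{..<m}. col k x) = PiM {..<m} (\<lambda>k. distr M (C n) (col k))"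
    using M.indep_vars_iff_distr_eq_PiM'[where I = "{..<m}" and M' = "\<lambda>_. C n" and X = col] ic by blast
  also have "\<dots> = Omm n m" by (intro PiM_cong refl) (simp add: cl)
  finally show ?thesis by (simp add: col_def)
qed

section \<open>Measurability in the columns, the vector and the spectral parameter\<close>

definition ycols :: "nat \<Rightarrow> nat \<Rightarrow> real \<Rightarrow> (nat \<Rightarrow> real) \<Rightarrow> (nat \<Rightarrow> nat \<Rightarrow> real) \<Rightarrow> (nat \<Rightarrow> real) list" where
  "ycols n m \<tau> v X = map (\<lambda>k. ycol n \<tau> v (X k)) [0..<m]"

lemma (in entry_law) model_ycols:
  assumes "model P n v z"
  shows "model.s n m \<tau> v z X = trn n z (ycols n m \<tau> v X)"
    "model.g n m \<tau> v z X = cdot n (cx v) (mv n (res n z (ycols n m \<tau> v X)) (cx v))"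
proof -
  have "model.Y n \<tau> v X = (\<lambda>k. ycol n \<tau> v (X k))" by (rule ext) (rule model.Y_def[OF assms])
  thus "model.s n m \<tau> v z X = trn n z (ycols n m \<tau> v X)"
    "model.g n m \<tau> v z X = cdot n (cx v) (mv n (res n z (ycols n m \<tau> v X)) (cx v))"
    by (simp_all only: model.s_def[OF assms] model.g_def[OF assms] model.cols_def[OF assms] ycols_def)
qed

lemma res_ycols_measurable:
  assumes X: "\<And>k i. k < m \<Longrightarrow> i < n \<Longrightarrow> (\<lambda>w. X w k i) \<in> borel_measurable N"
    and v: "\<And>i. i < n \<Longrightarrow> (\<lambda>w. v w i) \<in> borel_measurable N" and Z: "Z \<in> borel_measurable N"
  shows "(\<lambda>w. trn n (Z w) (ycols n m \<tau> (v w) (X w))) \<in> borel_measurable N"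
    "(\<lambda>w. cdot n (cx (v w)) (mv n (res n (Z w) (ycols n m \<tau> (v w) (X w))) (cx (v w)))) \<in> borel_measurable N"
proof -
  note [measurable] = X v Z
  have "(\<lambda>w. res n (Z w) (map (\<lambda>a. a w) (map (\<lambda>k w. ycol n \<tau> (v w) (X w k)) [0..<m])) i j) \<in> borel_measurable N"
    if "i < n" "j < n" for i j
  proof (rule res_measurable[OF _ Z that])
    fix a i assume "a \<in> set (map (\<lambda>k w. ycol n \<tau> (v w) (X w k)) [0..<m])" and [simp]: "i < n"
    then obtain k where a: "a = (\<lambda>w. ycol n \<tau> (v w) (X w k))" and [simp]: "k < m" by auto
    show "(\<lambda>w. a w i) \<in> borel_measurable N" unfolding a ycol_def by measurable
  qed
  hence [measurable]: "(\<lambda>w. res n (Z w) (ycols n m \<tau> (v w) (X w)) i j) \<in> borel_measurable N" if "i < n" "j < n" for i j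
    using that by (simp add: ycols_def comp_def)
  show "(\<lambda>w. trn n (Z w) (ycols n m \<tau> (v w) (X w))) \<in> borel_measurable N"
    unfolding trn_def by measurable
  show "(\<lambda>w. cdot n (cx (v w)) (mv n (res n (Z w) (ycols n m \<tau> (v w) (X w))) (cx (v w)))) \<in> borel_measurable N"
    unfolding cdot_def mv_def cx_def by measurable
qed

text \<open>Tonelli turns a bound on the mean at each point of the segment into a bound on the mean
  of the integral along it.\<close>

lemma integral_window_le:
  fixes f :: "real \<Rightarrow> 'b \<Rightarrow> complex"
  assumes A: "sigma_finite_measure A" and f: "(\<lambda>p. f (snd p) (fst p)) \<in> borel_measurable (A \<Otimes>\<^sub>M lborel)"
    and le: "\<And>u. u \<in> {p..q} \<Longrightarrow> (\<integral>\<^sup>+X. ennreal (cmod (f u X - c)) \<partial>A) \<le> ennreal e" and pq: "p \<le> q" "0 \<le> e"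
  shows "(\<integral>\<^sup>+X. (\<integral>\<^sup>+u\<in>{p..q}. ennreal (cmod (f u X - c)) \<partial>lborel) \<partial>A) \<le> ennreal (e * (q - p))"
proof -
  interpret A: sigma_finite_measure A by (rule A)
  interpret pair_sigma_finite A lborel ..
  note [measurable] = f
  have m: "case_prod (\<lambda>X u. ennreal (cmod (f u X - c)) * indicator {p..q} u) \<in> borel_measurable (A \<Otimes>\<^sub>M lborel)"
    unfolding case_prod_beta' by measurable
  have "(\<integral>\<^sup>+X. (\<integral>\<^sup>+u\<in>{p..q}. ennreal (cmod (f u X - c)) \<partial>lborel) \<partial>A)
      = (\<integral>\<^sup>+u. (\<integral>\<^sup>+X. ennreal (cmod (f u X - c)) * indicator {p..q} u \<partial>A) \<partial>lborel)"
    by (rule Fubini'[OF m, symmetric])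
  also have "\<dots> \<le> (\<integral>\<^sup>+u. ennreal e * indicator {p..q} u \<partial>lborel)"
  proof (rule nn_integral_mono)
    fix u :: real
    show "(\<integral>\<^sup>+X. ennreal (cmod (f u X - c)) * indicator {p..q} u \<partial>A) \<le> ennreal e * indicator {p..q} u"
      using le[of u] by (cases "u \<in> {p..q}") auto
  qed
  also have "\<dots> = ennreal e * ennreal (q - p)" using pq by (simp add: nn_integral_cmult_indicator)
  also have "\<dots> = ennreal (e * (q - p))" using pq by (simp add: ennreal_mult)
  finally show ?thesis .
qed

lemma vec_restrict_measurable: "(\<lambda>p. restrict (vec_index (snd p)) {..<n}) \<in> measurable (S \<Otimes>\<^sub>M borel_vec n) (PiM {..<n} (\<lambda>_. borel))"
proof -
  have "(\<lambda>v. restrict (vec_index v) {..<n}) \<in> measurable (borel_vec n) (PiM {..<n} (\<lambda>_. borel))"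
    unfolding borel_vec_def by (rule measurable_vimage_algebra1) (auto simp: space_PiM)
  thus ?thesis by (rule measurable_compose[OF measurable_snd])
qed

lemma (in entry_law) mat_array_measurable:
  "(\<lambda>A. \<lambda>k\<in>{..<m}. \<lambda>i\<in>{..<n}. A $$ (i, k)) \<in> measurable (borel_mat n m) (Omm n m)"
proof -
  have r: "(\<lambda>A. restrict (index_mat A) ({..<n} \<times> {..<m})) \<in> measurable (borel_mat n m) (PiM ({..<n} \<times> {..<m}) (\<lambda>_. borel))"
    unfolding borel_mat_def by (rule measurable_vimage_algebra1) (auto simp: space_PiM)
  have e: "(\<lambda>A. A $$ (i, k)) \<in> borel_measurable (borel_mat n m)" if "i < n" "k < m" for i k
    using measurable_compose[OF r measurable_component_singleton[of "(i, k)"]] that by simp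
  have "(\<lambda>A. A $$ (i, k)) \<in> measurable (borel_mat n m) P" if "i < n" "k < m" for i k
    using e[OF that] measurable_cong_sets[OF refl sets_P] by blast
  thus ?thesis by (intro measurable_restrict) auto
qed

section \<open>The quotient of the two masses and its limit\<close>

lemma ratio_close:
  fixes P Q t :: real
  assumes P: "0 < P" and t: "0 < t"
  shows "\<exists>\<kappa>>0. \<forall>p q. \<bar>p - P\<bar> \<le> \<kappa> \<longrightarrow> \<bar>q - Q\<bar> \<le> \<kappa> \<longrightarrow> \<bar>q / p - Q / P\<bar> \<le> t"
proof -
  \<comment> \<open>The first bound keeps p \<ge> P / 2; the second makes |q P - Q p| \<le> \<kappa>
    (P + |Q|) \<le> t P^2 / 2, which is at most t p P.\<close>
  define \<kappa> where "\<kappa> = min (P / 2) (t * P\<^sup>2 / (2 * (P + \<bar>Q\<bar>)))"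
  have k: "0 < \<kappa>" using P t by (simp add: \<kappa>_def)
  have kP: "\<kappa> \<le> P / 2" unfolding \<kappa>_def by (rule min.cobounded1)
  have k2: "\<kappa> * (P + \<bar>Q\<bar>) \<le> t * P\<^sup>2 / 2"
  proof -
    have "\<kappa> \<le> t * P\<^sup>2 / (2 * (P + \<bar>Q\<bar>))" by (simp add: \<kappa>_def)
    hence "\<kappa> * (P + \<bar>Q\<bar>) \<le> t * P\<^sup>2 / (2 * (P + \<bar>Q\<bar>)) * (P + \<bar>Q\<bar>)" using P by (intro mult_right_mono) auto
    also have "\<dots> = t * P\<^sup>2 / 2"
    proof -
      define R where "R = P + \<bar>Q\<bar>"
      have "R \<noteq> 0" using P by (auto simp: R_def)
      thus ?thesis unfolding R_def[symmetric] by simp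
    qed
    finally show ?thesis .
  qed
  show ?thesis
  proof (intro exI[of _ \<kappa>] conjI allI impI k)
    fix p q assume pq: "\<bar>p - P\<bar> \<le> \<kappa>" "\<bar>q - Q\<bar> \<le> \<kappa>"
    have p: "P / 2 \<le> p" using pq kP by linarith
    have "\<bar>q * P - Q * p\<bar> = \<bar>(q - Q) * P - Q * (p - P)\<bar>" by (simp add: algebra_simps)
    also have "\<dots> \<le> \<bar>q - Q\<bar> * P + \<bar>Q\<bar> * \<bar>p - P\<bar>"
      using abs_triangle_ineq4[of "(q - Q) * P" "Q * (p - P)"] P by (simp add: abs_mult)
    also have "\<dots> \<le> \<kappa> * P + \<bar>Q\<bar> * \<kappa>" using pq P by (intro add_mono mult_mono) auto
    also have "\<dots> \<le> t * P\<^sup>2 / 2" using k2 by (simp add: algebra_simps)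
    also have "\<dots> = t * (P / 2 * P)" by (simp add: power2_eq_square)
    also have "\<dots> \<le> t * (p * P)" using t P p by (intro mult_left_mono mult_right_mono) auto
    finally have "\<bar>q * P - Q * p\<bar> \<le> t * (p * P)" .
    moreover have "q / p - Q / P = (q * P - Q * p) / (p * P)" using p P by (simp add: field_simps)
    moreover have "0 < p * P" using p P by simp
    ultimately show "\<bar>q / p - Q / P\<bar> \<le> t" by (simp add: abs_divide pos_divide_le_eq)
  qed
qed

text \<open>For m = p + i q the quadratic at real x gives x |m|^2 = 1 and x |1 + m|^2 = \<alpha>.
  Hence \<alpha> \<theta> / (1 + m) is x \<theta> times the conjugate of 1 + m, \<open>Dlim\<close>
  has imaginary part x \<theta> q, and its squared modulus is x times the denominator of the claimed
  fraction.\<close>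

lemma Im_ratio:
  assumes x: "0 < x" "0 < 4 * x - (x + 1 - \<alpha>)\<^sup>2" and \<alpha>: "0 < \<alpha>" and \<theta>: "0 \<le> \<theta>"
  shows "Im (- 1 / Dlim \<alpha> \<theta> x) / Im (mp \<alpha> (of_real x)) = \<theta> / (x * (1 - \<theta>) + \<theta> * (\<alpha> * \<theta> - \<alpha> + 1))"
    "0 < Im (mp \<alpha> (of_real x))"
proof -
  define p where "p = - (x + 1 - \<alpha>) / (2 * x)"
  define q where "q = sqrt (4 * x - (x + 1 - \<alpha>)\<^sup>2) / (2 * x)"
  have mp: "mp \<alpha> (of_real x) = Complex p q" unfolding p_def q_def by (rule Im_mp_real[OF x])
  have q0: "0 < q" using x by (simp add: q_def)
  thus "0 < Im (mp \<alpha> (of_real x))" by (simp add: mp)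
  have px: "2 * p * x = - (x + 1 - \<alpha>)" using x by (simp add: p_def)
  have qx: "4 * (q\<^sup>2 * x\<^sup>2) = 4 * x - (x + 1 - \<alpha>)\<^sup>2" using x by (simp add: q_def power_divide power_mult_distrib)
  have "4 * ((p\<^sup>2 + q\<^sup>2) * x\<^sup>2) = (2 * p * x)\<^sup>2 + 4 * (q\<^sup>2 * x\<^sup>2)" by (simp add: power2_eq_square algebra_simps)
  also have "\<dots> = 4 * x" unfolding px qx by (simp add: power2_eq_square algebra_simps)
  finally have "(p\<^sup>2 + q\<^sup>2) * x * x = 1 * x" by (simp add: power2_eq_square mult.assoc)
  hence pq: "(p\<^sup>2 + q\<^sup>2) * x = 1" using x by simp
  have N: "((1 + p)\<^sup>2 + q\<^sup>2) * x = \<alpha>"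
  proof -
    have "((1 + p)\<^sup>2 + q\<^sup>2) * x = x + 2 * p * x + (p\<^sup>2 + q\<^sup>2) * x" by (simp add: power2_eq_square algebra_simps)
    thus ?thesis unfolding px pq by simp
  qed
  have Dl: "Dlim \<alpha> \<theta> x = Complex (x * (1 - \<theta> * (1 + p))) (x * \<theta> * q)"
  proof -
    have n0: "Complex (1 + p) q \<noteq> 0" using q0 by (simp add: complex_eq_iff)
    have "of_real (\<alpha> * \<theta>) / (1 + mp \<alpha> (of_real x)) = Complex (x * \<theta> * (1 + p)) (- (x * \<theta> * q))"
    proof -
      have "1 + mp \<alpha> (of_real x) = Complex (1 + p) q" by (simp add: mp complex_eq_iff)
      moreover have "Complex (x * \<theta> * (1 + p)) (- (x * \<theta> * q)) * Complex (1 + p) q = of_real (\<theta> * (((1 + p)\<^sup>2 + q\<^sup>2) * x))"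
        by (simp add: complex_eq_iff power2_eq_square algebra_simps)
      ultimately show ?thesis using n0 unfolding N by (simp add: nonzero_divide_eq_eq mult.commute)
    qed
    thus ?thesis unfolding Dlim_def by (simp add: complex_eq_iff algebra_simps)
  qed
  define E where "E = x * (1 - \<theta>) + \<theta> * (\<alpha> * \<theta> - \<alpha> + 1)"
  have mod: "(x * (1 - \<theta> * (1 + p)))\<^sup>2 + (x * \<theta> * q)\<^sup>2 = x * E"
  proof -
    have "(x * (1 - \<theta> * (1 + p)))\<^sup>2 + (x * \<theta> * q)\<^sup>2 = x * (x - 2 * \<theta> * x - \<theta> * (2 * p * x) + \<theta>\<^sup>2 * (((1 + p)\<^sup>2 + q\<^sup>2) * x))"
      by (simp add: power2_eq_square algebra_simps)
    also have "\<dots> = x * E" unfolding N px by (simp add: E_def power2_eq_square algebra_simps)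
    finally show ?thesis .
  qed
  have "Im (- 1 / Dlim \<alpha> \<theta> x) = (x * \<theta> * q) / (x * E)"
    unfolding Im_divide Dl mod[symmetric] by simp
  also have "\<dots> = \<theta> * q / E" using x by simp
  finally show "Im (- 1 / Dlim \<alpha> \<theta> x) / Im (mp \<alpha> (of_real x)) = \<theta> / (x * (1 - \<theta>) + \<theta> * (\<alpha> * \<theta> - \<alpha> + 1))"
    using q0 by (simp add: mp E_def)
qed

text \<open>Markov's inequality for one nonnegative function that encodes the hypotheses of
  \<open>window_mass\<close> for both transforms. The segment has length 4 eps and its integral is
  divided by a eps, so each transform contributes (4 / a + 1) e to the mean.\<close>

lemma (in entry_law) window_event:
  fixes X \<Sigma> :: "'a \<Rightarrow> real mat" and v :: "'a \<Rightarrow> real Matrix.vec"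
    and lam :: "'a \<Rightarrow> nat \<Rightarrow> real" and \<phi> :: "'a \<Rightarrow> nat \<Rightarrow> real Matrix.vec"
  assumes M: "prob_space M" and nm: "1 \<le> n" "1 \<le> m"
    and X_indep: "prob_space.indep_vars M (\<lambda>_. borel) (\<lambda>ij \<omega>. X \<omega> $$ ij) ({..<n} \<times> {..<m})"
    and X_law: "\<And>i j. i < n \<Longrightarrow> j < m \<Longrightarrow> distr M borel (\<lambda>\<omega>. X \<omega> $$ (i, j)) = P"
    and theta: "0 \<le> \<theta>"
    and ind: "indep_rvs M (borel_mat n m) X (borel_mat n n \<Otimes>\<^sub>M borel_vec n) (\<lambda>\<omega>. (\<Sigma> \<omega>, v \<omega>))"
    and sym: "\<And>\<omega>. \<omega> \<in> space M \<Longrightarrow> sym_mat n (\<Sigma> \<omega>)"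
    and cp: "\<And>\<omega>. \<omega> \<in> space M \<Longrightarrow> char_poly (\<Sigma> \<omega>) = (\<Prod>\<gamma>\<leftarrow>\<theta> # replicate (n - 1) 1. [:- \<gamma>, 1:])"
    and vu: "\<And>\<omega>. \<omega> \<in> space M \<Longrightarrow> scalar_prod (v \<omega>) (v \<omega>) = 1"
    and ve: "\<And>\<omega>. \<omega> \<in> space M \<Longrightarrow> eigenvector (\<Sigma> \<omega>) (v \<omega>) \<theta>"
    and eb: "\<And>\<omega>. \<omega> \<in> space M \<Longrightarrow> ordered_eigenbasis n (sample_cov n (\<Sigma> \<omega>) (X \<omega>)) (lam \<omega>) (\<phi> \<omega>)"
    and eps: "0 < eps" and eta: "0 < eta" "eta \<le> a\<^sup>2 * eps" and a: "0 < a" "a \<le> 1 / 2" and e: "0 \<le> e"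
    and bound: "\<And>u z. (\<Sum>i<n. (u i)\<^sup>2) = 1 \<Longrightarrow> \<bar>Re z - x\<bar> \<le> 2 * eps \<Longrightarrow> eta \<le> Im z \<Longrightarrow> Im z \<le> eps \<Longrightarrow>
       (\<integral>Y. cmod (model.s n m (sqrt \<theta> - 1) u z Y - c1) \<partial>Omm n m) \<le> e \<and>
       (\<integral>Y. cmod (model.g n m (sqrt \<theta> - 1) u z Y - c2) \<partial>Omm n m) \<le> e"
  obtains B where "B \<in> sets M" "measure M B \<le> (8 / a + 2) * e"
    "\<And>\<omega>. \<omega> \<in> space M - B \<Longrightarrow>
      \<bar>pi * (\<Sum>k\<in>window n (lam \<omega>) x eps. 1 / real n) / (2 * eps) - Im c1\<bar> \<le> 4 * a * (cmod c1 + 1) \<and>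
      \<bar>pi * (\<Sum>k\<in>window n (lam \<omega>) x eps. (scalar_prod (\<phi> \<omega> k) (v \<omega>))\<^sup>2) / (2 * eps) - Im c2\<bar> \<le> 4 * a * (cmod c2 + 1)"
proof -
  interpret M: prob_space M by (rule M)
  let ?\<tau> = "sqrt \<theta> - 1"
  let ?N = "PiM {..<n} (\<lambda>_. borel :: real measure)"
  let ?S = "{x - 2 * eps..x + 2 * eps}"
  interpret Om: prob_space "Omm n m" by (intro prob_space_PiM prob_C)
  define sf where "sf u p = trn n u (ycols n m ?\<tau> (snd p) (fst p))" for u and p :: "(nat \<Rightarrow> nat \<Rightarrow> real) \<times> (nat \<Rightarrow> real)"
  define gf where "gf u p = cdot n (cx (snd p)) (mv n (res n u (ycols n m ?\<tau> (snd p) (fst p))) (cx (snd p)))"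
    for u and p :: "(nat \<Rightarrow> nat \<Rightarrow> real) \<times> (nat \<Rightarrow> real)"
  define XX where "XX \<omega> = (\<lambda>k\<in>{..<m}. \<lambda>i\<in>{..<n}. X \<omega> $$ (i, k))" for \<omega>
  define vv where "vv \<omega> = restrict (vec_index (v \<omega>)) {..<n}" for \<omega>
  define W where "W \<omega> = (XX \<omega>, vv \<omega>)" for \<omega>
  define U where "U = {u :: nat \<Rightarrow> real. (\<Sum>i<n. (u i)\<^sup>2) = 1}"
  define J where "J f c p = (\<integral>\<^sup>+u\<in>?S. ennreal (cmod (f (Complex u eta) p - c)) \<partial>lborel)"
    for f :: "complex \<Rightarrow> (nat \<Rightarrow> nat \<Rightarrow> real) \<times> (nat \<Rightarrow> real) \<Rightarrow> complex" and c p
  \<comment> \<open>Normalised so that T \<le> 1 implies both closeness hypotheses of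
    \<open>window_mass\<close>: the L^1 bound a eps on the segment and the bound 1 at x + i
    eps.\<close>
  define T where "T f c p = ennreal (1 / (a * eps)) * J f c p + ennreal (cmod (f (Complex x eps) p - c))"
    for f :: "complex \<Rightarrow> (nat \<Rightarrow> nat \<Rightarrow> real) \<times> (nat \<Rightarrow> real) \<Rightarrow> complex" and c p
  \<comment> \<open>The indicator restricts to unit vectors, for which the expectation bounds are
    available; on the sample space v is always one of them.\<close>
  define F where "F p = indicator U (snd p) * (T sf c1 p + T gf c2 p)" for p
  have Xm: "X \<in> measurable M (borel_mat n m)" and Ym: "(\<lambda>\<omega>. (\<Sigma> \<omega>, v \<omega>)) \<in> measurable M (borel_mat n n \<Otimes>\<^sub>M borel_vec n)"
    using ind by (auto simp: indep_rvs_def)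
  have Xc: "X \<omega> \<in> carrier_mat n m" if "\<omega> \<in> space M" for \<omega>
    using measurable_space[OF Xm that] by (simp add: borel_mat_def)
  have XXm: "XX \<in> measurable M (Omm n m)"
    using measurable_compose[OF Xm mat_array_measurable] by (simp add: XX_def[abs_def])
  have vvm: "vv \<in> measurable M ?N"
    using measurable_compose[OF Ym vec_restrict_measurable] by (simp add: vv_def[abs_def])
  have Wm: "W \<in> measurable M (Omm n m \<Otimes>\<^sub>M ?N)" unfolding W_def[abs_def] by (intro measurable_Pair XXm vvm)
  have XXl: "distr M (Omm n m) XX = Omm n m"
    unfolding XX_def[abs_def] by (rule array_law[OF M X_indep X_law nm])
  have law: "distr M (Omm n m \<Otimes>\<^sub>M ?N) W = Omm n m \<Otimes>\<^sub>M distr M ?N vv"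
    using distr_indep_rvs[OF M ind mat_array_measurable vec_restrict_measurable]
    by (simp add: XXl XX_def[symmetric] vv_def[symmetric] W_def[abs_def, symmetric])
  have coordX: "(\<lambda>p. fst p k i) \<in> borel_measurable (Omm n m \<Otimes>\<^sub>M ?N)" if "k < m" "i < n" for k i
  proof -
    have "(\<lambda>Y. Y k) \<in> measurable (Omm n m) (C n)" using that by (intro measurable_component_singleton) simp
    from measurable_compose[OF measurable_compose[OF measurable_fst this] coord_measurable[OF that(2)]]
    show ?thesis using measurable_cong_sets[OF refl sets_P] by blast
  qed
  have coordv: "(\<lambda>p. snd p i) \<in> borel_measurable (Omm n m \<Otimes>\<^sub>M ?N)" if "i < n" for i
    by (rule measurable_compose[OF measurable_snd]) (use that in \<open>auto intro!: measurable_component_singleton\<close>)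
  have sfm: "(\<lambda>q. sf (Z q) (fst q)) \<in> borel_measurable ((Omm n m \<Otimes>\<^sub>M ?N) \<Otimes>\<^sub>M R)"
    and gfm: "(\<lambda>q. gf (Z q) (fst q)) \<in> borel_measurable ((Omm n m \<Otimes>\<^sub>M ?N) \<Otimes>\<^sub>M R)"
    if "Z \<in> borel_measurable ((Omm n m \<Otimes>\<^sub>M ?N) \<Otimes>\<^sub>M R)" for Z and R :: "real measure"
    unfolding sf_def gf_def
    using measurable_compose[OF measurable_fst coordX] measurable_compose[OF measurable_fst coordv]
    by (intro res_ycols_measurable that; simp)+
  have cm: "(\<lambda>u. Complex u y) \<in> borel_measurable borel" for y
    unfolding Complex_eq by measurable
  have Cm: "(\<lambda>q. Complex (snd q) eta) \<in> borel_measurable ((Omm n m \<Otimes>\<^sub>M ?N) \<Otimes>\<^sub>M lborel)"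
    using measurable_compose[OF measurable_snd, of "\<lambda>u. Complex u eta" lborel borel "Omm n m \<Otimes>\<^sub>M ?N"] cm by simp
  have Jm: "J f c \<in> borel_measurable (Omm n m \<Otimes>\<^sub>M ?N)"
    if "(\<lambda>q. f (Complex (snd q) eta) (fst q)) \<in> borel_measurable ((Omm n m \<Otimes>\<^sub>M ?N) \<Otimes>\<^sub>M lborel)" for f c
  proof -
    note [measurable] = that
    have "case_prod (\<lambda>p u. ennreal (cmod (f (Complex u eta) p - c)) * indicator ?S u) \<in> borel_measurable ((Omm n m \<Otimes>\<^sub>M ?N) \<Otimes>\<^sub>M lborel)"
      unfolding case_prod_beta' by measurable
    thus ?thesis unfolding J_def[abs_def] by (rule lborel.borel_measurable_nn_integral)
  qed
  have pm: "(\<lambda>p. sf z p) \<in> borel_measurable (Omm n m \<Otimes>\<^sub>M ?N)" "(\<lambda>p. gf z p) \<in> borel_measurable (Omm n m \<Otimes>\<^sub>M ?N)" for z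
    unfolding sf_def gf_def by (intro res_ycols_measurable coordX coordv; simp)+
  have Um: "(\<lambda>p. indicator U (snd p) :: ennreal) \<in> borel_measurable (Omm n m \<Otimes>\<^sub>M ?N)"
  proof -
    note [measurable] = coordv
    have "{p \<in> space (Omm n m \<Otimes>\<^sub>M ?N). (\<Sum>i<n. (snd p i)\<^sup>2) = 1} \<in> sets (Omm n m \<Otimes>\<^sub>M ?N)" by measurable
    hence "(indicator {p \<in> space (Omm n m \<Otimes>\<^sub>M ?N). (\<Sum>i<n. (snd p i)\<^sup>2) = 1} :: _ \<Rightarrow> ennreal) \<in> borel_measurable (Omm n m \<Otimes>\<^sub>M ?N)"
      by (rule borel_measurable_indicator)
    thus ?thesis by (rule measurable_cong[THEN iffD1, rotated]) (auto simp: indicator_def U_def)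
  qed
  have Tm: "T sf c1 \<in> borel_measurable (Omm n m \<Otimes>\<^sub>M ?N)" "T gf c2 \<in> borel_measurable (Omm n m \<Otimes>\<^sub>M ?N)"
  proof -
    note [measurable] = Jm[OF sfm[OF Cm]] Jm[OF gfm[OF Cm]] pm
    show "T sf c1 \<in> borel_measurable (Omm n m \<Otimes>\<^sub>M ?N)" "T gf c2 \<in> borel_measurable (Omm n m \<Otimes>\<^sub>M ?N)"
      unfolding T_def[abs_def] by measurable
  qed
  have Fm: "F \<in> borel_measurable (Omm n m \<Otimes>\<^sub>M ?N)"
    unfolding F_def[abs_def] by (intro borel_measurable_times_ennreal borel_measurable_add Um Tm)
  have Tle: "(\<integral>\<^sup>+Y. T f c (Y, u) \<partial>Omm n m) \<le> ennreal ((4 / a + 1) * e)"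
    if f: "(\<lambda>q. f (Complex (snd q) eta) (fst q)) \<in> borel_measurable ((Omm n m \<Otimes>\<^sub>M ?N) \<Otimes>\<^sub>M lborel)"
      and fz: "\<And>z. (\<lambda>p. f z p) \<in> borel_measurable (Omm n m \<Otimes>\<^sub>M ?N)" and u: "u \<in> space ?N"
      and le: "\<And>z. \<bar>Re z - x\<bar> \<le> 2 * eps \<Longrightarrow> eta \<le> Im z \<Longrightarrow> Im z \<le> eps \<Longrightarrow> (\<integral>\<^sup>+Y. ennreal (cmod (f z (Y, u) - c)) \<partial>Omm n m) \<le> ennreal e"
    for f u c
  proof -
    have ee: "eta \<le> eps"
    proof -
      have "a\<^sup>2 \<le> 1" using a by (simp add: power_le_one)
      hence "a\<^sup>2 * eps \<le> 1 * eps" using eps by (intro mult_right_mono) auto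
      thus ?thesis using eta by linarith
    qed
    have pu: "(\<lambda>Y. (Y, u)) \<in> measurable (Omm n m) (Omm n m \<Otimes>\<^sub>M ?N)" using u by (intro measurable_Pair2') auto
    have "(\<lambda>q. ((fst q, u), snd q)) \<in> measurable (Omm n m \<Otimes>\<^sub>M lborel) ((Omm n m \<Otimes>\<^sub>M ?N) \<Otimes>\<^sub>M lborel)"
      by (intro measurable_Pair measurable_compose[OF measurable_fst pu] measurable_snd)
    from measurable_compose[OF this f]
    have fq: "(\<lambda>q. f (Complex (snd q) eta) (fst q, u)) \<in> borel_measurable (Omm n m \<Otimes>\<^sub>M lborel)" by simp
    have Ju: "(\<lambda>Y. J f c (Y, u)) \<in> borel_measurable (Omm n m)" by (rule measurable_compose[OF pu Jm[OF f]])
    have fu: "(\<lambda>Y. f z (Y, u)) \<in> borel_measurable (Omm n m)" for z by (rule measurable_compose[OF pu fz])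
    have "(\<integral>\<^sup>+Y. J f c (Y, u) \<partial>Omm n m) \<le> ennreal (e * ((x + 2 * eps) - (x - 2 * eps)))"
      unfolding J_def
    proof (rule integral_window_le[OF Om.sigma_finite_measure fq])
      fix s assume "s \<in> ?S"
      thus "(\<integral>\<^sup>+Y. ennreal (cmod (f (Complex s eta) (Y, u) - c)) \<partial>Omm n m) \<le> ennreal e"
        using ee by (intro le) auto
    qed (use eps e in auto)
    hence 1: "ennreal (1 / (a * eps)) * (\<integral>\<^sup>+Y. J f c (Y, u) \<partial>Omm n m) \<le> ennreal (1 / (a * eps)) * ennreal (e * (4 * eps))"
      by (intro mult_left_mono) auto
    have 2: "(\<integral>\<^sup>+Y. ennreal (cmod (f (Complex x eps) (Y, u) - c)) \<partial>Omm n m) \<le> ennreal e"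
      using eps ee by (intro le) auto
    have "(\<integral>\<^sup>+Y. T f c (Y, u) \<partial>Omm n m) = ennreal (1 / (a * eps)) * (\<integral>\<^sup>+Y. J f c (Y, u) \<partial>Omm n m)
        + (\<integral>\<^sup>+Y. ennreal (cmod (f (Complex x eps) (Y, u) - c)) \<partial>Omm n m)"
    proof -
      note [measurable] = Ju fu
      show ?thesis unfolding T_def by (subst nn_integral_add) (auto simp: nn_integral_cmult)
    qed
    also have "\<dots> \<le> ennreal (1 / (a * eps)) * ennreal (e * (4 * eps)) + ennreal e" by (rule add_mono[OF 1 2])
    also have "\<dots> = ennreal (1 / (a * eps) * (e * (4 * eps)) + e)"
    proof -
      have p: "0 \<le> 1 / (a * eps)" "0 \<le> e * (4 * eps)" using a eps e by auto
      show ?thesis unfolding ennreal_mult[OF p, symmetric] by (rule ennreal_plus[OF mult_nonneg_nonneg[OF p] e, symmetric])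
    qed
    also have "1 / (a * eps) * (e * (4 * eps)) + e = (4 / a + 1) * e" using a eps by (simp add: field_simps)
    finally show ?thesis .
  qed
  have sec: "(\<integral>\<^sup>+Y. F (Y, u) \<partial>Omm n m) \<le> ennreal ((8 / a + 2) * e)" if u: "u \<in> space ?N" for u
  proof (cases "u \<in> U")
    case False
    thus ?thesis by (simp add: F_def)
  next
    case True
    hence u1: "(\<Sum>i<n. (u i)\<^sup>2) = 1" by (simp add: U_def)
    have le: "(\<integral>\<^sup>+Y. ennreal (cmod (sf z (Y, u) - c1)) \<partial>Omm n m) \<le> ennreal e"
      "(\<integral>\<^sup>+Y. ennreal (cmod (gf z (Y, u) - c2)) \<partial>Omm n m) \<le> ennreal e"
      if z: "\<bar>Re z - x\<bar> \<le> 2 * eps" "eta \<le> Im z" "Im z \<le> eps" for z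
    proof -
      have mod: "model P n u z" using z eta by (intro modelI nm u1) auto
      interpret mo: model P n m ?\<tau> u z by (rule mod)
      have s: "sf z (Y, u) = mo.s Y" and g: "gf z (Y, u) = mo.g Y" for Y
        by (simp_all add: sf_def gf_def model_ycols[OF mod])
      have "(\<integral>\<^sup>+Y. ennreal (cmod (mo.s Y - c1)) \<partial>Omm n m) = ennreal (\<integral>Y. cmod (mo.s Y - c1) \<partial>Omm n m)"
        by (intro nn_integral_eq_integral integrable_norm Bochner_Integration.integrable_diff mo.integrable_sg Om.integrable_const) auto
      moreover have "(\<integral>\<^sup>+Y. ennreal (cmod (mo.g Y - c2)) \<partial>Omm n m) = ennreal (\<integral>Y. cmod (mo.g Y - c2) \<partial>Omm n m)"
        by (intro nn_integral_eq_integral integrable_norm Bochner_Integration.integrable_diff mo.integrable_sg Om.integrable_const) auto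
      ultimately show "(\<integral>\<^sup>+Y. ennreal (cmod (sf z (Y, u) - c1)) \<partial>Omm n m) \<le> ennreal e"
        "(\<integral>\<^sup>+Y. ennreal (cmod (gf z (Y, u) - c2)) \<partial>Omm n m) \<le> ennreal e"
        using bound[OF u1 z] by (auto simp: s g intro!: ennreal_leI)
    qed
    have pu: "(\<lambda>Y. (Y, u)) \<in> measurable (Omm n m) (Omm n m \<Otimes>\<^sub>M ?N)" using u by (intro measurable_Pair2') auto
    have "(\<integral>\<^sup>+Y. F (Y, u) \<partial>Omm n m) = (\<integral>\<^sup>+Y. T sf c1 (Y, u) \<partial>Omm n m) + (\<integral>\<^sup>+Y. T gf c2 (Y, u) \<partial>Omm n m)"
      using True by (simp add: F_def nn_integral_add measurable_compose[OF pu Tm(1)] measurable_compose[OF pu Tm(2)])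
    also have "\<dots> \<le> ennreal ((4 / a + 1) * e) + ennreal ((4 / a + 1) * e)"
      by (intro add_mono Tle sfm gfm Cm pm u le)
    also have "\<dots> = ennreal ((8 / a + 2) * e)"
      using a e by (simp add: ennreal_plus[symmetric] algebra_simps del: ennreal_plus)
    finally show ?thesis .
  qed
  \<comment> \<open>Points outside the space of the product measure have no measurable section; the
    additional indicator makes the section bound hold for every u.\<close>
  define F' where "F' p = F p * indicator (space ?N) (snd p)" for p
  have WN: "snd (W \<omega>) \<in> space ?N" if "\<omega> \<in> space M" for \<omega>
    using measurable_space[OF vvm that] by (simp add: W_def)
  have "(\<integral>\<^sup>+\<omega>. F' (W \<omega>) \<partial>M) \<le> ennreal ((8 / a + 2) * e)"
  proof (rule nn_integral_le_of_sections[OF law Wm])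
    show "F' \<in> borel_measurable (Omm n m \<Otimes>\<^sub>M ?N)"
      unfolding F'_def[abs_def]
      by (intro borel_measurable_times_ennreal Fm measurable_compose[OF measurable_snd] borel_measurable_indicator) simp
    show "(\<integral>\<^sup>+Y. F' (Y, u) \<partial>Omm n m) \<le> ennreal ((8 / a + 2) * e)" for u
      using sec[of u] by (cases "u \<in> space ?N") (auto simp: F'_def)
  qed (use Om.prob_space_axioms M.prob_space_distr[OF vvm] in auto)
  moreover have "(\<integral>\<^sup>+\<omega>. F' (W \<omega>) \<partial>M) = (\<integral>\<^sup>+\<omega>. F (W \<omega>) \<partial>M)"
    by (intro nn_integral_cong) (simp add: F'_def WN)
  ultimately have EF: "(\<integral>\<^sup>+\<omega>. F (W \<omega>) \<partial>M) \<le> ennreal ((8 / a + 2) * e)" by simp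
  have FWm: "(\<lambda>\<omega>. F (W \<omega>)) \<in> borel_measurable M" by (rule measurable_compose[OF Wm Fm])
  \<comment> \<open>The event is expressed through the resolvent, which is measurable in the columns
    and in v, whereas \<open>lam\<close> and \<open>\<phi>\<close> are a choice of eigendata at each
    outcome and may fail to be measurable.\<close>
  define B where "B = {\<omega> \<in> space M. 1 \<le> 1 * F (W \<omega>)}"
  show thesis
  proof (rule that[of B])
    show Bs: "B \<in> sets M" unfolding B_def using FWm by measurable
    have "emeasure M B \<le> 1 * (\<integral>\<^sup>+\<omega>. F (W \<omega>) * indicator (space M) \<omega> \<partial>M)"
      unfolding B_def by (rule nn_integral_Markov_inequality) (use FWm in auto)
    also have "\<dots> = (\<integral>\<^sup>+\<omega>. F (W \<omega>) \<partial>M)" by (simp cong: nn_integral_cong_simp)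
    also have "\<dots> \<le> ennreal ((8 / a + 2) * e)" by (rule EF)
    finally have "ennreal (measure M B) \<le> ennreal ((8 / a + 2) * e)" by (simp add: M.emeasure_eq_measure)
    thus "measure M B \<le> (8 / a + 2) * e" using a e by (subst (asm) ennreal_le_iff) auto
    fix \<omega> assume w: "\<omega> \<in> space M - B"
    hence ws: "\<omega> \<in> space M" and F1: "F (W \<omega>) < 1" by (auto simp: B_def not_le)
    note sid = spectral_identity[OF nm(1) theta sym[OF ws] cp[OF ws] vu[OF ws] ve[OF ws] Xc[OF ws] eb[OF ws], of "XX \<omega>" "vv \<omega>"]
    have XXi: "XX \<omega> k i = X \<omega> $$ (i, k)" if "k < m" "i < n" for k i using that by (simp add: XX_def)
    have vvi: "vv \<omega> i = v \<omega> $ i" if "i < n" for i using that by (simp add: vv_def)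
    have v1: "(\<Sum>i<n. (vv \<omega> i)\<^sup>2) = 1" by (rule sid(3)[OF XXi vvi, where z = \<i>]) auto
    have st: "sf z (W \<omega>) = stj n (\<lambda>_. 1 / real n) (lam \<omega>) z"
      "gf z (W \<omega>) = stj n (\<lambda>k. (scalar_prod (\<phi> \<omega> k) (v \<omega>))\<^sup>2) (lam \<omega>) z" if "0 < Im z" for z
    proof -
      have mod: "model P n (vv \<omega>) z" by (rule modelI[OF nm(1) v1 that])
      show "sf z (W \<omega>) = stj n (\<lambda>_. 1 / real n) (lam \<omega>) z"
        using sid(1)[OF XXi vvi that] by (simp add: sf_def W_def model_ycols[OF mod])
      show "gf z (W \<omega>) = stj n (\<lambda>k. (scalar_prod (\<phi> \<omega> k) (v \<omega>))\<^sup>2) (lam \<omega>) z"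
        using sid(2)[OF XXi vvi that] by (simp add: gf_def W_def model_ycols[OF mod])
    qed
    have "vv \<omega> \<in> U" using v1 by (simp add: U_def)
    hence T1: "T sf c1 (W \<omega>) + T gf c2 (W \<omega>) < 1" using F1 by (simp add: F_def W_def)
    have Tl: "J f c p \<le> ennreal (a * eps)" "cmod (f (Complex x eps) p - c) \<le> 1" if "T f c p \<le> 1" for f c p
    proof -
      have 1: "ennreal (1 / (a * eps)) * J f c p \<le> 1" and 2: "ennreal (cmod (f (Complex x eps) p - c)) \<le> 1"
        using that unfolding T_def by (meson le_iff_add add.commute order_trans add_increasing2 add_increasing zero_le order_refl)+
      have "J f c p = ennreal (a * eps) * (ennreal (1 / (a * eps)) * J f c p)"
        using a eps by (simp add: mult.assoc[symmetric] ennreal_mult[symmetric])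
      also have "\<dots> \<le> ennreal (a * eps) * 1" by (rule mult_left_mono[OF 1]) simp
      finally show "J f c p \<le> ennreal (a * eps)" by simp
      show "cmod (f (Complex x eps) p - c) \<le> 1" using 2 by simp
    qed
    have Ts: "T sf c1 (W \<omega>) \<le> 1" by (rule order_trans[OF _ less_imp_le[OF T1]]) simp
    have Tg: "T gf c2 (W \<omega>) \<le> 1" by (rule order_trans[OF _ less_imp_le[OF T1]]) simp
    show "\<bar>pi * (\<Sum>k\<in>window n (lam \<omega>) x eps. 1 / real n) / (2 * eps) - Im c1\<bar> \<le> 4 * a * (cmod c1 + 1) \<and>
      \<bar>pi * (\<Sum>k\<in>window n (lam \<omega>) x eps. (scalar_prod (\<phi> \<omega> k) (v \<omega>))\<^sup>2) / (2 * eps) - Im c2\<bar> \<le> 4 * a * (cmod c2 + 1)"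
    proof (intro conjI window_mass[where e = eta] a eta eps)
      show "(\<integral>\<^sup>+u\<in>?S. ennreal (cmod (stj n (\<lambda>_. 1 / real n) (lam \<omega>) (Complex u eta) - c1)) \<partial>lborel) \<le> ennreal (a * eps)"
        using Tl(1)[OF Ts] eta by (simp add: J_def st)
      show "(\<integral>\<^sup>+u\<in>?S. ennreal (cmod (stj n (\<lambda>k. (scalar_prod (\<phi> \<omega> k) (v \<omega>))\<^sup>2) (lam \<omega>) (Complex u eta) - c2)) \<partial>lborel) \<le> ennreal (a * eps)"
        using Tl(1)[OF Tg] eta by (simp add: J_def st)
      show "cmod (stj n (\<lambda>_. 1 / real n) (lam \<omega>) (Complex x eps) - c1) \<le> 1"
        using Tl(2)[OF Ts] eps by (simp add: st)
      show "cmod (stj n (\<lambda>k. (scalar_prod (\<phi> \<omega> k) (v \<omega>))\<^sup>2) (lam \<omega>) (Complex x eps) - c2) \<le> 1"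
        using Tl(2)[OF Tg] eps by (simp add: st)
    qed auto
  qed
qed

theorem theorem4:
  fixes M :: "nat \<Rightarrow> 'a measure"
    and Q :: "'b measure" and \<xi> :: "'b \<Rightarrow> real"
    and m :: "nat \<Rightarrow> nat" and \<alpha> \<theta> x \<delta> t :: real
    and X \<Sigma> :: "nat \<Rightarrow> 'a \<Rightarrow> real mat"
    and v :: "nat \<Rightarrow> 'a \<Rightarrow> real Matrix.vec"
    and lam :: "nat \<Rightarrow> 'a \<Rightarrow> nat \<Rightarrow> real"
    and \<phi> :: "nat \<Rightarrow> 'a \<Rightarrow> nat \<Rightarrow> real Matrix.vec"
    and \<epsilon> :: "nat \<Rightarrow> real"
  assumes Q: "prob_space Q"
    and xi_rv: "\<xi> \<in> borel_measurable Q"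
    and xi_moments: "\<And>k::nat. integrable Q (\<lambda>\<omega>. \<xi> \<omega> ^ k)"
    and xi_mean: "integral\<^sup>L Q \<xi> = 0"
    and xi_var: "integral\<^sup>L Q (\<lambda>\<omega>. (\<xi> \<omega>)\<^sup>2) = 1"
    and alpha: "0 < \<alpha>"
    and m: "(\<lambda>n. real (m n) / real n) \<longlonglongrightarrow> \<alpha>"
    and M: "\<And>n. 1 \<le> n \<Longrightarrow> prob_space (M n)"
    and X_indep: "\<And>n. 1 \<le> n \<Longrightarrow>
          prob_space.indep_vars (M n) (\<lambda>_. borel) (\<lambda>ij \<omega>. X n \<omega> $$ ij) ({..<n} \<times> {..<m n})"
    and X_law: "\<And>n i j. 1 \<le> n \<Longrightarrow> i < n \<Longrightarrow> j < m n \<Longrightarrow>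
          distr (M n) borel (\<lambda>\<omega>. X n \<omega> $$ (i, j)) = distr Q borel \<xi>"
    and theta: "0 \<le> \<theta>"
    and Sigma_indep: "\<And>n. 1 \<le> n \<Longrightarrow>
          indep_rvs (M n) (borel_mat n (m n)) (X n)
            (borel_mat n n \<Otimes>\<^sub>M borel_vec n) (\<lambda>\<omega>. (\<Sigma> n \<omega>, v n \<omega>))"
    and Sigma_sym: "\<And>n \<omega>. 1 \<le> n \<Longrightarrow> \<omega> \<in> space (M n) \<Longrightarrow> sym_mat n (\<Sigma> n \<omega>)"
    and Sigma_eigenvalues: "\<And>n \<omega>. 1 \<le> n \<Longrightarrow> \<omega> \<in> space (M n) \<Longrightarrow>
          char_poly (\<Sigma> n \<omega>) = (\<Prod>\<gamma>\<leftarrow>\<theta> # replicate (n - 1) 1. [:- \<gamma>, 1:])"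
    and v_unit: "\<And>n \<omega>. 1 \<le> n \<Longrightarrow> \<omega> \<in> space (M n) \<Longrightarrow> scalar_prod (v n \<omega>) (v n \<omega>) = 1"
    and v_eigen: "\<And>n \<omega>. 1 \<le> n \<Longrightarrow> \<omega> \<in> space (M n) \<Longrightarrow> eigenvector (\<Sigma> n \<omega>) (v n \<omega>) \<theta>"
    and eigen: "\<And>n \<omega>. 1 \<le> n \<Longrightarrow> \<omega> \<in> space (M n) \<Longrightarrow>
          ordered_eigenbasis n (sample_cov n (\<Sigma> n \<omega>) (X n \<omega>)) (lam n \<omega>) (\<phi> n \<omega>)"
    and x: "(1 - sqrt \<alpha>)\<^sup>2 < x" "x < (1 + sqrt \<alpha>)\<^sup>2"
    and eps_pos: "\<And>n. 1 \<le> n \<Longrightarrow> 0 < \<epsilon> n"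
    and delta: "0 < \<delta>"
    and eps_lower: "(\<lambda>n. real n powr \<delta> / sqrt (real n)) \<lless> \<epsilon>"
    and eps_upper: "\<epsilon> \<lless> (\<lambda>_. 1)"
    and t: "0 < t"
  shows "(\<lambda>n. measure (M n) {\<omega> \<in> space (M n).
            \<bar>real n / real (card (window n (lam n \<omega>) x (\<epsilon> n)))
               * (\<Sum>i\<in>window n (lam n \<omega>) x (\<epsilon> n). \<bar>scalar_prod (\<phi> n \<omega> i) (v n \<omega>)\<bar>\<^sup>2)
             - \<theta> / (x * (1 - \<theta>) + \<theta> * (\<alpha> * \<theta> - \<alpha> + 1))\<bar> > t}) \<longlonglongrightarrow> 0"
proof -
  define P where "P = distr Q borel \<xi>"
  interpret Q: prob_space Q by (rule Q)
  note [measurable] = xi_rv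
  interpret entry_law P
  proof (unfold entry_law_def entry_law_axioms_def, intro conjI allI)
    show "prob_space P" unfolding P_def by (rule Q.prob_space_distr[OF xi_rv])
    show "sets P = sets borel" by (simp add: P_def)
    show "integrable P (\<lambda>x. x ^ k)" for k
      unfolding P_def using xi_moments[of k] by (subst integrable_distr_eq) auto
    show "(\<integral>x. x \<partial>P) = 0" unfolding P_def using xi_mean by (subst integral_distr) auto
    show "(\<integral>x. x\<^sup>2 \<partial>P) = 1" unfolding P_def using xi_var by (subst integral_distr) auto
  qed
  have disc: "0 < 4 * x - (x + 1 - \<alpha>)\<^sup>2" by (rule bulk_discriminant_pos[OF alpha x])
  have x0: "0 < x" using x(1) zero_le_power2[of "1 - sqrt \<alpha>"] by linarith
  define c1 where "c1 = mp \<alpha> (of_real x)"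
  define c2 where "c2 = - (1 / Dlim \<alpha> \<theta> x)"
  define L where "L = \<theta> / (x * (1 - \<theta>) + \<theta> * (\<alpha> * \<theta> - \<alpha> + 1))"
  have L: "Im c2 / Im c1 = L" and c1: "0 < Im c1"
    using Im_ratio[OF x0 disc alpha theta] by (simp_all add: c1_def c2_def L_def)
  obtain \<kappa> where \<kappa>: "0 < \<kappa>"
    and close: "\<And>p q. \<bar>p - Im c1\<bar> \<le> \<kappa> \<Longrightarrow> \<bar>q - Im c2\<bar> \<le> \<kappa> \<Longrightarrow> \<bar>q / p - L\<bar> \<le> t"
    using ratio_close[OF c1 t, of "Im c2"] unfolding L by blast
  \<comment> \<open>Chosen so that the error 4 a (|c| + 1) of \<open>window_mass\<close> is at most
    \<kappa> for both limits.\<close>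
  define a where "a = min (1 / 2) (min (\<kappa> / (4 * (cmod c1 + 1))) (\<kappa> / (4 * (cmod c2 + 1))))"
  have pos: "0 < 4 * (cmod c + 1)" for c by (simp add: add_nonneg_pos)
  have a: "0 < a" "a \<le> 1 / 2"
    using \<kappa> pos unfolding a_def by (simp) (rule min.cobounded1)
  have ac: "4 * a * (cmod c1 + 1) \<le> \<kappa>" "4 * a * (cmod c2 + 1) \<le> \<kappa>"
  proof -
    have "a \<le> \<kappa> / (4 * (cmod c1 + 1))" "a \<le> \<kappa> / (4 * (cmod c2 + 1))" by (auto simp: a_def)
    thus "4 * a * (cmod c1 + 1) \<le> \<kappa>" "4 * a * (cmod c2 + 1) \<le> \<kappa>"
      using pos[of c1] pos[of c2] by (simp_all only: pos_le_divide_eq mult_ac)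
  qed
  \<comment> \<open>The lower bound on the window width serves as the height: it is much smaller
    than \<epsilon> n, and n (\<eta> n)^2 = n^(2 \<delta>) feeds \<open>local_law\<close> with
    exponent 2 \<delta>.\<close>
  define \<eta> where "\<eta> n = real n powr \<delta> / sqrt (real n)" for n :: nat
  have \<eta>: "0 < \<eta> n" if "1 \<le> n" for n using that by (simp add: \<eta>_def)
  have d: "\<forall>\<^sub>F n in sequentially. real n powr (2 * \<delta>) \<le> n * (\<eta> n)\<^sup>2"
    using eventually_ge_at_top[of 1]
  proof eventually_elim
    case (elim n)
    have "n * (\<eta> n)\<^sup>2 = (real n powr \<delta>)\<^sup>2" using elim by (simp add: \<eta>_def power_divide)
    also have "\<dots> = real n powr (2 * \<delta>)" by (simp add: power2_eq_square powr_add[symmetric])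
    finally show ?case by simp
  qed
  define bad where "bad n = {\<omega> \<in> space (M n).
            \<bar>real n / real (card (window n (lam n \<omega>) x (\<epsilon> n)))
               * (\<Sum>i\<in>window n (lam n \<omega>) x (\<epsilon> n). \<bar>scalar_prod (\<phi> n \<omega> i) (v n \<omega>)\<bar>\<^sup>2) - L\<bar> > t}" for n
  have key: "\<forall>\<^sub>F n in sequentially. measure (M n) (bad n) \<le> r" if r: "0 < r" for r
  proof -
    \<comment> \<open>Makes the bound (8 / a + 2) e on the exceptional event equal to r.\<close>
    define e where "e = r / (8 / a + 2)"
    have a8: "0 < 8 / a + 2" using a by (simp add: add_pos_pos)
    have e: "0 < e" using r a8 by (simp add: e_def)
    have th: "\<theta> = (1 + (sqrt \<theta> - 1))\<^sup>2" using theta by simp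
    obtain \<rho> where \<rho>: "0 < \<rho>" and ll: "\<forall>\<^sub>F n in sequentially. \<forall>u z. (\<Sum>i<n. (u i)\<^sup>2) = 1 \<longrightarrow> \<bar>Re z - x\<bar> \<le> \<rho> \<longrightarrow> \<eta> n \<le> Im z \<longrightarrow> Im z \<le> \<rho> \<longrightarrow>
     (\<integral>Y. cmod (model.s n (m n) (sqrt \<theta> - 1) u z Y - mp \<alpha> (of_real x)) \<partial>Omm n (m n)) \<le> e \<and>
     (\<integral>Y. cmod (model.g n (m n) (sqrt \<theta> - 1) u z Y + 1 / Dlim \<alpha> \<theta> x) \<partial>Omm n (m n)) \<le> e"
      using local_law[OF alpha x m \<eta> _ d e th] delta by auto
    have "\<forall>\<^sub>F n in sequentially. \<epsilon> n / 1 < \<rho> / 2"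
      using eps_upper \<rho> unfolding much_less_def by (intro order_tendstoD(2)) auto
    moreover have "\<forall>\<^sub>F n in sequentially. \<eta> n / \<epsilon> n < a\<^sup>2"
      using eps_lower a unfolding much_less_def \<eta>_def by (intro order_tendstoD(2)) auto
    moreover have "\<forall>\<^sub>F n in sequentially. 0 < real (m n) / real n"
      by (rule order_tendstoD(1)[OF m alpha])
    ultimately show ?thesis using ll eventually_ge_at_top[of 1]
    proof eventually_elim
      case (elim n)
      have n: "1 \<le> n" by fact
      have mn: "1 \<le> m n" using elim(3) by (cases "m n") auto
      have eps: "0 < \<epsilon> n" "2 * \<epsilon> n \<le> \<rho>" using eps_pos[OF n] elim(1) by auto
      have eta: "\<eta> n \<le> a\<^sup>2 * \<epsilon> n" using elim(2) eps by (simp add: pos_divide_less_eq)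
      have bound: "(\<integral>Y. cmod (model.s n (m n) (sqrt \<theta> - 1) u z Y - c1) \<partial>Omm n (m n)) \<le> e \<and>
       (\<integral>Y. cmod (model.g n (m n) (sqrt \<theta> - 1) u z Y - c2) \<partial>Omm n (m n)) \<le> e"
        if "(\<Sum>i<n. (u i)\<^sup>2) = 1" "\<bar>Re z - x\<bar> \<le> 2 * \<epsilon> n" "\<eta> n \<le> Im z" "Im z \<le> \<epsilon> n" for u z
      proof -
        have "\<bar>Re z - x\<bar> \<le> \<rho>" "Im z \<le> \<rho>" using that eps by auto
        thus ?thesis using elim(4) that by (simp add: c1_def c2_def)
      qed
      obtain B where B: "B \<in> sets (M n)" "measure (M n) B \<le> (8 / a + 2) * e"
        "\<And>\<omega>. \<omega> \<in> space (M n) - B \<Longrightarrow>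
          \<bar>pi * (\<Sum>k\<in>window n (lam n \<omega>) x (\<epsilon> n). 1 / real n) / (2 * \<epsilon> n) - Im c1\<bar> \<le> 4 * a * (cmod c1 + 1) \<and>
          \<bar>pi * (\<Sum>k\<in>window n (lam n \<omega>) x (\<epsilon> n). (scalar_prod (\<phi> n \<omega> k) (v n \<omega>))\<^sup>2) / (2 * \<epsilon> n) - Im c2\<bar> \<le> 4 * a * (cmod c2 + 1)"
        by (rule window_event[OF M[OF n] n mn X_indep[OF n] X_law[OF n, folded P_def] theta Sigma_indep[OF n]
              Sigma_sym[OF n] Sigma_eigenvalues[OF n] v_unit[OF n] v_eigen[OF n] eigen[OF n] eps(1) \<eta>[OF n] eta a less_imp_le[OF e] bound])
          blast+
      have sub: "bad n \<subseteq> B"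
      proof
        fix \<omega> assume bad: "\<omega> \<in> bad n"
        show "\<omega> \<in> B"
        proof (rule ccontr)
          assume "\<omega> \<notin> B"
          hence w: "\<omega> \<in> space (M n) - B" using bad by (simp add: bad_def)
          define I where "I = window n (lam n \<omega>) x (\<epsilon> n)"
          define S where "S = (\<Sum>k\<in>I. (scalar_prod (\<phi> n \<omega> k) (v n \<omega>))\<^sup>2)"
          define p where "p = pi * (\<Sum>k\<in>I. 1 / real n) / (2 * \<epsilon> n)"
          define q where "q = pi * S / (2 * \<epsilon> n)"
          have "\<bar>q / p - L\<bar> \<le> t"
            using B(3)[OF w] ac by (intro close) (auto simp: p_def q_def S_def I_def)
          \<comment> \<open>The common factor pi / (2 \<epsilon> n) cancels, and the mass with
            weights 1 / n is the number of indices in the window divided by n.\<close>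
          moreover have "q / p = real n / real (card I) * S"
            using eps n by (simp add: p_def q_def field_simps)
          moreover have "t < \<bar>real n / real (card I) * S - L\<bar>"
            using bad by (simp add: bad_def I_def S_def)
          ultimately show False by simp
        qed
      qed
      show ?case
      proof (cases "bad n \<in> sets (M n)")
        case True
        interpret Mn: prob_space "M n" by (rule M[OF n])
        have "measure (M n) (bad n) \<le> measure (M n) B" by (rule Mn.finite_measure_mono[OF sub B(1)])
        also have "\<dots> \<le> r" using B(2) a8 by (simp add: e_def)
        finally show ?thesis .
      next
        \<comment> \<open>\<open>measure\<close> is 0 on sets that are not measurable, so the bound
          then holds by convention.\<close>
        case False
        thus ?thesis using r by (simp add: measure_notin_sets)
      qed
    qed
  qed
  have "(\<lambda>n. measure (M n) (bad n)) \<longlonglongrightarrow> 0"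
  proof (rule tendstoI)
    fix r :: real assume "0 < r"
    hence "\<forall>\<^sub>F n in sequentially. measure (M n) (bad n) \<le> r / 2" by (intro key) simp
    thus "\<forall>\<^sub>F n in sequentially. dist (measure (M n) (bad n)) 0 < r"
      by eventually_elim (use \<open>0 < r\<close> in simp)
  qed
  thus ?thesis unfolding bad_def L_def .
qed

end
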